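(* Let $N\ge2$ and $\alpha\ge0$. The eigenvalues of the weighted problem $$-\Delta\omega=\mu|x|^\alpha\omega\ \text{ in } B,\qquad \omega=0\ \text{ on }\partial B$$ are the numbers $$\mu_{n,i}=\left(\frac{2+\alpha}{2}\,z_i\left(\frac{N-2+2n}{2+\alpha}\right)\right)^2,\qquad n=0,1,2,\dots,\ i=1,2,\dots,$$ and the related eigenfunctions are $$\omega_{n,i}(x)=|x|^{-\frac{N-2}{2}}\,\mathcal J_{\frac{N-2+2n}{2+\alpha}}\left(z_i\left(\frac{N-2+2n}{2+\alpha}\right)|x|^{\frac{2+\alpha}{2}}\right)Y_{n,j}\left(\frac{x}{|x|}\right),\qquad j=1,\dots,N_n,$$ i.e. the eigenspace of an eigenvalue $\mu$ is spanned by these functions over all $(n,i,j)$ with $\mu_{n,i}=\mu$.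
   Context: $B$ is the open unit ball of $\mathbb R^N$; eigenfunctions are nontrivial elements of $H^1_0(B)$. For $\beta\ge0$, $\mathcal J_\beta(r)=r^\beta\sum_{k=0}^\infty\frac{(-1)^k}{k!\,\Gamma(k+1+\beta)}\left(\frac r2\right)^{2k}$ is the Bessel function of the first kind (in this normalization), and $z_i(\beta)$ is its $i$-th positive zero. For $n\ge0$, $Y_{n,1},\dots,Y_{n,N_n}$ is a basis of the eigenspace (spherical harmonics) of the Laplace–Beltrami operator on $\mathbb S^{N-1}$ for the eigenvalue $n(N-2+n)$, whose multiplicity is $N_n$. *)

theory Defs
  imports "HOL-Analysis.Analysis"
begin

section \<open>Bessel functions and their zeros\<close>

text \<open>The case distinction gives \<open>r\<^sup>0 = 1\<close> also at \<open>r = 0\<close>, where \<open>powr\<close> yields \<open>0\<close>.\<close>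

definition bessel_J :: "real \<Rightarrow> real \<Rightarrow> real" where
  "bessel_J \<beta> r = (if \<beta> = 0 then 1 else r powr \<beta>) *
     (\<Sum>k. (-1) ^ k / (fact k * Gamma (real k + 1 + \<beta>)) * (r / 2) ^ (2 * k))"

text \<open>The zero below and including which there are exactly \<open>i\<close> positive zeros, so \<open>i = 1\<close> is the
  smallest one; only \<open>i \<ge> 1\<close> is meaningful.\<close>

definition bessel_zero :: "real \<Rightarrow> nat \<Rightarrow> real" where
  "bessel_zero \<beta> i = (THE r. 0 < r \<and> bessel_J \<beta> r = 0 \<and>
     finite {s. 0 < s \<and> s \<le> r \<and> bessel_J \<beta> s = 0} \<and>
     card {s. 0 < s \<and> s \<le> r \<and> bessel_J \<beta> s = 0} = i)"


section \<open>Smooth functions\<close>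

definition partial_deriv :: "'a::euclidean_space \<Rightarrow> ('a \<Rightarrow> real) \<Rightarrow> 'a \<Rightarrow> real" where
  "partial_deriv b f x = frechet_derivative f (at x) b"

definition grad :: "('a::euclidean_space \<Rightarrow> real) \<Rightarrow> 'a \<Rightarrow> 'a" where
  "grad f x = (\<Sum>b\<in>Basis. partial_deriv b f x *\<^sub>R b)"

definition laplacian :: "('a::euclidean_space \<Rightarrow> real) \<Rightarrow> 'a \<Rightarrow> real" where
  "laplacian f x = (\<Sum>b\<in>Basis. partial_deriv b (partial_deriv b f) x)"

text \<open>The next two predicates are meant for open sets \<open>S\<close>.\<close>

primrec Ck_on :: "nat \<Rightarrow> 'a::euclidean_space set \<Rightarrow> ('a \<Rightarrow> real) \<Rightarrow> bool" where
  "Ck_on 0 S f \<longleftrightarrow> continuous_on S f"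
| "Ck_on (Suc k) S f \<longleftrightarrow> f differentiable_on S \<and> (\<forall>b\<in>Basis. Ck_on k S (partial_deriv b f))"

definition smooth_on :: "'a::euclidean_space set \<Rightarrow> ('a \<Rightarrow> real) \<Rightarrow> bool" where
  "smooth_on S f \<longleftrightarrow> (\<forall>k. Ck_on k S f)"

definition test_functions :: "'a::euclidean_space set \<Rightarrow> ('a \<Rightarrow> real) set" where
  "test_functions \<Omega> = {\<phi>. smooth_on UNIV \<phi> \<and>
     compact (closure {x. \<phi> x \<noteq> 0}) \<and> closure {x. \<phi> x \<noteq> 0} \<subseteq> \<Omega>}"


section \<open>Sobolev spaces\<close>

text \<open>Elements of \<open>L\<^sup>2(\<Omega>)\<close> are represented by functions on the whole space whose values
  outside \<open>\<Omega>\<close> are irrelevant; equality of elements is equality almost everywhere on \<open>\<Omega>\<close>.\<close>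

definition square_integrable_on ::
    "'a::euclidean_space set \<Rightarrow> ('a \<Rightarrow> 'b::euclidean_space) \<Rightarrow> bool" where
  "square_integrable_on \<Omega> f \<longleftrightarrow> f \<in> borel_measurable (lebesgue_on \<Omega>) \<and>
     integrable (lebesgue_on \<Omega>) (\<lambda>x. (norm (f x))\<^sup>2)"

definition has_weak_gradient ::
    "'a::euclidean_space set \<Rightarrow> ('a \<Rightarrow> real) \<Rightarrow> ('a \<Rightarrow> 'a) \<Rightarrow> bool" where
  "has_weak_gradient \<Omega> u g \<longleftrightarrow> square_integrable_on \<Omega> u \<and> square_integrable_on \<Omega> g \<and>
     (\<forall>\<phi>\<in>test_functions \<Omega>. \<forall>b\<in>Basis.
        (\<integral>x. u x * partial_deriv b \<phi> x \<partial>lebesgue_on \<Omega>)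
          = - (\<integral>x. (g x \<bullet> b) * \<phi> x \<partial>lebesgue_on \<Omega>))"

text \<open>\<open>H\<^sup>1\<^sub>0(\<Omega>)\<close> is the closure of the test functions in the norm of \<open>H\<^sup>1(\<Omega>)\<close>.\<close>

definition H10 :: "'a::euclidean_space set \<Rightarrow> ('a \<Rightarrow> real) set" where
  "H10 \<Omega> = {u. \<exists>g. has_weak_gradient \<Omega> u g \<and>
     (\<exists>\<phi>. (\<forall>k::nat. \<phi> k \<in> test_functions \<Omega>) \<and>
        (\<lambda>k. \<integral>x. (\<phi> k x - u x)\<^sup>2 + (norm (grad (\<phi> k) x - g x))\<^sup>2 \<partial>lebesgue_on \<Omega>)
          \<longlonglongrightarrow> 0)}"


section \<open>The weighted eigenvalue problem\<close>

text \<open>Weak solutions \<open>u \<in> H\<^sup>1\<^sub>0(\<Omega>)\<close>, possibly zero, of \<open>- \<Delta> u = \<mu> \<bar>x\<bar>\<^sup>\<alpha> u\<close> in \<open>\<Omega>\<close>,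
  \<open>u = 0\<close> on the boundary. (For \<open>\<alpha> = 0\<close>, the value \<open>0 powr 0 = 0\<close> only affects
  the weight at the origin, a null set.)\<close>

definition eigenspace :: "'a::euclidean_space set \<Rightarrow> real \<Rightarrow> real \<Rightarrow> ('a \<Rightarrow> real) set" where
  "eigenspace \<Omega> \<alpha> \<mu> = {u \<in> H10 \<Omega>. \<exists>g. has_weak_gradient \<Omega> u g \<and>
     (\<forall>v\<in>H10 \<Omega>. \<forall>h. has_weak_gradient \<Omega> v h \<longrightarrow>
        (\<integral>x. g x \<bullet> h x \<partial>lebesgue_on \<Omega>)
          = \<mu> * (\<integral>x. norm x powr \<alpha> * u x * v x \<partial>lebesgue_on \<Omega>))}"

definition eigenfunction ::
    "'a::euclidean_space set \<Rightarrow> real \<Rightarrow> real \<Rightarrow> ('a \<Rightarrow> real) \<Rightarrow> bool" where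
  "eigenfunction \<Omega> \<alpha> \<mu> u \<longleftrightarrow>
     u \<in> eigenspace \<Omega> \<alpha> \<mu> \<and> \<not> (AE x in lebesgue_on \<Omega>. u x = 0)"

definition eigenvalue :: "'a::euclidean_space set \<Rightarrow> real \<Rightarrow> real \<Rightarrow> bool" where
  "eigenvalue \<Omega> \<alpha> \<mu> \<longleftrightarrow> (\<exists>u. eigenfunction \<Omega> \<alpha> \<mu> u)"


section \<open>Spherical harmonics\<close>

text \<open>Functions on the unit sphere are represented by functions on the whole space whose values
  off the sphere are irrelevant. Smoothness and the Laplace--Beltrami operator
  are expressed through the extension that is constant along rays, which is defined off the
  origin.\<close>

definition radial_ext :: "('a::euclidean_space \<Rightarrow> real) \<Rightarrow> 'a \<Rightarrow> real" where
  "radial_ext f x = f (x /\<^sub>R norm x)"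

definition laplace_beltrami :: "('a::euclidean_space \<Rightarrow> real) \<Rightarrow> 'a \<Rightarrow> real" where
  "laplace_beltrami f x = laplacian (radial_ext f) x"

definition sphere_eigenspace :: "real \<Rightarrow> ('a::euclidean_space \<Rightarrow> real) set" where
  "sphere_eigenspace l = {f. smooth_on (- {0}) (radial_ext f) \<and>
     (\<forall>x\<in>sphere 0 1. - laplace_beltrami f x = l * f x)}"

text \<open>The functions \<open>Y 1, \<dots>, Y m\<close>, restricted to the unit sphere, form a basis of the
  space \<open>V\<close> of functions on the unit sphere.\<close>

definition is_sphere_basis ::
    "('a::euclidean_space \<Rightarrow> real) set \<Rightarrow> nat \<Rightarrow> (nat \<Rightarrow> 'a \<Rightarrow> real) \<Rightarrow> bool" where
  "is_sphere_basis V m Y \<longleftrightarrow>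
     (\<forall>j\<in>{1..m}. Y j \<in> V) \<and>
     (\<forall>c. (\<forall>x\<in>sphere 0 1. (\<Sum>j=1..m. c j * Y j x) = 0) \<longrightarrow> (\<forall>j\<in>{1..m}. c j = 0)) \<and>
     (\<forall>f\<in>V. \<exists>c. \<forall>x\<in>sphere 0 1. f x = (\<Sum>j=1..m. c j * Y j x))"


section \<open>The explicit eigenvalues and eigenfunctions\<close>

definition bessel_order :: "nat \<Rightarrow> real \<Rightarrow> nat \<Rightarrow> real" where
  "bessel_order N \<alpha> n = (real N - 2 + 2 * real n) / (2 + \<alpha>)"

definition mu :: "nat \<Rightarrow> real \<Rightarrow> nat \<Rightarrow> nat \<Rightarrow> real" where
  "mu N \<alpha> n i = ((2 + \<alpha>) / 2 * bessel_zero (bessel_order N \<alpha> n) i)\<^sup>2"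

text \<open>Only the values for \<open>x \<noteq> 0\<close> are meaningful.\<close>

definition omega ::
    "real \<Rightarrow> nat \<Rightarrow> nat \<Rightarrow> ('a::euclidean_space \<Rightarrow> real) \<Rightarrow> 'a \<Rightarrow> real" where
  "omega \<alpha> n i Y x =
     norm x powr (- ((real DIM('a) - 2) / 2)) *
     bessel_J (bessel_order DIM('a) \<alpha> n)
       (bessel_zero (bessel_order DIM('a) \<alpha> n) i * norm x powr ((2 + \<alpha>) / 2)) *
     Y (x /\<^sub>R norm x)"

end

theory Submission
  imports Defs "HOL-Computational_Algebra.Polynomial"
begin

text \<open>Write \<open>s = \<bar>x\<bar>\<^sup>2\<close>, \<open>a = 1 + \<alpha> / 2\<close> and \<open>N\<close> for the dimension. If \<open>H\<close> is harmonic and homogeneous of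
  degree \<open>n\<close>, then \<open>\<Delta>(G(\<bar>x\<bar>\<^sup>2) H) = (L G)(\<bar>x\<bar>\<^sup>2) H\<close> with \<open>L G = 4 s G'' + 2 (N + 2 n) G'\<close>
  (\<open>laplacian_radial_mult\<close>). For functions of this form, the eigenvalue equation is the ordinary differential equation
  \<open>L G + \<mu> s\<^sup>a\<^sup>-\<^sup>1 G = 0\<close>. Its solution that is regular at the origin is the Frobenius
  series \<open>frob\<close> with index \<open>k = 0\<close>. It equals, up to scaling and a power of \<open>s\<close>, the
  Bessel function of order \<open>(N - 2 + 2 n) / (2 + \<alpha>)\<close>, and it vanishes at \<open>s = 1\<close> exactly if \<open>\<mu>\<close> is one of
  the numbers \<open>\<mu>\<^sub>n\<^sub>,\<^sub>i\<close> (\<open>frob_zero_iff_mu\<close>). The homogeneous extension of degree \<open>n\<close> of a spherical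
  harmonic is such an \<open>H\<close> (\<open>sphere_eigenspace_imp_solid_harmonic\<close>). What has to be checked for the
  \<open>\<omega>\<^sub>n\<^sub>,\<^sub>i\<close> is therefore that the products with \<open>G(1) = 0\<close> belong to \<open>H\<^sup>1\<^sub>0\<close>, as limits of test functions with
  bounded gradients, and that Green's formula holds for them although \<open>H\<close> may be singular at the origin
  (\<open>radial_harmonic_dirichlet_function\<close>).

  Conversely, let \<open>u\<close> belong to the eigenspace of \<open>\<mu>\<close>. Its coefficients with respect to spherical harmonics
  are never formed. Instead, the Fredholm alternative is applied on the side of the test functions. The series \<open>frob\<close> with
  index \<open>k + 1\<close> solves \<open>L G + \<mu> s\<^sup>a\<^sup>-\<^sup>1 G = q s\<^sup>k\<close> with a constant \<open>q > 0\<close>. If the solution with index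
  \<open>0\<close> does not vanish at \<open>s = 1\<close>, a multiple of it can be subtracted to achieve \<open>G(1) = 0\<close>. Testing
  the equation for \<open>u\<close> with \<open>G(\<bar>x\<bar>\<^sup>2) H\<close> yields \<open>\<integral> u \<bar>x\<bar>\<^sup>2\<^sup>k H = 0\<close>. If it does vanish at \<open>1\<close>, then its
  zero is simple, and one subtracts a multiple of its derivative \<open>s d/ds\<close>, which solves the same
  equation with right-hand side proportional to \<open>s\<^sup>a\<^sup>-\<^sup>1 frob\<close>. The conclusion is the same provided that \<open>u\<close> is
  orthogonal, with weight \<open>\<bar>x\<bar>\<^sup>\<alpha>\<close>, to the eigenfunctions \<open>frob(\<bar>x\<bar>\<^sup>2) H\<close>. Since every polynomial is a sum of
  products \<open>\<bar>x\<bar>\<^sup>2\<^sup>k H\<close> (\<open>polynomial_harmonic_induct\<close>), such a \<open>u\<close> is orthogonal to all polynomials and vanishes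
  (\<open>eigenspace_orthogonal_imp_AE_0\<close>). For given \<open>\<mu>\<close>, only finitely many triples \<open>(n, i, j)\<close> satisfy
  \<open>\<mu>\<^sub>n\<^sub>,\<^sub>i = \<mu>\<close>. So an arbitrary \<open>u\<close> can be projected onto the span of the corresponding \<open>\<omega>\<^sub>n\<^sub>,\<^sub>i\<close>, and the
  difference is zero.

  The zeros \<open>z\<^sub>i(\<beta>)\<close> exist for all \<open>i \<ge> 1\<close> because the zeros of the Bessel function are simple, hence locally
  finite, and unbounded by Sturm comparison with \<open>sin (r / 2)\<close>.\<close>

section \<open>Calculus of partial derivatives and smooth functions\<close>

lemma partial_deriv_eq: "(f has_derivative f') (at x) \<Longrightarrow> partial_deriv b f x = f' b"
  unfolding partial_deriv_def by (metis frechet_derivative_at)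

lemma grad_inner_Basis: "b \<in> Basis \<Longrightarrow> grad f x \<bullet> b = partial_deriv b f x"
  unfolding grad_def by simp

lemma has_derivative_imp_grad:
  assumes "(f has_derivative f') (at x)" shows "f' h = grad f x \<bullet> h"
proof -
  interpret f': bounded_linear f' using assms by (rule has_derivative_bounded_linear)
  have "f' h = f' (\<Sum>b\<in>Basis. (h \<bullet> b) *\<^sub>R b)" by (simp add: euclidean_representation)
  also have "\<dots> = (\<Sum>b\<in>Basis. (h \<bullet> b) * f' b)" by (simp add: f'.sum f'.scaleR)
  also have "\<dots> = (\<Sum>b\<in>Basis. (h \<bullet> b) * (grad f x \<bullet> b))"
    by (intro sum.cong) (auto simp: grad_inner_Basis partial_deriv_eq[OF assms])
  also have "\<dots> = grad f x \<bullet> h"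
    by (subst euclidean_inner) (simp add: mult.commute)
  finally show ?thesis .
qed

lemma has_derivative_grad:
  assumes "f differentiable (at x)" shows "(f has_derivative (\<lambda>h. grad f x \<bullet> h)) (at x)"
proof -
  obtain f' where f': "(f has_derivative f') (at x)" using assms unfolding differentiable_def by auto
  then have "f' = (\<lambda>h. grad f x \<bullet> h)" using has_derivative_imp_grad by blast
  with f' show ?thesis by simp
qed

lemma grad_unique:
  assumes "(f has_derivative (\<lambda>h. v \<bullet> h)) (at x)" shows "grad f x = v"
  using has_derivative_imp_grad[OF assms] vector_eq_ldot[of v "grad f x"] by (metis inner_commute)

lemma has_derivative_cong_open:
  assumes "open S" "x \<in> S" "\<And>y. y \<in> S \<Longrightarrow> f y = g y" "(f has_derivative f') (at x)"
  shows "(g has_derivative f') (at x)"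
  using has_derivative_transform_within_open[OF assms(4,1,2,3)] .

lemma partial_deriv_cong:
  assumes "open S" "x \<in> S" "\<And>y. y \<in> S \<Longrightarrow> f y = g y"
  shows "partial_deriv b f x = partial_deriv b g x"
proof -
  have "(f has_derivative D) (at x) \<longleftrightarrow> (g has_derivative D) (at x)" for D
    using has_derivative_cong_open[of S x f g] has_derivative_cong_open[of S x g f] assms by metis
  then show ?thesis unfolding partial_deriv_def frechet_derivative_def by simp
qed

lemma grad_cong:
  assumes "open S" "x \<in> S" "\<And>y. y \<in> S \<Longrightarrow> f y = g y" shows "grad f x = grad g x"
  unfolding grad_def using partial_deriv_cong[OF assms] by simp

lemma laplacian_cong:
  assumes "open S" "x \<in> S" "\<And>y. y \<in> S \<Longrightarrow> f y = g y" shows "laplacian f x = laplacian g x"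
  unfolding laplacian_def
  by (intro sum.cong refl partial_deriv_cong[OF assms(1,2)]) (rule partial_deriv_cong[OF assms(1) _ assms(3)])

lemma Ck_on_Suc_iff:
  assumes "open S"
  shows "Ck_on (Suc k) S f \<longleftrightarrow> (\<forall>x\<in>S. f differentiable (at x)) \<and> (\<forall>b\<in>Basis. Ck_on k S (partial_deriv b f))"
  using at_within_open[OF _ assms] by (auto simp: differentiable_on_def)

lemma Ck_on_cong:
  assumes "open S" "\<And>y. y \<in> S \<Longrightarrow> f y = g y" "Ck_on k S f"
  shows "Ck_on k S g"
  using assms(2,3)
proof (induction k arbitrary: f g)
  case 0
  then show ?case using continuous_on_cong[of S S f g] by simp
next
  case (Suc k)
  have "g differentiable (at x)" if x: "x \<in> S" for x
  proof -
    obtain D where D: "(f has_derivative D) (at x)"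
      using Suc.prems(2) x unfolding Ck_on_Suc_iff[OF assms(1)] differentiable_def by blast
    have "(g has_derivative D) (at x)"
      by (rule has_derivative_cong_open[of S x f g D, OF assms(1) x Suc.prems(1) D])
    then show ?thesis unfolding differentiable_def by blast
  qed
  moreover have "Ck_on k S (partial_deriv b g)" if "b \<in> Basis" for b
  proof (rule Suc.IH[of "partial_deriv b f"])
    show "partial_deriv b f y = partial_deriv b g y" if "y \<in> S" for y
      by (rule partial_deriv_cong[of S y f g b, OF assms(1) that Suc.prems(1)])
    show "Ck_on k S (partial_deriv b f)" using Suc.prems(2) that by simp
  qed
  ultimately show ?case unfolding Ck_on_Suc_iff[OF assms(1)] by blast
qed

lemma Ck_on_SucD:
  assumes "open S" "Ck_on (Suc k) S f" shows "Ck_on k S f"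
  using assms(2)
proof (induction k arbitrary: f)
  case 0
  then show ?case by (simp add: differentiable_imp_continuous_on)
next
  case (Suc k)
  then show ?case unfolding Ck_on.simps(2)[of "Suc k"] Ck_on.simps(2)[of k] by blast
qed

lemma Ck_on_subset:
  assumes "open S" "open T" "T \<subseteq> S" "Ck_on k S f" shows "Ck_on k T f"
  using assms(4)
proof (induction k arbitrary: f)
  case 0 then show ?case using assms continuous_on_subset by auto
next
  case (Suc k)
  then show ?case using assms unfolding Ck_on_Suc_iff[OF assms(1)] Ck_on_Suc_iff[OF assms(2)] by blast
qed

lemma Ck_on_Un:
  assumes "open S" "open T" "Ck_on k S f" "Ck_on k T f" shows "Ck_on k (S \<union> T) f"
  using assms(3,4)
proof (induction k arbitrary: f)
  case 0 then show ?case using assms by (simp add: continuous_on_open_Un)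
next
  case (Suc k)
  then show ?case
    unfolding Ck_on_Suc_iff[OF assms(1)] Ck_on_Suc_iff[OF assms(2)] Ck_on_Suc_iff[OF open_Un[OF assms(1,2)]]
    by blast
qed

lemma Ck_on_const: "open S \<Longrightarrow> Ck_on k S (\<lambda>x. c)"
proof (induction k arbitrary: c)
  case (Suc k)
  have "partial_deriv b (\<lambda>x::'a. c) = (\<lambda>x. 0)" for b
    by (rule ext, rule partial_deriv_eq) (auto intro!: derivative_eq_intros)
  then show ?case using Suc unfolding Ck_on_Suc_iff[OF Suc.prems] by simp
qed simp

lemma Ck_on_inner:
  assumes "open S" shows "Ck_on k S (\<lambda>x. x \<bullet> v)"
proof (cases k)
  case (Suc k)
  have "partial_deriv b (\<lambda>x::'a. x \<bullet> v) = (\<lambda>x. b \<bullet> v)" for b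
    by (rule ext, rule partial_deriv_eq) (auto intro!: derivative_eq_intros)
  moreover have "(\<lambda>x. x \<bullet> v) differentiable (at x)" for x
    by simp
  ultimately show ?thesis using assms unfolding Suc Ck_on_Suc_iff[OF assms] by (simp add: Ck_on_const)
qed (auto intro!: continuous_intros)

lemma partial_deriv_mult:
  fixes f g :: "'a::euclidean_space \<Rightarrow> real"
  assumes "f differentiable (at x)" "g differentiable (at x)"
  shows "partial_deriv b (\<lambda>x. f x * g x) x = partial_deriv b f x * g x + f x * partial_deriv b g x"
  using partial_deriv_eq[OF has_derivative_mult[OF has_derivative_grad[OF assms(1)] has_derivative_grad[OF assms(2)]]]
    partial_deriv_eq[OF has_derivative_grad[OF assms(1)]] partial_deriv_eq[OF has_derivative_grad[OF assms(2)]]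
  by (simp add: add.commute)

lemma partial_deriv_add:
  fixes f g :: "'a::euclidean_space \<Rightarrow> real"
  assumes "f differentiable (at x)" "g differentiable (at x)"
  shows "partial_deriv b (\<lambda>x. f x + g x) x = partial_deriv b f x + partial_deriv b g x"
  using partial_deriv_eq[OF has_derivative_add[OF has_derivative_grad[OF assms(1)] has_derivative_grad[OF assms(2)]]]
    partial_deriv_eq[OF has_derivative_grad[OF assms(1)]] partial_deriv_eq[OF has_derivative_grad[OF assms(2)]]
  by simp

lemma Ck_on_add:
  assumes "open S" "Ck_on k S f" "Ck_on k S g" shows "Ck_on k S (\<lambda>x. f x + g x)"
  using assms(2,3)
proof (induction k arbitrary: f g)
  case 0 then show ?case by (auto intro!: continuous_intros)
next
  case (Suc k)
  note d = Suc.prems[unfolded Ck_on_Suc_iff[OF assms(1)]]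
  have "partial_deriv b f x + partial_deriv b g x = partial_deriv b (\<lambda>x. f x + g x) x" if "x \<in> S" for x b
    using d that by (intro partial_deriv_add[symmetric]) auto
  then have "Ck_on k S (partial_deriv b (\<lambda>x. f x + g x))" if "b \<in> Basis" for b
    by (rule Ck_on_cong[OF assms(1), of "\<lambda>x. partial_deriv b f x + partial_deriv b g x"])
      (use d that in \<open>auto intro!: Suc.IH\<close>)
  moreover have "(\<lambda>x. f x + g x) differentiable (at x)" if "x \<in> S" for x using d that by simp
  ultimately show ?case unfolding Ck_on_Suc_iff[OF assms(1)] by blast
qed

lemma Ck_on_mult:
  assumes "open S" "Ck_on k S f" "Ck_on k S g" shows "Ck_on k S (\<lambda>x. f x * g x)"
  using assms(2,3)
proof (induction k arbitrary: f g)
  case 0 then show ?case by (auto intro!: continuous_intros)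
next
  case (Suc k)
  note d = Suc.prems[unfolded Ck_on_Suc_iff[OF assms(1)]]
  have C: "Ck_on k S f" "Ck_on k S g" using Suc.prems Ck_on_SucD[OF assms(1)] by auto
  have "Ck_on k S (partial_deriv b (\<lambda>x. f x * g x))" if "b \<in> Basis" for b
    by (rule Ck_on_cong[OF assms(1), of "\<lambda>x. partial_deriv b f x * g x + f x * partial_deriv b g x"])
      (use d that C in \<open>auto intro!: Ck_on_add[OF assms(1)] Suc.IH simp: partial_deriv_mult\<close>)
  moreover have "(\<lambda>x. f x * g x) differentiable (at x)" if "x \<in> S" for x using d that by simp
  ultimately show ?case unfolding Ck_on_Suc_iff[OF assms(1)] by blast
qed

lemma partial_deriv_chain:
  fixes g :: "'a::euclidean_space \<Rightarrow> real" and f :: "real \<Rightarrow> real"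
  assumes "(f has_real_derivative D) (at (g x))" "g differentiable (at x)"
  shows "partial_deriv b (\<lambda>x. f (g x)) x = D * partial_deriv b g x"
proof -
  have "(g has_derivative frechet_derivative g (at x)) (at x)"
    using assms(2) frechet_derivative_works by blast
  from has_derivative_compose[OF this assms(1)[unfolded has_field_derivative_def]]
  show ?thesis by (subst partial_deriv_eq) (auto simp: partial_deriv_def)
qed

lemma real_partial_deriv:
  fixes f :: "real \<Rightarrow> real"
  assumes "f differentiable (at x)"
  shows "(f has_real_derivative partial_deriv 1 f x) (at x)"
proof -
  have "(\<lambda>h. grad f x \<bullet> h) = (*) (partial_deriv 1 f x)" by (simp add: grad_def fun_eq_iff)
  then show ?thesis using has_derivative_grad[OF assms] unfolding has_field_derivative_def by simp
qed

lemma Ck_on_compose: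
  fixes f :: "real \<Rightarrow> real"
  assumes "open S" "open T" "g ` S \<subseteq> T" "Ck_on k T f" "Ck_on k S g"
  shows "Ck_on k S (\<lambda>x. f (g x))"
  using assms(4,5)
proof (induction k arbitrary: f)
  case 0
  then show ?case using assms(3) by (auto intro: continuous_on_compose2)
next
  case (Suc k)
  note d = Suc.prems(1)[unfolded Ck_on_Suc_iff[OF assms(2)]] Suc.prems(2)[unfolded Ck_on_Suc_iff[OF assms(1)]]
  have C: "Ck_on k S g" using Suc.prems Ck_on_SucD[OF assms(1)] by auto
  have fd: "(f has_real_derivative partial_deriv 1 f (g x)) (at (g x))" if "x \<in> S" for x
    using d that assms(3) by (intro real_partial_deriv) auto
  have "(\<lambda>x. f (g x)) differentiable (at x)" if "x \<in> S" for x
    using d that assms(3) differentiable_chain_at[of g x f] by (auto simp: o_def)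
  moreover have "Ck_on k S (partial_deriv b (\<lambda>x. f (g x)))" if "b \<in> Basis" for b
    by (rule Ck_on_cong[OF assms(1), of "\<lambda>x. partial_deriv 1 f (g x) * partial_deriv b g x"])
      (use d that C in \<open>auto intro!: Ck_on_mult[OF assms(1)] Suc.IH simp: partial_deriv_chain[where f = f and g = g, OF fd]\<close>)
  ultimately show ?case unfolding Ck_on_Suc_iff[OF assms(1)] by blast
qed

lemma smooth_on_cong: "open S \<Longrightarrow> (\<And>y. y \<in> S \<Longrightarrow> f y = g y) \<Longrightarrow> smooth_on S f \<Longrightarrow> smooth_on S g"
  unfolding smooth_on_def using Ck_on_cong by blast

lemma smooth_on_subset: "open S \<Longrightarrow> open T \<Longrightarrow> T \<subseteq> S \<Longrightarrow> smooth_on S f \<Longrightarrow> smooth_on T f"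
  unfolding smooth_on_def using Ck_on_subset by blast

lemma smooth_on_Un: "open S \<Longrightarrow> open T \<Longrightarrow> smooth_on S f \<Longrightarrow> smooth_on T f \<Longrightarrow> smooth_on (S \<union> T) f"
  unfolding smooth_on_def using Ck_on_Un by blast

named_theorems smooth

lemma smooth_on_const [smooth]: "open S \<Longrightarrow> smooth_on S (\<lambda>x. c)"
  unfolding smooth_on_def using Ck_on_const by blast

lemma smooth_on_inner [smooth]: "open S \<Longrightarrow> smooth_on S (\<lambda>x. x \<bullet> v)"
  unfolding smooth_on_def using Ck_on_inner by blast

lemma smooth_on_id [smooth]: "open S \<Longrightarrow> smooth_on S (\<lambda>x::real. x)"
  using smooth_on_inner[of S "1::real"] by simp

lemma smooth_on_add [smooth]:
  "open S \<Longrightarrow> smooth_on S f \<Longrightarrow> smooth_on S g \<Longrightarrow> smooth_on S (\<lambda>x. f x + g x)"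
  unfolding smooth_on_def using Ck_on_add by blast

lemma smooth_on_mult [smooth]:
  "open S \<Longrightarrow> smooth_on S f \<Longrightarrow> smooth_on S g \<Longrightarrow> smooth_on S (\<lambda>x. f x * g x)"
  unfolding smooth_on_def using Ck_on_mult by blast

lemma smooth_on_minus [smooth]: "open S \<Longrightarrow> smooth_on S f \<Longrightarrow> smooth_on S (\<lambda>x. - f x)"
  using smooth_on_mult[OF _ smooth_on_const[of S "-1"], of f] by simp

lemma smooth_on_diff [smooth]:
  "open S \<Longrightarrow> smooth_on S f \<Longrightarrow> smooth_on S g \<Longrightarrow> smooth_on S (\<lambda>x. f x - g x)"
  using smooth_on_add[of S f "\<lambda>x. - g x"] smooth_on_minus[of S g] by simp

lemma smooth_on_power [smooth]: "open S \<Longrightarrow> smooth_on S f \<Longrightarrow> smooth_on S (\<lambda>x. f x ^ n)"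
  by (induction n) (auto intro!: smooth)

lemma smooth_on_sum [smooth]:
  assumes "open S" "\<And>i. i \<in> I \<Longrightarrow> smooth_on S (f i)" shows "smooth_on S (\<lambda>x. \<Sum>i\<in>I. f i x)"
  using assms(2) by (induction I rule: infinite_finite_induct) (auto intro!: smooth assms(1))

lemma smooth_on_norm_sq [smooth]: "open S \<Longrightarrow> smooth_on S (\<lambda>x. x \<bullet> x)"
  by (subst euclidean_inner) (auto intro!: smooth)

lemma smooth_on_compose:
  fixes f :: "real \<Rightarrow> real"
  shows "open S \<Longrightarrow> open T \<Longrightarrow> g ` S \<subseteq> T \<Longrightarrow> smooth_on T f \<Longrightarrow> smooth_on S g \<Longrightarrow> smooth_on S (\<lambda>x. f (g x))"
  unfolding smooth_on_def using Ck_on_compose by blast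

lemma smooth_on_partial_deriv:
  "smooth_on S f \<Longrightarrow> b \<in> Basis \<Longrightarrow> smooth_on S (partial_deriv b f)"
  unfolding smooth_on_def by (metis Ck_on.simps(2))

lemma smooth_on_differentiable:
  "open S \<Longrightarrow> smooth_on S f \<Longrightarrow> x \<in> S \<Longrightarrow> f differentiable (at x)"
  unfolding smooth_on_def using Ck_on_Suc_iff by blast

lemma smooth_on_continuous: "smooth_on S f \<Longrightarrow> continuous_on S f"
  unfolding smooth_on_def by (metis Ck_on.simps(1))

lemma smooth_on_has_derivative_grad:
  "open S \<Longrightarrow> smooth_on S f \<Longrightarrow> x \<in> S \<Longrightarrow> (f has_derivative (\<lambda>h. grad f x \<bullet> h)) (at x)"
  using smooth_on_differentiable has_derivative_grad by blast

lemma smooth_on_continuous_grad: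
  "smooth_on S f \<Longrightarrow> continuous_on S (grad f)"
  unfolding grad_def by (intro continuous_intros) (auto intro: smooth_on_continuous smooth_on_partial_deriv)

text \<open>A family of functions of one real variable that is closed under differentiation consists of
  smooth functions. The powers, the power series and the functions behind the bump function below
  are recognised as smooth in this way.\<close>

lemma smooth_on_family:
  fixes F :: "'i \<Rightarrow> real \<Rightarrow> real"
  assumes "open S" "\<And>i x. i \<in> I \<Longrightarrow> x \<in> S \<Longrightarrow> (F i has_real_derivative F (d i) x) (at x)"
    and "\<And>i. i \<in> I \<Longrightarrow> d i \<in> I" and "i \<in> I"
  shows "smooth_on S (F i)"
proof -
  have "Ck_on k S (F i)" if "i \<in> I" for k i using that
  proof (induction k arbitrary: i)
    case 0
    then show ?case using assms(2) by (auto intro!: continuous_at_imp_continuous_on DERIV_isCont)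
  next
    case (Suc k)
    have "F i differentiable (at x)" if "x \<in> S" for x
      using assms(2)[OF Suc.prems that] real_differentiable_def by blast
    moreover have "F (d i) x = partial_deriv b (F i) x" if "x \<in> S" "b \<in> Basis" for x b
      using assms(2)[OF Suc.prems that(1)] that(2)
      by (auto simp: has_field_derivative_def intro!: partial_deriv_eq[symmetric, of _ "(*) (F (d i) x)" _ 1, simplified])
    then have "Ck_on k S (partial_deriv b (F i))" if "b \<in> Basis" for b
      by (intro Ck_on_cong[OF assms(1) _ Suc.IH[OF assms(3)[OF Suc.prems]]]) (use that in auto)
    ultimately show ?case unfolding Ck_on_Suc_iff[OF assms(1)] by blast
  qed
  then show ?thesis using assms(4) by (simp add: smooth_on_def)
qed

lemma smooth_on_powr: "smooth_on {0<..} (\<lambda>s::real. c * s powr p)"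
proof -
  have "smooth_on {0<..} ((\<lambda>(c,p) s. c * s powr p) (c,p))"
    by (rule smooth_on_family[where I = UNIV and d = "\<lambda>(c,p). (c*p, p-1)"])
      (auto intro!: derivative_eq_intros simp: powr_diff)
  then show ?thesis by simp
qed

lemma grad_mult:
  fixes f g :: "'a::euclidean_space \<Rightarrow> real"
  assumes "f differentiable (at x)" "g differentiable (at x)"
  shows "grad (\<lambda>x. f x * g x) x = g x *\<^sub>R grad f x + f x *\<^sub>R grad g x"
  by (rule euclidean_eqI) (auto simp: grad_inner_Basis inner_add_left partial_deriv_mult[OF assms])

lemma grad_chain:
  fixes g :: "'a::euclidean_space \<Rightarrow> real" and f :: "real \<Rightarrow> real"
  assumes "(f has_real_derivative D) (at (g x))" "g differentiable (at x)"
  shows "grad (\<lambda>x. f (g x)) x = D *\<^sub>R grad g x"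
  by (rule euclidean_eqI) (auto simp: grad_inner_Basis partial_deriv_chain[OF assms])

lemma continuous_on_compact_bounded:
  fixes f :: "'a::topological_space \<Rightarrow> 'b::real_normed_vector"
  assumes "compact S" "continuous_on S f" obtains C where "C > 0" "\<And>x. x \<in> S \<Longrightarrow> norm (f x) \<le> C"
proof -
  have "bounded (f ` S)" using assms by (intro compact_imp_bounded compact_continuous_image)
  then show ?thesis using that unfolding bounded_pos by auto
qed

section \<open>A smooth step function\<close>

definition exp_recip :: "real poly \<Rightarrow> real \<Rightarrow> real" where
  "exp_recip p t = (if t > 0 then poly p (1 / t) * exp (- (1 / t)) else 0)"

lemma poly_over_exp_tendsto_0: "((\<lambda>x::real. poly p x * exp (- x)) \<longlongrightarrow> 0) at_top"
proof -
  have "((\<lambda>x. \<Sum>i\<le>degree p. coeff p i * (x ^ i / exp x)) \<longlongrightarrow> (\<Sum>i\<le>degree p. coeff p i * 0)) at_top"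
    by (intro tendsto_intros tendsto_power_div_exp_0)
  then show ?thesis
    by (simp add: poly_altdef sum_divide_distrib exp_minus field_simps)
qed

lemma exp_recip_deriv_0: "(exp_recip p has_real_derivative 0) (at 0)"
  unfolding has_field_derivative_iff
proof (rule filterlim_split_at)
  show "((\<lambda>y. (exp_recip p y - exp_recip p 0) / (y - 0)) \<longlongrightarrow> 0) (at_left 0)"
    by (rule tendsto_eventually) (auto simp: eventually_at_filter exp_recip_def)
  have "((\<lambda>x. poly (pCons 0 p) x * exp (- x)) \<longlongrightarrow> 0) at_top" by (rule poly_over_exp_tendsto_0)
  then have "((\<lambda>y. poly (pCons 0 p) (inverse y) * exp (- inverse y)) \<longlongrightarrow> 0) (at_right 0)"
    by (rule filterlim_compose[OF _ filterlim_inverse_at_top_right])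
  then show "((\<lambda>y. (exp_recip p y - exp_recip p 0) / (y - 0)) \<longlongrightarrow> 0) (at_right 0)"
    by (rule Lim_transform_eventually)
      (auto simp: eventually_at_filter exp_recip_def field_simps)
qed

text \<open>Since the derivative of \<open>p(1/t) exp(-1/t)\<close> has the same form, with \<open>X\<^sup>2(p - p')\<close> in place
  of \<open>p\<close>, all these functions are smooth.\<close>

lemma smooth_on_exp_recip: "smooth_on UNIV (exp_recip p)"
proof (rule smooth_on_family[where I = UNIV and d = "\<lambda>p. [:0, 0, 1:] * (p - pderiv p)"])
  fix p :: "real poly" and x :: real
  let ?q = "[:0, 0, 1:] * (p - pderiv p)"
  consider "x > 0" | "x < 0" | "x = 0" by linarith
  then show "(exp_recip p has_real_derivative exp_recip ?q x) (at x)"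
  proof cases
    case 1
    have "((\<lambda>t. poly p (1 / t) * exp (- (1 / t))) has_real_derivative exp_recip ?q x) (at x)"
      using 1 by (auto intro!: derivative_eq_intros poly_DERIV[THEN DERIV_chain2]
          simp: exp_recip_def divide_simps power2_eq_square algebra_simps)
    then show ?thesis
      by (rule has_field_derivative_transform_within_open[of _ _ _ "{0<..}"]) (use 1 in \<open>auto simp: exp_recip_def\<close>)
  next
    case 2
    have "((\<lambda>t. 0) has_real_derivative exp_recip ?q x) (at x)"
      using 2 by (auto simp: exp_recip_def)
    then show ?thesis
      by (rule has_field_derivative_transform_within_open[of _ _ _ "{..<0}"]) (use 2 in \<open>auto simp: exp_recip_def\<close>)
  next
    case 3
    then show ?thesis using exp_recip_deriv_0[of p] by (simp add: exp_recip_def)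
  qed
qed auto

definition smooth_step :: "real \<Rightarrow> real" where
  "smooth_step s = exp_recip 1 (s - 1) / (exp_recip 1 (s - 1) + exp_recip 1 (2 - s))"

lemma exp_recip_nonneg: "exp_recip 1 t \<ge> 0" and exp_recip_pos: "t > 0 \<Longrightarrow> exp_recip 1 t > 0"
  by (auto simp: exp_recip_def)

lemma smooth_step_denom_pos: "exp_recip 1 (s - 1) + exp_recip 1 (2 - s) > 0"
  using exp_recip_nonneg[of "s - 1"] exp_recip_nonneg[of "2 - s"] exp_recip_pos[of "s - 1"] exp_recip_pos[of "2 - s"]
  by (cases "s > 1") (auto intro: add_pos_nonneg add_nonneg_pos)

lemma smooth_step_0: "s \<le> 1 \<Longrightarrow> smooth_step s = 0"
  by (simp add: smooth_step_def exp_recip_def)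

lemma smooth_step_1: "s \<ge> 2 \<Longrightarrow> smooth_step s = 1"
  using smooth_step_denom_pos[of s] by (simp add: smooth_step_def exp_recip_def[of 1 "2 - s"])

lemma smooth_step_nonneg: "0 \<le> smooth_step s" and smooth_step_le_1: "smooth_step s \<le> 1"
  using smooth_step_denom_pos[of s] exp_recip_nonneg[of "s - 1"] exp_recip_nonneg[of "2 - s"]
  by (auto simp: smooth_step_def)

lemma smooth_step_pos: "s > 1 \<Longrightarrow> smooth_step s > 0"
  using smooth_step_denom_pos[of s] exp_recip_pos[of "s - 1"] by (auto simp: smooth_step_def)

lemma smooth_on_smooth_step: "smooth_on UNIV smooth_step"
proof -
  have *: "smooth_on UNIV (\<lambda>s. exp_recip 1 (s - 1) + exp_recip 1 (2 - s))" "smooth_on UNIV (\<lambda>s. exp_recip 1 (s - 1))"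
    by (auto intro!: smooth smooth_on_compose[OF _ _ _ smooth_on_exp_recip])
  have "smooth_on UNIV (\<lambda>s. exp_recip 1 (s - 1) * (1 * (exp_recip 1 (s - 1) + exp_recip 1 (2 - s)) powr (-1)))"
    by (rule smooth_on_mult[OF _ *(2) smooth_on_compose[OF _ _ _ smooth_on_powr *(1)]])
      (use smooth_step_denom_pos in \<open>auto\<close>)
  then show ?thesis
    by (rule smooth_on_cong[rotated 2])
      (use smooth_step_denom_pos in \<open>auto simp: smooth_step_def powr_minus field_simps less_le\<close>)
qed

lemma smooth_step_has_derivative: "(smooth_step has_real_derivative deriv smooth_step s) (at s)"
  using smooth_on_differentiable[OF _ smooth_on_smooth_step, of s] 
  by (metis DERIV_deriv_iff_real_differentiable UNIV_I open_UNIV)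

lemma deriv_smooth_step_eq_0: "s < 1 \<or> s > 2 \<Longrightarrow> deriv smooth_step s = 0"
proof (erule disjE)
  assume "s < 1"
  have "((\<lambda>_. 0) has_real_derivative 0) (at s)" by simp
  then have "(smooth_step has_real_derivative 0) (at s)"
    by (rule has_field_derivative_transform_within_open[of _ _ _ "{..<1}"]) (use \<open>s < 1\<close> smooth_step_0 in auto)
  then show ?thesis by (rule DERIV_imp_deriv)
next
  assume "s > 2"
  have "((\<lambda>_. 1) has_real_derivative 0) (at s)" by simp
  then have "(smooth_step has_real_derivative 0) (at s)"
    by (rule has_field_derivative_transform_within_open[of _ _ _ "{2<..}"]) (use \<open>s > 2\<close> smooth_step_1 in auto)
  then show ?thesis by (rule DERIV_imp_deriv)
qed

lemma deriv_smooth_step_bounded: "\<exists>C>0. \<forall>s. \<bar>deriv smooth_step s\<bar> \<le> C"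
proof -
  have "deriv smooth_step = partial_deriv 1 smooth_step"
    by (rule ext, rule DERIV_imp_deriv, rule real_partial_deriv)
      (use smooth_on_differentiable[OF _ smooth_on_smooth_step] in auto)
  then have "continuous_on UNIV (deriv smooth_step)"
    using smooth_on_continuous[OF smooth_on_partial_deriv[OF smooth_on_smooth_step, of 1]] by simp
  then obtain C where C: "C > 0" "\<And>s. s \<in> {1..2} \<Longrightarrow> \<bar>deriv smooth_step s\<bar> \<le> C"
    by (rule continuous_on_compact_bounded[of "{1..2}" "deriv smooth_step", OF compact_Icc, unfolded real_norm_def, OF continuous_on_subset]) auto
  then have "\<bar>deriv smooth_step s\<bar> \<le> C" for s
    using C deriv_smooth_step_eq_0[of s] by (cases "s \<in> {1..2}") auto
  with C show ?thesis by blast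
qed

section \<open>Integration by parts\<close>

lemma integral_lebesgue_on_eq:
  fixes f :: "'a::euclidean_space \<Rightarrow> real"
  assumes "S \<in> sets lebesgue" "\<And>x. x \<notin> S \<Longrightarrow> f x = 0"
  shows "integral\<^sup>L (lebesgue_on S) f = integral\<^sup>L lebesgue f"
    and "integrable (lebesgue_on S) f \<longleftrightarrow> integrable lebesgue f"
proof -
  have "(\<lambda>x. if x \<in> S then f x else 0) = f" using assms(2) by auto
  then show "integral\<^sup>L (lebesgue_on S) f = integral\<^sup>L lebesgue f"
    and "integrable (lebesgue_on S) f \<longleftrightarrow> integrable lebesgue f"
    using Lebesgue_Measure.integral_restrict_UNIV[OF assms(1), of f] Lebesgue_Measure.integrable_restrict_UNIV[OF assms(1), of f] by metis+
qed

lemma integrable_bounded_support: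
  fixes f :: "'a::euclidean_space \<Rightarrow> real"
  assumes "f \<in> borel_measurable borel" "\<And>x. \<bar>f x\<bar> \<le> C" "\<And>x. x \<notin> cball 0 R \<Longrightarrow> f x = 0"
  shows "integrable lborel f"
proof (rule Bochner_Integration.integrable_bound)
  show "integrable lborel (\<lambda>x. C * indicator (cball (0::'a) R) x)"
    using emeasure_bounded_finite[of "cball (0::'a) R"] by (intro integrable_mult_right integrable_real_indicator) auto
  show "AE x in lborel. norm (f x) \<le> norm (C * indicator (cball (0::'a) R) x)"
    using assms(2,3) by (intro always_eventually allI) (auto simp: indicator_def intro: order_trans[OF _ abs_ge_self])
qed (use assms in simp)

text \<open>The difference quotients of a compactly supported function have integral zero by translation
  invariance, and they converge boundedly to the partial derivative.\<close>

lemma integral_partial_deriv_eq_0: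
  fixes F :: "'a::euclidean_space \<Rightarrow> real"
  assumes diff: "\<And>x. F differentiable (at x)" and cont: "continuous_on UNIV (partial_deriv b F)"
    and supp: "\<And>x. norm x > R \<Longrightarrow> F x = 0" and b: "b \<in> Basis"
  shows "integrable lebesgue (partial_deriv b F)" "(\<integral>x. partial_deriv b F x \<partial>lebesgue) = 0"
proof -
  let ?D = "partial_deriv b F"
  have D0: "?D x = 0" if "norm x > R" for x
  proof -
    have "open {x::'a. norm x > R}" by (intro open_Collect_less continuous_intros)
    moreover have "((\<lambda>x::'a. 0::real) has_derivative (\<lambda>_. 0)) (at x)" by simp
    ultimately have "(F has_derivative (\<lambda>_. 0)) (at x)"
      using has_derivative_cong_open[of "{x. norm x > R}" x "\<lambda>_. 0" F "\<lambda>_. 0"] that supp by simp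
    then show ?thesis by (rule partial_deriv_eq)
  qed
  have contF: "continuous_on UNIV F"
    using diff by (simp add: continuous_at_imp_continuous_on differentiable_imp_continuous_within)
  have bdd: "\<exists>C. \<forall>x. \<bar>f x\<bar> \<le> C" if "continuous_on UNIV f" "\<And>x. norm x > R \<Longrightarrow> f x = 0" for f :: "'a \<Rightarrow> real"
  proof -
    have "continuous_on (cball 0 R) f" using that(1) by (rule continuous_on_subset) auto
    then obtain C where C: "C > 0" "\<And>x. x \<in> cball 0 R \<Longrightarrow> norm (f x) \<le> C"
      by (rule continuous_on_compact_bounded[OF compact_cball]) auto
    then have "\<bar>f x\<bar> \<le> C" for x
      using that(2)[of x] by (cases "norm x > R") auto
    then show ?thesis by blast
  qed
  obtain C where C: "\<And>x. \<bar>?D x\<bar> \<le> C" using bdd[OF cont D0] by auto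
  obtain C' where C': "\<And>x. \<bar>F x\<bar> \<le> C'" using bdd[OF contF supp] by auto
  have [measurable]: "?D \<in> borel_measurable borel" "F \<in> borel_measurable borel"
    using cont contF by (simp_all add: borel_measurable_continuous_onI)
  have intF: "integrable lborel F"
    by (rule integrable_bounded_support[of _ C' R]) (use C' supp in auto)
  define t where "t k = inverse (real (Suc k))" for k
  have t: "t k > 0" "t k \<le> 1" for k by (auto simp: t_def divide_simps)
  define s where "s k x = (F (x + t k *\<^sub>R b) - F x) / t k" for k x
  have line: "((\<lambda>\<tau>. F (x + \<tau> *\<^sub>R b)) has_real_derivative ?D (x + \<tau> *\<^sub>R b)) (at \<tau>)" for x \<tau>
  proof -
    have "((\<lambda>\<tau>. x + \<tau> *\<^sub>R b) has_derivative (\<lambda>h. h *\<^sub>R b)) (at \<tau>)"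
      by (auto intro!: derivative_eq_intros)
    from has_derivative_compose[OF this has_derivative_grad[OF diff]]
    show ?thesis using b
      by (simp add: has_field_derivative_def grad_inner_Basis mult_commute_abs)
  qed
  have s_bound: "\<bar>s k x\<bar> \<le> C" for k x
  proof -
    obtain z where "F (x + t k *\<^sub>R b) - F (x + 0 *\<^sub>R b) = (t k - 0) * ?D (x + z *\<^sub>R b)"
      using MVT2[of 0 "t k" "\<lambda>\<tau>. F (x + \<tau> *\<^sub>R b)" "\<lambda>\<tau>. ?D (x + \<tau> *\<^sub>R b)"] line t by metis
    then have "s k x = ?D (x + z *\<^sub>R b)" using t[of k] by (simp add: s_def)
    then show ?thesis using C by simp
  qed
  have s_supp: "s k x = 0" if "x \<notin> cball 0 (R + 1)" for k x
  proof -
    have "norm x \<le> norm (x + t k *\<^sub>R b) + norm (t k *\<^sub>R b)" by (metis add_diff_cancel norm_triangle_ineq4)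
    then have "norm (x + t k *\<^sub>R b) > R" using that t[of k] b by simp
    then show ?thesis using that supp by (simp add: s_def)
  qed
  have [measurable]: "s k \<in> borel_measurable borel" for k unfolding s_def by measurable
  have "(\<lambda>k. integral\<^sup>L lborel (s k)) \<longlonglongrightarrow> integral\<^sup>L lborel ?D"
  proof (rule integral_dominated_convergence)
    show "integrable lborel (\<lambda>x. C * indicator (cball (0::'a) (R + 1)) x)"
      using emeasure_bounded_finite[of "cball (0::'a) (R + 1)"] by (intro integrable_mult_right integrable_real_indicator) auto
    show "AE x in lborel. norm (s k x) \<le> C * indicator (cball 0 (R + 1)) x" for k
      using s_bound s_supp by (intro always_eventually allI) (auto simp: indicator_def)
    have "(\<lambda>k. s k x) \<longlonglongrightarrow> ?D x" for x
    proof -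
      have "filterlim t (at 0) sequentially"
        unfolding filterlim_at using LIMSEQ_inverse_real_of_nat t(1) unfolding t_def[abs_def] by (auto simp: less_imp_neq[THEN not_sym])
      moreover have "((\<lambda>\<tau>. (F (x + \<tau> *\<^sub>R b) - F x) / \<tau>) \<longlongrightarrow> ?D x) (at 0)"
        using line[of x 0] by (simp add: has_field_derivative_iff)
      ultimately show ?thesis unfolding s_def by (rule filterlim_compose[rotated])
    qed
    then show "AE x in lborel. (\<lambda>k. s k x) \<longlonglongrightarrow> ?D x" by simp
  qed auto
  moreover have "integral\<^sup>L lborel (s k) = 0" for k
  proof -
    have "integral\<^sup>L lborel F = integral\<^sup>L (distr lborel borel ((+) (t k *\<^sub>R b))) F" by (simp add: lborel_distr_plus)
    also have "\<dots> = integral\<^sup>L lborel (\<lambda>x. F (x + t k *\<^sub>R b))" by (subst integral_distr) (auto simp: add.commute)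
    finally have 1: "integral\<^sup>L lborel (\<lambda>x. F (x + t k *\<^sub>R b)) = integral\<^sup>L lborel F" by simp
    have "integrable (distr lborel borel ((+) (t k *\<^sub>R b))) F" using intF by (simp add: lborel_distr_plus)
    then have "integrable lborel (\<lambda>x. F (x + t k *\<^sub>R b))" by (subst (asm) integrable_distr_eq) (auto simp: add.commute)
    moreover have "s k = (\<lambda>x. (F (x + t k *\<^sub>R b) - F x) / t k)" by (auto simp: s_def)
    ultimately show ?thesis using 1 intF by simp
  qed
  ultimately have "integral\<^sup>L lborel ?D = 0" by (simp add: LIMSEQ_const_iff)
  then show "(\<integral>x. ?D x \<partial>lebesgue) = 0" by (subst integral_completion) auto
  have "integrable lborel ?D"
    by (rule integrable_bounded_support[of _ C R]) (use C D0 in auto)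
  then show "integrable lebesgue ?D" by (subst integrable_completion) auto
qed

lemma test_functionsD:
  assumes "\<phi> \<in> test_functions \<Omega>"
  shows "smooth_on UNIV \<phi>" "compact (closure {x. \<phi> x \<noteq> 0})" "closure {x. \<phi> x \<noteq> 0} \<subseteq> \<Omega>"
    and "x \<notin> closure {x. \<phi> x \<noteq> 0} \<Longrightarrow> \<phi> x = 0" and "x \<notin> \<Omega> \<Longrightarrow> \<phi> x = 0"
    and "x \<notin> closure {x. \<phi> x \<noteq> 0} \<Longrightarrow> partial_deriv b \<phi> x = 0"
proof -
  show *: "smooth_on UNIV \<phi>" "compact (closure {x. \<phi> x \<noteq> 0})" "closure {x. \<phi> x \<noteq> 0} \<subseteq> \<Omega>"
    using assms by (auto simp: test_functions_def)
  show **: "\<phi> x = 0" if "x \<notin> closure {x. \<phi> x \<noteq> 0}" for x using that closure_subset[of "{x. \<phi> x \<noteq> 0}"] by auto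
  show "x \<notin> \<Omega> \<Longrightarrow> \<phi> x = 0" using *(3) **[of x] by blast
  show "partial_deriv b \<phi> x = 0" if "x \<notin> closure {x. \<phi> x \<noteq> 0}"
  proof (rule partial_deriv_eq[of _ "\<lambda>_. 0"])
    show "(\<phi> has_derivative (\<lambda>_. 0)) (at x)"
    proof (rule has_derivative_cong_open[of "- closure {x. \<phi> x \<noteq> 0}" _ "\<lambda>_. 0"])
      show "0 = \<phi> y" if "y \<in> - closure {x. \<phi> x \<noteq> 0}" for y using **[of y] that by simp
    qed (use that in auto)
  qed
qed

lemma test_functions_grad_0: "\<phi> \<in> test_functions \<Omega> \<Longrightarrow> x \<notin> \<Omega> \<Longrightarrow> grad \<phi> x = 0"
  unfolding grad_def using test_functionsD(3)[of \<phi> \<Omega>] test_functionsD(6)[of \<phi> \<Omega> x]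
  by (intro sum.neutral ballI) (auto dest: subsetD)

text \<open>The product \<open>\<phi> w\<close> is smooth on \<open>\<Omega>\<close> and zero off the support of \<open>\<phi>\<close>. These two open sets cover the
  whole space, so the previous lemma applies to it even where \<open>w\<close> is arbitrary.\<close>

lemma integral_by_parts:
  fixes w :: "'a::euclidean_space \<Rightarrow> real"
  assumes \<phi>: "\<phi> \<in> test_functions \<Omega>" and "open \<Omega>" and w: "smooth_on \<Omega> w" and b: "b \<in> Basis"
  shows "integrable lebesgue (\<lambda>x. \<phi> x * partial_deriv b w x + w x * partial_deriv b \<phi> x)" (is ?int)
    and "(\<integral>x. \<phi> x * partial_deriv b w x + w x * partial_deriv b \<phi> x \<partial>lebesgue) = 0" (is ?eq)
proof -
  define K where "K = closure {x. \<phi> x \<noteq> 0}"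
  note \<phi>D = test_functionsD[OF \<phi>, folded K_def]
  have [simp]: "open \<Omega>" "open (-K)" using assms by (auto simp: K_def)
  have U: "\<Omega> \<union> -K = UNIV" using \<phi>D(3) by auto
  let ?F = "\<lambda>x. \<phi> x * w x"
  have "smooth_on \<Omega> ?F" using \<phi>D(1) w by (auto intro!: smooth intro: smooth_on_subset[of UNIV])
  moreover have "smooth_on (-K) ?F"
    by (rule smooth_on_cong[of _ "\<lambda>_. 0"]) (use \<phi>D(4) in \<open>auto intro!: smooth\<close>)
  ultimately have F: "smooth_on UNIV ?F" using smooth_on_Un[of \<Omega> "-K" ?F] U by simp
  have eq: "partial_deriv b ?F x = \<phi> x * partial_deriv b w x + w x * partial_deriv b \<phi> x" for x
  proof (cases "x \<in> \<Omega>")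
    case True
    then show ?thesis using smooth_on_differentiable[OF _ w True] smooth_on_differentiable[OF _ \<phi>D(1), of x]
      by (subst partial_deriv_mult) auto
  next
    case False
    then have x: "x \<in> -K" using \<phi>D(3) by auto
    have "partial_deriv b ?F x = partial_deriv b (\<lambda>_. 0) x"
      by (rule partial_deriv_cong[of "-K"]) (use x \<phi>D(4) in auto)
    also have "\<dots> = 0" by (rule partial_deriv_eq[of _ "\<lambda>_. 0"]) simp
    finally show ?thesis using x \<phi>D(4)[of x] \<phi>D(6)[of x] by simp
  qed
  obtain R where R: "\<And>x. x \<in> K \<Longrightarrow> norm x \<le> R" using compact_imp_bounded[OF \<phi>D(2)] unfolding bounded_iff by auto
  have R': "?F x = 0" if "norm x > R" for x using R[of x] that \<phi>D(4)[of x] by (cases "x \<in> K") auto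
  note * = integral_partial_deriv_eq_0[of ?F b R, OF smooth_on_differentiable[OF open_UNIV F UNIV_I]
      smooth_on_continuous[OF smooth_on_partial_deriv[OF F b]] R' b, unfolded eq]
  then show ?int ?eq by auto
qed


lemma integrable_lebesgue_on_bounded:
  fixes f :: "'a::euclidean_space \<Rightarrow> 'b::euclidean_space"
  assumes "S \<in> lmeasurable" "f \<in> borel_measurable (lebesgue_on S)" "AE x in lebesgue_on S. norm (f x) \<le> C"
  shows "integrable (lebesgue_on S) f"
  by (rule finite_measure.integrable_const_bound[OF finite_measure_lebesgue_on[OF assms(1)] assms(3,2)])

lemma AE_lebesgue_on_nonzero: "S \<in> sets lebesgue \<Longrightarrow> AE x in lebesgue_on S. x \<noteq> (0::'a::euclidean_space)"
proof -
  assume S: "S \<in> sets lebesgue"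
  have "AE x in lebesgue. x \<noteq> (0::'a)"
    by (rule AE_I'[of "{0}"]) (auto intro: null_sets_completionI simp: finite_imp_null_set_lborel)
  then show ?thesis using S by (subst AE_restrict_space_iff) auto
qed

lemma AE_lebesgue_on_off_origin:
  assumes "S \<in> sets lebesgue" "\<And>x::'a::euclidean_space. x \<in> S - {0} \<Longrightarrow> P x"
  shows "AE x in lebesgue_on S. P x"
  using AE_lebesgue_on_nonzero[OF assms(1)]
proof (rule AE_mp)
  show "AE x in lebesgue_on S. x \<noteq> 0 \<longrightarrow> P x" by (rule AE_I2) (use assms in auto)
qed

lemma borel_measurable_insert_origin:
  fixes f :: "'a::euclidean_space \<Rightarrow> 'b::euclidean_space"
  assumes S: "S \<in> sets lebesgue" and f: "f \<in> borel_measurable (lebesgue_on (S - {0}))"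
  shows "f \<in> borel_measurable (lebesgue_on S)"
proof -
  have S0: "S - {0} \<in> sets lebesgue" using S by auto
  from f have *: "(\<lambda>x. if x \<in> S - {0} then f x else 0) \<in> borel_measurable (lebesgue_on S)"
    using borel_measurable_if_lebesgue_on[OF S0 S, of f] by auto
  have [measurable]: "S \<inter> {0} \<in> sets (lebesgue_on S)" using S by (simp add: sets_restrict_space_iff sets.Int)
  have "(\<lambda>x. if x \<in> {0} then f 0 else (if x \<in> S - {0} then f x else 0)) \<in> borel_measurable (lebesgue_on S)"
    by (rule measurable_If_set[OF _ *]) (auto simp: Int_commute)
  then show ?thesis by (rule measurable_cong[THEN iffD1, rotated]) auto
qed

lemma borel_measurable_off_origin:
  fixes f :: "'a::euclidean_space \<Rightarrow> 'b::euclidean_space"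
  assumes S: "S \<in> sets lebesgue" and f: "continuous_on (S - {0}) f"
  shows "f \<in> borel_measurable (lebesgue_on S)"
  by (rule borel_measurable_insert_origin[OF S continuous_imp_measurable_on_sets_lebesgue[OF f]]) (use S in auto)

lemma ball_lebesgue [simp]: "ball (c::'a::euclidean_space) r \<in> sets lebesgue" "ball c r \<in> lmeasurable"
  by (auto intro: fmeasurableD)

text \<open>The rescaled step \<open>smooth_step (m\<^sup>2 \<bar>x\<bar>\<^sup>2)\<close> cuts off the origin.\<close>

lemma grad_step_norm_sq:
  "grad (\<lambda>x::'a::euclidean_space. smooth_step (c * (x \<bullet> x))) x = (deriv smooth_step (c * (x \<bullet> x)) * (c * 2)) *\<^sub>R x"
proof -
  have "((\<lambda>x. smooth_step (c * (x \<bullet> x))) has_derivative (\<lambda>h. deriv smooth_step (c * (x \<bullet> x)) * (c * (2 * (x \<bullet> h))))) (at x)"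
    by (rule has_derivative_compose[OF _ smooth_step_has_derivative[unfolded has_field_derivative_def], where f = "\<lambda>x. c * (x \<bullet> x)"])
      (auto intro!: derivative_eq_intros simp: inner_commute)
  then have "((\<lambda>x. smooth_step (c * (x \<bullet> x))) has_derivative (\<lambda>h. ((deriv smooth_step (c * (x \<bullet> x)) * (c * 2)) *\<^sub>R x) \<bullet> h)) (at x)"
    by (simp add: mult.assoc)
  then show ?thesis by (rule grad_unique)
qed

lemma smooth_on_step_norm_sq: "open S \<Longrightarrow> smooth_on S (\<lambda>x. smooth_step (c * (x \<bullet> x)))"
  by (rule smooth_on_compose[OF _ open_UNIV _ smooth_on_smooth_step]) (auto intro!: smooth)

lemma test_functions_cutoff:
  assumes \<phi>: "\<phi> \<in> test_functions \<Omega>" and c: "c > 0"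
  shows "(\<lambda>x. \<phi> x * smooth_step (c * (x \<bullet> x))) \<in> test_functions (\<Omega> - {0})"
proof -
  note \<phi>D = test_functionsD[OF \<phi>]
  let ?K = "closure {x. \<phi> x \<noteq> 0}"
  let ?A = "{x. \<phi> x * smooth_step (c * (x \<bullet> x)) \<noteq> 0}"
  have cl: "closed {x::'a. 1 \<le> c * (x \<bullet> x)}" by (intro closed_Collect_le continuous_intros)
  have "?A \<subseteq> ?K \<inter> {x. 1 \<le> c * (x \<bullet> x)}"
    using closure_subset[of "{x. \<phi> x \<noteq> 0}"] by (auto; metis linear smooth_step_0)
  then have sub: "closure ?A \<subseteq> ?K \<inter> {x. 1 \<le> c * (x \<bullet> x)}"
    using cl by (intro closure_minimal) auto
  then have "compact (closure ?A)" using \<phi>D(2)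
    by (metis (no_types, lifting) Int_subset_iff closed_closure compact_Int_closed inf.absorb2)
  moreover have "closure ?A \<subseteq> \<Omega> - {0}" using sub \<phi>D(3) by auto
  ultimately show ?thesis using \<phi>D(1) unfolding test_functions_def
    by (auto intro!: smooth smooth_on_step_norm_sq)
qed

lemma test_functions_bounded:
  fixes \<phi> :: "'a::euclidean_space \<Rightarrow> real"
  assumes \<phi>: "\<phi> \<in> test_functions \<Omega>"
  obtains C where "C > 0" "\<And>x. \<bar>\<phi> x\<bar> \<le> C" "\<And>x. norm (grad \<phi> x) \<le> C"
proof -
  note \<phi>D = test_functionsD[OF \<phi>]
  obtain C1 where C1: "C1 > 0" "\<And>x. x \<in> closure {x. \<phi> x \<noteq> 0} \<Longrightarrow> norm (\<phi> x) \<le> C1"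
    using continuous_on_compact_bounded[OF \<phi>D(2) continuous_on_subset[OF smooth_on_continuous[OF \<phi>D(1)]]] by auto
  obtain C2 where C2: "C2 > 0" "\<And>x. x \<in> closure {x. \<phi> x \<noteq> 0} \<Longrightarrow> norm (grad \<phi> x) \<le> C2"
    using continuous_on_compact_bounded[OF \<phi>D(2) continuous_on_subset[OF smooth_on_continuous_grad[OF \<phi>D(1)]]] by auto
  have g0: "grad \<phi> x = 0" if "x \<notin> closure {x. \<phi> x \<noteq> 0}" for x
    unfolding grad_def using \<phi>D(6)[OF that] by simp
  have "\<bar>\<phi> x\<bar> \<le> max C1 C2" "norm (grad \<phi> x) \<le> max C1 C2" for x
    using C1 C2 g0[of x] \<phi>D(4)[of x] by (cases "x \<in> closure {x. \<phi> x \<noteq> 0}"; force simp: max_def)+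
  then show ?thesis using that[of "max C1 C2"] C1(1) by auto
qed

text \<open>Green's formula for a function that may be singular at the origin, as long as its gradient
  and its Laplacian stay bounded: in dimension at least two, the gradients of the cutoffs, of size
  \<open>m\<close> on a ball of radius \<open>2/m\<close>, contribute nothing in the limit.\<close>

lemma green_off_origin:
  fixes v :: "'a::euclidean_space \<Rightarrow> real"
  assumes dim: "DIM('a) \<ge> 2" and \<phi>: "\<phi> \<in> test_functions (ball 0 1)"
    and v: "smooth_on (ball 0 1 - {0}) v"
    and g: "\<And>x. x \<in> ball 0 1 - {0} \<Longrightarrow> norm (grad v x) \<le> C"
    and l: "\<And>x. x \<in> ball 0 1 - {0} \<Longrightarrow> \<bar>laplacian v x\<bar> \<le> C"
  shows "(\<integral>x. grad v x \<bullet> grad \<phi> x \<partial>lebesgue_on (ball 0 1)) = - (\<integral>x. \<phi> x * laplacian v x \<partial>lebesgue_on (ball 0 1))"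
proof -
  let ?B = "ball 0 1 :: 'a set"
  let ?M = "lebesgue_on ?B"
  note \<phi>D = test_functionsD[OF \<phi>]
  have [simp]: "open (?B - {0})" by auto
  have C0: "C \<ge> 0"
  proof -
    obtain b :: 'a where "b \<in> Basis" using nonempty_Basis by blast
    then have "norm (grad v ((1/2) *\<^sub>R b)) \<le> C" by (intro g) auto
    then show ?thesis using norm_ge_zero order_trans by blast
  qed
  obtain P where P: "P > 0" "\<And>x. \<bar>\<phi> x\<bar> \<le> P" "\<And>x. norm (grad \<phi> x) \<le> P" by (rule test_functions_bounded[OF \<phi>]) blast
  obtain K where K: "K > 0" "\<And>s. \<bar>deriv smooth_step s\<bar> \<le> K" using deriv_smooth_step_bounded by blast
  have cv: "continuous_on (?B - {0}) (grad v)" by (rule smooth_on_continuous_grad[OF v])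
  have cl: "continuous_on (?B - {0}) (laplacian v)" unfolding laplacian_def
    by (intro continuous_intros smooth_on_continuous smooth_on_partial_deriv v)
  have c\<phi>: "continuous_on S \<phi>" "continuous_on S (grad \<phi>)" for S
    using smooth_on_continuous[OF \<phi>D(1)] smooth_on_continuous_grad[OF \<phi>D(1)] by (auto intro: continuous_on_subset)
  \<comment> \<open>Index \<open>j\<close> belongs to \<open>m = j + 1\<close>. Integrating \<open>\<eta> f + r\<close> gives zero, where \<open>r\<close> collects the gradient of the cutoff.\<close>
  define \<eta> where "\<eta> j x = smooth_step ((real (Suc j))\<^sup>2 * (x \<bullet> x))" for j and x :: 'a
  have c\<eta>: "continuous_on S (\<eta> j)" "continuous_on S (grad (\<eta> j))" for S j
    using smooth_on_continuous[OF smooth_on_step_norm_sq[OF open_UNIV, of "(real (Suc j))\<^sup>2"]]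
      smooth_on_continuous_grad[OF smooth_on_step_norm_sq[OF open_UNIV, of "(real (Suc j))\<^sup>2"]]
    unfolding \<eta>_def by (auto intro: continuous_on_subset)
  have \<eta>01: "0 \<le> \<eta> j x" "\<eta> j x \<le> 1" for j x by (auto simp: \<eta>_def smooth_step_nonneg smooth_step_le_1)
  define f where "f x = \<phi> x * laplacian v x + grad v x \<bullet> grad \<phi> x" for x
  define r where "r j x = \<phi> x * (grad v x \<bullet> grad (\<eta> j) x)" for j x
  have cr: "continuous_on (?B - {0}) f" "continuous_on (?B - {0}) (r j)" for j
    unfolding f_def r_def by (intro continuous_intros cv cl c\<phi> c\<eta>)+
  have [measurable]: "f \<in> borel_measurable ?M" "r j \<in> borel_measurable ?M" "\<eta> j \<in> borel_measurable ?M" for j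
    by (auto intro!: borel_measurable_off_origin cr c\<eta>)
  have f_bound: "AE x in ?M. norm (f x) \<le> P * C + C * P"
  proof -
    have "norm (f x) \<le> P * C + C * P" if "x \<in> ?B - {0}" for x
    proof -
      have "norm (f x) \<le> \<bar>\<phi> x\<bar> * \<bar>laplacian v x\<bar> + norm (grad v x) * norm (grad \<phi> x)"
        unfolding f_def using Cauchy_Schwarz_ineq2[of "grad v x" "grad \<phi> x"]
        by (auto simp: abs_mult intro!: order_trans[OF abs_triangle_ineq])
      also have "\<dots> \<le> P * C + C * P"
        using P(2,3)[of x] g[OF that] l[OF that] P(1) C0 by (intro add_mono mult_mono) auto
      finally show ?thesis .
    qed
    then show ?thesis by (intro AE_lebesgue_on_off_origin) auto
  qed
  have int_f: "integrable ?M f" by (rule integrable_lebesgue_on_bounded[OF _ _ f_bound]) auto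
  have \<eta>0: "grad (\<eta> j) x = 0" if "norm x > 2 / real (Suc j)" for j x
  proof -
    have "2 < real (Suc j) * norm x" using that by (simp add: field_simps)
    then have "2\<^sup>2 < (real (Suc j) * norm x)\<^sup>2" by (intro power_strict_mono) auto
    then have "(real (Suc j))\<^sup>2 * (x \<bullet> x) > 2" by (simp add: power_mult_distrib power2_norm_eq_inner)
    then show ?thesis unfolding \<eta>_def grad_step_norm_sq by (simp add: deriv_smooth_step_eq_0)
  qed
  have \<eta>1: "norm (grad (\<eta> j) x) \<le> 4 * K * real (Suc j)" for j x
  proof (cases "norm x > 2 / real (Suc j)")
    case False
    have "norm (grad (\<eta> j) x) = \<bar>deriv smooth_step ((real (Suc j))\<^sup>2 * (x \<bullet> x))\<bar> * (2 * (real (Suc j))\<^sup>2 * norm x)"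
      unfolding \<eta>_def grad_step_norm_sq by (simp add: abs_mult)
    also have "\<dots> \<le> K * (2 * (real (Suc j))\<^sup>2 * (2 / real (Suc j)))"
      using False K(1) by (intro mult_mono K(2)) auto
    also have "\<dots> = 4 * K * real (Suc j)" by (simp add: power2_eq_square)
    finally show ?thesis .
  qed (use \<eta>0 K(1) in auto)
  have r_bound: "norm (r j x) \<le> (P * C * (4 * K * real (Suc j))) * indicator (cball 0 (2 / real (Suc j))) x"
    if "x \<in> ?B - {0}" for j x
  proof (cases "norm x > 2 / real (Suc j)")
    case False
    have "norm (r j x) \<le> \<bar>\<phi> x\<bar> * (norm (grad v x) * norm (grad (\<eta> j) x))"
      unfolding r_def by (simp add: abs_mult mult_left_mono Cauchy_Schwarz_ineq2)
    also have "\<dots> \<le> P * (C * (4 * K * real (Suc j)))"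
      using P(2)[of x] g[OF that] \<eta>1[of j x] P(1) C0 K(1) by (intro mult_mono) auto
    finally show ?thesis using False by simp
  qed (use \<eta>0 in \<open>auto simp: r_def\<close>)
  have ind: "integrable ?M (\<lambda>x. c * indicator (cball 0 R) x)" for c R :: real
  proof (rule integrable_lebesgue_on_bounded[where C = "\<bar>c\<bar>"])
    show "(\<lambda>x. c * indicator (cball 0 R) x) \<in> borel_measurable ?M"
      by (intro measurable_restrict_space1 measurable_completion borel_measurable_times borel_measurable_const
          borel_measurable_indicator) auto
  qed (auto simp: indicator_def)
  have r_AE: "AE x in ?M. norm (r j x) \<le> (P * C * (4 * K * real (Suc j))) * indicator (cball 0 (2 / real (Suc j))) x" for j
    by (intro AE_lebesgue_on_off_origin r_bound) auto
  have int_r: "integrable ?M (r j)" for j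
  proof (rule Bochner_Integration.integrable_bound)
    show "integrable ?M (\<lambda>x. (P * C * (4 * K * real (Suc j))) * indicator (cball 0 (2 / real (Suc j))) x)" by (rule ind)
    show "AE x in ?M. norm (r j x) \<le> norm ((P * C * (4 * K * real (Suc j))) * indicator (cball 0 (2 / real (Suc j))) x)"
      using r_AE[of j] by eventually_elim (auto intro: order_trans[OF _ abs_ge_self])
  qed simp
  define V where "V = P * C * (4 * K) * (unit_ball_vol (real DIM('a)) * 2 ^ DIM('a))"
  have r_int: "\<bar>integral\<^sup>L ?M (r j)\<bar> \<le> V / real (Suc j)" for j
  proof -
    have "\<bar>integral\<^sup>L ?M (r j)\<bar> \<le> (\<integral>x. (P * C * (4 * K * real (Suc j))) * indicator (cball 0 (2 / real (Suc j))) x \<partial>?M)"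
      using order_trans[OF integral_norm_bound[of ?M "r j"] integral_mono_AE[OF integrable_norm[OF int_r[of j]] ind r_AE[of j]]]
      unfolding real_norm_def .
    also have "\<dots> = (P * C * (4 * K * real (Suc j))) * measure ?M (cball 0 (2 / real (Suc j)) \<inter> ?B)"
      by simp
    finally have 1: "\<bar>integral\<^sup>L ?M (r j)\<bar> \<le> (P * C * (4 * K * real (Suc j))) * measure ?M (cball 0 (2 / real (Suc j)) \<inter> ?B)" .
    have "measure ?M (cball 0 (2 / real (Suc j)) \<inter> ?B) = measure lebesgue (cball 0 (2 / real (Suc j)) \<inter> ?B)"
      by (rule measure_restrict_space) auto
    also have "\<dots> \<le> measure lebesgue (cball 0 (2 / real (Suc j)) :: 'a set)"
      by (intro measure_mono_fmeasurable) (auto intro: sets.Int)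
    also have "\<dots> = unit_ball_vol (real DIM('a)) * (2 / real (Suc j)) ^ DIM('a)"
      by (simp add: content_cball)
    also have "\<dots> \<le> unit_ball_vol (real DIM('a)) * (2 ^ DIM('a) / (real (Suc j))\<^sup>2)"
      using dim by (intro mult_left_mono) (auto simp: power_divide intro!: divide_left_mono power_increasing)
    finally have 2: "measure ?M (cball 0 (2 / real (Suc j)) \<inter> ?B) \<le> \<dots>" .
    have "\<bar>integral\<^sup>L ?M (r j)\<bar> \<le> (P * C * (4 * K * real (Suc j))) * (unit_ball_vol (real DIM('a)) * (2 ^ DIM('a) / (real (Suc j))\<^sup>2))"
      using P(1) C0 K(1) by (intro order_trans[OF 1 mult_left_mono[OF 2]]) auto
    then show ?thesis by (simp add: V_def power2_eq_square)
  qed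
  have zero: "(\<integral>x. \<eta> j x * f x + r j x \<partial>?M) = 0" for j
  proof -
    define \<psi> where "\<psi> = (\<lambda>x. \<phi> x * \<eta> j x)"
    have \<psi>: "\<psi> \<in> test_functions (?B - {0})"
      unfolding \<psi>_def \<eta>_def by (rule test_functions_cutoff[OF \<phi>]) simp
    have eq: "(\<Sum>b\<in>Basis. \<psi> x * partial_deriv b (partial_deriv b v) x + partial_deriv b v x * partial_deriv b \<psi> x)
        = \<eta> j x * f x + r j x" for x
    proof -
      have "grad \<psi> x = \<eta> j x *\<^sub>R grad \<phi> x + \<phi> x *\<^sub>R grad (\<eta> j) x"
        unfolding \<psi>_def \<eta>_def using smooth_on_differentiable[OF open_UNIV] \<phi>D(1) smooth_on_step_norm_sq[OF open_UNIV]
        by (intro grad_mult) auto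
      then have "grad v x \<bullet> grad \<psi> x = \<eta> j x * (grad v x \<bullet> grad \<phi> x) + \<phi> x * (grad v x \<bullet> grad (\<eta> j) x)"
        by (simp add: inner_add_right)
      moreover have "(\<Sum>b\<in>Basis. partial_deriv b v x * partial_deriv b \<psi> x) = grad v x \<bullet> grad \<psi> x"
        by (subst euclidean_inner) (simp add: grad_inner_Basis)
      ultimately show ?thesis
        by (simp add: sum.distrib sum_distrib_left[symmetric] laplacian_def[symmetric] f_def r_def \<psi>_def algebra_simps)
    qed
    note ibp = integral_by_parts[OF \<psi> _ smooth_on_partial_deriv[OF v]]
    have "(\<integral>x. (\<Sum>b\<in>Basis. \<psi> x * partial_deriv b (partial_deriv b v) x + partial_deriv b v x * partial_deriv b \<psi> x) \<partial>lebesgue) = 0"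
      by (subst Bochner_Integration.integral_sum) (auto intro: ibp(1) simp: ibp(2))
    then have "(\<integral>x. \<eta> j x * f x + r j x \<partial>lebesgue) = 0" unfolding eq .
    moreover have "\<eta> j x * f x + r j x = 0" if "x \<notin> ?B" for x
      using that \<phi>D(5) test_functions_grad_0[OF \<phi>] by (simp add: f_def r_def)
    ultimately show ?thesis by (subst integral_lebesgue_on_eq(1)) auto
  qed
  have int_\<eta>f: "integrable ?M (\<lambda>x. \<eta> j x * f x)" for j
    using int_f by (rule Bochner_Integration.integrable_bound)
      (use \<eta>01[of j] in \<open>auto simp: abs_mult intro!: always_eventually mult_left_le_one_le\<close>)
  have "(\<lambda>j. \<integral>x. \<eta> j x * f x \<partial>?M) \<longlonglongrightarrow> integral\<^sup>L ?M f"
  proof (rule integral_dominated_convergence[where w = "\<lambda>x. norm (f x)"])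
    show "AE x in ?M. norm (\<eta> j x * f x) \<le> norm (f x)" for j
      using \<eta>01[of j] by (auto simp: abs_mult intro!: always_eventually mult_left_le_one_le)
    have "(\<lambda>j. \<eta> j x * f x) \<longlonglongrightarrow> f x" if "x \<noteq> 0" for x
    proof (rule tendsto_eventually)
      have "eventually (\<lambda>j. real j > 2 / norm x) sequentially" using reals_Archimedean2[of "2 / norm x"] by (meson eventually_sequentially less_le_trans of_nat_mono)
      then show "\<forall>\<^sub>F j in sequentially. \<eta> j x * f x = f x"
      proof eventually_elim
        case (elim j)
        then have "2 < real j * norm x" using that by (simp add: field_simps)
        then have "2 < real (Suc j) * norm x" by (simp add: distrib_right add_strict_increasing2)
        then have "2\<^sup>2 < (real (Suc j) * norm x)\<^sup>2" by (intro power_strict_mono) auto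
        then have "(real (Suc j))\<^sup>2 * (x \<bullet> x) > 2" by (simp add: power_mult_distrib power2_norm_eq_inner)
        then show ?case by (simp add: \<eta>_def smooth_step_1)
      qed
    qed
    then show "AE x in ?M. (\<lambda>j. \<eta> j x * f x) \<longlonglongrightarrow> f x"
      using AE_lebesgue_on_nonzero[of ?B] by (auto elim!: eventually_mono)
  qed (use int_f in auto)
  moreover have "(\<lambda>j. integral\<^sup>L ?M (r j)) \<longlonglongrightarrow> 0"
  proof (rule Lim_null_comparison[OF always_eventually])
    show "\<forall>j. norm (integral\<^sup>L ?M (r j)) \<le> V * inverse (real (Suc j))" using r_int by (simp add: divide_inverse)
    show "(\<lambda>j. V * inverse (real (Suc j))) \<longlonglongrightarrow> 0"
      by (rule tendsto_mult_right_zero[OF LIMSEQ_inverse_real_of_nat])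
  qed
  ultimately have "(\<lambda>j. (\<integral>x. \<eta> j x * f x \<partial>?M) + integral\<^sup>L ?M (r j)) \<longlonglongrightarrow> integral\<^sup>L ?M f + 0"
    by (rule tendsto_add)
  moreover have "(\<integral>x. \<eta> j x * f x \<partial>?M) + integral\<^sup>L ?M (r j) = 0" for j
    using zero[of j] int_\<eta>f int_r by simp
  ultimately have f0: "integral\<^sup>L ?M f = 0" by (simp add: LIMSEQ_const_iff)
  have "integrable ?M (\<lambda>x. \<phi> x * laplacian v x)"
  proof (rule integrable_lebesgue_on_bounded[where C = "P * C"])
    show "(\<lambda>x. \<phi> x * laplacian v x) \<in> borel_measurable ?M"
      by (intro borel_measurable_off_origin continuous_intros c\<phi> cl) auto
    have "norm (\<phi> x * laplacian v x) \<le> P * C" if "x \<in> ?B - {0}" for x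
      using P(2)[of x] l[OF that] P(1) by (auto simp: abs_mult intro!: mult_mono)
    then show "AE x in ?M. norm (\<phi> x * laplacian v x) \<le> P * C"
      by (intro AE_lebesgue_on_off_origin) auto
  qed auto
  moreover from Bochner_Integration.integrable_diff[OF int_f this]
  have "integrable ?M (\<lambda>x. grad v x \<bullet> grad \<phi> x)" by (simp add: f_def)
  ultimately show ?thesis using f0 unfolding f_def[abs_def] by simp
qed

section \<open>Functions orthogonal to all polynomials\<close>

abbreviation unit_ball_measure :: "'a::euclidean_space measure" where
  "unit_ball_measure \<equiv> lebesgue_on (ball 0 1)"

lemma integrable_mult_bounded:
  fixes f h :: "'a::euclidean_space \<Rightarrow> real"
  assumes "integrable M f" "h \<in> borel_measurable M" "AE x in M. \<bar>h x\<bar> \<le> C"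
  shows "integrable M (\<lambda>x. f x * h x)"
proof (rule Bochner_Integration.integrable_bound)
  show "integrable M (\<lambda>x. C * f x)" using assms(1) by simp
  show "AE x in M. norm (f x * h x) \<le> norm (C * f x)"
    using assms(3)
  proof eventually_elim
    case (elim x)
    then show ?case using mult_right_mono[of "\<bar>h x\<bar>" "\<bar>C\<bar>" "\<bar>f x\<bar>"] by (simp add: abs_mult mult.commute)
  qed
qed (use assms in auto)

lemma measurable_continuous_ball:
  fixes f :: "'a::euclidean_space \<Rightarrow> 'b::euclidean_space"
  assumes "continuous_on (ball 0 1) f" shows "f \<in> borel_measurable unit_ball_measure"
  using assms by (intro continuous_imp_measurable_on_sets_lebesgue) auto

text \<open>By the Stone--Weierstrass theorem.\<close>

lemma orthogonal_polynomials_imp_orthogonal_continuous: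
  fixes u :: "'a::euclidean_space \<Rightarrow> real"
  assumes u: "integrable unit_ball_measure u"
    and orth: "\<And>p. real_polynomial_function p \<Longrightarrow> (\<integral>x. u x * p x \<partial>unit_ball_measure) = 0"
    and g: "continuous_on UNIV g"
  shows "(\<integral>x. u x * g x \<partial>unit_ball_measure) = 0"
proof -
  let ?M = "unit_ball_measure :: 'a measure"
  have bd: "integrable ?M (\<lambda>x. u x * h x)" if "continuous_on UNIV h" for h
  proof -
    have "continuous_on (cball 0 1) h" using that by (rule continuous_on_subset) auto
    then obtain C where "\<And>x. x \<in> cball 0 1 \<Longrightarrow> norm (h x) \<le> C"
      by (rule continuous_on_compact_bounded[OF compact_cball]) auto
    moreover have "h \<in> borel_measurable ?M"
      by (intro measurable_continuous_ball continuous_on_subset[OF that]) auto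
    ultimately show ?thesis by (intro integrable_mult_bounded[OF u, where C = C] AE_I2) auto
  qed
  have "\<bar>\<integral>x. u x * g x \<partial>?M\<bar> \<le> e * (\<integral>x. \<bar>u x\<bar> \<partial>?M)" if "e > 0" for e
  proof -
    obtain p where p: "real_polynomial_function p" "\<And>x. x \<in> cball 0 1 \<Longrightarrow> \<bar>g x - p x\<bar> < e"
      by (rule Stone_Weierstrass_real_polynomial_function[OF compact_cball[of "0::'a" 1] continuous_on_subset[OF g subset_UNIV] \<open>e > 0\<close>]) blast
    have cp: "continuous_on UNIV p" using p(1) by (simp add: continuous_on_polymonial_function real_polynomial_function_eq)
    have "(\<integral>x. u x * g x \<partial>?M) = (\<integral>x. u x * (g x - p x) \<partial>?M)"
      using bd[OF g] bd[OF cp] orth[OF p(1)] by (simp add: right_diff_distrib)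
    also have "\<bar>\<dots>\<bar> \<le> (\<integral>x. \<bar>u x * (g x - p x)\<bar> \<partial>?M)" by (rule integral_abs_bound)
    also have "\<dots> \<le> (\<integral>x. e * \<bar>u x\<bar> \<partial>?M)"
    proof (rule integral_mono)
      show "integrable ?M (\<lambda>x. \<bar>u x * (g x - p x)\<bar>)"
        by (intro integrable_abs bd continuous_on_diff g cp)
      show "\<bar>u x * (g x - p x)\<bar> \<le> e * \<bar>u x\<bar>" if "x \<in> space ?M" for x
        using p(2)[of x] that mult_left_mono[of "\<bar>g x - p x\<bar>" e "\<bar>u x\<bar>"] by (auto simp: abs_mult mult.commute)
    qed (use u in auto)
    finally show ?thesis by simp
  qed
  note * = this
  show ?thesis
  proof (rule ccontr)
    assume n: "(\<integral>x. u x * g x \<partial>?M) \<noteq> 0"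
    define I where "I = (\<integral>x. \<bar>u x\<bar> \<partial>?M)"
    have "I \<ge> 0" unfolding I_def by simp
    define e where "e = \<bar>\<integral>x. u x * g x \<partial>?M\<bar> / (2 * (I + 1))"
    have "e > 0" using n \<open>I \<ge> 0\<close> by (auto simp: e_def)
    have "e * I \<le> \<bar>\<integral>x. u x * g x \<partial>?M\<bar> / 2"
      using \<open>I \<ge> 0\<close> by (auto simp: e_def field_simps mult_left_mono)
    with *[OF \<open>e > 0\<close>] n show False unfolding I_def by auto
  qed
qed

text \<open>The sign of \<open>u\<close> is almost everywhere a limit of continuous functions with values in
  \<open>[-1, 1]\<close>, so that orthogonality to continuous functions gives \<open>\<integral> \<bar>u\<bar> = 0\<close>.\<close>

lemma orthogonal_polynomials_imp_AE_0:
  fixes u :: "'a::euclidean_space \<Rightarrow> real"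
  assumes u: "integrable unit_ball_measure u"
    and orth: "\<And>p. real_polynomial_function p \<Longrightarrow> (\<integral>x. u x * p x \<partial>unit_ball_measure) = 0"
  shows "AE x in unit_ball_measure. u x = 0"
proof -
  let ?M = "unit_ball_measure :: 'a measure"
  have um[measurable]: "u \<in> borel_measurable ?M" using u by auto
  define s where "s x = (if x \<in> ball 0 1 then sgn (u x) else 0)" for x
  have "s \<in> borel_measurable lebesgue" unfolding s_def
    by (subst borel_measurable_if) (auto intro: borel_measurable_sgn)
  then have "s measurable_on UNIV" by (rule lebesgue_measurable_imp_measurable_on) auto
  then obtain N g where N: "negligible N" and g: "\<And>n. continuous_on UNIV (g n)"
    and lim: "\<And>x. x \<notin> N \<Longrightarrow> (\<lambda>n. g n x) \<longlonglongrightarrow> s x"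
    unfolding measurable_on_def by auto
  define c where "c n x = max (-1) (min 1 (g n x))" for n :: nat and x
  have c: "continuous_on UNIV (c n)" for n unfolding c_def by (intro continuous_intros g)
  have [measurable]: "c n \<in> borel_measurable ?M" for n
    by (intro measurable_continuous_ball continuous_on_subset[OF c]) auto
  have "(\<lambda>n. \<integral>x. u x * c n x \<partial>?M) \<longlonglongrightarrow> (\<integral>x. \<bar>u x\<bar> \<partial>?M)"
  proof (rule integral_dominated_convergence[where w = "\<lambda>x. \<bar>u x\<bar>"])
    have "AE x in lebesgue. x \<notin> N" using N by (intro AE_not_in) (simp add: negligible_iff_null_sets)
    then have "AE x in ?M. x \<notin> N" by (subst AE_restrict_space_iff) auto
    moreover have "AE x in ?M. x \<in> ball 0 1" by (intro AE_I2) auto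
    ultimately show "AE x in ?M. (\<lambda>n. u x * c n x) \<longlonglongrightarrow> \<bar>u x\<bar>"
    proof eventually_elim
      case (elim x)
      have "(\<lambda>n. u x * c n x) \<longlonglongrightarrow> u x * max (-1) (min 1 (s x))"
        unfolding c_def by (intro tendsto_intros lim elim)
      also have "u x * max (-1) (min 1 (s x)) = \<bar>u x\<bar>" using elim by (auto simp: s_def sgn_if)
      finally show ?case .
    qed
    show "AE x in ?M. norm (u x * c n x) \<le> \<bar>u x\<bar>" for n
      by (intro AE_I2) (auto simp: abs_mult c_def intro!: mult_left_le)
  qed (use u in auto)
  moreover have "(\<integral>x. u x * c n x \<partial>?M) = 0" for n
    by (rule orthogonal_polynomials_imp_orthogonal_continuous[OF u orth c])
  ultimately have "(\<integral>x. \<bar>u x\<bar> \<partial>?M) = 0" by (simp add: LIMSEQ_const_iff)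
  then show ?thesis using u by (subst (asm) integral_nonneg_eq_0_iff_AE) auto
qed

section \<open>Weak gradients and the Sobolev space\<close>

lemma test_functions_step:
  fixes w :: "'a::euclidean_space \<Rightarrow> real"
  assumes "open \<Omega>" and w: "smooth_on \<Omega> w" and d: "smooth_on UNIV d"
    and comp: "compact {x. 1 \<le> d x}" and sub: "{x. 1 \<le> d x} \<subseteq> \<Omega>"
  shows "(\<lambda>x. w x * smooth_step (d x)) \<in> test_functions \<Omega>"
proof -
  let ?A = "{x. w x * smooth_step (d x) \<noteq> 0}"
  have "?A \<subseteq> {x. 1 \<le> d x}" by (auto; metis linear smooth_step_0)
  then have cA: "closure ?A \<subseteq> {x. 1 \<le> d x}" using comp by (intro closure_minimal compact_imp_closed) auto
  then have "compact (closure ?A)" using comp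
    by (metis (no_types, lifting) closed_closure compact_Int_closed inf.absorb2)
  moreover have "smooth_on UNIV (\<lambda>x. w x * smooth_step (d x))"
  proof -
    have sd: "smooth_on UNIV (\<lambda>x. smooth_step (d x))"
      by (rule smooth_on_compose[OF _ open_UNIV _ smooth_on_smooth_step d]) auto
    have o: "open (- {x. 1 \<le> d x})" using comp compact_imp_closed by blast
    have "smooth_on \<Omega> (\<lambda>x. w x * smooth_step (d x))"
      using assms(1) by (intro smooth_on_mult w smooth_on_subset[OF _ _ _ sd]) auto
    moreover have "smooth_on (- {x. 1 \<le> d x}) (\<lambda>x. w x * smooth_step (d x))"
      by (rule smooth_on_cong[OF o _ smooth_on_const[OF o, of 0]]) (auto simp: smooth_step_0)
    moreover have "\<Omega> \<union> - {x. 1 \<le> d x} = UNIV" using sub by auto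
    ultimately show ?thesis using smooth_on_Un[OF assms(1) o] by simp
  qed
  ultimately show ?thesis using cA sub unfolding test_functions_def by auto
qed

lemma smooth_on_real_polynomial_function:
  fixes p :: "'a::euclidean_space \<Rightarrow> real"
  assumes "real_polynomial_function p" shows "smooth_on UNIV p"
  using assms
proof induction
  case (linear f)
  interpret bounded_linear f by fact
  have "f x = (\<Sum>b\<in>Basis. (x \<bullet> b) * f b)" for x
  proof -
    have "f x = f (\<Sum>b\<in>Basis. (x \<bullet> b) *\<^sub>R b)" by (simp add: euclidean_representation)
    then show ?thesis by (simp add: sum scaleR)
  qed
  then have "f = (\<lambda>x. \<Sum>b\<in>Basis. (x \<bullet> b) * f b)" by (rule ext)
  moreover have "smooth_on UNIV (\<lambda>x. \<Sum>b\<in>Basis. (x \<bullet> b) * f b)" by (auto intro!: smooth)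
  ultimately show ?case by metis
qed (auto intro!: smooth)

lemma compact_ball_step:
  fixes k :: real assumes "k > 0"
  shows "compact {x::'a::euclidean_space. 1 \<le> k * (1 - x \<bullet> x)}" "{x::'a. 1 \<le> k * (1 - x \<bullet> x)} \<subseteq> ball 0 1"
proof -
  have *: "norm x < 1" if "1 \<le> k * (1 - x \<bullet> x)" for x :: 'a
  proof (rule ccontr)
    assume "\<not> norm x < 1"
    then have "1 \<le> x \<bullet> x" using power_mono[of 1 "norm x" 2] by (simp add: power2_norm_eq_inner)
    then have "k * (1 - x \<bullet> x) \<le> 0" using assms by (simp add: mult_nonneg_nonpos)
    with that show False by simp
  qed
  then show "{x::'a. 1 \<le> k * (1 - x \<bullet> x)} \<subseteq> ball 0 1" by auto
  have "closed {x::'a. 1 \<le> k * (1 - x \<bullet> x)}" by (intro closed_Collect_le continuous_intros)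
  moreover have "bounded {x::'a. 1 \<le> k * (1 - x \<bullet> x)}" using * unfolding bounded_iff by (meson less_imp_le mem_Collect_eq)
  ultimately show "compact {x::'a. 1 \<le> k * (1 - x \<bullet> x)}" by (simp add: compact_eq_bounded_closed)
qed

lemma square_integrable_imp_integrable:
  fixes f :: "'a::euclidean_space \<Rightarrow> 'b::euclidean_space"
  assumes "S \<in> lmeasurable" "square_integrable_on S f" shows "integrable (lebesgue_on S) f"
proof (rule Bochner_Integration.integrable_bound)
  show "integrable (lebesgue_on S) (\<lambda>x. 1 + (norm (f x))\<^sup>2)"
    using assms finite_measure.emeasure_finite[OF finite_measure_lebesgue_on[OF assms(1)]]
    by (auto simp: square_integrable_on_def intro!: Bochner_Integration.integrable_add finite_measure.integrable_const finite_measure_lebesgue_on)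
  have "norm (f x) \<le> 1 + (norm (f x))\<^sup>2" for x
    using zero_le_power2[of "norm (f x) - 1/2"]
    by (auto simp: power2_eq_square algebra_simps)
  then show "AE x in lebesgue_on S. norm (f x) \<le> norm (1 + (norm (f x))\<^sup>2)" by auto
qed (use assms in \<open>auto simp: square_integrable_on_def\<close>)

lemma square_integrable_inner:
  fixes f g :: "'a::euclidean_space \<Rightarrow> 'b::euclidean_space"
  assumes "square_integrable_on S f" "square_integrable_on S g"
  shows "integrable (lebesgue_on S) (\<lambda>x. f x \<bullet> g x)"
proof (rule Bochner_Integration.integrable_bound)
  show "integrable (lebesgue_on S) (\<lambda>x. (norm (f x))\<^sup>2 + (norm (g x))\<^sup>2)"
    using assms by (auto simp: square_integrable_on_def)
  have "norm (f x \<bullet> g x) \<le> norm ((norm (f x))\<^sup>2 + (norm (g x))\<^sup>2)" for x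
  proof -
    have "\<bar>f x \<bullet> g x\<bar> \<le> norm (f x) * norm (g x)" by (rule Cauchy_Schwarz_ineq2)
    also have "\<dots> \<le> (norm (f x))\<^sup>2 + (norm (g x))\<^sup>2"
      using sum_squares_bound[of "norm (f x)" "norm (g x)"] mult_nonneg_nonneg[of "norm (f x)" "norm (g x)"] norm_ge_zero[of "f x"] norm_ge_zero[of "g x"] by linarith
    finally show ?thesis by simp
  qed
  then show "AE x in lebesgue_on S. norm (f x \<bullet> g x) \<le> norm ((norm (f x))\<^sup>2 + (norm (g x))\<^sup>2)" by blast
qed (use assms in \<open>auto simp: square_integrable_on_def\<close>)

lemma square_integrable_mult:
  fixes f g :: "'a::euclidean_space \<Rightarrow> real"
  assumes "square_integrable_on S f" "square_integrable_on S g"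
  shows "integrable (lebesgue_on S) (\<lambda>x. f x * g x)"
  using square_integrable_inner[OF assms] by simp

lemma square_integrable_add:
  fixes f g :: "'a::euclidean_space \<Rightarrow> 'b::euclidean_space"
  assumes "square_integrable_on S f" "square_integrable_on S g"
  shows "square_integrable_on S (\<lambda>x. f x + g x)"
  unfolding square_integrable_on_def
proof
  have "(norm (f x + g x))\<^sup>2 = (norm (f x))\<^sup>2 + 2 * (f x \<bullet> g x) + (norm (g x))\<^sup>2" for x
    by (simp add: power2_norm_eq_inner inner_add_left inner_add_right inner_commute)
  then show "integrable (lebesgue_on S) (\<lambda>x. (norm (f x + g x))\<^sup>2)"
    using assms square_integrable_inner[OF assms] by (simp add: square_integrable_on_def)
qed (use assms in \<open>auto simp: square_integrable_on_def\<close>)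

lemma square_integrable_scaleR:
  fixes f :: "'a::euclidean_space \<Rightarrow> 'b::euclidean_space"
  assumes "square_integrable_on S f" shows "square_integrable_on S (\<lambda>x. c *\<^sub>R f x)"
  using assms by (auto simp: square_integrable_on_def power_mult_distrib)

lemma square_integrable_diff:
  fixes f g :: "'a::euclidean_space \<Rightarrow> 'b::euclidean_space"
  assumes "square_integrable_on S f" "square_integrable_on S g"
  shows "square_integrable_on S (\<lambda>x. f x - g x)"
  using square_integrable_add[OF assms(1) square_integrable_scaleR[OF assms(2), of "-1"]] by simp

lemma square_integrable_bounded:
  fixes f :: "'a::euclidean_space \<Rightarrow> 'b::euclidean_space"
  assumes "S \<in> lmeasurable" "f \<in> borel_measurable (lebesgue_on S)" "AE x in lebesgue_on S. norm (f x) \<le> C"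
  shows "square_integrable_on S f"
  unfolding square_integrable_on_def
proof
  show "integrable (lebesgue_on S) (\<lambda>x. (norm (f x))\<^sup>2)"
  proof (rule integrable_lebesgue_on_bounded[OF assms(1), where C = "C\<^sup>2"])
    show "AE x in lebesgue_on S. norm ((norm (f x))\<^sup>2) \<le> C\<^sup>2"
      using assms(3) by eventually_elim (auto intro: power_mono)
  qed (use assms(2) in measurable)
qed fact

lemma square_integrable_inner_const:
  fixes f :: "'a::euclidean_space \<Rightarrow> 'b::euclidean_space"
  assumes "square_integrable_on S f" shows "square_integrable_on S (\<lambda>x. f x \<bullet> b)"
  unfolding square_integrable_on_def
proof
  have [measurable]: "f \<in> borel_measurable (lebesgue_on S)" using assms by (simp add: square_integrable_on_def)
  show "(\<lambda>x. f x \<bullet> b) \<in> borel_measurable (lebesgue_on S)" by measurable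
  show "integrable (lebesgue_on S) (\<lambda>x. (norm (f x \<bullet> b))\<^sup>2)"
  proof (rule Bochner_Integration.integrable_bound)
    show "integrable (lebesgue_on S) (\<lambda>x. (norm b)\<^sup>2 * (norm (f x))\<^sup>2)"
      using assms by (auto simp: square_integrable_on_def)
    show "AE x in lebesgue_on S. norm ((norm (f x \<bullet> b))\<^sup>2) \<le> norm ((norm b)\<^sup>2 * (norm (f x))\<^sup>2)"
      using Cauchy_Schwarz_ineq[of "f _" b] by (intro AE_I2) (simp add: power2_norm_eq_inner mult.commute)
  qed measurable
qed

lemma square_integrable_test_function:
  assumes "\<phi> \<in> test_functions \<Omega>" "S \<in> lmeasurable"
  shows "square_integrable_on S \<phi>" "square_integrable_on S (grad \<phi>)"
proof -
  obtain C where C: "C > 0" "\<And>x. \<bar>\<phi> x\<bar> \<le> C" "\<And>x. norm (grad \<phi> x) \<le> C" by (rule test_functions_bounded[OF assms(1)]) blast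
  have "S \<in> sets lebesgue" using assms(2) by blast
  then show "square_integrable_on S \<phi>" "square_integrable_on S (grad \<phi>)"
    using C(2,3) test_functionsD(1)[OF assms(1)]
    by (auto intro!: square_integrable_bounded[OF assms(2), where C = C] continuous_imp_measurable_on_sets_lebesgue
        intro: continuous_on_subset[OF smooth_on_continuous] continuous_on_subset[OF smooth_on_continuous_grad])
qed

text \<open>The difference of two weak gradients is orthogonal to all products of a polynomial with a cutoff. So its
  product with the cutoff vanishes almost everywhere, and the cutoffs exhaust the ball.\<close>

lemma has_weak_gradient_unique:
  fixes u :: "'a::euclidean_space \<Rightarrow> real"
  assumes g: "has_weak_gradient (ball 0 1) u g" and g': "has_weak_gradient (ball 0 1) u g'"
  shows "AE x in unit_ball_measure. g x = g' x"
proof -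
  let ?M = "unit_ball_measure :: 'a measure"
  have comp: "AE x in ?M. (g x - g' x) \<bullet> b = 0" if b: "b \<in> Basis" for b
  proof -
    define d where "d x = (g x - g' x) \<bullet> b" for x
    have sg: "square_integrable_on (ball 0 1) g" "square_integrable_on (ball 0 1) g'"
      using g g' by (auto simp: has_weak_gradient_def)
    have sd: "square_integrable_on (ball 0 1) d"
      unfolding d_def by (intro square_integrable_inner_const square_integrable_diff sg)
    have d0: "(\<integral>x. d x * \<phi> x \<partial>?M) = 0" if "\<phi> \<in> test_functions (ball 0 1)" for \<phi>
    proof -
      have "(\<integral>x. (g x \<bullet> b) * \<phi> x \<partial>?M) = (\<integral>x. (g' x \<bullet> b) * \<phi> x \<partial>?M)"
      proof -
        have "(\<integral>x. u x * partial_deriv b \<phi> x \<partial>?M) = - (\<integral>x. (g x \<bullet> b) * \<phi> x \<partial>?M)"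
          using g that b unfolding has_weak_gradient_def by blast
        moreover have "(\<integral>x. u x * partial_deriv b \<phi> x \<partial>?M) = - (\<integral>x. (g' x \<bullet> b) * \<phi> x \<partial>?M)"
          using g' that b unfolding has_weak_gradient_def by blast
        ultimately show ?thesis by simp
      qed
      moreover have "integrable ?M (\<lambda>x. (g x \<bullet> b) * \<phi> x)" "integrable ?M (\<lambda>x. (g' x \<bullet> b) * \<phi> x)"
        by (auto intro!: square_integrable_mult square_integrable_inner_const sg square_integrable_test_function[OF that])
      ultimately show ?thesis by (simp add: d_def inner_diff_left left_diff_distrib)
    qed
    define \<theta> where "\<theta> k x = smooth_step (real (Suc k) * (1 - x \<bullet> x))" for k and x :: 'a
    have \<theta>: "(\<lambda>x. p x * \<theta> k x) \<in> test_functions (ball 0 1)" if "smooth_on UNIV p" for p k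
      unfolding \<theta>_def using smooth_on_subset[OF open_UNIV open_ball _ that, of 0 1]
      by (intro test_functions_step compact_ball_step) (auto intro!: smooth)
    have "AE x in ?M. d x * \<theta> k x = 0" for k
    proof (rule orthogonal_polynomials_imp_AE_0)
      have "(\<lambda>x. 1 * \<theta> k x) \<in> test_functions (ball 0 1)" by (rule \<theta>) (auto intro!: smooth)
      then show "integrable ?M (\<lambda>x. d x * \<theta> k x)"
        using square_integrable_mult[OF sd square_integrable_test_function(1), of "\<theta> k" "ball 0 1"] by simp
      show "(\<integral>x. d x * \<theta> k x * p x \<partial>?M) = 0" if "real_polynomial_function p" for p
        using d0[OF \<theta>[OF smooth_on_real_polynomial_function[OF that], of k]] by (simp add: ac_simps)
    qed
    then have "AE x in ?M. \<forall>k. d x * \<theta> k x = 0" by (subst AE_all_countable) blast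
    moreover have "AE x in ?M. x \<in> ball 0 1" by (intro AE_I2) auto
    ultimately show ?thesis
    proof eventually_elim
      case (elim x)
      have "0 < 1 - x \<bullet> x" using elim power_strict_mono[of "norm x" 1 2] by (auto simp: power2_norm_eq_inner)
      then obtain k where "1 < real k * (1 - x \<bullet> x)" using reals_Archimedean3 by blast
      then have "1 < real (Suc k) * (1 - x \<bullet> x)" using \<open>0 < 1 - x \<bullet> x\<close> by (simp add: distrib_right)
      then have "\<theta> k x > 0" unfolding \<theta>_def by (rule smooth_step_pos)
      then show ?case using elim(1) by (auto simp: d_def)
    qed
  qed
  have "AE x in ?M. \<forall>b\<in>Basis. (g x - g' x) \<bullet> b = 0"
    using comp by (subst AE_ball_countable) (auto intro: countable_finite)
  then show ?thesis by eventually_elim (metis eq_iff_diff_eq_0 euclidean_all_zero_iff)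
qed

text \<open>Test functions are dense in \<open>H\<^sup>1\<^sub>0\<close>, and a functional that is linear in a function and its gradient, with
  bounded coefficients, is continuous there.\<close>

lemma H10_extend_identity:
  fixes u :: "'a::euclidean_space \<Rightarrow> real"
  assumes u: "u \<in> H10 (ball 0 1)" and g: "has_weak_gradient (ball 0 1) u g"
    and W: "W \<in> borel_measurable unit_ball_measure" "AE x in unit_ball_measure. norm (W x) \<le> C"
    and w: "w \<in> borel_measurable unit_ball_measure" "AE x in unit_ball_measure. \<bar>w x\<bar> \<le> C"
    and test: "\<And>\<phi>. \<phi> \<in> test_functions (ball 0 1) \<Longrightarrow>
      (\<integral>x. W x \<bullet> grad \<phi> x \<partial>unit_ball_measure) = (\<integral>x. w x * \<phi> x \<partial>unit_ball_measure)"
  shows "(\<integral>x. W x \<bullet> g x \<partial>unit_ball_measure) = (\<integral>x. w x * u x \<partial>unit_ball_measure)"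
proof -
  let ?M = "unit_ball_measure :: 'a measure"
  obtain g0 \<phi> where g0: "has_weak_gradient (ball 0 1) u g0"
    and \<phi>: "\<And>k::nat. \<phi> k \<in> test_functions (ball 0 1)"
    and lim: "(\<lambda>k. \<integral>x. (\<phi> k x - u x)\<^sup>2 + (norm (grad (\<phi> k) x - g0 x))\<^sup>2 \<partial>?M) \<longlonglongrightarrow> 0"
    using u unfolding H10_def by auto
  define F where "F k x = (\<phi> k x - u x)\<^sup>2 + (norm (grad (\<phi> k) x - g0 x))\<^sup>2" for k x
  have su: "square_integrable_on (ball 0 1) u" and sg: "square_integrable_on (ball 0 1) g0"
    using g0 by (auto simp: has_weak_gradient_def)
  have sW: "square_integrable_on (ball 0 1) W" and sw: "square_integrable_on (ball 0 1) w"
    using W w by (auto intro!: square_integrable_bounded)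
  note st = square_integrable_test_function[OF \<phi>, of "ball 0 1", OF ball_lebesgue(2)]
  have intF: "integrable ?M (F k)" for k
    using square_integrable_diff[OF st(1)[of k] su] square_integrable_diff[OF st(2)[of k] sg]
    unfolding F_def square_integrable_on_def by auto
  define L where "L = (\<integral>x. W x \<bullet> g0 x \<partial>?M) - (\<integral>x. w x * u x \<partial>?M)"
  define D where "D k x = W x \<bullet> (grad (\<phi> k) x - g0 x) - w x * (\<phi> k x - u x)" for k x
  have intD: "integrable ?M (D k)" for k
    unfolding D_def using square_integrable_inner[OF sW square_integrable_diff[OF st(2)[of k] sg]]
      square_integrable_mult[OF sw square_integrable_diff[OF st(1)[of k] su]] by auto
  have D: "integral\<^sup>L ?M (D k) = - L" for k
  proof -
    have "integral\<^sup>L ?M (D k) = ((\<integral>x. W x \<bullet> grad (\<phi> k) x \<partial>?M) - (\<integral>x. W x \<bullet> g0 x \<partial>?M))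
       - ((\<integral>x. w x * \<phi> k x \<partial>?M) - (\<integral>x. w x * u x \<partial>?M))"
      unfolding D_def inner_diff_right right_diff_distrib
      using square_integrable_inner[OF sW st(2)[of k]] square_integrable_inner[OF sW sg]
        square_integrable_mult[OF sw st(1)[of k]] square_integrable_mult[OF sw su] by simp
    then show ?thesis using test[OF \<phi>, of k] by (simp add: L_def)
  qed
  define V where "V = measure ?M (ball 0 1)"
  \<comment> \<open>\<open>p + q \<le> t + (p\<^sup>2 + q\<^sup>2) / t\<close> reduces the \<open>L\<^sup>1\<close> norm of the error to its squared \<open>L\<^sup>2\<close> norm: first \<open>k \<longlongrightarrow> \<infinity>\<close>, then \<open>t \<longlongrightarrow> 0\<close>.\<close>
  have bound: "\<bar>L\<bar> \<le> \<bar>C\<bar> * (t * V + integral\<^sup>L ?M (F k) / t)" if t: "t > 0" for t k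
  proof -
    have "\<bar>L\<bar> = \<bar>integral\<^sup>L ?M (D k)\<bar>" using D by simp
    also have "\<dots> \<le> (\<integral>x. \<bar>D k x\<bar> \<partial>?M)" by (rule integral_abs_bound)
    also have "\<dots> \<le> (\<integral>x. \<bar>C\<bar> * (t + F k x / t) \<partial>?M)"
    proof (rule integral_mono_AE)
      show "integrable ?M (\<lambda>x. \<bar>C\<bar> * (t + F k x / t))"
        using intF by (intro integrable_mult_right Bochner_Integration.integrable_add finite_measure.integrable_const
            finite_measure_lebesgue_on) auto
      show "AE x in ?M. \<bar>D k x\<bar> \<le> \<bar>C\<bar> * (t + F k x / t)"
        using W(2) w(2)
      proof eventually_elim
        case (elim x)
        define a where "a = norm (grad (\<phi> k) x - g0 x)"
        define b where "b = \<bar>\<phi> k x - u x\<bar>"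
        have "\<bar>D k x\<bar> \<le> norm (W x) * a + \<bar>w x\<bar> * b"
          unfolding D_def a_def b_def
          using Cauchy_Schwarz_ineq2[of "W x" "grad (\<phi> k) x - g0 x"] by (simp add: abs_mult[symmetric])
        also have "\<dots> \<le> \<bar>C\<bar> * a + \<bar>C\<bar> * b"
          using elim by (intro add_mono mult_right_mono) (auto simp: a_def b_def)
        also have "\<dots> = \<bar>C\<bar> * (a + b)" by (simp add: distrib_left)
        also have "\<dots> \<le> \<bar>C\<bar> * (t + (b\<^sup>2 + a\<^sup>2) / t)"
        proof (rule mult_left_mono)
          have "t * (a + b) \<le> t\<^sup>2 + (b\<^sup>2 + a\<^sup>2)"
          proof -
            have "0 \<le> (a - t/2)\<^sup>2 + (b - t/2)\<^sup>2 + t\<^sup>2 / 2" by simp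
            then show ?thesis by (simp add: power2_eq_square algebra_simps)
          qed
          then show "a + b \<le> t + (b\<^sup>2 + a\<^sup>2) / t" using t by (simp add: field_simps power2_eq_square)
        qed auto
        finally show ?case by (simp add: F_def a_def b_def)
      qed
    qed (use intD in auto)
    also have "\<dots> = \<bar>C\<bar> * (t * V + integral\<^sup>L ?M (F k) / t)"
    proof -
      have "integrable ?M (\<lambda>x. t)" by (intro finite_measure.integrable_const finite_measure_lebesgue_on) auto
      then show ?thesis using intF by (simp add: V_def)
    qed
    finally show ?thesis .
  qed
  have "\<bar>L\<bar> \<le> \<bar>C\<bar> * (t * V)" if t: "t > 0" for t
  proof -
    have "(\<lambda>k. \<bar>C\<bar> * (t * V + integral\<^sup>L ?M (F k) / t)) \<longlonglongrightarrow> \<bar>C\<bar> * (t * V + 0 / t)"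
      using lim unfolding F_def[symmetric] by (intro tendsto_intros) (use t in auto)
    from LIMSEQ_le_const[OF this, of "\<bar>L\<bar>"] bound[OF t] show ?thesis by auto
  qed
  moreover have "((\<lambda>t. \<bar>C\<bar> * (t * V)) \<longlongrightarrow> \<bar>C\<bar> * (0 * V)) (at_right 0)" by (intro tendsto_intros)
  ultimately have "\<bar>L\<bar> \<le> \<bar>C\<bar> * (0 * V)"
    by (intro tendsto_lowerbound[of "\<lambda>t. \<bar>C\<bar> * (t * V)" _ "at_right 0"]) (auto simp: eventually_at_filter)
  then have "L = 0" by simp
  moreover have "(\<integral>x. W x \<bullet> g x \<partial>?M) = (\<integral>x. W x \<bullet> g0 x \<partial>?M)"
  proof (rule integral_cong_AE)
    show "AE x in ?M. W x \<bullet> g x = W x \<bullet> g0 x"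
      using has_weak_gradient_unique[OF g g0] by eventually_elim simp
  qed (use g g0 W in \<open>auto simp: has_weak_gradient_def square_integrable_on_def\<close>)
  ultimately show ?thesis by (simp add: L_def)
qed

text \<open>Bounded pointwise convergence of test functions and of their gradients is the source of all
  elements of \<open>H\<^sup>1\<^sub>0\<close> below. The weak gradient of the limit comes for free.\<close>

lemma bounded_limit_in_H10:
  fixes v :: "'a::euclidean_space \<Rightarrow> real"
  assumes \<phi>: "\<And>k::nat. \<phi> k \<in> test_functions (ball 0 1)"
    and bd: "\<And>k x. x \<in> ball 0 1 - {0} \<Longrightarrow> \<bar>\<phi> k x\<bar> \<le> C"
      "\<And>k x. x \<in> ball 0 1 - {0} \<Longrightarrow> norm (grad (\<phi> k) x) \<le> C"
    and lim: "\<And>x. x \<in> ball 0 1 - {0} \<Longrightarrow> (\<lambda>k. \<phi> k x) \<longlonglongrightarrow> v x"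
      "\<And>x. x \<in> ball 0 1 - {0} \<Longrightarrow> (\<lambda>k. grad (\<phi> k) x) \<longlonglongrightarrow> g x"
  shows "has_weak_gradient (ball 0 1) v g" "v \<in> H10 (ball 0 1)"
    and "AE x in unit_ball_measure. \<bar>v x\<bar> \<le> C" "AE x in unit_ball_measure. norm (g x) \<le> C"
proof -
  let ?M = "unit_ball_measure :: 'a measure"
  let ?L = "lebesgue_on (ball 0 1 - {0}) :: 'a measure"
  have c: "continuous_on S (\<phi> k)" "continuous_on S (grad (\<phi> k))" for S k
    using smooth_on_continuous smooth_on_continuous_grad test_functionsD(1)[OF \<phi>]
    by (blast intro: continuous_on_subset)+
  have [measurable]: "v \<in> borel_measurable ?M"
  proof -
    have "\<phi> k \<in> borel_measurable ?L" for k
      by (rule continuous_imp_measurable_on_sets_lebesgue[OF c(1)]) auto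
    then have "v \<in> borel_measurable ?L"
      by (rule borel_measurable_LIMSEQ_metric[of "\<lambda>k. \<phi> k"]) (use lim(1) in auto)
    then show ?thesis by (rule borel_measurable_insert_origin[OF ball_lebesgue(1)])
  qed
  have [measurable]: "g \<in> borel_measurable ?M"
  proof -
    have "grad (\<phi> k) \<in> borel_measurable ?L" for k
      by (rule continuous_imp_measurable_on_sets_lebesgue[OF c(2)]) auto
    then have "g \<in> borel_measurable ?L"
      by (rule borel_measurable_LIMSEQ_metric[of "\<lambda>k. grad (\<phi> k)"]) (use lim(2) in auto)
    then show ?thesis by (rule borel_measurable_insert_origin[OF ball_lebesgue(1)])
  qed
  have [measurable]: "\<phi> k \<in> borel_measurable ?M" "grad (\<phi> k) \<in> borel_measurable ?M" for k
    by (auto intro!: continuous_imp_measurable_on_sets_lebesgue c)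
  have bv: "\<bar>v x\<bar> \<le> C" "norm (g x) \<le> C" if x: "x \<in> ball 0 1 - {0}" for x
  proof -
    show "\<bar>v x\<bar> \<le> C" by (rule LIMSEQ_le_const2[OF tendsto_rabs[OF lim(1)[OF x]]]) (use bd x in auto)
    show "norm (g x) \<le> C" by (rule LIMSEQ_le_const2[OF tendsto_norm[OF lim(2)[OF x]]]) (use bd x in auto)
  qed
  show AEv: "AE x in ?M. \<bar>v x\<bar> \<le> C" and AEg: "AE x in ?M. norm (g x) \<le> C"
    by (auto intro!: AE_lebesgue_on_off_origin bv)
  have sv: "square_integrable_on (ball 0 1) v" and sg: "square_integrable_on (ball 0 1) g"
    by (auto intro!: square_integrable_bounded[where C = C] AEv AEg)
  have weak: "(\<integral>x. v x * partial_deriv b \<psi> x \<partial>?M) = - (\<integral>x. (g x \<bullet> b) * \<psi> x \<partial>?M)"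
    if \<psi>: "\<psi> \<in> test_functions (ball 0 1)" and b: "b \<in> Basis" for \<psi> b
  proof -
    obtain P where P: "P > 0" "\<And>x. \<bar>\<psi> x\<bar> \<le> P" "\<And>x. norm (grad \<psi> x) \<le> P" by (rule test_functions_bounded[OF \<psi>]) blast
    have P': "\<bar>partial_deriv b \<psi> x\<bar> \<le> P" for x
      using P(3)[of x] Basis_le_norm[OF b, of "grad \<psi> x"] grad_inner_Basis[OF b, of \<psi> x] by simp
    have [measurable]: "\<psi> \<in> borel_measurable ?M" "partial_deriv b \<psi> \<in> borel_measurable ?M"
      using smooth_on_continuous[OF test_functionsD(1)[OF \<psi>]]
        smooth_on_continuous[OF smooth_on_partial_deriv[OF test_functionsD(1)[OF \<psi>] b]]
      by (auto intro!: measurable_continuous_ball intro: continuous_on_subset)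
    have const: "integrable ?M (\<lambda>x. C * P)"
      by (intro finite_measure.integrable_const finite_measure_lebesgue_on) auto
    have l1: "(\<lambda>k. \<integral>x. \<phi> k x * partial_deriv b \<psi> x \<partial>?M) \<longlonglongrightarrow> (\<integral>x. v x * partial_deriv b \<psi> x \<partial>?M)"
    proof (rule integral_dominated_convergence[where w = "\<lambda>x. C * P"])
      show "AE x in ?M. (\<lambda>k. \<phi> k x * partial_deriv b \<psi> x) \<longlonglongrightarrow> v x * partial_deriv b \<psi> x"
        by (intro AE_lebesgue_on_off_origin tendsto_intros lim) auto
      show "AE x in ?M. norm (\<phi> k x * partial_deriv b \<psi> x) \<le> C * P" for k
      proof (rule AE_lebesgue_on_off_origin)
        show "norm (\<phi> k x * partial_deriv b \<psi> x) \<le> C * P" if "x \<in> ball 0 1 - {0}" for x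
          using bd(1)[OF that, of k] P'[of x] by (auto simp: abs_mult intro!: mult_mono)
      qed auto
    qed (use const in auto)
    have l2: "(\<lambda>k. \<integral>x. (grad (\<phi> k) x \<bullet> b) * \<psi> x \<partial>?M) \<longlonglongrightarrow> (\<integral>x. (g x \<bullet> b) * \<psi> x \<partial>?M)"
    proof (rule integral_dominated_convergence[where w = "\<lambda>x. C * P"])
      show "AE x in ?M. (\<lambda>k. (grad (\<phi> k) x \<bullet> b) * \<psi> x) \<longlonglongrightarrow> (g x \<bullet> b) * \<psi> x"
        by (intro AE_lebesgue_on_off_origin tendsto_intros lim) auto
      show "AE x in ?M. norm ((grad (\<phi> k) x \<bullet> b) * \<psi> x) \<le> C * P" for k
      proof (rule AE_lebesgue_on_off_origin)
        show "norm ((grad (\<phi> k) x \<bullet> b) * \<psi> x) \<le> C * P" if "x \<in> ball 0 1 - {0}" for x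
          using order_trans[OF Basis_le_norm[OF b] bd(2)[OF that, of k]] P(2)[of x]
          by (auto simp: abs_mult intro!: mult_mono)
      qed auto
    qed (use const in auto)
    have "(\<integral>x. \<phi> k x * partial_deriv b \<psi> x \<partial>?M) = - (\<integral>x. (grad (\<phi> k) x \<bullet> b) * \<psi> x \<partial>?M)" for k
    proof -
      have "(\<integral>x. \<psi> x * partial_deriv b (\<phi> k) x + \<phi> k x * partial_deriv b \<psi> x \<partial>lebesgue) = 0"
        by (rule integral_by_parts(2)[OF \<psi>])
          (use smooth_on_subset[OF open_UNIV open_ball _ test_functionsD(1)[OF \<phi>]] b in auto)
      then have "(\<integral>x. \<psi> x * partial_deriv b (\<phi> k) x + \<phi> k x * partial_deriv b \<psi> x \<partial>?M) = 0"
        using test_functionsD(5)[OF \<phi>] test_functionsD(5)[OF \<psi>]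
        by (subst integral_lebesgue_on_eq(1)) auto
      moreover have "integrable ?M (\<lambda>x. \<phi> k x * (grad \<psi> x \<bullet> b))" "integrable ?M (\<lambda>x. \<psi> x * (grad (\<phi> k) x \<bullet> b))"
        by (intro square_integrable_mult square_integrable_inner_const square_integrable_test_function[OF \<phi>]
            square_integrable_test_function[OF \<psi>] ball_lebesgue(2))+
      ultimately show ?thesis by (simp add: grad_inner_Basis[OF b] mult.commute)
    qed
    then have "(\<lambda>k. \<integral>x. \<phi> k x * partial_deriv b \<psi> x \<partial>?M) \<longlonglongrightarrow> - (\<integral>x. (g x \<bullet> b) * \<psi> x \<partial>?M)"
      using tendsto_minus[OF l2] by simp
    with l1 show ?thesis by (rule LIMSEQ_unique)
  qed
  show wg: "has_weak_gradient (ball 0 1) v g"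
    unfolding has_weak_gradient_def using sv sg weak by blast
  have "(\<lambda>k. \<integral>x. (\<phi> k x - v x)\<^sup>2 + (norm (grad (\<phi> k) x - g x))\<^sup>2 \<partial>?M) \<longlonglongrightarrow> (\<integral>x. 0 \<partial>?M)"
  proof (rule integral_dominated_convergence[where w = "\<lambda>x. (2 * C)\<^sup>2 + (2 * C)\<^sup>2"])
    have "(\<lambda>k. (\<phi> k x - v x)\<^sup>2 + (norm (grad (\<phi> k) x - g x))\<^sup>2) \<longlonglongrightarrow> 0" if "x \<in> ball 0 1 - {0}" for x
    proof -
      have "(\<lambda>k. (\<phi> k x - v x)\<^sup>2 + (norm (grad (\<phi> k) x - g x))\<^sup>2) \<longlonglongrightarrow> (v x - v x)\<^sup>2 + (norm (g x - g x))\<^sup>2"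
        by (intro tendsto_intros lim that)
      then show ?thesis by simp
    qed
    then show "AE x in ?M. (\<lambda>k. (\<phi> k x - v x)\<^sup>2 + (norm (grad (\<phi> k) x - g x))\<^sup>2) \<longlonglongrightarrow> 0"
      by (intro AE_lebesgue_on_off_origin) auto
    have "norm ((\<phi> k x - v x)\<^sup>2 + (norm (grad (\<phi> k) x - g x))\<^sup>2) \<le> (2 * C)\<^sup>2 + (2 * C)\<^sup>2" if x: "x \<in> ball 0 1 - {0}" for k x
    proof -
      have "\<bar>\<phi> k x - v x\<bar> \<le> 2 * C" "norm (grad (\<phi> k) x - g x) \<le> 2 * C"
        using bd(1)[OF x, of k] bd(2)[OF x, of k] bv[OF x] norm_triangle_ineq4[of "grad (\<phi> k) x" "g x"] by auto
      then have "\<bar>\<phi> k x - v x\<bar>\<^sup>2 \<le> (2 * C)\<^sup>2" "(norm (grad (\<phi> k) x - g x))\<^sup>2 \<le> (2 * C)\<^sup>2"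
        by (intro power_mono; simp)+
      then show ?thesis by simp
    qed
    then show "AE x in ?M. norm ((\<phi> k x - v x)\<^sup>2 + (norm (grad (\<phi> k) x - g x))\<^sup>2) \<le> (2 * C)\<^sup>2 + (2 * C)\<^sup>2" for k
      by (intro AE_lebesgue_on_off_origin) auto
    show "integrable ?M (\<lambda>x. (2 * C)\<^sup>2 + (2 * C)\<^sup>2)"
      by (intro finite_measure.integrable_const finite_measure_lebesgue_on) auto
  qed auto
  then show "v \<in> H10 (ball 0 1)" unfolding H10_def using wg \<phi> by auto
qed

lemma test_functions_add:
  assumes "\<phi> \<in> test_functions \<Omega>" "\<psi> \<in> test_functions \<Omega>"
  shows "(\<lambda>x. \<phi> x + \<psi> x) \<in> test_functions \<Omega>"
proof -
  note D = test_functionsD[OF assms(1)] test_functionsD[OF assms(2)]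
  let ?K = "closure {x. \<phi> x \<noteq> 0} \<union> closure {x. \<psi> x \<noteq> 0}"
  have "{x. \<phi> x + \<psi> x \<noteq> 0} \<subseteq> {x. \<phi> x \<noteq> 0} \<union> {x. \<psi> x \<noteq> 0}" by auto
  from closure_mono[OF this] have sub: "closure {x. \<phi> x + \<psi> x \<noteq> 0} \<subseteq> ?K" by (simp only: closure_Un)
  have "compact ?K" using D(2,8) by (intro compact_Un)
  then have "compact (closure {x. \<phi> x + \<psi> x \<noteq> 0})"
    using sub by (metis (no_types, lifting) closed_closure compact_Int_closed inf.absorb2)
  moreover have "closure {x. \<phi> x + \<psi> x \<noteq> 0} \<subseteq> \<Omega>" using sub D(3,9) by blast
  moreover have "smooth_on UNIV (\<lambda>x. \<phi> x + \<psi> x)" using D(1,7) by (intro smooth) auto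
  ultimately show ?thesis unfolding test_functions_def by blast
qed

lemma test_functions_scale:
  assumes "\<phi> \<in> test_functions \<Omega>" shows "(\<lambda>x. c * \<phi> x) \<in> test_functions \<Omega>"
proof -
  note D = test_functionsD[OF assms(1)]
  have "{x. c * \<phi> x \<noteq> 0} \<subseteq> {x. \<phi> x \<noteq> 0}" by auto
  then have sub: "closure {x. c * \<phi> x \<noteq> 0} \<subseteq> closure {x. \<phi> x \<noteq> 0}" by (rule closure_mono)
  then have "compact (closure {x. c * \<phi> x \<noteq> 0})"
    using D(2) by (metis (no_types, lifting) closed_closure compact_Int_closed inf.absorb2)
  moreover have "closure {x. c * \<phi> x \<noteq> 0} \<subseteq> \<Omega>" using sub D(3) by blast
  moreover have "smooth_on UNIV (\<lambda>x. c * \<phi> x)" using D(1) by (intro smooth) auto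
  ultimately show ?thesis unfolding test_functions_def by blast
qed

lemma has_weak_gradient_add:
  fixes u :: "'a::euclidean_space \<Rightarrow> real"
  assumes "has_weak_gradient (ball 0 1) u g" "has_weak_gradient (ball 0 1) u' g'"
  shows "has_weak_gradient (ball 0 1) (\<lambda>x. u x + u' x) (\<lambda>x. g x + g' x)"
proof -
  note s = assms[unfolded has_weak_gradient_def]
  have "(\<integral>x. (u x + u' x) * partial_deriv b \<phi> x \<partial>unit_ball_measure) = - (\<integral>x. ((g x + g' x) \<bullet> b) * \<phi> x \<partial>unit_ball_measure)"
    if \<phi>: "\<phi> \<in> test_functions (ball 0 1)" and b: "b \<in> Basis" for \<phi> b
  proof -
    note st = square_integrable_test_function[OF \<phi> ball_lebesgue(2)[of 0 1]]
    have "(\<integral>x. u x * partial_deriv b \<phi> x \<partial>unit_ball_measure) = - (\<integral>x. (g x \<bullet> b) * \<phi> x \<partial>unit_ball_measure)"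
      using s(1) \<phi> b by blast
    moreover have "(\<integral>x. u' x * partial_deriv b \<phi> x \<partial>unit_ball_measure) = - (\<integral>x. (g' x \<bullet> b) * \<phi> x \<partial>unit_ball_measure)"
      using s(2) \<phi> b by blast
    moreover have "integrable unit_ball_measure (\<lambda>x. u x * partial_deriv b \<phi> x)" "integrable unit_ball_measure (\<lambda>x. u' x * partial_deriv b \<phi> x)"
      using s square_integrable_mult[OF _ square_integrable_inner_const[OF st(2), of b]] by (auto simp: grad_inner_Basis[OF b])
    moreover have "integrable unit_ball_measure (\<lambda>x. (g x \<bullet> b) * \<phi> x)" "integrable unit_ball_measure (\<lambda>x. (g' x \<bullet> b) * \<phi> x)"
      using s square_integrable_mult[OF square_integrable_inner_const st(1)] by auto
    ultimately show ?thesis by (simp add: inner_add_left distrib_right)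
  qed
  then show ?thesis using s unfolding has_weak_gradient_def by (blast intro: square_integrable_add)
qed

lemma has_weak_gradient_scale:
  fixes u :: "'a::euclidean_space \<Rightarrow> real"
  assumes "has_weak_gradient \<Omega> u g"
  shows "has_weak_gradient \<Omega> (\<lambda>x. c * u x) (\<lambda>x. c *\<^sub>R g x)"
proof -
  note s = assms[unfolded has_weak_gradient_def]
  have "(\<integral>x. (c * u x) * partial_deriv b \<phi> x \<partial>lebesgue_on \<Omega>) = - (\<integral>x. ((c *\<^sub>R g x) \<bullet> b) * \<phi> x \<partial>lebesgue_on \<Omega>)"
    if \<phi>: "\<phi> \<in> test_functions \<Omega>" and b: "b \<in> Basis" for \<phi> b
  proof -
    have "(\<integral>x. u x * partial_deriv b \<phi> x \<partial>lebesgue_on \<Omega>) = - (\<integral>x. (g x \<bullet> b) * \<phi> x \<partial>lebesgue_on \<Omega>)"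
      using s \<phi> b by blast
    then show ?thesis by (simp add: mult.assoc)
  qed
  moreover have "square_integrable_on \<Omega> (\<lambda>x. c * u x)" using s square_integrable_scaleR[of \<Omega> u c] by simp
  ultimately show ?thesis using s unfolding has_weak_gradient_def by (blast intro: square_integrable_scaleR)
qed

lemma integrable_H10_error:
  assumes "\<phi> \<in> test_functions (ball 0 1)" "has_weak_gradient (ball 0 1) u g"
  shows "integrable unit_ball_measure (\<lambda>x. (\<phi> x - u x)\<^sup>2 + (norm (grad \<phi> x - g x))\<^sup>2)"
proof -
  note st = square_integrable_test_function[OF assms(1) ball_lebesgue(2)[of 0 1]]
  have "square_integrable_on (ball 0 1) u" "square_integrable_on (ball 0 1) g"
    using assms(2) by (auto simp: has_weak_gradient_def)
  then show ?thesis
    using square_integrable_diff[OF st(1), of u] square_integrable_diff[OF st(2), of g]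
    unfolding square_integrable_on_def by auto
qed

lemma grad_add:
  assumes "f differentiable (at x)" "g differentiable (at x)"
  shows "grad (\<lambda>x. f x + g x) x = grad f x + grad g x"
  by (rule euclidean_eqI) (auto simp: grad_inner_Basis inner_add_left partial_deriv_add[OF assms])

lemma H10_add:
  fixes u :: "'a::euclidean_space \<Rightarrow> real"
  assumes "u \<in> H10 (ball 0 1)" "u' \<in> H10 (ball 0 1)" shows "(\<lambda>x. u x + u' x) \<in> H10 (ball 0 1)"
proof -
  let ?M = "unit_ball_measure :: 'a measure"
  obtain g \<phi> where g: "has_weak_gradient (ball 0 1) u g"
    and \<phi>: "\<And>k::nat. \<phi> k \<in> test_functions (ball 0 1)"
    and lim: "(\<lambda>k. \<integral>x. (\<phi> k x - u x)\<^sup>2 + (norm (grad (\<phi> k) x - g x))\<^sup>2 \<partial>?M) \<longlonglongrightarrow> 0"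
    using assms(1) unfolding H10_def by auto
  obtain g' \<phi>' where g': "has_weak_gradient (ball 0 1) u' g'"
    and \<phi>': "\<And>k::nat. \<phi>' k \<in> test_functions (ball 0 1)"
    and lim': "(\<lambda>k. \<integral>x. (\<phi>' k x - u' x)\<^sup>2 + (norm (grad (\<phi>' k) x - g' x))\<^sup>2 \<partial>?M) \<longlonglongrightarrow> 0"
    using assms(2) unfolding H10_def by auto
  define F where "F k x = (\<phi> k x - u x)\<^sup>2 + (norm (grad (\<phi> k) x - g x))\<^sup>2" for k x
  define F' where "F' k x = (\<phi>' k x - u' x)\<^sup>2 + (norm (grad (\<phi>' k) x - g' x))\<^sup>2" for k x
  define G where "G k x = ((\<phi> k x + \<phi>' k x) - (u x + u' x))\<^sup>2 + (norm (grad (\<lambda>x. \<phi> k x + \<phi>' k x) x - (g x + g' x)))\<^sup>2" for k x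
  have int: "integrable ?M (F k)" "integrable ?M (F' k)" "integrable ?M (G k)" for k
    unfolding F_def F'_def G_def
    by (intro integrable_H10_error \<phi> \<phi>' g g' test_functions_add has_weak_gradient_add)+
  have le: "G k x \<le> 2 * F k x + 2 * F' k x" for k x
  proof -
    have *: "(norm (a + b))\<^sup>2 \<le> 2 * (norm a)\<^sup>2 + 2 * (norm b)\<^sup>2" for a b :: "'b::real_inner"
      using zero_le_power2[of "norm (a - b)"]
      by (simp add: power2_norm_eq_inner inner_add_left inner_add_right inner_diff_left inner_diff_right inner_commute)
    have "grad (\<lambda>x. \<phi> k x + \<phi>' k x) x = grad (\<phi> k) x + grad (\<phi>' k) x"
      by (intro grad_add smooth_on_differentiable[OF open_UNIV] test_functionsD(1)[OF \<phi>] test_functionsD(1)[OF \<phi>']) auto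
    then have "G k x = (norm ((\<phi> k x - u x) + (\<phi>' k x - u' x)))\<^sup>2 + (norm ((grad (\<phi> k) x - g x) + (grad (\<phi>' k) x - g' x)))\<^sup>2"
      by (simp add: G_def algebra_simps)
    also have "\<dots> \<le> 2 * F k x + 2 * F' k x"
      using *[of "\<phi> k x - u x" "\<phi>' k x - u' x"] *[of "grad (\<phi> k) x - g x" "grad (\<phi>' k) x - g' x"]
      by (simp add: F_def F'_def)
    finally show ?thesis .
  qed
  have "(\<lambda>k. integral\<^sup>L ?M (G k)) \<longlonglongrightarrow> 0"
  proof (rule tendsto_sandwich[of "\<lambda>_. 0" _ _ "\<lambda>k. 2 * integral\<^sup>L ?M (F k) + 2 * integral\<^sup>L ?M (F' k)"])
    show "\<forall>\<^sub>F k in sequentially. integral\<^sup>L ?M (G k) \<le> 2 * integral\<^sup>L ?M (F k) + 2 * integral\<^sup>L ?M (F' k)"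
    proof (intro always_eventually allI)
      fix k
      have "integral\<^sup>L ?M (G k) \<le> integral\<^sup>L ?M (\<lambda>x. 2 * F k x + 2 * F' k x)"
        using int le by (intro integral_mono) auto
      then show "integral\<^sup>L ?M (G k) \<le> 2 * integral\<^sup>L ?M (F k) + 2 * integral\<^sup>L ?M (F' k)" using int by simp
    qed
    show "(\<lambda>k. 2 * integral\<^sup>L ?M (F k) + 2 * integral\<^sup>L ?M (F' k)) \<longlonglongrightarrow> 0"
      using tendsto_add[OF tendsto_mult_right_zero[OF lim, of 2] tendsto_mult_right_zero[OF lim', of 2]] by (simp add: F_def[abs_def] F'_def[abs_def])
  qed (auto simp: G_def)
  then show ?thesis unfolding H10_def G_def
    using has_weak_gradient_add[OF g g'] test_functions_add[OF \<phi> \<phi>'] 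
    by (intro CollectI exI[of _ "\<lambda>x. g x + g' x"] conjI exI[of _ "\<lambda>k x. \<phi> k x + \<phi>' k x"]) auto
qed

lemma grad_scale:
  assumes "f differentiable (at x)" shows "grad (\<lambda>x. c * f x) x = c *\<^sub>R grad f x"
  using grad_mult[OF differentiable_const[of c] assms] grad_unique[of "\<lambda>_. c" 0 x] by simp

lemma H10_scale:
  fixes u :: "'a::euclidean_space \<Rightarrow> real"
  assumes "u \<in> H10 (ball 0 1)" shows "(\<lambda>x. c * u x) \<in> H10 (ball 0 1)"
proof -
  let ?M = "unit_ball_measure :: 'a measure"
  obtain g \<phi> where g: "has_weak_gradient (ball 0 1) u g"
    and \<phi>: "\<And>k::nat. \<phi> k \<in> test_functions (ball 0 1)"
    and lim: "(\<lambda>k. \<integral>x. (\<phi> k x - u x)\<^sup>2 + (norm (grad (\<phi> k) x - g x))\<^sup>2 \<partial>?M) \<longlonglongrightarrow> 0"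
    using assms(1) unfolding H10_def by auto
  have "(c * \<phi> k x - c * u x)\<^sup>2 + (norm (grad (\<lambda>x. c * \<phi> k x) x - c *\<^sub>R g x))\<^sup>2
    = c\<^sup>2 * ((\<phi> k x - u x)\<^sup>2 + (norm (grad (\<phi> k) x - g x))\<^sup>2)" for k x
  proof -
    have "grad (\<lambda>x. c * \<phi> k x) x = c *\<^sub>R grad (\<phi> k) x"
      by (intro grad_scale smooth_on_differentiable[OF open_UNIV] test_functionsD(1)[OF \<phi>]) auto
    then show ?thesis
      by (simp add: scaleR_right_diff_distrib[symmetric] right_diff_distrib[symmetric] power_mult_distrib distrib_left)
  qed
  then have "(\<lambda>k. \<integral>x. (c * \<phi> k x - c * u x)\<^sup>2 + (norm (grad (\<lambda>x. c * \<phi> k x) x - c *\<^sub>R g x))\<^sup>2 \<partial>?M) \<longlonglongrightarrow> 0"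
    using tendsto_mult_right_zero[OF lim, of "c\<^sup>2"] by simp
  then show ?thesis unfolding H10_def
    using has_weak_gradient_scale[OF g, of c] test_functions_scale[OF \<phi>, of c]
    by (intro CollectI exI[of _ "\<lambda>x. c *\<^sub>R g x"] conjI exI[of _ "\<lambda>k x. c * \<phi> k x"]) auto
qed

lemma measurable_AE_cong:
  fixes u :: "'a::euclidean_space \<Rightarrow> real"
  assumes S: "S \<in> sets lebesgue" and u: "u \<in> borel_measurable (lebesgue_on S)" and eq: "AE x in lebesgue_on S. u x = u' x"
  shows "u' \<in> borel_measurable (lebesgue_on S)"
proof -
  have "AE x in lebesgue. (if x \<in> S then u x else 0) = (if x \<in> S then u' x else 0)"
    using eq S by (subst (asm) AE_restrict_space_iff) (auto elim!: eventually_mono)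
  moreover have "(\<lambda>x. if x \<in> S then u x else 0) \<in> borel_measurable lebesgue" using u S by (subst borel_measurable_if)
  ultimately have "(\<lambda>x. if x \<in> S then u' x else 0) \<in> borel_measurable lebesgue"
    by (rule borel_measurable_AE[rotated])
  then show ?thesis using S by (subst (asm) borel_measurable_if)
qed


lemma square_integrable_AE_cong:
  fixes u :: "'a::euclidean_space \<Rightarrow> real"
  assumes S: "S \<in> sets lebesgue" and u: "square_integrable_on S u" and eq: "AE x in lebesgue_on S. u x = u' x"
  shows "square_integrable_on S u'"
proof -
  have m: "u \<in> borel_measurable (lebesgue_on S)" using u by (simp add: square_integrable_on_def)
  have m': "u' \<in> borel_measurable (lebesgue_on S)" by (rule measurable_AE_cong[OF S m eq])
  have "integrable (lebesgue_on S) (\<lambda>x. (norm (u x))\<^sup>2) = integrable (lebesgue_on S) (\<lambda>x. (norm (u' x))\<^sup>2)"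
    by (rule integrable_cong_AE) (use m m' eq in \<open>auto elim!: eventually_mono\<close>)
  then show ?thesis using u m' by (simp add: square_integrable_on_def)
qed

lemma has_weak_gradient_AE_cong:
  fixes u :: "'a::euclidean_space \<Rightarrow> real"
  assumes u: "has_weak_gradient (ball 0 1) u g" and eq: "AE x in unit_ball_measure. u x = u' x"
  shows "has_weak_gradient (ball 0 1) u' g"
proof -
  note s = u[unfolded has_weak_gradient_def]
  have s': "square_integrable_on (ball 0 1) u'"
    by (rule square_integrable_AE_cong[OF ball_lebesgue(1) _ eq]) (use s in blast)
  have "(\<integral>x. u' x * partial_deriv b \<phi> x \<partial>unit_ball_measure) = - (\<integral>x. (g x \<bullet> b) * \<phi> x \<partial>unit_ball_measure)"
    if \<phi>: "\<phi> \<in> test_functions (ball 0 1)" and b: "b \<in> Basis" for \<phi> b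
  proof -
    have [measurable]: "u \<in> borel_measurable unit_ball_measure" "u' \<in> borel_measurable unit_ball_measure"
      using s s' by (auto simp: square_integrable_on_def)
    have [measurable]: "partial_deriv b \<phi> \<in> borel_measurable unit_ball_measure"
      using smooth_on_continuous[OF smooth_on_partial_deriv[OF test_functionsD(1)[OF \<phi>] b]]
      by (intro measurable_continuous_ball) (rule continuous_on_subset, auto)
    have "(\<integral>x. u' x * partial_deriv b \<phi> x \<partial>unit_ball_measure) = (\<integral>x. u x * partial_deriv b \<phi> x \<partial>unit_ball_measure)"
      by (rule integral_cong_AE) (use eq in \<open>auto elim!: eventually_mono\<close>)
    also have "\<dots> = - (\<integral>x. (g x \<bullet> b) * \<phi> x \<partial>unit_ball_measure)" using s \<phi> b by blast
    finally show ?thesis .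
  qed
  then show ?thesis using s s' unfolding has_weak_gradient_def by blast
qed

lemma H10_AE_cong:
  fixes u :: "'a::euclidean_space \<Rightarrow> real"
  assumes u: "u \<in> H10 (ball 0 1)" and eq: "AE x in unit_ball_measure. u x = u' x"
  shows "u' \<in> H10 (ball 0 1)"
proof -
  let ?M = "unit_ball_measure :: 'a measure"
  obtain g \<phi> where g: "has_weak_gradient (ball 0 1) u g"
    and \<phi>: "\<And>k::nat. \<phi> k \<in> test_functions (ball 0 1)"
    and lim: "(\<lambda>k. \<integral>x. (\<phi> k x - u x)\<^sup>2 + (norm (grad (\<phi> k) x - g x))\<^sup>2 \<partial>?M) \<longlonglongrightarrow> 0"
    using u unfolding H10_def by auto
  note g' = has_weak_gradient_AE_cong[OF g eq]
  have "(\<integral>x. (\<phi> k x - u x)\<^sup>2 + (norm (grad (\<phi> k) x - g x))\<^sup>2 \<partial>?M)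
      = (\<integral>x. (\<phi> k x - u' x)\<^sup>2 + (norm (grad (\<phi> k) x - g x))\<^sup>2 \<partial>?M)" for k
    by (rule integral_cong_AE)
      (use eq borel_measurable_integrable[OF integrable_H10_error[OF \<phi> g]] borel_measurable_integrable[OF integrable_H10_error[OF \<phi> g']]
        in \<open>auto elim!: eventually_mono\<close>)
  then show ?thesis unfolding H10_def using g' \<phi> lim by auto
qed

section \<open>The eigenspaces of the weighted problem\<close>

lemma weight_measurable [measurable]: "(\<lambda>x. norm x powr \<alpha>) \<in> borel_measurable (unit_ball_measure :: 'a::euclidean_space measure)"
  by (intro measurable_restrict_space1 measurable_completion) simp

lemma weight_le_1:
  assumes "\<alpha> \<ge> 0" shows "AE x in unit_ball_measure. norm x powr \<alpha> \<le> 1"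
  by (rule AE_I2) (use assms in \<open>auto intro: powr_le1\<close>)

lemma integrable_weighted_product:
  fixes u v :: "'a::euclidean_space \<Rightarrow> real"
  assumes "\<alpha> \<ge> 0" "square_integrable_on (ball 0 1) u" "square_integrable_on (ball 0 1) v"
  shows "integrable unit_ball_measure (\<lambda>x. norm x powr \<alpha> * u x * v x)"
  using integrable_mult_bounded[OF square_integrable_mult[OF assms(2,3)] weight_measurable, of \<alpha> 1] weight_le_1[OF assms(1)]
  by (simp add: ac_simps)

lemma H10_square_integrable: "u \<in> H10 \<Omega> \<Longrightarrow> square_integrable_on \<Omega> u"
  unfolding H10_def has_weak_gradient_def by blast

lemma eigenspaceD: "u \<in> eigenspace \<Omega> \<alpha> \<mu> \<Longrightarrow> u \<in> H10 \<Omega>"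
  by (simp add: eigenspace_def)

lemma eigenspace_AE_cong:
  fixes u :: "'a::euclidean_space \<Rightarrow> real"
  assumes \<alpha>: "\<alpha> \<ge> 0" and u: "u \<in> eigenspace (ball 0 1) \<alpha> \<mu>" and eq: "AE x in unit_ball_measure. u x = u' x"
  shows "u' \<in> eigenspace (ball 0 1) \<alpha> \<mu>"
proof -
  obtain g where g: "has_weak_gradient (ball 0 1) u g" and
    w: "\<And>v h. v \<in> H10 (ball 0 1) \<Longrightarrow> has_weak_gradient (ball 0 1) v h \<Longrightarrow>
      (\<integral>x. g x \<bullet> h x \<partial>unit_ball_measure) = \<mu> * (\<integral>x. norm x powr \<alpha> * u x * v x \<partial>unit_ball_measure)"
    using u unfolding eigenspace_def by blast
  have H: "u' \<in> H10 (ball 0 1)" by (rule H10_AE_cong[OF eigenspaceD[OF u] eq])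
  have "(\<integral>x. norm x powr \<alpha> * u x * v x \<partial>unit_ball_measure) = (\<integral>x. norm x powr \<alpha> * u' x * v x \<partial>unit_ball_measure)"
    if v: "v \<in> H10 (ball 0 1)" for v
    by (rule integral_cong_AE)
      (use eq borel_measurable_integrable[OF integrable_weighted_product[OF \<alpha> H10_square_integrable[OF eigenspaceD[OF u]] H10_square_integrable[OF v]]]
         borel_measurable_integrable[OF integrable_weighted_product[OF \<alpha> H10_square_integrable[OF H] H10_square_integrable[OF v]]]
        in \<open>auto elim!: eventually_mono\<close>)
  then show ?thesis unfolding eigenspace_def
    using has_weak_gradient_AE_cong[OF g eq] w H by fastforce
qed

lemma eigenspace_add:
  fixes u :: "'a::euclidean_space \<Rightarrow> real"
  assumes \<alpha>: "\<alpha> \<ge> 0" and u: "u \<in> eigenspace (ball 0 1) \<alpha> \<mu>" and u': "u' \<in> eigenspace (ball 0 1) \<alpha> \<mu>"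
  shows "(\<lambda>x. u x + u' x) \<in> eigenspace (ball 0 1) \<alpha> \<mu>"
proof -
  obtain g where g: "has_weak_gradient (ball 0 1) u g" and
    w: "\<And>v h. v \<in> H10 (ball 0 1) \<Longrightarrow> has_weak_gradient (ball 0 1) v h \<Longrightarrow>
      (\<integral>x. g x \<bullet> h x \<partial>unit_ball_measure) = \<mu> * (\<integral>x. norm x powr \<alpha> * u x * v x \<partial>unit_ball_measure)"
    using u unfolding eigenspace_def by blast
  obtain g' where g': "has_weak_gradient (ball 0 1) u' g'" and
    w': "\<And>v h. v \<in> H10 (ball 0 1) \<Longrightarrow> has_weak_gradient (ball 0 1) v h \<Longrightarrow>
      (\<integral>x. g' x \<bullet> h x \<partial>unit_ball_measure) = \<mu> * (\<integral>x. norm x powr \<alpha> * u' x * v x \<partial>unit_ball_measure)"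
    using u' unfolding eigenspace_def by blast
  have "(\<integral>x. (g x + g' x) \<bullet> h x \<partial>unit_ball_measure) = \<mu> * (\<integral>x. norm x powr \<alpha> * (u x + u' x) * v x \<partial>unit_ball_measure)"
    if v: "v \<in> H10 (ball 0 1)" and h: "has_weak_gradient (ball 0 1) v h" for v h
  proof -
    have "square_integrable_on (ball 0 1) g" "square_integrable_on (ball 0 1) g'" "square_integrable_on (ball 0 1) h"
      using g g' h by (auto simp: has_weak_gradient_def)
    then have "(\<integral>x. (g x + g' x) \<bullet> h x \<partial>unit_ball_measure) = (\<integral>x. g x \<bullet> h x \<partial>unit_ball_measure) + (\<integral>x. g' x \<bullet> h x \<partial>unit_ball_measure)"
      unfolding inner_add_left by (intro Bochner_Integration.integral_add square_integrable_inner)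
    moreover have "(\<integral>x. norm x powr \<alpha> * (u x + u' x) * v x \<partial>unit_ball_measure)
      = (\<integral>x. norm x powr \<alpha> * u x * v x \<partial>unit_ball_measure) + (\<integral>x. norm x powr \<alpha> * u' x * v x \<partial>unit_ball_measure)"
      unfolding distrib_left distrib_right
      by (intro Bochner_Integration.integral_add integrable_weighted_product \<alpha>
          H10_square_integrable[OF eigenspaceD[OF u]] H10_square_integrable[OF eigenspaceD[OF u']] H10_square_integrable[OF v])
    ultimately show ?thesis using w[OF v h] w'[OF v h] by (simp add: distrib_left)
  qed
  then show ?thesis unfolding eigenspace_def
    using H10_add[OF eigenspaceD[OF u] eigenspaceD[OF u']] has_weak_gradient_add[OF g g'] by blast
qed

lemma eigenspace_scale:
  fixes u :: "'a::euclidean_space \<Rightarrow> real"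
  assumes u: "u \<in> eigenspace (ball 0 1) \<alpha> \<mu>"
  shows "(\<lambda>x. c * u x) \<in> eigenspace (ball 0 1) \<alpha> \<mu>"
proof -
  obtain g where g: "has_weak_gradient (ball 0 1) u g" and
    w: "\<And>v h. v \<in> H10 (ball 0 1) \<Longrightarrow> has_weak_gradient (ball 0 1) v h \<Longrightarrow>
      (\<integral>x. g x \<bullet> h x \<partial>unit_ball_measure) = \<mu> * (\<integral>x. norm x powr \<alpha> * u x * v x \<partial>unit_ball_measure)"
    using u unfolding eigenspace_def by blast
  have "(\<integral>x. (c *\<^sub>R g x) \<bullet> h x \<partial>unit_ball_measure) = \<mu> * (\<integral>x. norm x powr \<alpha> * (c * u x) * v x \<partial>unit_ball_measure)"
    if v: "v \<in> H10 (ball 0 1)" and h: "has_weak_gradient (ball 0 1) v h" for v h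
  proof -
    have "(\<integral>x. norm x powr \<alpha> * (c * u x) * v x \<partial>unit_ball_measure) = (\<integral>x. c * (norm x powr \<alpha> * u x * v x) \<partial>unit_ball_measure)"
      by (rule Bochner_Integration.integral_cong) auto
    then show ?thesis using w[OF v h] by simp
  qed
  then show ?thesis unfolding eigenspace_def
    using H10_scale[OF eigenspaceD[OF u]] has_weak_gradient_scale[OF g] by blast
qed

lemma zero_in_eigenspace: "(\<lambda>x::'a::euclidean_space. 0) \<in> eigenspace (ball 0 1) \<alpha> \<mu>"
proof -
  have z: "(\<lambda>x::'a. 0) \<in> test_functions (ball 0 1)" by (auto simp: test_functions_def intro!: smooth)
  have g0: "grad (\<lambda>x::'a. 0) x = 0" for x :: 'a by (rule grad_unique) simp
  have "has_weak_gradient (ball 0 1) (\<lambda>x::'a. 0) (\<lambda>x. 0)"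
    by (simp add: has_weak_gradient_def square_integrable_on_def)
  moreover have "(\<lambda>x::'a. 0) \<in> H10 (ball 0 1)"
    by (rule bounded_limit_in_H10[where \<phi> = "\<lambda>k x. 0" and C = 0 and g = "\<lambda>x. 0"]) (use z g0 in auto)
  ultimately show ?thesis unfolding eigenspace_def by (auto intro!: exI[of _ "\<lambda>x. 0"])
qed

lemma eigenspace_sum:
  assumes \<alpha>: "\<alpha> \<ge> 0" and u: "\<And>i. i \<in> I \<Longrightarrow> u i \<in> eigenspace (ball (0::'a::euclidean_space) 1) \<alpha> \<mu>"
  shows "(\<lambda>x. \<Sum>i\<in>I. c i * u i x) \<in> eigenspace (ball 0 1) \<alpha> \<mu>"
  using u
proof (induction I rule: infinite_finite_induct)
  case (insert i I)
  then show ?case using eigenspace_add[OF \<alpha> eigenspace_scale[of "u i" \<alpha> \<mu> "c i"], of "\<lambda>x. \<Sum>i\<in>I. c i * u i x"] by auto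
qed (auto intro: zero_in_eigenspace)

text \<open>A function \<open>v\<close> that vanishes on the sphere, with bounded gradient \<open>g\<close> and bounded
  \<open>l = - \<Delta> v\<close>, to be used as test function in the equation for an eigenfunction.\<close>

definition dirichlet_function ::
    "('a::euclidean_space \<Rightarrow> real) \<Rightarrow> ('a \<Rightarrow> 'a) \<Rightarrow> ('a \<Rightarrow> real) \<Rightarrow> bool" where
  "dirichlet_function v g l \<longleftrightarrow> v \<in> H10 (ball 0 1) \<and> has_weak_gradient (ball 0 1) v g \<and>
     l \<in> borel_measurable unit_ball_measure \<and>
     (\<exists>C. (AE x in unit_ball_measure. \<bar>v x\<bar> \<le> C) \<and> (AE x in unit_ball_measure. norm (g x) \<le> C) \<and>
        (AE x in unit_ball_measure. \<bar>l x\<bar> \<le> C)) \<and>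
     (\<forall>\<phi>\<in>test_functions (ball 0 1).
        (\<integral>x. g x \<bullet> grad \<phi> x \<partial>unit_ball_measure) = (\<integral>x. l x * \<phi> x \<partial>unit_ball_measure))"

text \<open>Both the equation for \<open>u\<close> tested with \<open>v\<close> and Green's formula for \<open>v\<close> tested
  with \<open>u \<in> H\<^sup>1\<^sub>0\<close> express \<open>\<integral> \<nabla>u \<bullet> \<nabla>v\<close>.\<close>

lemma eigenspace_orthogonal:
  fixes u :: "'a::euclidean_space \<Rightarrow> real"
  assumes \<alpha>: "\<alpha> \<ge> 0" and u: "u \<in> eigenspace (ball 0 1) \<alpha> \<mu>" and v: "dirichlet_function v g l"
  shows "(\<integral>x. u x * (\<mu> * (norm x powr \<alpha> * v x) - l x) \<partial>unit_ball_measure) = 0"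
    and "integrable unit_ball_measure (\<lambda>x. u x * (\<mu> * (norm x powr \<alpha> * v x) - l x))"
proof -
  let ?M = "unit_ball_measure :: 'a measure"
  obtain gu where gu: "has_weak_gradient (ball 0 1) u gu" and
    w: "\<And>v h. v \<in> H10 (ball 0 1) \<Longrightarrow> has_weak_gradient (ball 0 1) v h \<Longrightarrow>
      (\<integral>x. gu x \<bullet> h x \<partial>?M) = \<mu> * (\<integral>x. norm x powr \<alpha> * u x * v x \<partial>?M)"
    using u unfolding eigenspace_def by blast
  obtain C where vH: "v \<in> H10 (ball 0 1)" and vg: "has_weak_gradient (ball 0 1) v g"
    and lm: "l \<in> borel_measurable ?M" and C: "AE x in ?M. norm (g x) \<le> C" "AE x in ?M. \<bar>l x\<bar> \<le> C"
    and test: "\<And>\<phi>. \<phi> \<in> test_functions (ball 0 1) \<Longrightarrow> (\<integral>x. g x \<bullet> grad \<phi> x \<partial>?M) = (\<integral>x. l x * \<phi> x \<partial>?M)"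
    using v unfolding dirichlet_function_def by blast
  have gm: "g \<in> borel_measurable ?M" using vg by (auto simp: has_weak_gradient_def square_integrable_on_def)
  have "(\<integral>x. g x \<bullet> gu x \<partial>?M) = (\<integral>x. l x * u x \<partial>?M)"
    by (rule H10_extend_identity[OF eigenspaceD[OF u] gu gm C(1) lm C(2) test])
  moreover have "(\<integral>x. gu x \<bullet> g x \<partial>?M) = \<mu> * (\<integral>x. norm x powr \<alpha> * u x * v x \<partial>?M)"
    by (rule w[OF vH vg])
  ultimately have eq: "(\<integral>x. l x * u x \<partial>?M) = \<mu> * (\<integral>x. norm x powr \<alpha> * u x * v x \<partial>?M)"
    by (simp add: inner_commute)
  have su: "square_integrable_on (ball 0 1) u" by (rule H10_square_integrable[OF eigenspaceD[OF u]])
  have sl: "square_integrable_on (ball 0 1) l" by (rule square_integrable_bounded[OF _ lm, where C = C]) (use C in auto)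
  have i1: "integrable ?M (\<lambda>x. l x * u x)" by (rule square_integrable_mult[OF sl su])
  have i2: "integrable ?M (\<lambda>x. norm x powr \<alpha> * u x * v x)"
    by (rule integrable_weighted_product[OF \<alpha> su H10_square_integrable[OF vH]])
  have split: "u x * (\<mu> * (norm x powr \<alpha> * v x) - l x) = \<mu> * (norm x powr \<alpha> * u x * v x) - l x * u x" for x
    by (simp add: algebra_simps)
  show "(\<integral>x. u x * (\<mu> * (norm x powr \<alpha> * v x) - l x) \<partial>?M) = 0" unfolding split using i1 i2 eq by simp
  show "integrable ?M (\<lambda>x. u x * (\<mu> * (norm x powr \<alpha> * v x) - l x))" unfolding split using i1 i2 by simp
qed

lemma dirichlet_function_in_eigenspace:
  fixes v :: "'a::euclidean_space \<Rightarrow> real"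
  assumes v: "dirichlet_function v g l"
    and eq: "AE x in unit_ball_measure. l x = \<mu> * (norm x powr \<alpha> * v x)"
  shows "v \<in> eigenspace (ball 0 1) \<alpha> \<mu>"
proof -
  let ?M = "unit_ball_measure :: 'a measure"
  obtain C where vH: "v \<in> H10 (ball 0 1)" and vg: "has_weak_gradient (ball 0 1) v g"
    and lm: "l \<in> borel_measurable ?M" and C: "AE x in ?M. norm (g x) \<le> C" "AE x in ?M. \<bar>l x\<bar> \<le> C"
    and test: "\<And>\<phi>. \<phi> \<in> test_functions (ball 0 1) \<Longrightarrow> (\<integral>x. g x \<bullet> grad \<phi> x \<partial>?M) = (\<integral>x. l x * \<phi> x \<partial>?M)"
    using v unfolding dirichlet_function_def by blast
  have gm: "g \<in> borel_measurable ?M" and [measurable]: "v \<in> borel_measurable ?M"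
    using vg by (auto simp: has_weak_gradient_def square_integrable_on_def)
  have "(\<integral>x. g x \<bullet> h x \<partial>?M) = \<mu> * (\<integral>x. norm x powr \<alpha> * v x * v' x \<partial>?M)"
    if v': "v' \<in> H10 (ball 0 1)" and h: "has_weak_gradient (ball 0 1) v' h" for v' h
  proof -
    have [measurable]: "v' \<in> borel_measurable ?M" using h by (auto simp: has_weak_gradient_def square_integrable_on_def)
    have "(\<integral>x. g x \<bullet> h x \<partial>?M) = (\<integral>x. l x * v' x \<partial>?M)"
      by (rule H10_extend_identity[OF v' h gm C(1) lm C(2) test])
    also have "\<dots> = (\<integral>x. \<mu> * (norm x powr \<alpha> * v x * v' x) \<partial>?M)"
      by (rule integral_cong_AE) (use eq lm in \<open>auto elim!: eventually_mono\<close>)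
    finally show ?thesis by simp
  qed
  then show ?thesis unfolding eigenspace_def using vH vg by blast
qed

section \<open>Frobenius series\<close>

definition entire_coeffs :: "(nat \<Rightarrow> real) \<Rightarrow> bool" where
  "entire_coeffs c \<longleftrightarrow> (\<forall>t. summable (\<lambda>j. c j * t ^ j))"

definition pser :: "real \<Rightarrow> real \<Rightarrow> (nat \<Rightarrow> real) \<Rightarrow> real \<Rightarrow> real" where
  "pser a p c s = s powr p * (\<Sum>j. c j * (s powr a) ^ j)"

lemma entire_coeffsD: "entire_coeffs c \<Longrightarrow> summable (\<lambda>j. c j * t ^ j)"
  by (simp add: entire_coeffs_def)

lemma entire_coeffs_of_nat_mult:
  assumes c: "entire_coeffs c"
  shows "(\<lambda>j. real j * c j * t ^ j) sums (t * (\<Sum>j. diffs c j * t ^ j))"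
proof -
  have "summable (\<lambda>j. diffs c j * t ^ j)" by (rule termdiff_converges_all) (rule entire_coeffsD[OF c])
  from sums_mult[OF diffs_equiv[OF this], of t] 
  show ?thesis
  proof (rule sums_cong[THEN iffD1, rotated])
    show "t * (real j * c j * t ^ (j - Suc 0)) = real j * c j * t ^ j" for j by (cases j) auto
  qed
qed

lemma entire_coeffs_affine: 
  assumes c: "entire_coeffs c" shows "entire_coeffs (\<lambda>j. (p + a * real j) * c j)"
  unfolding entire_coeffs_def
proof
  fix t
  have "summable (\<lambda>j. p * (c j * t ^ j) + a * (real j * c j * t ^ j))"
    by (intro summable_add summable_mult entire_coeffsD[OF c] sums_summable[OF entire_coeffs_of_nat_mult[OF c]])
  then show "summable (\<lambda>j. (p + a * real j) * c j * t ^ j)" by (simp add: algebra_simps)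
qed

lemma pser_has_derivative:
  assumes c: "entire_coeffs c" and s: "s > 0"
  shows "(pser a p c has_real_derivative pser a (p - 1) (\<lambda>j. (p + a * real j) * c j) s) (at s)"
proof -
  let ?t = "s powr a"
  have E: "((\<lambda>t. \<Sum>j. c j * t ^ j) has_real_derivative (\<Sum>j. diffs c j * ?t ^ j)) (at ?t)"
    by (rule termdiffs_strong_converges_everywhere) (rule entire_coeffsD[OF c])
  have P: "((\<lambda>s. s powr a) has_real_derivative a * s powr (a - 1)) (at s)"
    by (rule has_real_derivative_powr[OF s])
  have "(pser a p c has_real_derivative
      p * s powr (p - 1) * (\<Sum>j. c j * ?t ^ j) + (\<Sum>j. diffs c j * ?t ^ j) * (a * s powr (a - 1)) * s powr p) (at s)"
    unfolding pser_def[abs_def] by (rule DERIV_mult[OF has_real_derivative_powr[OF s] DERIV_chain2[OF E P]])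
  also have "(\<Sum>j. diffs c j * ?t ^ j) * (a * s powr (a - 1)) * s powr p = s powr (p - 1) * (a * (?t * (\<Sum>j. diffs c j * ?t ^ j)))"
    using s by (simp add: powr_diff)
  also have "p * s powr (p - 1) * (\<Sum>j. c j * ?t ^ j) + s powr (p - 1) * (a * (?t * (\<Sum>j. diffs c j * ?t ^ j)))
    = pser a (p - 1) (\<lambda>j. (p + a * real j) * c j) s"
  proof -
    have "(\<lambda>j. p * (c j * ?t ^ j) + a * (real j * c j * ?t ^ j)) sums (p * (\<Sum>j. c j * ?t ^ j) + a * (?t * (\<Sum>j. diffs c j * ?t ^ j)))"
      by (intro sums_add sums_mult summable_sums entire_coeffsD[OF c] entire_coeffs_of_nat_mult[OF c])
    then have "(\<lambda>j. (p + a * real j) * c j * ?t ^ j) sums (p * (\<Sum>j. c j * ?t ^ j) + a * (?t * (\<Sum>j. diffs c j * ?t ^ j)))"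
      by (simp add: algebra_simps)
    then show ?thesis unfolding pser_def by (simp add: sums_unique[symmetric] algebra_simps)
  qed
  finally show ?thesis .
qed

lemma smooth_on_pser:
  assumes "entire_coeffs c" shows "smooth_on {0<..} (pser a p c)"
proof -
  have "smooth_on {0<..} ((\<lambda>(p, c). pser a p c) (p, c))"
    by (rule smooth_on_family[where I = "{(p, c). entire_coeffs c}" and d = "\<lambda>(p, c). (p - 1, \<lambda>j. (p + a * real j) * c j)"])
      (use assms in \<open>auto intro!: pser_has_derivative entire_coeffs_affine\<close>)
  then show ?thesis by simp
qed

lemma pser_shift:
  assumes c: "entire_coeffs c" and c0: "c 0 = 0"
  shows "pser a p c s = pser a (p + a) (\<lambda>j. c (Suc j)) s"
proof -
  have "(\<Sum>j. c j * (s powr a) ^ j) = (\<Sum>j. c (Suc j) * (s powr a) ^ Suc j)"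
    using suminf_split_head[OF entire_coeffsD[OF c], of "s powr a"] c0 by simp
  also have "\<dots> = (\<Sum>j. s powr a * (c (Suc j) * (s powr a) ^ j))" by (simp add: ac_simps)
  also have "\<dots> = s powr a * (\<Sum>j. c (Suc j) * (s powr a) ^ j)"
  proof (cases "s powr a = 0")
    case False
    have "summable (\<lambda>j. c (Suc j) * (s powr a) ^ Suc j)"
      using summable_ignore_initial_segment[OF entire_coeffsD[OF c, of "s powr a"], of 1] by simp
    then have "summable (\<lambda>j. inverse (s powr a) * (c (Suc j) * (s powr a) ^ Suc j))" by (rule summable_mult)
    then have "summable (\<lambda>j. c (Suc j) * (s powr a) ^ j)" using False by (simp add: field_simps)
    then show ?thesis by (rule suminf_mult)
  qed simp
  finally show ?thesis by (simp add: pser_def powr_add)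
qed

lemma entire_coeffs_Suc:
  assumes c: "entire_coeffs c" shows "entire_coeffs (\<lambda>j. c (Suc j))"
  unfolding entire_coeffs_def
proof
  fix t :: real
  show "summable (\<lambda>j. c (Suc j) * t ^ j)"
  proof (cases "t = 0")
    case True
    then show ?thesis by (intro summable_finite[of "{0}"]) auto
  next
    case False
    have "summable (\<lambda>j. c (Suc j) * t ^ Suc j)"
      using summable_ignore_initial_segment[OF entire_coeffsD[OF c, of t], of 1] by simp
    then have "summable (\<lambda>j. inverse t * (c (Suc j) * t ^ Suc j))" by (rule summable_mult)
    then show ?thesis using False by (simp add: field_simps)
  qed
qed

lemma pser_add:
  assumes "entire_coeffs c" "entire_coeffs d"
  shows "pser a p (\<lambda>j. c j + d j) s = pser a p c s + pser a p d s"
proof -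
  have "(\<Sum>j. (c j + d j) * (s powr a) ^ j) = (\<Sum>j. c j * (s powr a) ^ j) + (\<Sum>j. d j * (s powr a) ^ j)"
    unfolding distrib_right by (intro suminf_add[symmetric] entire_coeffsD assms)
  then show ?thesis by (simp add: pser_def distrib_left)
qed

lemma pser_scale:
  assumes "entire_coeffs c" shows "pser a p (\<lambda>j. x * c j) s = x * pser a p c s"
  unfolding pser_def using suminf_mult[OF entire_coeffsD[OF assms], of x "s powr a"] by (simp add: algebra_simps)

lemma pser_powr_mult: "s > 0 \<Longrightarrow> s powr q * pser a p c s = pser a (q + p) c s"
  by (simp add: pser_def powr_add)

lemma isCont_power_series: "entire_coeffs c \<Longrightarrow> isCont (\<lambda>t. \<Sum>j. c j * t ^ j) t"
  by (rule DERIV_isCont, rule termdiffs_strong_converges_everywhere) (rule entire_coeffsD)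

lemma pser_bounded:
  assumes c: "entire_coeffs c" and "a \<ge> 0" "p \<ge> 0"
  shows "\<exists>C. \<forall>s\<in>{0<..4}. \<bar>pser a p c s\<bar> \<le> C"
proof -
  have "continuous_on {0..4 powr a} (\<lambda>t. \<Sum>j. c j * t ^ j)"
    by (intro continuous_at_imp_continuous_on ballI isCont_power_series c)
  then obtain C where C: "C > 0" "\<And>t. t \<in> {0..4 powr a} \<Longrightarrow> norm (\<Sum>j. c j * t ^ j) \<le> C"
    by (rule continuous_on_compact_bounded[OF compact_Icc]) blast
  have "\<bar>pser a p c s\<bar> \<le> 4 powr p * C" if "s \<in> {0<..4}" for s
  proof -
    have "s powr a \<le> 4 powr a" "s powr p \<le> 4 powr p" using that assms(2,3) by (auto intro: powr_mono2)
    then show ?thesis unfolding pser_def abs_mult using C(2)[of "s powr a"] by (intro mult_mono) auto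
  qed
  then show ?thesis by blast
qed

lemma pser_tendsto_0:
  assumes c: "entire_coeffs c" and "a > 0"
  shows "(pser a 0 c \<longlongrightarrow> c 0) (at_right 0)"
proof -
  have "((\<lambda>s. s powr a) \<longlongrightarrow> 0) (at_right 0)"
    using \<open>a > 0\<close> by (intro tendsto_zero_powrI) (auto simp: eventually_at_filter intro!: tendsto_intros)
  then have "((\<lambda>s. \<Sum>j. c j * (s powr a) ^ j) \<longlongrightarrow> (\<Sum>j. c j * 0 ^ j)) (at_right 0)"
    by (rule isCont_tendsto_compose[OF isCont_power_series[OF c]])
  also have "(\<Sum>j. c j * 0 ^ j) = c 0" by simp
  finally show ?thesis
    by (rule Lim_transform_eventually) (auto simp: pser_def eventually_at_filter)
qed

section \<open>Radial solutions\<close>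

text \<open>The Laplacian of \<open>G(\<bar>x\<bar>\<^sup>2) H(x)\<close> is \<open>H\<close> times this operator with \<open>M = N + 2n\<close>,
  for \<open>H\<close> harmonic and homogeneous of degree \<open>n\<close> on an \<open>N\<close>-dimensional space.\<close>

definition radial_laplacian :: "real \<Rightarrow> (real \<Rightarrow> real) \<Rightarrow> real \<Rightarrow> real" where
  "radial_laplacian M G s = 4 * s * deriv (deriv G) s + 2 * M * deriv G s"

lemma radial_laplacian_eq:
  assumes "\<And>s. s > 0 \<Longrightarrow> (G has_real_derivative G1 s) (at s)"
    and "\<And>s. s > 0 \<Longrightarrow> (G1 has_real_derivative G2 s) (at s)" and s: "s > 0"
  shows "radial_laplacian M G s = 4 * s * G2 s + 2 * M * G1 s"
proof -
  have 1: "deriv G t = G1 t" if "t > 0" for t using assms(1)[OF that] by (rule DERIV_imp_deriv)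
  have "(deriv G has_real_derivative G2 s) (at s)"
    by (rule has_field_derivative_transform_within_open[OF assms(2)[OF s], of "{0<..}"]) (use s 1 in auto)
  then have "deriv (deriv G) s = G2 s" by (rule DERIV_imp_deriv)
  with 1[OF s] show ?thesis by (simp add: radial_laplacian_def)
qed

definition indicial :: "real \<Rightarrow> real \<Rightarrow> real" where
  "indicial M \<sigma> = 2 * \<sigma> * (2 * \<sigma> - 2 + M)"

lemma radial_laplacian_pser:
  assumes c: "entire_coeffs c" and s: "s > 0"
  shows "radial_laplacian M (pser a p c) s = pser a (p - 1) (\<lambda>j. indicial M (p + a * real j) * c j) s"
proof -
  let ?c1 = "\<lambda>j. (p + a * real j) * c j"
  let ?c2 = "\<lambda>j. (p - 1 + a * real j) * ?c1 j"
  have e: "entire_coeffs ?c1" "entire_coeffs ?c2" by (intro entire_coeffs_affine c)+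
  have e4: "entire_coeffs (\<lambda>j. 4 * ?c2 j)" "entire_coeffs (\<lambda>j. 2 * M * ?c1 j)"
    using entire_coeffs_affine[OF e(2), of 4 0] entire_coeffs_affine[OF e(1), of "2 * M" 0] by simp_all
  have "radial_laplacian M (pser a p c) s = 4 * s * pser a (p - 1 - 1) ?c2 s + 2 * M * pser a (p - 1) ?c1 s"
    by (rule radial_laplacian_eq[OF _ _ s]) (intro pser_has_derivative e c; assumption)+
  also have "4 * s * pser a (p - 1 - 1) ?c2 s = 4 * pser a (p - 1) ?c2 s"
    using pser_powr_mult[OF s, of 1 a "p - 1 - 1" ?c2] s by simp
  also have "4 * pser a (p - 1) ?c2 s + 2 * M * pser a (p - 1) ?c1 s = pser a (p - 1) (\<lambda>j. 4 * ?c2 j + 2 * M * ?c1 j) s"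
    using pser_scale[OF e(2), of a "p - 1" 4 s] pser_scale[OF e(1), of a "p - 1" "2 * M" s] pser_add[OF e4, of a "p - 1" s] by simp
  also have "(\<lambda>j. 4 * ?c2 j + 2 * M * ?c1 j) = (\<lambda>j. indicial M (p + a * real j) * c j)"
    by (auto simp: indicial_def algebra_simps)
  finally show ?thesis .
qed

text \<open>The coefficients of the solution \<open>s\<^sup>k + \<dots>\<close> of \<open>L G + \<mu> s\<^sup>a\<^sup>-\<^sup>1 G = const s\<^sup>k\<^sup>-\<^sup>1\<close>.\<close>

primrec frob_coeff :: "real \<Rightarrow> real \<Rightarrow> real \<Rightarrow> nat \<Rightarrow> nat \<Rightarrow> real" where
  "frob_coeff M a \<mu> k 0 = 1"
| "frob_coeff M a \<mu> k (Suc j) = - \<mu> * frob_coeff M a \<mu> k j / indicial M (real k + a * real (Suc j))"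

definition frob :: "real \<Rightarrow> real \<Rightarrow> real \<Rightarrow> nat \<Rightarrow> real \<Rightarrow> real" where
  "frob M a \<mu> k = pser a (real k) (frob_coeff M a \<mu> k)"

lemma indicial_ge:
  assumes "a \<ge> 1" "M \<ge> 2" shows "indicial M (real k + a * real (Suc j)) \<ge> real (Suc j)"
proof -
  have "real (Suc j) = 1 * real (Suc j)" by simp
  also have "\<dots> \<le> a * real (Suc j)" by (rule mult_right_mono) (use assms in auto)
  also have "\<dots> \<le> real k + a * real (Suc j)" by simp
  finally have *: "real k + a * real (Suc j) \<ge> real (Suc j)" .
  have "real (Suc j) * 1 \<le> (2 * (real k + a * real (Suc j))) * (2 * (real k + a * real (Suc j)) - 2 + M)"
    by (rule mult_mono) (use * assms in auto)
  then show ?thesis by (simp add: indicial_def)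
qed

lemma indicial_pos: "a \<ge> 1 \<Longrightarrow> M \<ge> 2 \<Longrightarrow> indicial M (real k + a * real (Suc j)) > 0"
  using indicial_ge[of a M j k] by simp

lemma entire_frob_coeff:
  assumes "a \<ge> 1" "M \<ge> 2" shows "entire_coeffs (frob_coeff M a \<mu> k)"
  unfolding entire_coeffs_def
proof
  fix t :: real
  obtain N where N: "real N \<ge> 2 * \<bar>\<mu> * t\<bar>" using real_arch_simple by blast
  show "summable (\<lambda>j. frob_coeff M a \<mu> k j * t ^ j)"
  proof (rule summable_ratio_test[of "1/2" N])
    fix j assume j: "j \<ge> N"
    let ?q = "indicial M (real k + a * real (Suc j))"
    have q: "?q \<ge> real (Suc j)" by (rule indicial_ge[OF assms])
    have "norm (frob_coeff M a \<mu> k (Suc j) * t ^ Suc j) = (\<bar>\<mu> * t\<bar> / ?q) * norm (frob_coeff M a \<mu> k j * t ^ j)"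
      using q by (simp add: abs_mult)
    also have "\<dots> \<le> (1/2) * norm (frob_coeff M a \<mu> k j * t ^ j)"
    proof (rule mult_right_mono)
      have "2 * \<bar>\<mu> * t\<bar> \<le> ?q" using N j q by simp
      then show "\<bar>\<mu> * t\<bar> / ?q \<le> 1/2" using q by (simp add: divide_le_eq)
    qed auto
    finally show "norm (frob_coeff M a \<mu> k (Suc j) * t ^ Suc j) \<le> 1/2 * norm (frob_coeff M a \<mu> k j * t ^ j)" .
  qed simp
qed

text \<open>The recursion for the coefficients \<open>c\<^sub>j\<close> says that \<open>L\<close> maps the term \<open>c\<^sub>j\<^sub>+\<^sub>1 s\<^bsup>k + a(j+1)\<^esup>\<close> to
  \<open>- \<mu> c\<^sub>j s\<^bsup>k + a(j+1) - 1\<^esup>\<close>. Only the image of the leading term \<open>s\<^sup>k\<close> remains, and it vanishes for \<open>k = 0\<close>.\<close>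

lemma frob_equation:
  assumes "a \<ge> 1" "M \<ge> 2" and s: "s > 0"
  shows "radial_laplacian M (frob M a \<mu> k) s + \<mu> * s powr (a - 1) * frob M a \<mu> k s = indicial M (real k) * s powr (real k - 1)"
proof -
  let ?c = "frob_coeff M a \<mu> k"
  let ?d = "\<lambda>j. indicial M (real k + a * real j) * ?c j"
  note e = entire_frob_coeff[OF assms(1,2), of \<mu> k]
  have d: "?d (Suc j) = - \<mu> * ?c j" for j using indicial_pos[OF assms(1,2), of k j] by simp
  have ed: "entire_coeffs (\<lambda>j. - \<mu> * ?c j)" using entire_coeffs_affine[OF e, of "- \<mu>" 0] by simp
  have "radial_laplacian M (frob M a \<mu> k) s = s powr (real k - 1) * (\<Sum>j. ?d j * (s powr a) ^ j)"
    unfolding frob_def radial_laplacian_pser[OF e s] pser_def ..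
  also have "(\<Sum>j. ?d j * (s powr a) ^ j) = indicial M (real k) + (\<Sum>j. - \<mu> * ?c j * (s powr a) ^ Suc j)"
  proof -
    have "summable (\<lambda>j. (s powr a) * (- \<mu> * ?c j * (s powr a) ^ j))" by (intro summable_mult entire_coeffsD ed)
    then have "summable (\<lambda>j. ?d (Suc j) * (s powr a) ^ Suc j)" unfolding d by (simp add: ac_simps)
    then have "summable (\<lambda>j. ?d j * (s powr a) ^ j)" by (subst (asm) summable_Suc_iff)
    from suminf_split_head[OF this] show ?thesis unfolding d by simp
  qed
  also have "(\<Sum>j. - \<mu> * ?c j * (s powr a) ^ Suc j) = - \<mu> * s powr a * (\<Sum>j. ?c j * (s powr a) ^ j)"
    using suminf_mult[OF entire_coeffsD[OF e], of "- \<mu> * s powr a" "s powr a"] by (simp add: ac_simps)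
  finally have R: "radial_laplacian M (frob M a \<mu> k) s
    = s powr (real k - 1) * (indicial M (real k) + - \<mu> * s powr a * (\<Sum>j. ?c j * (s powr a) ^ j))" .
  show ?thesis unfolding R using s by (simp add: frob_def pser_def powr_diff algebra_simps)
qed

text \<open>Since the commutator of the Laplacian with \<open>s d/ds\<close> is a multiple of the Laplacian, applying
  \<open>s d/ds\<close> to the homogeneous solution \<open>frob 0\<close> gives a solution of the equation with right-hand side
  a multiple of \<open>s\<^sup>a\<^sup>-\<^sup>1 frob 0\<close>.\<close>

definition euler_frob :: "real \<Rightarrow> real \<Rightarrow> real \<Rightarrow> real \<Rightarrow> real" where
  "euler_frob M a \<mu> = pser a 0 (\<lambda>j. a * real j * frob_coeff M a \<mu> 0 j)"

lemma entire_euler_coeff: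
  assumes "a \<ge> 1" "M \<ge> 2" shows "entire_coeffs (\<lambda>j. a * real j * frob_coeff M a \<mu> 0 j)"
  using entire_coeffs_affine[OF entire_frob_coeff[OF assms], of 0 a \<mu> 0] by simp

lemma frob_has_derivative:
  assumes "a \<ge> 1" "M \<ge> 2" "s > 0"
  shows "(frob M a \<mu> 0 has_real_derivative euler_frob M a \<mu> s / s) (at s)"
proof -
  have "(frob M a \<mu> 0 has_real_derivative pser a (0 - 1) (\<lambda>j. (0 + a * real j) * frob_coeff M a \<mu> 0 j) s) (at s)"
    unfolding frob_def of_nat_0 by (rule pser_has_derivative[OF entire_frob_coeff[OF assms(1,2)] assms(3)])
  also have "pser a (0 - 1) (\<lambda>j. (0 + a * real j) * frob_coeff M a \<mu> 0 j) s = euler_frob M a \<mu> s / s"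
    using assms(3) by (simp add: euler_frob_def pser_def powr_minus divide_inverse)
  finally show ?thesis .
qed

lemma euler_frob_equation:
  assumes "a \<ge> 1" "M \<ge> 2" and s: "s > 0"
  shows "radial_laplacian M (euler_frob M a \<mu>) s + \<mu> * s powr (a - 1) * euler_frob M a \<mu> s
    = - (\<mu> * a) * s powr (a - 1) * frob M a \<mu> 0 s"
proof -
  let ?c = "frob_coeff M a \<mu> 0"
  let ?e = "\<lambda>j. a * real j * ?c j"
  let ?d = "\<lambda>j. indicial M (0 + a * real j) * ?e j"
  note e = entire_frob_coeff[OF assms(1,2), of \<mu> 0]
  note ee = entire_euler_coeff[OF assms(1,2), of \<mu>]
  have d: "?d (Suc j) = - \<mu> * (a * ?c j + ?e j)" for j
    using indicial_pos[OF assms(1,2), of 0 j] by (simp add: field_simps)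
  have ed: "entire_coeffs (\<lambda>j. - \<mu> * (a * ?c j + ?e j))"
    using entire_coeffs_affine[OF e, of "- \<mu> * a" "- \<mu> * a"] by (simp add: algebra_simps)
  have sum: "(\<Sum>j. (a * ?c j + ?e j) * (s powr a) ^ j) = a * (\<Sum>j. ?c j * (s powr a) ^ j) + (\<Sum>j. ?e j * (s powr a) ^ j)"
    using suminf_add[OF summable_mult[OF entire_coeffsD[OF e]] entire_coeffsD[OF ee], of a "s powr a" "s powr a"]
      suminf_mult[OF entire_coeffsD[OF e], of a "s powr a"] by (simp add: algebra_simps)
  have "radial_laplacian M (euler_frob M a \<mu>) s = s powr (0 - 1) * (\<Sum>j. ?d j * (s powr a) ^ j)"
    unfolding euler_frob_def radial_laplacian_pser[OF ee s] pser_def ..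
  also have "(\<Sum>j. ?d j * (s powr a) ^ j) = (\<Sum>j. - \<mu> * (a * ?c j + ?e j) * (s powr a) ^ Suc j)"
  proof -
    have "summable (\<lambda>j. (s powr a) * (- \<mu> * (a * ?c j + ?e j) * (s powr a) ^ j))" by (intro summable_mult entire_coeffsD ed)
    then have "summable (\<lambda>j. ?d (Suc j) * (s powr a) ^ Suc j)" unfolding d by (simp add: ac_simps)
    then have "summable (\<lambda>j. ?d j * (s powr a) ^ j)" by (subst (asm) summable_Suc_iff)
    from suminf_split_head[OF this] show ?thesis unfolding d by simp
  qed
  also have "\<dots> = - \<mu> * s powr a * (\<Sum>j. (a * ?c j + ?e j) * (s powr a) ^ j)"
  proof -
    have "entire_coeffs (\<lambda>j. a * ?c j + ?e j)"
      using entire_coeffs_affine[OF e, of a a] by (simp add: algebra_simps)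
    from suminf_mult[OF entire_coeffsD[OF this], of "- \<mu> * s powr a" "s powr a"] show ?thesis by (simp add: ac_simps)
  qed
  finally have R: "radial_laplacian M (euler_frob M a \<mu>) s
    = s powr (0 - 1) * (- \<mu> * s powr a * (\<Sum>j. (a * ?c j + ?e j) * (s powr a) ^ j))" .
  show ?thesis unfolding R sum using s by (simp add: euler_frob_def frob_def pser_def powr_diff algebra_simps)
qed

lemma frob_tendsto_1:
  assumes "a \<ge> 1" "M \<ge> 2" shows "(frob M a \<mu> 0 \<longlongrightarrow> 1) (at_right 0)"
  using pser_tendsto_0[OF entire_frob_coeff[OF assms], of a \<mu> 0] assms by (simp add: frob_def)

text \<open>A double zero would, by uniqueness for the second-order equation, force the homogeneous
  solution to vanish on all of \<open>(0, s]\<close>, whereas it tends to \<open>1\<close> at the origin. Uniqueness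
  is a Gronwall argument for the energy \<open>G\<^sup>2 + (G')\<^sup>2\<close>.\<close>

lemma frob_zero_simple:
  assumes a: "a \<ge> 1" and M: "M \<ge> 2" and s0: "s0 > 0" and z: "frob M a \<mu> 0 s0 = 0"
  shows "euler_frob M a \<mu> s0 \<noteq> 0"
proof
  assume z': "euler_frob M a \<mu> s0 = 0"
  let ?G = "frob M a \<mu> 0"
  define G1 where "G1 = pser a (0 - 1) (\<lambda>j. (0 + a * real j) * frob_coeff M a \<mu> 0 j)"
  define G2 where "G2 = pser a (0 - 1 - 1) (\<lambda>j. (0 - 1 + a * real j) * ((0 + a * real j) * frob_coeff M a \<mu> 0 j))"
  note e = entire_frob_coeff[OF a M, of \<mu> 0]
  have dG: "(?G has_real_derivative G1 s) (at s)" if "s > 0" for s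
    unfolding frob_def G1_def of_nat_0 by (rule pser_has_derivative[OF e that])
  have dG1: "(G1 has_real_derivative G2 s) (at s)" if "s > 0" for s
    unfolding G2_def G1_def by (rule pser_has_derivative[OF entire_coeffs_affine[OF e] that])
  have eq: "4 * s * G2 s + 2 * M * G1 s + \<mu> * s powr (a - 1) * ?G s = 0" if "s > 0" for s
    using frob_equation[OF a M that, of \<mu> 0] radial_laplacian_eq[OF dG dG1 that, of M] by (simp add: indicial_def)
  have "G1 s0 = 0" using DERIV_unique[OF dG[OF s0] frob_has_derivative[OF a M s0]] z' by simp
  have zero: "?G \<epsilon> = 0" if \<epsilon>: "0 < \<epsilon>" "\<epsilon> \<le> s0" for \<epsilon>
  proof -
    \<comment> \<open>\<open>K\<close> bounds the logarithmic derivative of \<open>G\<^sup>2 + (G')\<^sup>2\<close> from below by \<open>- K\<close> on \<open>[\<epsilon>, s0]\<close>.\<close>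
    define K where "K = 1 + (\<bar>\<mu>\<bar> * s0 powr (a - 1) / 4 + M) / \<epsilon>"
    define E where "E s = ((?G s)\<^sup>2 + (G1 s)\<^sup>2) * exp (K * s)" for s
    have "E \<epsilon> \<le> E s0"
    proof (rule DERIV_nonneg_imp_nondecreasing[OF \<epsilon>(2)])
      fix s assume s: "\<epsilon> \<le> s" "s \<le> s0"
      then have "s > 0" using \<epsilon> by simp
      have D: "(E has_real_derivative (2 * ?G s * G1 s + 2 * G1 s * G2 s + K * ((?G s)\<^sup>2 + (G1 s)\<^sup>2)) * exp (K * s)) (at s)"
        unfolding E_def[abs_def]
        by (auto intro!: derivative_eq_intros dG dG1 \<open>s > 0\<close> simp: algebra_simps)
      have G2: "G2 s = - (2 * M * G1 s + \<mu> * s powr (a - 1) * ?G s) / (4 * s)"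
        using eq[OF \<open>s > 0\<close>] \<open>s > 0\<close> by (simp add: field_simps)
      define R where "R = (?G s)\<^sup>2 + (G1 s)\<^sup>2"
      have R: "\<bar>2 * ?G s * G1 s\<bar> \<le> R" "(G1 s)\<^sup>2 \<le> R" "R \<ge> 0"
        using sum_squares_bound[of "\<bar>?G s\<bar>" "\<bar>G1 s\<bar>"] by (auto simp: R_def abs_mult)
      have p: "s powr (a - 1) \<le> s0 powr (a - 1)" using s \<open>s > 0\<close> a by (intro powr_mono2) auto
      have "2 * ?G s * G1 s + 2 * G1 s * G2 s = 2 * ?G s * G1 s - (M / s) * (G1 s)\<^sup>2 - (\<mu> * s powr (a - 1) / (4 * s)) * (2 * ?G s * G1 s)"
        unfolding G2 using \<open>s > 0\<close> by (simp add: field_simps power2_eq_square)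
      also have "\<dots> \<ge> - R - (M / s) * R - (\<bar>\<mu>\<bar> * s powr (a - 1) / (4 * s)) * R"
      proof -
        have "(M / s) * (G1 s)\<^sup>2 \<le> (M / s) * R" using R M \<open>s > 0\<close> by (intro mult_left_mono) auto
        moreover have "\<bar>(\<mu> * s powr (a - 1) / (4 * s)) * (2 * ?G s * G1 s)\<bar> \<le> (\<bar>\<mu>\<bar> * s powr (a - 1) / (4 * s)) * R"
          unfolding abs_mult[of "\<mu> * s powr (a - 1) / (4 * s)"] using R \<open>s > 0\<close>
          by (intro mult_mono) (auto simp: abs_mult)
        ultimately show ?thesis using R by linarith
      qed
      also have "- R - (M / s) * R - (\<bar>\<mu>\<bar> * s powr (a - 1) / (4 * s)) * R = - (1 + (\<bar>\<mu>\<bar> * s powr (a - 1) / 4 + M) / s) * R"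
        using \<open>s > 0\<close> by (simp add: field_simps)
      finally have 1: "2 * ?G s * G1 s + 2 * G1 s * G2 s \<ge> - (1 + (\<bar>\<mu>\<bar> * s powr (a - 1) / 4 + M) / s) * R" .
      have "(\<bar>\<mu>\<bar> * s powr (a - 1) / 4 + M) / s \<le> (\<bar>\<mu>\<bar> * s0 powr (a - 1) / 4 + M) / \<epsilon>"
        using p s \<epsilon> M \<open>s > 0\<close> by (intro frac_le add_mono divide_right_mono mult_left_mono) auto
      then have "(1 + (\<bar>\<mu>\<bar> * s powr (a - 1) / 4 + M) / s) * R \<le> K * R"
        using R(3) by (intro mult_right_mono) (auto simp: K_def)
      with 1 have "0 \<le> 2 * ?G s * G1 s + 2 * G1 s * G2 s + K * R" unfolding mult_minus_left by linarith
      then show "\<exists>y. (E has_real_derivative y) (at s) \<and> 0 \<le> y"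
        using D by (auto simp: R_def intro!: exI[of _ "(2 * ?G s * G1 s + 2 * G1 s * G2 s + K * ((?G s)\<^sup>2 + (G1 s)\<^sup>2)) * exp (K * s)"])
    qed
    also have "E s0 = 0" using z \<open>G1 s0 = 0\<close> by (simp add: E_def)
    finally have "(?G \<epsilon>)\<^sup>2 + (G1 \<epsilon>)\<^sup>2 \<le> 0" by (simp add: E_def mult_le_0_iff)
    then show ?thesis by (metis add_increasing2 add_nonneg_eq_0_iff order_antisym zero_eq_power2 zero_le_power2)
  qed
  have "(?G \<longlongrightarrow> 0) (at_right 0)"
    by (rule tendsto_eventually) (use s0 zero in \<open>auto simp: eventually_at_right[OF s0] intro!: exI[of _ s0]\<close>)
  have "(1::real) = 0" by (rule tendsto_unique[OF _ frob_tendsto_1[OF a M, of \<mu>] \<open>(?G \<longlongrightarrow> 0) (at_right 0)\<close>]) simp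
  then show False by simp
qed


lemma smooth_on_deriv_open:
  assumes T: "open T" and G: "smooth_on T G"
  shows "s \<in> T \<Longrightarrow> (G has_real_derivative deriv G s) (at s)" "smooth_on T (deriv G)"
proof -
  have 1: "(G has_real_derivative partial_deriv 1 G s) (at s)" if "s \<in> T" for s
    using smooth_on_differentiable[OF T G that] by (rule real_partial_deriv)
  then have 2: "deriv G s = partial_deriv 1 G s" if "s \<in> T" for s using that by (intro DERIV_imp_deriv) auto
  show "s \<in> T \<Longrightarrow> (G has_real_derivative deriv G s) (at s)" using 1 2 by simp
  show "smooth_on T (deriv G)"
    by (rule smooth_on_cong[OF T _ smooth_on_partial_deriv[OF G, of 1]]) (use 2 in auto)
qed

lemmas smooth_on_deriv = smooth_on_deriv_open[OF open_greaterThan[of 0], unfolded greaterThan_iff]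

lemma radial_laplacian_diff:
  assumes G: "smooth_on {0<..} G" and F: "smooth_on {0<..} F" and s: "s > 0"
  shows "deriv (\<lambda>s. G s - c * F s) s = deriv G s - c * deriv F s"
    and "radial_laplacian M (\<lambda>s. G s - c * F s) s = radial_laplacian M G s - c * radial_laplacian M F s"
proof -
  note dG = smooth_on_deriv(1)[OF G] and dF = smooth_on_deriv(1)[OF F]
  note ddG = smooth_on_deriv(1)[OF smooth_on_deriv(2)[OF G]] and ddF = smooth_on_deriv(1)[OF smooth_on_deriv(2)[OF F]]
  have 1: "((\<lambda>s. G s - c * F s) has_real_derivative deriv G s - c * deriv F s) (at s)" if "s > 0" for s
    using dG[OF that] dF[OF that] by (auto intro!: derivative_eq_intros)
  have 2: "((\<lambda>s. deriv G s - c * deriv F s) has_real_derivative deriv (deriv G) s - c * deriv (deriv F) s) (at s)" if "s > 0" for s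
    using ddG[OF that] ddF[OF that] by (auto intro!: derivative_eq_intros)
  show "deriv (\<lambda>s. G s - c * F s) s = deriv G s - c * deriv F s" by (rule DERIV_imp_deriv[OF 1[OF s]])
  have R: "radial_laplacian M (\<lambda>s. G s - c * F s) s
      = 4 * s * (deriv (deriv G) s - c * deriv (deriv F) s) + 2 * M * (deriv G s - c * deriv F s)"
    by (rule radial_laplacian_eq[OF 1 2 s])
  show "radial_laplacian M (\<lambda>s. G s - c * F s) s = radial_laplacian M G s - c * radial_laplacian M F s"
    unfolding R by (simp add: radial_laplacian_def algebra_simps)
qed

definition radial_profile :: "real \<Rightarrow> (real \<Rightarrow> real) \<Rightarrow> bool" where
  "radial_profile M G \<longleftrightarrow> smooth_on {0<..} G \<and>
     (\<exists>C. \<forall>s\<in>{0<..4}. \<bar>G s\<bar> \<le> C \<and> \<bar>deriv G s\<bar> \<le> C \<and> \<bar>radial_laplacian M G s\<bar> \<le> C)"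

lemma radial_profile_diff:
  assumes "radial_profile M G" "radial_profile M F" shows "radial_profile M (\<lambda>s. G s - c * F s)"
proof -
  obtain C where C: "\<And>s. s \<in> {0<..4} \<Longrightarrow> \<bar>G s\<bar> \<le> C \<and> \<bar>deriv G s\<bar> \<le> C \<and> \<bar>radial_laplacian M G s\<bar> \<le> C"
    using assms(1) unfolding radial_profile_def by blast
  obtain D where D: "\<And>s. s \<in> {0<..4} \<Longrightarrow> \<bar>F s\<bar> \<le> D \<and> \<bar>deriv F s\<bar> \<le> D \<and> \<bar>radial_laplacian M F s\<bar> \<le> D"
    using assms(2) unfolding radial_profile_def by blast
  have sm: "smooth_on {0<..} G" "smooth_on {0<..} F" using assms by (auto simp: radial_profile_def)
  have *: "\<bar>x - c * y\<bar> \<le> C + \<bar>c\<bar> * D" if "\<bar>x\<bar> \<le> C" "\<bar>y\<bar> \<le> D" for x y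
  proof -
    have "\<bar>x - c * y\<bar> \<le> \<bar>x\<bar> + \<bar>c\<bar> * \<bar>y\<bar>" by (metis abs_mult abs_triangle_ineq4)
    also have "\<dots> \<le> C + \<bar>c\<bar> * D" using that by (intro add_mono mult_left_mono) auto
    finally show ?thesis .
  qed
  have "smooth_on {0<..} (\<lambda>s. G s - c * F s)" using sm by (intro smooth) auto
  moreover have "\<forall>s\<in>{0<..4}. \<bar>G s - c * F s\<bar> \<le> C + \<bar>c\<bar> * D \<and> \<bar>deriv (\<lambda>s. G s - c * F s) s\<bar> \<le> C + \<bar>c\<bar> * D
      \<and> \<bar>radial_laplacian M (\<lambda>s. G s - c * F s) s\<bar> \<le> C + \<bar>c\<bar> * D"
  proof
    fix s :: real assume s: "s \<in> {0<..4}"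
    then have "s > 0" by simp
    show "\<bar>G s - c * F s\<bar> \<le> C + \<bar>c\<bar> * D \<and> \<bar>deriv (\<lambda>s. G s - c * F s) s\<bar> \<le> C + \<bar>c\<bar> * D
      \<and> \<bar>radial_laplacian M (\<lambda>s. G s - c * F s) s\<bar> \<le> C + \<bar>c\<bar> * D"
      unfolding radial_laplacian_diff[OF sm \<open>s > 0\<close>] using C[OF s] D[OF s] * by blast
  qed
  ultimately show ?thesis unfolding radial_profile_def by blast
qed

lemma radial_profile_pser:
  assumes c: "entire_coeffs c" and a: "a \<ge> 1" and p: "p = 0 \<or> p \<ge> 1"
    and L: "\<And>s. s \<in> {0<..4} \<Longrightarrow> \<bar>radial_laplacian M (pser a p c) s\<bar> \<le> C3"
  shows "radial_profile M (pser a p c)"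
proof -
  obtain C1 where C1: "\<And>s. s \<in> {0<..4} \<Longrightarrow> \<bar>pser a p c s\<bar> \<le> C1"
    using pser_bounded[OF c, of a p] a p by force
  let ?c = "\<lambda>j. (p + a * real j) * c j"
  note e = entire_coeffs_affine[OF c, of p a]
  have "\<exists>C. \<forall>s\<in>{0<..4}. \<bar>pser a (p - 1) ?c s\<bar> \<le> C"
  proof (cases "p = 0")
    case True
    then have "pser a (p - 1) ?c s = pser a (p - 1 + a) (\<lambda>j. ?c (Suc j)) s" for s
      by (intro pser_shift[OF e]) simp
    moreover have "\<exists>C. \<forall>s\<in>{0<..4}. \<bar>pser a (p - 1 + a) (\<lambda>j. ?c (Suc j)) s\<bar> \<le> C"
      using a True by (intro pser_bounded entire_coeffs_Suc[OF e]) auto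
    ultimately show ?thesis by simp
  next
    case False
    then show ?thesis using a p by (intro pser_bounded[OF e]) auto
  qed
  then obtain C2 where C2': "\<And>s. s \<in> {0<..4} \<Longrightarrow> \<bar>pser a (p - 1) ?c s\<bar> \<le> C2" by blast
  have C2: "\<bar>deriv (pser a p c) s\<bar> \<le> C2" if "s \<in> {0<..4}" for s
    using DERIV_imp_deriv[OF pser_has_derivative[OF c, of s a p]] C2'[OF that] that by simp
  have "\<forall>s\<in>{0<..4}. \<bar>pser a p c s\<bar> \<le> max C1 (max C2 C3) \<and> \<bar>deriv (pser a p c) s\<bar> \<le> max C1 (max C2 C3)
      \<and> \<bar>radial_laplacian M (pser a p c) s\<bar> \<le> max C1 (max C2 C3)"
  proof
    fix s :: real assume s: "s \<in> {0<..4}"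
    show "\<bar>pser a p c s\<bar> \<le> max C1 (max C2 C3) \<and> \<bar>deriv (pser a p c) s\<bar> \<le> max C1 (max C2 C3)
      \<and> \<bar>radial_laplacian M (pser a p c) s\<bar> \<le> max C1 (max C2 C3)"
      using C1[OF s] C2[OF s] L[OF s] by linarith
  qed
  then show ?thesis unfolding radial_profile_def using smooth_on_pser[OF c] by blast
qed

lemma radial_profile_frob:
  assumes a: "a \<ge> 1" and M: "M \<ge> 2" shows "radial_profile M (frob M a \<mu> k)"
proof -
  obtain C where C: "\<And>s. s \<in> {0<..4} \<Longrightarrow> \<bar>frob M a \<mu> k s\<bar> \<le> C"
    using pser_bounded[OF entire_frob_coeff[OF a M], of a "real k" \<mu> k] a unfolding frob_def by force
  show ?thesis unfolding frob_def
  proof (rule radial_profile_pser[OF entire_frob_coeff[OF a M] a])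
    show "real k = 0 \<or> real k \<ge> 1" by (cases k) auto
    fix s :: real assume s: "s \<in> {0<..4}"
    have "radial_laplacian M (frob M a \<mu> k) s = indicial M (real k) * s powr (real k - 1) - \<mu> * s powr (a - 1) * frob M a \<mu> k s"
      using frob_equation[OF a M, of s \<mu> k] s by auto
    also have "\<bar>\<dots>\<bar> \<le> \<bar>indicial M (real k) * s powr (real k - 1)\<bar> + \<bar>\<mu> * s powr (a - 1) * frob M a \<mu> k s\<bar>"
      by (rule abs_triangle_ineq4)
    also have "\<dots> \<le> \<bar>indicial M (real k)\<bar> * 4 powr (real k - 1) + \<bar>\<mu>\<bar> * 4 powr (a - 1) * C"
    proof (rule add_mono)
      show "\<bar>indicial M (real k) * s powr (real k - 1)\<bar> \<le> \<bar>indicial M (real k)\<bar> * 4 powr (real k - 1)"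
      proof (cases k)
        case (Suc j)
        have "s powr (real k - 1) \<le> 4 powr (real k - 1)" using s Suc by (intro powr_mono2) auto
        then show ?thesis by (simp add: abs_mult mult_left_mono)
      qed (simp add: indicial_def)
      have "s powr (a - 1) \<le> 4 powr (a - 1)" using s a by (intro powr_mono2) auto
      then show "\<bar>\<mu> * s powr (a - 1) * frob M a \<mu> k s\<bar> \<le> \<bar>\<mu>\<bar> * 4 powr (a - 1) * C"
        unfolding abs_mult using C[OF s] by (intro mult_mono) auto
    qed
    finally show "\<bar>radial_laplacian M (pser a (real k) (frob_coeff M a \<mu> k)) s\<bar>
        \<le> \<bar>indicial M (real k)\<bar> * 4 powr (real k - 1) + \<bar>\<mu>\<bar> * 4 powr (a - 1) * C" by (simp add: frob_def)
  qed
qed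

lemma radial_profile_euler_frob:
  assumes a: "a \<ge> 1" and M: "M \<ge> 2" shows "radial_profile M (euler_frob M a \<mu>)"
proof -
  obtain C where C: "\<And>s. s \<in> {0<..4} \<Longrightarrow> \<bar>euler_frob M a \<mu> s\<bar> \<le> C"
    using pser_bounded[OF entire_euler_coeff[OF a M], of a 0 \<mu>] a unfolding euler_frob_def by force
  obtain D where D: "\<And>s. s \<in> {0<..4} \<Longrightarrow> \<bar>frob M a \<mu> 0 s\<bar> \<le> D"
    using pser_bounded[OF entire_frob_coeff[OF a M], of a 0 \<mu> 0] a unfolding frob_def by force
  show ?thesis unfolding euler_frob_def
  proof (rule radial_profile_pser[OF entire_euler_coeff[OF a M] a])
    fix s :: real assume s: "s \<in> {0<..4}"
    have "radial_laplacian M (euler_frob M a \<mu>) s = - (\<mu> * a) * s powr (a - 1) * frob M a \<mu> 0 s - \<mu> * s powr (a - 1) * euler_frob M a \<mu> s"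
      using euler_frob_equation[OF a M, of s \<mu>] s by auto
    also have "\<bar>\<dots>\<bar> \<le> \<bar>- (\<mu> * a) * s powr (a - 1) * frob M a \<mu> 0 s\<bar> + \<bar>\<mu> * s powr (a - 1) * euler_frob M a \<mu> s\<bar>"
      by (rule abs_triangle_ineq4)
    also have "\<dots> \<le> \<bar>- (\<mu> * a)\<bar> * 4 powr (a - 1) * D + \<bar>\<mu>\<bar> * 4 powr (a - 1) * C"
    proof (rule add_mono)
      have "s powr (a - 1) \<le> 4 powr (a - 1)" using s a by (intro powr_mono2) auto
      then show "\<bar>\<mu> * s powr (a - 1) * euler_frob M a \<mu> s\<bar> \<le> \<bar>\<mu>\<bar> * 4 powr (a - 1) * C"
        "\<bar>- (\<mu> * a) * s powr (a - 1) * frob M a \<mu> 0 s\<bar> \<le> \<bar>- (\<mu> * a)\<bar> * 4 powr (a - 1) * D"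
        unfolding abs_mult[of _ "frob M a \<mu> 0 s"] abs_mult[of _ "euler_frob M a \<mu> s"] abs_mult[of _ "s powr (a - 1)"]
        using C[OF s] D[OF s] by (intro mult_mono; simp)+
    qed
    finally show "\<bar>radial_laplacian M (pser a 0 (\<lambda>j. a * real j * frob_coeff M a \<mu> 0 j)) s\<bar>
        \<le> \<bar>- (\<mu> * a)\<bar> * 4 powr (a - 1) * D + \<bar>\<mu>\<bar> * 4 powr (a - 1) * C" by (simp add: euler_frob_def)
  qed simp
qed

text \<open>This rules out eigenvalues \<open>\<mu> \<le> 0\<close>: all coefficients of the series are nonnegative.\<close>

lemma frob_pos_of_nonpos:
  assumes a: "a \<ge> 1" and M: "M \<ge> 2" and "\<mu> \<le> 0" shows "frob M a \<mu> 0 1 > 0"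
proof -
  have nn: "frob_coeff M a \<mu> 0 j \<ge> 0" for j
  proof (induction j)
    case (Suc j)
    have "- \<mu> * frob_coeff M a \<mu> 0 j \<ge> 0" using Suc assms by (intro mult_nonneg_nonneg) auto
    from this indicial_pos[OF a M, of 0 j] show ?case unfolding frob_coeff.simps by (rule divide_nonneg_pos)
  qed simp
  have "summable (\<lambda>j. frob_coeff M a \<mu> 0 j)" using entire_coeffsD[OF entire_frob_coeff[OF a M], of \<mu> 0 1] by simp
  then have "sum (frob_coeff M a \<mu> 0) {..<1} \<le> suminf (frob_coeff M a \<mu> 0)"
    by (rule sum_le_suminf) (use nn in auto)
  then show ?thesis by (simp add: frob_def pser_def)
qed

text \<open>For fixed \<open>\<mu>\<close> and large \<open>M\<close>, i.e. large degree \<open>n\<close>, the leading coefficient \<open>1\<close> dominates the series, as the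
  others decay at least like \<open>4\<^sup>-\<^sup>j\<close>. So each \<open>\<mu>\<close> is resonant in finitely many degrees only.\<close>

lemma frob_pos_of_small:
  assumes a: "a \<ge> 1" and M: "M \<ge> 2" and "\<mu> \<ge> 0" and small: "4 * \<mu> \<le> M" shows "frob M a \<mu> 0 1 > 0"
proof -
  let ?c = "frob_coeff M a \<mu> 0"
  have q: "indicial M (real 0 + a * real (Suc j)) \<ge> M" for j
  proof -
    have "a * real (Suc j) \<ge> 1" using a mult_mono[of 1 a 1 "real (Suc j)"] by simp
    moreover have "1 * M \<le> (2 * (a * real (Suc j))) * (2 * (a * real (Suc j)) - 2 + M)"
      by (rule mult_mono) (use M calculation in auto)
    ultimately show ?thesis by (simp add: indicial_def)
  qed
  have bd: "\<bar>?c j\<bar> \<le> (1/4) ^ j" for j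
  proof (induction j)
    case (Suc j)
    let ?q = "indicial M (real 0 + a * real (Suc j))"
    have "\<bar>?c (Suc j)\<bar> = (\<mu> / ?q) * \<bar>?c j\<bar>" using q[of j] assms by (simp add: abs_mult)
    also have "\<dots> \<le> (1/4) * (1/4) ^ j"
    proof (rule mult_mono)
      show "\<mu> / ?q \<le> 1/4" using small q[of j] M by (simp add: divide_le_eq)
    qed (use Suc in auto)
    finally show ?case by simp
  qed simp
  have s: "summable ?c" using entire_coeffsD[OF entire_frob_coeff[OF a M], of \<mu> 0 1] by simp
  have s': "summable (\<lambda>j. ?c (Suc j))" using s by (subst summable_Suc_iff)
  have g: "(\<lambda>j. (1/4::real) * (1/4) ^ j) sums ((1/4) * (1 / (1 - 1/4)))"
    by (intro sums_mult geometric_sums) simp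
  have "\<bar>\<Sum>j. ?c (Suc j)\<bar> \<le> (\<Sum>j. (1/4::real) * (1/4) ^ j)"
    using norm_suminf_le[of "\<lambda>j. ?c (Suc j)" "\<lambda>j. (1/4::real) * (1/4) ^ j"] bd[of "Suc _"] sums_summable[OF g] by simp
  also have "\<dots> = 1/3" using sums_unique[OF g] by simp
  finally have "(\<Sum>j. ?c (Suc j)) > -1" by simp
  then show ?thesis using suminf_split_head[OF s] by (simp add: frob_def pser_def)
qed

section \<open>Bessel functions\<close>

definition bessel_series :: "real \<Rightarrow> real \<Rightarrow> real" where
  "bessel_series \<beta> = frob (2 + 2 * \<beta>) 1 1 0"

lemma frob_coeff_bessel:
  assumes \<beta>: "\<beta> \<ge> 0"
  shows "(-1) ^ j / (fact j * Gamma (real j + 1 + \<beta>)) * (1/4) ^ j = frob_coeff (2 + 2 * \<beta>) 1 1 0 j / Gamma (\<beta> + 1)"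
proof (induction j)
  case 0
  then show ?case by (simp add: add.commute)
next
  case (Suc j)
  have G: "Gamma (real (Suc j) + 1 + \<beta>) = (real j + 1 + \<beta>) * Gamma (real j + 1 + \<beta>)"
  proof -
    have "real j + 1 + \<beta> \<notin> \<int>\<^sub>\<le>\<^sub>0" using \<beta> by (auto elim!: nonpos_Ints_cases)
    from Gamma_plus1[OF this] show ?thesis by (simp add: algebra_simps)
  qed
  have i: "indicial (2 + 2 * \<beta>) (0 + 1 * real (Suc j)) = 4 * (real (Suc j) * (real j + 1 + \<beta>))"
    by (simp add: indicial_def algebra_simps)
  have "(-1) ^ Suc j / (fact (Suc j) * Gamma (real (Suc j) + 1 + \<beta>)) * (1/4) ^ Suc j
     = ((-1) ^ j / (fact j * Gamma (real j + 1 + \<beta>)) * (1/4) ^ j) * (- 1 / (4 * (real (Suc j) * (real j + 1 + \<beta>))))"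
    unfolding G by (simp add: divide_simps)
  also have "\<dots> = frob_coeff (2 + 2 * \<beta>) 1 1 0 (Suc j) / Gamma (\<beta> + 1)"
    unfolding Suc.IH frob_coeff.simps using i by simp
  finally show ?case .
qed

lemma bessel_J_eq:
  assumes \<beta>: "\<beta> \<ge> 0" and r: "r > 0"
  shows "bessel_J \<beta> r = r powr \<beta> / Gamma (\<beta> + 1) * bessel_series \<beta> (r\<^sup>2)"
proof -
  have e: "entire_coeffs (frob_coeff (2 + 2 * \<beta>) 1 1 0)" using \<beta> by (intro entire_frob_coeff) auto
  have "(-1) ^ k / (fact k * Gamma (real k + 1 + \<beta>)) * (r / 2) ^ (2 * k)
     = inverse (Gamma (\<beta> + 1)) * (frob_coeff (2 + 2 * \<beta>) 1 1 0 k * (r\<^sup>2) ^ k)" for k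
  proof -
    have "(r / 2) ^ (2 * k) = (1/4) ^ k * (r\<^sup>2) ^ k"
    proof -
      have "(r / 2)\<^sup>2 = (1/4) * r\<^sup>2" by (simp add: power2_eq_square)
      then show ?thesis by (simp only: power_mult power_mult_distrib)
    qed
    then have "(-1) ^ k / (fact k * Gamma (real k + 1 + \<beta>)) * (r / 2) ^ (2 * k)
       = ((-1) ^ k / (fact k * Gamma (real k + 1 + \<beta>)) * (1/4) ^ k) * (r\<^sup>2) ^ k" by (simp only: mult.assoc)
    then show ?thesis unfolding frob_coeff_bessel[OF \<beta>, of k] by (simp only: divide_inverse mult_ac)
  qed
  then have "(\<Sum>k. (-1) ^ k / (fact k * Gamma (real k + 1 + \<beta>)) * (r / 2) ^ (2 * k))
     = (\<Sum>k. inverse (Gamma (\<beta> + 1)) * (frob_coeff (2 + 2 * \<beta>) 1 1 0 k * (r\<^sup>2) ^ k))" by (simp only:)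
  also have "\<dots> = inverse (Gamma (\<beta> + 1)) * (\<Sum>k. frob_coeff (2 + 2 * \<beta>) 1 1 0 k * (r\<^sup>2) ^ k)"
    by (rule suminf_mult[OF entire_coeffsD[OF e]])
  finally have "(\<Sum>k. (-1) ^ k / (fact k * Gamma (real k + 1 + \<beta>)) * (r / 2) ^ (2 * k))
     = inverse (Gamma (\<beta> + 1)) * (\<Sum>k. frob_coeff (2 + 2 * \<beta>) 1 1 0 k * (r\<^sup>2) ^ k)" .
  note 1 = this
  have 2: "(if \<beta> = 0 then 1 else r powr \<beta>) = r powr \<beta>" using r by simp
  have 3: "bessel_series \<beta> (r\<^sup>2) = (\<Sum>k. frob_coeff (2 + 2 * \<beta>) 1 1 0 k * (r\<^sup>2) ^ k)"
    using r by (simp add: bessel_series_def frob_def pser_def)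
  show ?thesis unfolding bessel_J_def 1 2 3 by (simp only: divide_inverse mult_ac)
qed

lemma bessel_J_zero_iff:
  assumes "\<beta> \<ge> 0" "r > 0" shows "bessel_J \<beta> r = 0 \<longleftrightarrow> bessel_series \<beta> (r\<^sup>2) = 0"
proof -
  have "Gamma (\<beta> + 1) > 0" using assms by (intro Gamma_real_pos) auto
  then have "Gamma (\<beta> + 1) \<noteq> 0" by linarith
  then show ?thesis using bessel_J_eq[OF assms] assms by simp
qed

text \<open>The series for arbitrary \<open>a\<close> and \<open>\<mu>\<close> arises from the one for \<open>a = \<mu> = 1\<close> by the substitution
  \<open>s \<mapsto> \<mu> / a\<^sup>2 s\<^sup>a\<close>, which changes the parameter \<open>M\<close> to \<open>2 + 2 \<beta>\<close> with \<open>\<beta> = (M - 2) / (2 a)\<close>.\<close>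

lemma frob_eq_bessel_series:
  assumes a: "a \<ge> 1" and M: "M \<ge> 2" and \<mu>: "\<mu> > 0" and s: "s > 0"
  shows "frob M a \<mu> 0 s = bessel_series ((M - 2) / (2 * a)) (\<mu> / a\<^sup>2 * s powr a)"
proof -
  define \<beta> where "\<beta> = (M - 2) / (2 * a)"
  have \<beta>: "\<beta> \<ge> 0" "2 * a * \<beta> = M - 2" using a M by (auto simp: \<beta>_def)
  have "frob_coeff M a \<mu> 0 j = frob_coeff (2 + 2 * \<beta>) 1 1 0 j * (\<mu> / a\<^sup>2) ^ j" for j
  proof (induction j)
    case (Suc j)
    have "indicial M (0 + a * real (Suc j)) = a\<^sup>2 * indicial (2 + 2 * \<beta>) (0 + 1 * real (Suc j))"
    proof -
      have "indicial M (0 + a * real (Suc j)) = 2 * (a * real (Suc j)) * (2 * (a * real (Suc j)) + 2 * a * \<beta>)"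
        using \<beta>(2) by (simp add: indicial_def)
      also have "\<dots> = a\<^sup>2 * indicial (2 + 2 * \<beta>) (0 + 1 * real (Suc j))"
        by (simp add: indicial_def power2_eq_square algebra_simps)
      finally show ?thesis .
    qed
    then show ?case using Suc by (simp add: mult_ac)
  qed simp
  then show ?thesis using \<mu> s a
    by (simp add: frob_def bessel_series_def pser_def \<beta>_def[symmetric] power_mult_distrib[symmetric] mult.assoc)
qed

text \<open>Zeros do not accumulate at a positive point since they are simple, nor at the origin, where
  the series tends to \<open>1\<close>.\<close>

lemma finite_bessel_series_zeros:
  assumes \<beta>: "\<beta> \<ge> 0" shows "finite {s. 0 < s \<and> s \<le> S \<and> bessel_series \<beta> s = 0}" (is "finite ?A")
proof (rule ccontr)
  assume inf: "infinite ?A"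
  let ?G = "bessel_series \<beta>"
  have "?A \<subseteq> {0..S}" by auto
  with inf obtain x where x: "x \<in> {0..S}" "x islimpt ?A"
    using compact_eq_Bolzano_Weierstrass[of "{0..S}"] compact_Icc by blast
  have M: "2 + 2 * \<beta> \<ge> 2" using \<beta> by simp
  have "x \<noteq> 0"
  proof
    assume "x = 0"
    have "(?G \<longlongrightarrow> 1) (at_right 0)" unfolding bessel_series_def by (rule frob_tendsto_1) (use M in auto)
    then have "\<forall>\<^sub>F s in at_right 0. ?G s > 0" by (rule order_tendstoD) simp
    then obtain e where e: "e > 0" "\<And>s. 0 < s \<Longrightarrow> s < e \<Longrightarrow> ?G s > 0"
      unfolding eventually_at_right_field by auto
    obtain y where "y \<in> ?A" "dist y x < e" using x(2) e(1) unfolding islimpt_approachable by blast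
    then show False using e(2)[of y] \<open>x = 0\<close> by auto
  qed
  then have "x > 0" using x by simp
  then have d: "(?G has_real_derivative euler_frob (2 + 2 * \<beta>) 1 1 x / x) (at x)"
    unfolding bessel_series_def by (intro frob_has_derivative M) auto
  obtain f where f: "\<And>n::nat. f n \<in> ?A - {x}" "f \<longlonglongrightarrow> x" using x(2) unfolding islimpt_sequential by blast
  have "(\<lambda>n. ?G (f n)) \<longlonglongrightarrow> ?G x" by (rule isCont_tendsto_compose[OF DERIV_isCont[OF d] f(2)])
  moreover have "?G (f n) = 0" for n using f(1) by blast
  ultimately have z: "?G x = 0" by (simp add: LIMSEQ_const_iff)
  have "filterlim f (at x) sequentially" unfolding filterlim_at using f by auto
  with d have "(\<lambda>n. (?G (f n) - ?G x) / (f n - x)) \<longlonglongrightarrow> euler_frob (2 + 2 * \<beta>) 1 1 x / x"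
    unfolding has_field_derivative_iff by (rule filterlim_compose)
  then have "euler_frob (2 + 2 * \<beta>) 1 1 x / x = 0" using z \<open>\<And>n. ?G (f n) = 0\<close> by (simp add: LIMSEQ_const_iff)
  then show False
    using frob_zero_simple[of 1 "2 + 2 * \<beta>" x 1] M \<open>x > 0\<close> z by (simp add: bessel_series_def)
qed

text \<open>Sturm comparison: \<open>y(r) = r\<^bsup>\<beta> + 1/2\<^esup> B(r\<^sup>2)\<close> satisfies \<open>y'' = - (1 - (\<beta>\<^sup>2 - 1/4) / r\<^sup>2) y\<close>, where the
  coefficient is at least \<open>1/4\<close> for large \<open>r\<close>. So \<open>y\<close> oscillates at least as
  fast as \<open>sin (r/2)\<close>.\<close>

lemma bessel_series_zeros_unbounded:
  assumes \<beta>: "\<beta> \<ge> 0" shows "\<exists>r>R. r > 0 \<and> bessel_series \<beta> (r\<^sup>2) = 0"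
proof (rule ccontr)
  assume no: "\<not> (\<exists>r>R. r > 0 \<and> bessel_series \<beta> (r\<^sup>2) = 0)"
  let ?c = "frob_coeff (2 + 2 * \<beta>) 1 1 0"
  have M: "2 + 2 * \<beta> \<ge> 2" using \<beta> by simp
  note e = entire_frob_coeff[OF order_refl M, of 1 0]
  define p where "p = \<beta> + 1/2"
  define y where "y = pser 2 p ?c"
  define y1 where "y1 = pser 2 (p - 1) (\<lambda>j. (p + 2 * real j) * ?c j)"
  define y2 where "y2 = pser 2 (p - 1 - 1) (\<lambda>j. (p - 1 + 2 * real j) * ((p + 2 * real j) * ?c j))"
  have dy: "(y has_real_derivative y1 r) (at r)" "(y1 has_real_derivative y2 r) (at r)" if "r > 0" for r
    unfolding y_def y1_def y2_def by (intro pser_has_derivative e entire_coeffs_affine that)+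
  have yB: "y r = r powr p * bessel_series \<beta> (r\<^sup>2)" if "r > 0" for r
    using that by (simp add: y_def bessel_series_def frob_def pser_def)
  have y2: "y2 r = - (1 - (\<beta>\<^sup>2 - 1/4) / r\<^sup>2) * y r" if r: "r > 0" for r
  proof -
    let ?d = "\<lambda>j. indicial (2 + 2 * \<beta>) (real j) * ?c j"
    have ed: "entire_coeffs ?d"
      using entire_coeffs_affine[OF entire_coeffs_affine[OF e, of "2 * \<beta>" 2], of 0 2]
      by (simp add: indicial_def algebra_simps)
    have ec: "entire_coeffs (\<lambda>j. (\<beta>\<^sup>2 - 1/4) * ?c j)" using entire_coeffs_affine[OF e, of "\<beta>\<^sup>2 - 1/4" 0] by simp
    have "(\<lambda>j. (p - 1 + 2 * real j) * ((p + 2 * real j) * ?c j)) = (\<lambda>j. (\<beta>\<^sup>2 - 1/4) * ?c j + ?d j)"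
      by (rule ext) (simp add: p_def indicial_def power2_eq_square field_simps)
    then have "y2 r = (\<beta>\<^sup>2 - 1/4) * pser 2 (p - 1 - 1) ?c r + pser 2 (p - 1 - 1) ?d r"
      by (simp add: y2_def pser_add[OF ec ed] pser_scale[OF e])
    also have "pser 2 (p - 1 - 1) ?d r = pser 2 (p - 1 - 1 + 2) (\<lambda>j. ?d (Suc j)) r"
      by (rule pser_shift[OF ed]) (simp add: indicial_def)
    also have "(\<lambda>j. ?d (Suc j)) = (\<lambda>j. -1 * ?c j)"
    proof
      fix j
      have "indicial (2 + 2 * \<beta>) (real 0 + 1 * real (Suc j)) \<noteq> 0" using indicial_pos[OF order_refl M, of 0 j] by linarith
      then show "?d (Suc j) = -1 * ?c j" by simp
    qed
    also have "pser 2 (p - 1 - 1 + 2) (\<lambda>j. -1 * ?c j) r = - y r" unfolding pser_scale[OF e] by (simp add: y_def)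
    also have "pser 2 (p - 1 - 1) ?c r = y r / r\<^sup>2"
      using pser_powr_mult[OF r, of "-2" 2 p ?c] r by (simp add: y_def powr_minus divide_inverse mult.commute add.commute)
    finally show ?thesis using r by (simp add: field_simps)
  qed
  define A where "A = max R (2 * \<beta>) + 1"
  have A: "A > 0" "A > R" "A > 2 * \<beta>" using \<beta> by (auto simp: A_def)
  let ?b = "A + 2 * pi"
  have nz: "y r \<noteq> 0" if "A \<le> r" for r
    using no yB[of r] that A by auto
  have cont: "continuous_on {A..?b} y"
    by (intro continuous_at_imp_continuous_on ballI DERIV_isCont[OF dy(1)]) (use A in auto)
  obtain \<sigma> :: real where \<sigma>: "\<And>r. r \<in> {A..?b} \<Longrightarrow> \<sigma> * y r > 0"
  proof -
    have same: "(y A > 0 \<and> y r > 0) \<or> (y A < 0 \<and> y r < 0)" if r: "r \<in> {A..?b}" for r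
    proof (rule ccontr)
      assume "\<not> ?thesis"
      with nz[of A] nz[of r] r have "(y A < 0 \<and> y r > 0) \<or> (y A > 0 \<and> y r < 0)" by auto
      moreover have c: "continuous_on {A..r} y" using cont r by (auto intro: continuous_on_subset)
      ultimately obtain x where "A \<le> x" "y x = 0"
        using IVT'[of y A 0 r] IVT2'[of y r 0 A] r by (metis atLeastAtMost_iff less_imp_le)
      then show False using nz by blast
    qed
    show thesis
    proof (cases "y A > 0")
      case True
      then show thesis using that[of 1] same by auto
    next
      case False
      then show thesis using that[of "-1"] same by auto
    qed
  qed
  \<comment> \<open>The Wronskian of \<open>y\<close> and \<open>sin ((r - A) / 2)\<close>, on an interval between two consecutive zeros of the sine.\<close>
  define W where "W r = \<sigma> * (y r * cos ((r - A) / 2) / 2 - y1 r * sin ((r - A) / 2))" for r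
  have "W A \<le> W ?b"
  proof (rule DERIV_nonneg_imp_nondecreasing[of A ?b W])
    fix r assume r: "A \<le> r" "r \<le> ?b"
    then have "r > 0" using A by simp
    have D: "(W has_real_derivative \<sigma> * (- (y r) * sin ((r - A) / 2) / 4 - y2 r * sin ((r - A) / 2))) (at r)"
      unfolding W_def[abs_def]
      by (auto intro!: derivative_eq_intros dy \<open>r > 0\<close> simp: field_simps)
    have "\<beta>\<^sup>2 / r\<^sup>2 \<le> 1/4"
    proof -
      have "(2 * \<beta>)\<^sup>2 \<le> r\<^sup>2" using A r \<beta> by (intro power_mono) auto
      then show ?thesis using \<open>r > 0\<close> by (simp add: divide_le_eq power_mult_distrib)
    qed
    moreover have "(\<beta>\<^sup>2 - 1/4) / r\<^sup>2 \<le> \<beta>\<^sup>2 / r\<^sup>2" by (intro divide_right_mono) auto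
    ultimately have "(\<beta>\<^sup>2 - 1/4) / r\<^sup>2 \<le> 1/4" by (rule order_trans[rotated])
    moreover have "1 - x - 1/4 \<ge> 0" if "x \<le> 1/4" for x :: real using that by simp
    ultimately have Q: "1 - (\<beta>\<^sup>2 - 1/4) / r\<^sup>2 - 1/4 \<ge> 0" by blast
    have "sin ((r - A) / 2) \<ge> 0" using r by (intro sin_ge_zero) auto
    then have "0 \<le> (\<sigma> * y r) * ((1 - (\<beta>\<^sup>2 - 1/4) / r\<^sup>2 - 1/4) * sin ((r - A) / 2))"
      using \<sigma>[of r] r by (intro mult_nonneg_nonneg[OF _ mult_nonneg_nonneg[OF Q]]) auto
    also have "\<dots> = \<sigma> * (- (y r) * sin ((r - A) / 2) / 4 - y2 r * sin ((r - A) / 2))"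
      unfolding y2[OF \<open>r > 0\<close>] by (simp add: algebra_simps)
    finally show "\<exists>y. (W has_real_derivative y) (at r) \<and> 0 \<le> y" using D by blast
  qed simp
  moreover have "W A > 0" using \<sigma>[of A] by (simp add: W_def)
  moreover have "W ?b < 0" using \<sigma>[of ?b] by (simp add: W_def)
  ultimately show False by simp
qed

lemma nth_element_exists:
  fixes Z :: "real set"
  assumes fin: "\<And>R. finite {s. 0 < s \<and> s \<le> R \<and> s \<in> Z}" and unb: "\<And>R. \<exists>r>R. r > 0 \<and> r \<in> Z" and i: "i \<ge> 1"
  shows "\<exists>!r. 0 < r \<and> r \<in> Z \<and> card {s. 0 < s \<and> s \<le> r \<and> s \<in> Z} = i"
proof -
  let ?S = "\<lambda>r. {s. 0 < s \<and> s \<le> r \<and> s \<in> Z}"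
  have "\<exists>r\<ge>0. card (?S r) = i \<and> (i \<ge> 1 \<longrightarrow> 0 < r \<and> r \<in> Z)" for i
  proof (induction i)
    case 0
    have "?S 0 = {}" by auto
    then show ?case by (intro exI[of _ 0]) (simp del: Collect_empty_eq)
  next
    case (Suc i)
    then obtain r where r: "r \<ge> 0" "card (?S r) = i" by blast
    obtain R where R: "R > r" "R > 0" "R \<in> Z" using unb by blast
    let ?T = "{s. 0 < s \<and> s \<le> R \<and> s \<in> Z} \<inter> {r<..}"
    have T: "finite ?T" "?T \<noteq> {}" using fin[of R] R by auto
    define r' where "r' = Min ?T"
    have r': "r' \<in> ?T" unfolding r'_def using T by (rule Min_in)
    have min: "r' \<le> s" if "s \<in> ?T" for s unfolding r'_def using T(1) that by (rule Min_le)
    have "?S r' = insert r' (?S r)"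
    proof (intro equalityI subsetI)
      fix s assume s: "s \<in> ?S r'"
      show "s \<in> insert r' (?S r)"
      proof (cases "s \<le> r")
        case False
        then have "s \<in> ?T" using s r' by auto
        then show ?thesis using min s by fastforce
      qed (use s in auto)
    qed (use r' in auto)
    moreover have "r' \<notin> ?S r" using r' by auto
    ultimately have "card (?S r') = Suc i" using r(2) fin[of r] by simp
    then show ?case using r' r(1) by (intro exI[of _ r']) auto
  qed
  then obtain r where r: "0 < r" "r \<in> Z" "card (?S r) = i" using i by blast
  have mono: "card (?S x) < card (?S x')" if "x < x'" "0 < x" "x \<in> Z" "x' \<in> Z" for x x'
  proof (intro psubset_card_mono fin psubsetI)
    show "?S x \<subseteq> ?S x'" using that by auto
    have "x' \<in> ?S x'" "x' \<notin> ?S x" using that by auto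
    then show "?S x \<noteq> ?S x'" by blast
  qed
  show ?thesis
  proof (intro ex1I[of _ r])
    fix x assume x: "0 < x \<and> x \<in> Z \<and> card (?S x) = i"
    show "x = r" using mono[of x r] mono[of r x] x r by (cases x r rule: linorder_cases) auto
  qed (use r in auto)
qed

lemma bessel_zero_exists:
  assumes \<beta>: "\<beta> \<ge> 0" and i: "i \<ge> 1"
  shows "\<exists>!r. 0 < r \<and> bessel_J \<beta> r = 0 \<and>
     finite {s. 0 < s \<and> s \<le> r \<and> bessel_J \<beta> s = 0} \<and>
     card {s. 0 < s \<and> s \<le> r \<and> bessel_J \<beta> s = 0} = i"
    and "finite {s. 0 < s \<and> s \<le> R \<and> bessel_J \<beta> s = 0}"
proof -
  have fin: "finite {s. 0 < s \<and> s \<le> R \<and> bessel_J \<beta> s = 0}" for R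
  proof (rule finite_imageD)
    have "power2 ` {s. 0 < s \<and> s \<le> R \<and> bessel_J \<beta> s = 0} \<subseteq> {s. 0 < s \<and> s \<le> R\<^sup>2 \<and> bessel_series \<beta> s = 0}"
      using bessel_J_zero_iff[OF \<beta>] by (auto intro: power_mono)
    then show "finite (power2 ` {s. 0 < s \<and> s \<le> R \<and> bessel_J \<beta> s = 0})"
      using finite_bessel_series_zeros[OF \<beta>] finite_subset by blast
    show "inj_on power2 {s. 0 < s \<and> s \<le> R \<and> bessel_J \<beta> s = 0}" by (auto simp: inj_on_def)
  qed
  show "finite {s. 0 < s \<and> s \<le> R \<and> bessel_J \<beta> s = 0}" by (rule fin)
  have unb: "\<exists>r>R. r > 0 \<and> bessel_J \<beta> r = 0" for R
    using bessel_series_zeros_unbounded[OF \<beta>, of R] bessel_J_zero_iff[OF \<beta>] by blast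
  show "\<exists>!r. 0 < r \<and> bessel_J \<beta> r = 0 \<and>
     finite {s. 0 < s \<and> s \<le> r \<and> bessel_J \<beta> s = 0} \<and>
     card {s. 0 < s \<and> s \<le> r \<and> bessel_J \<beta> s = 0} = i"
    using nth_element_exists[of "{r. bessel_J \<beta> r = 0}" i] fin unb i by simp
qed

lemma bessel_zero_props:
  assumes "\<beta> \<ge> 0" "i \<ge> 1"
  shows "bessel_zero \<beta> i > 0" "bessel_J \<beta> (bessel_zero \<beta> i) = 0"
    and "card {s. 0 < s \<and> s \<le> bessel_zero \<beta> i \<and> bessel_J \<beta> s = 0} = i"
  using theI'[OF bessel_zero_exists(1)[OF assms]] unfolding bessel_zero_def[symmetric] by blast+

lemma bessel_zero_surj:
  assumes \<beta>: "\<beta> \<ge> 0" and r: "r > 0" "bessel_J \<beta> r = 0"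
  shows "\<exists>i\<ge>1. bessel_zero \<beta> i = r"
proof -
  let ?S = "{s. 0 < s \<and> s \<le> r \<and> bessel_J \<beta> s = 0}"
  have fin: "finite ?S" using bessel_zero_exists(2)[OF \<beta> order_refl] .
  have "r \<in> ?S" using r by simp
  then have "card ?S \<noteq> 0" using fin by auto
  then have "card ?S \<ge> 1" by simp
  then have "bessel_zero \<beta> (card ?S) = r"
    unfolding bessel_zero_def by (intro the1_equality bessel_zero_exists \<beta>) (use fin r in auto)
  with \<open>card ?S \<ge> 1\<close> show ?thesis by blast
qed

section \<open>Products of radial and homogeneous functions\<close>

lemma laplacian_add:
  assumes S: "open S" "x \<in> S" and f: "smooth_on S f" and g: "smooth_on S g"
  shows "laplacian (\<lambda>x. f x + g x) x = laplacian f x + laplacian g x"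
proof -
  have "partial_deriv b (partial_deriv b (\<lambda>x. f x + g x)) x = partial_deriv b (partial_deriv b f) x + partial_deriv b (partial_deriv b g) x"
    if b: "b \<in> Basis" for b
  proof -
    have "partial_deriv b (partial_deriv b (\<lambda>x. f x + g x)) x = partial_deriv b (\<lambda>x. partial_deriv b f x + partial_deriv b g x) x"
      by (rule partial_deriv_cong[OF S]) (intro partial_deriv_add smooth_on_differentiable[OF S(1)] f g; assumption)
    also have "\<dots> = partial_deriv b (partial_deriv b f) x + partial_deriv b (partial_deriv b g) x"
      by (intro partial_deriv_add smooth_on_differentiable[OF S(1) _ S(2)] smooth_on_partial_deriv f g b)
    finally show ?thesis .
  qed
  then show ?thesis unfolding laplacian_def by (simp add: sum.distrib)
qed

lemma partial_deriv_const: "partial_deriv b (\<lambda>x. c) x = 0"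
  by (rule partial_deriv_eq[of _ "\<lambda>_. 0"]) simp

lemma laplacian_scale:
  assumes S: "open S" "x \<in> S" and f: "smooth_on S f"
  shows "laplacian (\<lambda>x. c * f x) x = c * laplacian f x"
proof -
  have 1: "partial_deriv b (\<lambda>x. c * h x) y = c * partial_deriv b h y" if "smooth_on S h" "y \<in> S" for b h y
    using partial_deriv_mult[of "\<lambda>_. c" y h b] smooth_on_differentiable[OF S(1) that] by (simp add: partial_deriv_const)
  have "partial_deriv b (partial_deriv b (\<lambda>x. c * f x)) x = c * partial_deriv b (partial_deriv b f) x"
    if b: "b \<in> Basis" for b
  proof -
    have "partial_deriv b (partial_deriv b (\<lambda>x. c * f x)) x = partial_deriv b (\<lambda>x. c * partial_deriv b f x) x"
      by (rule partial_deriv_cong[OF S]) (rule 1[OF f])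
    also have "\<dots> = c * partial_deriv b (partial_deriv b f) x"
      by (rule 1[OF smooth_on_partial_deriv[OF f b] S(2)])
    finally show ?thesis .
  qed
  then show ?thesis unfolding laplacian_def by (simp add: sum_distrib_left)
qed

lemma partial_deriv_norm_sq: "partial_deriv b (\<lambda>x. x \<bullet> x) x = 2 * (x \<bullet> b)"
  by (rule partial_deriv_eq[of _ "\<lambda>h. 2 * (x \<bullet> h)"]) (auto intro!: derivative_eq_intros simp: inner_commute)

lemma partial_deriv_inner: "partial_deriv b (\<lambda>x. x \<bullet> v) x = b \<bullet> v"
  by (rule partial_deriv_eq[of _ "\<lambda>h. h \<bullet> v"]) (auto intro!: derivative_eq_intros)

lemma smooth_on_radial_mult:
  fixes H :: "'a::euclidean_space \<Rightarrow> real"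
  assumes "open T" "smooth_on T G" "open S" "smooth_on S H" "\<And>y. y \<in> S \<Longrightarrow> y \<bullet> y \<in> T"
  shows "smooth_on S (\<lambda>x. G (x \<bullet> x) * H x)" "smooth_on S (\<lambda>x. G (x \<bullet> x))"
proof -
  show "smooth_on S (\<lambda>x. G (x \<bullet> x))"
    by (rule smooth_on_compose[OF assms(3,1) _ assms(2)]) (use assms in \<open>auto intro!: smooth\<close>)
  then show "smooth_on S (\<lambda>x. G (x \<bullet> x) * H x)" using assms by (intro smooth_on_mult)
qed

lemma partial_deriv_radial_mult:
  fixes H :: "'a::euclidean_space \<Rightarrow> real"
  assumes T: "open T" "smooth_on T G" and S: "open S" "smooth_on S H" and ST: "\<And>y. y \<in> S \<Longrightarrow> y \<bullet> y \<in> T" and x: "x \<in> S"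
  shows "partial_deriv b (\<lambda>x. G (x \<bullet> x) * H x) x = deriv G (x \<bullet> x) * (2 * (x \<bullet> b)) * H x + G (x \<bullet> x) * partial_deriv b H x"
proof -
  have d: "(\<lambda>x. x \<bullet> x) differentiable (at x)"
    by (rule smooth_on_differentiable[OF open_UNIV]) (auto intro: smooth)
  have "partial_deriv b (\<lambda>x. G (x \<bullet> x)) x = deriv G (x \<bullet> x) * (2 * (x \<bullet> b))"
    using partial_deriv_chain[OF smooth_on_deriv_open(1)[OF T ST[OF x]] d] by (simp add: partial_deriv_norm_sq)
  moreover have "(\<lambda>x. G (x \<bullet> x)) differentiable (at x)" 
    by (rule smooth_on_differentiable[OF S(1) smooth_on_radial_mult(2)[OF T S ST] x])
  ultimately show ?thesis
    using partial_deriv_mult[of "\<lambda>x. G (x \<bullet> x)" x H b] smooth_on_differentiable[OF S x] by simp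
qed

lemma grad_radial_mult:
  fixes H :: "'a::euclidean_space \<Rightarrow> real"
  assumes T: "open T" "smooth_on T G" and S: "open S" "smooth_on S H" and ST: "\<And>y. y \<in> S \<Longrightarrow> y \<bullet> y \<in> T" and x: "x \<in> S"
  shows "grad (\<lambda>x. G (x \<bullet> x) * H x) x = (2 * deriv G (x \<bullet> x) * H x) *\<^sub>R x + G (x \<bullet> x) *\<^sub>R grad H x"
  by (rule euclidean_eqI)
    (simp add: grad_inner_Basis inner_add_left partial_deriv_radial_mult[OF T S ST x])

text \<open>By Euler's identity for \<open>H\<close>, the mixed term \<open>2 \<nabla>G(\<bar>x\<bar>\<^sup>2) \<bullet> \<nabla>H = 4 G' x \<bullet> \<nabla>H\<close> of the product rule is the
  multiple \<open>4 e G' H\<close> of \<open>H\<close>. It raises the dimension in the radial operator by \<open>2 e\<close>.\<close>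

lemma laplacian_radial_mult:
  fixes H :: "'a::euclidean_space \<Rightarrow> real"
  assumes T: "open T" "smooth_on T G" and S: "open S" "smooth_on S H" and ST: "\<And>y. y \<in> S \<Longrightarrow> y \<bullet> y \<in> T" and x: "x \<in> S"
    and euler: "grad H x \<bullet> x = e * H x"
  shows "laplacian (\<lambda>x. G (x \<bullet> x) * H x) x
    = radial_laplacian (real DIM('a) + 2 * e) G (x \<bullet> x) * H x + G (x \<bullet> x) * laplacian H x"
proof -
  let ?s = "x \<bullet> x"
  note dG = smooth_on_deriv_open[OF T]
  have 2: "partial_deriv b (partial_deriv b (\<lambda>x. G (x \<bullet> x) * H x)) x
     = 4 * deriv (deriv G) ?s * (x \<bullet> b)\<^sup>2 * H x + 2 * deriv G ?s * H x + 4 * deriv G ?s * ((grad H x \<bullet> b) * (x \<bullet> b))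
       + G ?s * partial_deriv b (partial_deriv b H) x" if b: "b \<in> Basis" for b
  proof -
    have sm: "smooth_on S (\<lambda>x. 2 * ((x \<bullet> b) * H x))" using S by (intro smooth) auto
    note pH = smooth_on_partial_deriv[OF S(2) b]
    have "partial_deriv b (partial_deriv b (\<lambda>x. G (x \<bullet> x) * H x)) x
       = partial_deriv b (\<lambda>x. deriv G (x \<bullet> x) * (2 * ((x \<bullet> b) * H x)) + G (x \<bullet> x) * partial_deriv b H x) x"
      by (rule partial_deriv_cong[OF S(1) x]) (simp add: partial_deriv_radial_mult[OF T S ST])
    also have "\<dots> = partial_deriv b (\<lambda>x. deriv G (x \<bullet> x) * (2 * ((x \<bullet> b) * H x))) x + partial_deriv b (\<lambda>x. G (x \<bullet> x) * partial_deriv b H x) x"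
      by (rule partial_deriv_add)
        (rule smooth_on_differentiable[OF S(1) smooth_on_radial_mult(1)[OF T(1) dG(2) S(1) sm ST] x]
              smooth_on_differentiable[OF S(1) smooth_on_radial_mult(1)[OF T S(1) pH ST] x]; assumption)+
    also have "partial_deriv b (\<lambda>x. G (x \<bullet> x) * partial_deriv b H x) x
       = deriv G ?s * (2 * (x \<bullet> b)) * partial_deriv b H x + G ?s * partial_deriv b (partial_deriv b H) x"
      by (rule partial_deriv_radial_mult[OF T S(1) pH ST x])
    also have "partial_deriv b (\<lambda>x. deriv G (x \<bullet> x) * (2 * ((x \<bullet> b) * H x))) x
       = deriv (deriv G) ?s * (2 * (x \<bullet> b)) * (2 * ((x \<bullet> b) * H x)) + deriv G ?s * partial_deriv b (\<lambda>x. 2 * ((x \<bullet> b) * H x)) x"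
      by (rule partial_deriv_radial_mult[OF T(1) dG(2) S(1) sm ST x])
    also have "partial_deriv b (\<lambda>x. 2 * ((x \<bullet> b) * H x)) x = 2 * (H x + (x \<bullet> b) * partial_deriv b H x)"
    proof -
      have d: "(\<lambda>x. x \<bullet> b) differentiable (at x)" "H differentiable (at x)" "(\<lambda>x. (x \<bullet> b) * H x) differentiable (at x)"
        using smooth_on_differentiable[OF S x] by auto
      show ?thesis using partial_deriv_mult[OF differentiable_const[of 2] d(3), of b] partial_deriv_mult[OF d(1,2), of b] b
        by (simp add: partial_deriv_const partial_deriv_inner)
    qed
    finally show ?thesis using b by (simp add: grad_inner_Basis power2_eq_square algebra_simps)
  qed
  have "(\<Sum>b\<in>Basis. (x \<bullet> b)\<^sup>2) = ?s" by (subst (2) euclidean_inner) (simp add: power2_eq_square)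
  moreover have "(\<Sum>b\<in>Basis. (grad H x \<bullet> b) * (x \<bullet> b)) = e * H x" using euler by (subst (asm) euclidean_inner)
  moreover have "laplacian (\<lambda>x. G (x \<bullet> x) * H x) x = (\<Sum>b\<in>Basis. 4 * deriv (deriv G) ?s * (x \<bullet> b)\<^sup>2 * H x
      + 2 * deriv G ?s * H x + 4 * deriv G ?s * ((grad H x \<bullet> b) * (x \<bullet> b)) + G ?s * partial_deriv b (partial_deriv b H) x)"
    unfolding laplacian_def by (rule sum.cong[OF refl 2])
  then have "laplacian (\<lambda>x. G (x \<bullet> x) * H x) x = 4 * deriv (deriv G) ?s * H x * (\<Sum>b\<in>Basis. (x \<bullet> b)\<^sup>2)
      + real DIM('a) * (2 * deriv G ?s * H x) + 4 * deriv G ?s * (\<Sum>b\<in>Basis. (grad H x \<bullet> b) * (x \<bullet> b))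
      + G ?s * laplacian H x"
    by (simp add: laplacian_def[of H] sum.distrib sum_distrib_left mult_ac)
  ultimately show ?thesis by (simp add: radial_laplacian_def algebra_simps)
qed

definition homogeneous :: "real \<Rightarrow> ('a::euclidean_space \<Rightarrow> real) \<Rightarrow> bool" where
  "homogeneous \<kappa> H \<longleftrightarrow> (\<forall>x. \<forall>t>0. x \<noteq> 0 \<longrightarrow> H (t *\<^sub>R x) = t powr \<kappa> * H x)"

lemma homogeneousD: "homogeneous \<kappa> H \<Longrightarrow> x \<noteq> 0 \<Longrightarrow> t > 0 \<Longrightarrow> H (t *\<^sub>R x) = t powr \<kappa> * H x"
  by (auto simp: homogeneous_def)

lemma open_minus_0 [simp]: "open (- {0::'a::euclidean_space})" by auto

lemma homogeneous_euler:
  assumes h: "homogeneous \<kappa> H" and sm: "smooth_on (- {0}) H" and x: "x \<noteq> 0"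
  shows "grad H x \<bullet> x = \<kappa> * H x"
proof -
  have "((\<lambda>t. t *\<^sub>R x) has_derivative (\<lambda>h. h *\<^sub>R x)) (at 1)" by (auto intro!: derivative_eq_intros)
  moreover have "(H has_derivative (\<lambda>h. grad H x \<bullet> h)) (at (1 *\<^sub>R x))"
    using smooth_on_has_derivative_grad[OF open_minus_0 sm, of x] x by simp
  ultimately have "((\<lambda>t. H (t *\<^sub>R x)) has_derivative (\<lambda>h. grad H x \<bullet> (h *\<^sub>R x))) (at 1)" by (rule has_derivative_compose)
  then have 1: "((\<lambda>t. H (t *\<^sub>R x)) has_real_derivative grad H x \<bullet> x) (at 1)"
    by (simp add: has_field_derivative_def mult_commute_abs)
  have "((\<lambda>t. t powr \<kappa> * H x) has_real_derivative \<kappa> * H x) (at 1)" by (auto intro!: derivative_eq_intros)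
  then have "((\<lambda>t. H (t *\<^sub>R x)) has_real_derivative \<kappa> * H x) (at 1)"
    by (rule has_field_derivative_transform_within_open[of _ _ _ "{0<..}"]) (use homogeneousD[OF h x] in auto)
  with 1 show ?thesis by (rule DERIV_unique)
qed

lemma homogeneous_grad:
  fixes H :: "'a::euclidean_space \<Rightarrow> real"
  assumes h: "homogeneous \<kappa> H" and sm: "smooth_on (- {0}) H" and x: "x \<noteq> 0" and t: "t > 0"
  shows "grad H (t *\<^sub>R x) = t powr (\<kappa> - 1) *\<^sub>R grad H x"
proof -
  have "((\<lambda>y. t *\<^sub>R y) has_derivative (\<lambda>h. t *\<^sub>R h)) (at x)" by (auto intro!: derivative_eq_intros)
  moreover have "(H has_derivative (\<lambda>h. grad H (t *\<^sub>R x) \<bullet> h)) (at (t *\<^sub>R x))"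
    using smooth_on_has_derivative_grad[OF open_minus_0 sm, of "t *\<^sub>R x"] x t by simp
  ultimately have "((\<lambda>y. H (t *\<^sub>R y)) has_derivative (\<lambda>h. grad H (t *\<^sub>R x) \<bullet> (t *\<^sub>R h))) (at x)" by (rule has_derivative_compose)
  then have "((\<lambda>y. H (t *\<^sub>R y)) has_derivative (\<lambda>h. (t *\<^sub>R grad H (t *\<^sub>R x)) \<bullet> h)) (at x)" by simp
  then have 1: "grad (\<lambda>y. H (t *\<^sub>R y)) x = t *\<^sub>R grad H (t *\<^sub>R x)" by (rule grad_unique)
  have "grad (\<lambda>y. H (t *\<^sub>R y)) x = grad (\<lambda>y. t powr \<kappa> * H y) x"
    by (rule grad_cong[of "- {0}"]) (use x t homogeneousD[OF h] in auto)
  also have "\<dots> = t powr \<kappa> *\<^sub>R grad H x"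
    by (rule grad_scale) (use smooth_on_differentiable[OF open_minus_0 sm, of x] x in auto)
  finally have "t *\<^sub>R grad H (t *\<^sub>R x) = t powr \<kappa> *\<^sub>R grad H x" using 1 by simp
  then have "(1/t) *\<^sub>R (t *\<^sub>R grad H (t *\<^sub>R x)) = (1/t) *\<^sub>R (t powr \<kappa> *\<^sub>R grad H x)" by simp
  then show ?thesis using t by (simp add: powr_diff)
qed

lemma homogeneous_partial_deriv:
  assumes h: "homogeneous \<kappa> H" and sm: "smooth_on (- {0}) H" and b: "b \<in> Basis"
  shows "homogeneous (\<kappa> - 1) (partial_deriv b H)"
  unfolding homogeneous_def using homogeneous_grad[OF h sm] grad_inner_Basis[OF b, of H] by (metis inner_scaleR_left)

lemma homogeneous_laplacian:
  assumes h: "homogeneous \<kappa> H" and sm: "smooth_on (- {0}) H"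
  shows "homogeneous (\<kappa> - 2) (laplacian H)"
proof -
  have "homogeneous (\<kappa> - 2) (partial_deriv b (partial_deriv b H))" if b: "b \<in> Basis" for b
    using homogeneous_partial_deriv[OF homogeneous_partial_deriv[OF h sm b] smooth_on_partial_deriv[OF sm b] b] by simp
  then show ?thesis unfolding homogeneous_def laplacian_def by (simp add: sum_distrib_left)
qed

section \<open>Solid harmonics and the eigenspaces of the Laplace--Beltrami operator\<close>

definition solid_harmonic :: "nat \<Rightarrow> ('a::euclidean_space \<Rightarrow> real) \<Rightarrow> bool" where
  "solid_harmonic n H \<longleftrightarrow> smooth_on (- {0}) H \<and> homogeneous (real n) H \<and> (\<forall>x. x \<noteq> 0 \<longrightarrow> laplacian H x = 0)"

lemma smooth_on_powr': "smooth_on {0<..} (\<lambda>s::real. s powr p)"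
  using smooth_on_powr[of 1 p] by simp

lemma radial_laplacian_powr:
  assumes "s > 0" shows "radial_laplacian M (\<lambda>s. s powr p) s = 2 * p * (2 * p - 2 + M) * s powr (p - 1)"
proof -
  have "radial_laplacian M (\<lambda>s. s powr p) s = 4 * s * (p * ((p - 1) * s powr (p - 1 - 1))) + 2 * M * (p * s powr (p - 1))"
    by (rule radial_laplacian_eq[OF _ _ assms]) (auto intro!: derivative_eq_intros)
  also have "s powr (p - 1 - 1) = s powr (p - 1) / s" using assms powr_diff[of s "p - 1" 1] by simp
  finally have R: "radial_laplacian M (\<lambda>s. s powr p) s
    = 4 * s * (p * ((p - 1) * (s powr (p - 1) / s))) + 2 * M * (p * s powr (p - 1))" .
  show ?thesis unfolding R using assms by (simp add: field_simps)
qed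

lemma homogeneous_radial_ext: "homogeneous 0 (radial_ext f)"
proof -
  have "radial_ext f (t *\<^sub>R x) = t powr 0 * radial_ext f x" if "x \<noteq> 0" "t > 0" for x :: 'a and t
  proof -
    have "t *\<^sub>R x /\<^sub>R norm (t *\<^sub>R x) = x /\<^sub>R norm x" using that by simp
    then have "radial_ext f (t *\<^sub>R x) = radial_ext f x" unfolding radial_ext_def by (rule arg_cong)
    then show ?thesis using that by simp
  qed
  then show ?thesis unfolding homogeneous_def by blast
qed

lemma norm_eq_inner_powr: "x \<noteq> 0 \<Longrightarrow> (x \<bullet> x) powr p = norm x powr (2 * p)"
  by (simp add: power2_norm_eq_inner[symmetric] powr_powr[symmetric] powr_numeral)

lemma inner_self_pos: "x \<noteq> 0 \<Longrightarrow> x \<bullet> x > (0::real)" by simp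

text \<open>The eigenvalue \<open>n (N - 2 + n)\<close> is the factor by which \<open>\<Delta>\<close> maps \<open>\<bar>x\<bar>\<^sup>n\<close> to \<open>\<bar>x\<bar>\<^sup>n\<^sup>-\<^sup>2\<close>, so the radial and the
  angular contribution to the Laplacian cancel.\<close>

lemma sphere_eigenspace_imp_solid_harmonic:
  fixes f :: "'a::euclidean_space \<Rightarrow> real"
  assumes f: "f \<in> sphere_eigenspace (real n * (real DIM('a) - 2 + real n))"
  shows "solid_harmonic n (\<lambda>x. norm x powr real n * f (x /\<^sub>R norm x))"
proof -
  let ?F = "radial_ext f"
  let ?K = "\<lambda>x. (x \<bullet> x) powr (real n / 2) * ?F x"
  let ?H = "\<lambda>x. norm x powr real n * f (x /\<^sub>R norm x)"
  have F: "smooth_on (- {0}) ?F" and eig: "\<And>x. norm x = 1 \<Longrightarrow> - laplacian ?F x = real n * (real DIM('a) - 2 + real n) * f x"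
    using f by (auto simp: sphere_eigenspace_def laplace_beltrami_def)
  have HK: "?K x = ?H x" if "x \<noteq> 0" for x using that by (simp add: radial_ext_def norm_eq_inner_powr)
  note args = open_greaterThan smooth_on_powr'[of "real n / 2"] open_minus_0 F
  have pos: "y \<in> - {0} \<Longrightarrow> y \<bullet> y \<in> {0<..}" for y :: 'a by simp
  have smK: "smooth_on (- {0}) ?K" by (rule smooth_on_radial_mult(1)[OF args pos])
  then have sm: "smooth_on (- {0}) ?H" by (rule smooth_on_cong[rotated 2]) (use HK in auto)
  have hom: "homogeneous (real n) ?H"
    unfolding homogeneous_def
  proof (intro allI impI)
    fix x :: 'a and t :: real assume "t > 0" "x \<noteq> 0"
    then show "norm (t *\<^sub>R x) powr real n * f (t *\<^sub>R x /\<^sub>R norm (t *\<^sub>R x)) = t powr real n * (norm x powr real n * f (x /\<^sub>R norm x))"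
      using homogeneousD[OF homogeneous_radial_ext[of f], of x t] by (simp add: radial_ext_def powr_mult mult.assoc)
  qed
  have "laplacian ?H x = 0" if x: "x \<noteq> 0" for x
  proof -
    have "laplacian ?H x = laplacian ?K x" by (rule laplacian_cong[of "- {0}"]) (use x HK in auto)
    also have "\<dots> = radial_laplacian (real DIM('a) + 2 * 0) (\<lambda>s. s powr (real n / 2)) (x \<bullet> x) * ?F x + (x \<bullet> x) powr (real n / 2) * laplacian ?F x"
      by (rule laplacian_radial_mult[OF args pos]) (use homogeneous_euler[OF homogeneous_radial_ext F x] x in auto)
    also have "laplacian ?F x = norm x powr (-2) * laplacian ?F (x /\<^sub>R norm x)"
      using homogeneousD[OF homogeneous_laplacian[OF homogeneous_radial_ext F], of "x /\<^sub>R norm x" "norm x"] x by simp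
    also have "laplacian ?F (x /\<^sub>R norm x) = - (real n * (real DIM('a) - 2 + real n) * ?F x)"
      using eig[of "x /\<^sub>R norm x"] x by (simp add: radial_ext_def)
    also have "norm x powr (-2) = (x \<bullet> x) powr (-1)" using norm_eq_inner_powr[OF x, of "-1"] by (metis mult_minus1_right)
    also have "radial_laplacian (real DIM('a) + 2 * 0) (\<lambda>s. s powr (real n / 2)) (x \<bullet> x) * ?F x
        + (x \<bullet> x) powr (real n / 2) * ((x \<bullet> x) powr (-1) * - (real n * (real DIM('a) - 2 + real n) * ?F x)) = 0"
      unfolding radial_laplacian_powr[OF inner_self_pos[OF x]] powr_diff powr_minus using x by (simp add: field_simps)
    finally show ?thesis .
  qed
  with sm hom show ?thesis unfolding solid_harmonic_def by blast
qed

lemma solid_harmonic_in_sphere_eigenspace: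
  fixes H :: "'a::euclidean_space \<Rightarrow> real"
  assumes H: "solid_harmonic n H"
  shows "H \<in> sphere_eigenspace (real n * (real DIM('a) - 2 + real n))"
proof -
  have sm: "smooth_on (- {0}) H" and hom: "homogeneous (real n) H" and lap: "\<And>x. x \<noteq> 0 \<Longrightarrow> laplacian H x = 0"
    using H by (auto simp: solid_harmonic_def)
  let ?K = "\<lambda>x. (x \<bullet> x) powr (- real n / 2) * H x"
  have K: "?K x = radial_ext H x" if "x \<noteq> 0" for x
    using homogeneousD[OF hom, of x "inverse (norm x)"] that
    by (simp add: radial_ext_def norm_eq_inner_powr powr_minus inverse_powr)
  note args = open_greaterThan smooth_on_powr'[of "- real n / 2"] open_minus_0 sm
  have pos: "y \<in> - {0} \<Longrightarrow> y \<bullet> y \<in> {0<..}" for y :: 'a by simp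
  have smK: "smooth_on (- {0}) ?K" by (rule smooth_on_radial_mult(1)[OF args pos])
  then have 1: "smooth_on (- {0}) (radial_ext H)" by (rule smooth_on_cong[rotated 2]) (use K in auto)
  have "- laplace_beltrami H x = real n * (real DIM('a) - 2 + real n) * H x" if "norm x = 1" for x
  proof -
    have x: "x \<noteq> 0" using that by auto
    have s: "x \<bullet> x = 1" using that by (simp add: power2_norm_eq_inner[symmetric])
    have "laplace_beltrami H x = laplacian ?K x" unfolding laplace_beltrami_def
      by (rule laplacian_cong[of "- {0}"]) (use x K in auto)
    also have "\<dots> = radial_laplacian (real DIM('a) + 2 * real n) (\<lambda>s. s powr (- real n / 2)) (x \<bullet> x) * H x + (x \<bullet> x) powr (- real n / 2) * laplacian H x"
      by (rule laplacian_radial_mult[OF args pos]) (use homogeneous_euler[OF hom sm x] x in auto)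
    also have "\<dots> = - (real n * (real DIM('a) - 2 + real n) * H x)"
      unfolding radial_laplacian_powr[OF inner_self_pos[OF x]] unfolding lap[OF x] s by (simp add: algebra_simps)
    finally show ?thesis by simp
  qed
  with 1 show ?thesis unfolding sphere_eigenspace_def by auto
qed


lemma smooth_on_UNIV_imp: "smooth_on UNIV f \<Longrightarrow> open S \<Longrightarrow> smooth_on S f"
  using smooth_on_subset[OF open_UNIV _ subset_UNIV] by blast

lemma compact_annulus_step:
  fixes c :: real assumes "c > 0"
  shows "compact {x::'a::euclidean_space. 1 \<le> c * ((x \<bullet> x) * (1 - x \<bullet> x))}"
    and "{x::'a. 1 \<le> c * ((x \<bullet> x) * (1 - x \<bullet> x))} \<subseteq> ball 0 1 - {0}"
proof -
  let ?K = "{x::'a. 1 \<le> c * ((x \<bullet> x) * (1 - x \<bullet> x))}"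
  show sub: "?K \<subseteq> ball 0 1 - {0}"
  proof
    fix x assume "x \<in> ?K"
    then have "c * ((x \<bullet> x) * (1 - x \<bullet> x)) > 0" by simp
    then have "(x \<bullet> x) * (1 - x \<bullet> x) > 0" using assms by (simp add: zero_less_mult_iff)
    then have "x \<bullet> x > 0" "x \<bullet> x < 1" using inner_ge_zero[of x] by (auto simp: zero_less_mult_iff)
    then have "norm x < 1" "x \<noteq> 0" by (auto simp: norm_lt_square)
    then show "x \<in> ball 0 1 - {0}" by simp
  qed
  have "closed ?K" by (intro closed_Collect_le continuous_intros)
  moreover have "bounded ?K" using sub by (rule bounded_subset[rotated]) (auto intro: bounded_subset[OF bounded_ball])
  ultimately show "compact ?K" by (simp add: compact_eq_bounded_closed)
qed

text \<open>A solid harmonic of degree \<open>0\<close> is a function \<open>F\<close> of \<open>x / \<bar>x\<bar>\<close> with \<open>\<Delta>F = 0\<close>. Integrating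
  \<open>\<rho> F \<Delta>F\<close> by parts with a radial cutoff \<open>\<rho>\<close>, whose gradient is orthogonal to that of \<open>F\<close>,
  yields \<open>\<integral> \<rho> \<bar>\<nabla>F\<bar>\<^sup>2 = 0\<close>.\<close>

lemma solid_harmonic_0_const:
  fixes F :: "'a::euclidean_space \<Rightarrow> real"
  assumes dim: "DIM('a) \<ge> 2" and F: "solid_harmonic 0 F"
  shows "\<exists>c. \<forall>x. x \<noteq> 0 \<longrightarrow> F x = c"
proof -
  have sm: "smooth_on (- {0}) F" and hom: "homogeneous 0 F" and lap: "\<And>x. x \<noteq> 0 \<Longrightarrow> laplacian F x = 0"
    using F by (auto simp: solid_harmonic_def)
  let ?B = "ball 0 1 - {0} :: 'a set"
  have oB: "open ?B" by auto
  have smB: "smooth_on ?B F" by (rule smooth_on_subset[OF open_minus_0 oB _ sm]) auto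
  define d where "d x = 16 * ((x \<bullet> x) * (1 - x \<bullet> x))" for x :: 'a
  have sd: "smooth_on UNIV d" unfolding d_def by (auto intro!: smooth)
  have comp: "compact {x. 1 \<le> d x}" and dB: "{x. 1 \<le> d x} \<subseteq> ?B"
    unfolding d_def by (rule compact_annulus_step; simp)+
  define \<rho> where "\<rho> x = smooth_step (d x)" for x
  define \<phi> where "\<phi> x = F x * \<rho> x" for x
  have \<phi>: "\<phi> \<in> test_functions ?B"
    unfolding \<phi>_def \<rho>_def by (rule test_functions_step[OF oB smB sd comp dB])
  have s\<rho>: "smooth_on UNIV \<rho>"
    unfolding \<rho>_def by (rule smooth_on_compose[OF _ open_UNIV _ smooth_on_smooth_step sd]) auto
  have grad\<rho>: "\<exists>c. grad \<rho> x = c *\<^sub>R x" for x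
  proof -
    have "d = (\<lambda>x. (\<lambda>s. 16 * (s * (1 - s))) (x \<bullet> x) * 1)" by (auto simp: d_def)
    then have "grad d x = (2 * deriv (\<lambda>s. 16 * (s * (1 - s))) (x \<bullet> x) * 1) *\<^sub>R x + (16 * ((x \<bullet> x) * (1 - x \<bullet> x))) *\<^sub>R grad (\<lambda>_. 1) x"
      by (simp only:) (rule grad_radial_mult[of UNIV _ UNIV], auto intro!: smooth)
    moreover have "grad (\<lambda>_::'a. 1) x = 0" by (rule grad_unique) simp
    moreover have "grad \<rho> x = deriv smooth_step (d x) *\<^sub>R grad d x"
      unfolding \<rho>_def by (rule grad_chain[OF smooth_step_has_derivative]) (rule smooth_on_differentiable[OF open_UNIV sd UNIV_I])
    ultimately show ?thesis by auto
  qed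
  have eq: "(\<Sum>b\<in>Basis. \<phi> x * partial_deriv b (partial_deriv b F) x + partial_deriv b F x * partial_deriv b \<phi> x)
      = \<rho> x * (norm (grad F x))\<^sup>2" for x
  proof (cases "x \<in> ?B")
    case True
    then have x: "x \<noteq> 0" by auto
    have "grad \<phi> x = \<rho> x *\<^sub>R grad F x + F x *\<^sub>R grad \<rho> x"
      unfolding \<phi>_def by (intro grad_mult smooth_on_differentiable[OF open_minus_0 sm] smooth_on_differentiable[OF open_UNIV s\<rho>]) (use x in auto)
    moreover obtain c where "grad \<rho> x = c *\<^sub>R x" using grad\<rho> by blast
    ultimately have "grad F x \<bullet> grad \<phi> x = \<rho> x * (norm (grad F x))\<^sup>2"
      using homogeneous_euler[OF hom sm x] by (simp add: inner_add_right power2_norm_eq_inner)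
    moreover have "(\<Sum>b\<in>Basis. partial_deriv b F x * partial_deriv b \<phi> x) = grad F x \<bullet> grad \<phi> x"
      by (subst euclidean_inner) (simp add: grad_inner_Basis)
    ultimately show ?thesis using lap[OF x]
      by (simp add: sum.distrib sum_distrib_left[symmetric] laplacian_def[symmetric])
  next
    case False
    then have "\<not> 1 \<le> d x" using dB by blast
    then have "\<rho> x = 0" by (simp add: \<rho>_def smooth_step_0)
    moreover have "\<phi> x = 0" using \<open>\<rho> x = 0\<close> by (simp add: \<phi>_def)
    moreover have "partial_deriv b \<phi> x = 0" for b
      using test_functionsD(3)[OF \<phi>] test_functionsD(6)[OF \<phi>, of x b] False by blast
    ultimately show ?thesis by simp
  qed
  have int: "integrable lebesgue (\<lambda>x. \<rho> x * (norm (grad F x))\<^sup>2)" "(\<integral>x. \<rho> x * (norm (grad F x))\<^sup>2 \<partial>lebesgue) = 0"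
  proof -
    note ibp = integral_by_parts[OF \<phi> oB smooth_on_partial_deriv[OF smB]]
    show "integrable lebesgue (\<lambda>x. \<rho> x * (norm (grad F x))\<^sup>2)"
      unfolding eq[symmetric] by (intro Bochner_Integration.integrable_sum ibp(1))
    show "(\<integral>x. \<rho> x * (norm (grad F x))\<^sup>2 \<partial>lebesgue) = 0"
      unfolding eq[symmetric] by (subst Bochner_Integration.integral_sum) (auto intro: ibp(1) simp: ibp(2))
  qed
  have AE: "AE x in lebesgue. \<rho> x * (norm (grad F x))\<^sup>2 = 0"
    using int by (subst (asm) integral_nonneg_eq_0_iff_AE) (auto simp: \<rho>_def smooth_step_nonneg)
  have g0: "grad F x = 0" if x: "x \<noteq> 0" for x
  proof -
    \<comment> \<open>On the sphere of radius \<open>sqrt (1/2)\<close> the cutoff is positive: there \<open>d = 4\<close>.\<close>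
    let ?y = "(sqrt (1/2) / norm x) *\<^sub>R x"
    define Z where "Z = {y \<in> ?B. \<rho> y * (norm (grad F y))\<^sup>2 \<noteq> 0}"
    have "continuous_on ?B (\<lambda>y. \<rho> y * (norm (grad F y))\<^sup>2)"
      by (intro continuous_intros continuous_on_subset[OF smooth_on_continuous[OF s\<rho>]] smooth_on_continuous_grad[OF smB]) auto
    then have "open (?B \<inter> (\<lambda>y. \<rho> y * (norm (grad F y))\<^sup>2) -` (- {0}))"
      by (intro continuous_open_preimage oB) auto
    also have "?B \<inter> (\<lambda>y. \<rho> y * (norm (grad F y))\<^sup>2) -` (- {0}) = Z" by (auto simp: Z_def)
    finally have "open Z" .
    have AEZ: "AE y\<in>UNIV in lebesgue. y \<in> - Z"
      using AE by (auto elim!: eventually_mono simp: Z_def)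
    have "?y \<in> - Z" by (rule mem_closed_if_AE_lebesgue_open[OF open_UNIV _ AEZ]) (use \<open>open Z\<close> in auto)
    moreover have ny: "norm ?y = sqrt (1/2)" using x by simp
    then have yy: "?y \<bullet> ?y = 1/2" by (metis power2_norm_eq_inner real_sqrt_pow2 zero_le_divide_1_iff zero_le_numeral)
    have "?y \<in> ?B" using ny x by (auto simp: real_sqrt_divide)
    moreover have "\<rho> ?y > 0" unfolding \<rho>_def by (rule smooth_step_pos) (simp add: d_def yy del: inner_scaleR_left inner_scaleR_right)
    ultimately have "grad F ?y = 0" by (auto simp: Z_def)
    then show ?thesis using homogeneous_grad[OF hom sm x, of "sqrt (1/2) / norm x"] x by simp
  qed
  have dF: "(F has_derivative (\<lambda>h. 0)) (at x)" if "x \<in> - {0}" for x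
    using smooth_on_has_derivative_grad[OF open_minus_0 sm that] g0[of x] that by simp
  have "F x = F y" if "x \<noteq> 0" "y \<noteq> 0" for x y
    by (rule has_derivative_zero_unique_connected[OF open_minus_0 path_connected_imp_connected[OF path_connected_punctured_universe] dF])
      (use dim that in auto)
  then show ?thesis by metis
qed


section \<open>Homogeneous polynomials\<close>

inductive homogeneous_poly :: "nat \<Rightarrow> ('a::euclidean_space \<Rightarrow> real) \<Rightarrow> bool" where
  const: "homogeneous_poly 0 (\<lambda>x. c)"
| times_coordinate: "b \<in> Basis \<Longrightarrow> homogeneous_poly d p \<Longrightarrow> homogeneous_poly (Suc d) (\<lambda>x. (x \<bullet> b) * p x)"
| add: "homogeneous_poly d p \<Longrightarrow> homogeneous_poly d q \<Longrightarrow> homogeneous_poly d (\<lambda>x. p x + q x)"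

lemma homogeneous_poly_zero: "homogeneous_poly d (\<lambda>x::'a::euclidean_space. 0)"
proof (induction d)
  case (Suc d)
  obtain b :: 'a where "b \<in> Basis" using nonempty_Basis by blast
  from homogeneous_poly.times_coordinate[OF this Suc] show ?case by simp
qed (rule homogeneous_poly.const)

lemma homogeneous_poly_scale: "homogeneous_poly d p \<Longrightarrow> homogeneous_poly d (\<lambda>x. c * p x)"
proof (induction rule: homogeneous_poly.induct)
  case (times_coordinate b d p)
  from homogeneous_poly.times_coordinate[OF this(1) this(3)] show ?case by (simp add: mult.left_commute)
next
  case (add d p q)
  from homogeneous_poly.add[OF add.IH] show ?case by (simp add: distrib_left)
qed (rule homogeneous_poly.const)

lemma homogeneous_poly_diff:
  "homogeneous_poly d p \<Longrightarrow> homogeneous_poly d q \<Longrightarrow> homogeneous_poly d (\<lambda>x. p x - q x)"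
  using homogeneous_poly.add[of d p "\<lambda>x. - 1 * q x"] homogeneous_poly_scale[of d q "- 1"] by simp

lemma homogeneous_poly_sum:
  assumes "\<And>i. i \<in> I \<Longrightarrow> homogeneous_poly d (p i)" shows "homogeneous_poly d (\<lambda>x. \<Sum>i\<in>I. p i x)"
  using assms by (induction I rule: infinite_finite_induct) (auto intro: homogeneous_poly_zero homogeneous_poly.add)

lemma homogeneous_poly_mult:
  "homogeneous_poly d p \<Longrightarrow> homogeneous_poly e q \<Longrightarrow> homogeneous_poly (d + e) (\<lambda>x. p x * q x)"
proof (induction rule: homogeneous_poly.induct)
  case (const c)
  then show ?case by (simp add: homogeneous_poly_scale)
next
  case (times_coordinate b d p)
  from homogeneous_poly.times_coordinate[OF this(1) this(3)[OF this(4)]] show ?case by (simp add: mult.assoc)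
next
  case (add d p p')
  from homogeneous_poly.add[OF add.IH(1)[OF add.prems] add.IH(2)[OF add.prems]] show ?case by (simp add: distrib_right)
qed

lemma homogeneous_poly_norm_sq: "homogeneous_poly 2 (\<lambda>x. x \<bullet> x)"
proof -
  have "homogeneous_poly 2 (\<lambda>x::'a. \<Sum>b\<in>Basis. (x \<bullet> b) * (x \<bullet> b))"
  proof (rule homogeneous_poly_sum)
    fix b :: 'a assume b: "b \<in> Basis"
    have "homogeneous_poly (Suc (Suc 0)) (\<lambda>x. (x \<bullet> b) * ((x \<bullet> b) * 1))"
      by (intro homogeneous_poly.intros b)
    then show "homogeneous_poly 2 (\<lambda>x. (x \<bullet> b) * (x \<bullet> b))" by (simp add: numeral_2_eq_2)
  qed
  then show ?thesis by (simp add: euclidean_inner[symmetric])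
qed

lemma smooth_on_homogeneous_poly: "homogeneous_poly d p \<Longrightarrow> smooth_on UNIV p"
  by (induction rule: homogeneous_poly.induct) (auto intro!: smooth)

lemma homogeneous_poly_scaleR: "homogeneous_poly d p \<Longrightarrow> p (t *\<^sub>R x) = t ^ d * p x"
  by (induction rule: homogeneous_poly.induct) (auto simp: algebra_simps)

lemma homogeneous_poly_homogeneous: "homogeneous_poly d p \<Longrightarrow> homogeneous (real d) p"
  unfolding homogeneous_def using homogeneous_poly_scaleR[of d p] by (auto simp: powr_realpow)

lemma homogeneous_poly_partial_deriv_aux:
  assumes "homogeneous_poly d p" and b: "b \<in> Basis"
  shows "(d = 0 \<longrightarrow> partial_deriv b p = (\<lambda>x. 0)) \<and> (\<forall>e. d = Suc e \<longrightarrow> homogeneous_poly e (partial_deriv b p))"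
  using assms(1)
proof (induction rule: homogeneous_poly.induct)
  case (const c)
  then show ?case by (auto simp: partial_deriv_const)
next
  case (times_coordinate c d p)
  have "partial_deriv b (\<lambda>x. (x \<bullet> c) * p x) x = (b \<bullet> c) * p x + (x \<bullet> c) * partial_deriv b p x" for x
    using partial_deriv_mult[of "\<lambda>x. x \<bullet> c" x p b]
      smooth_on_differentiable[OF open_UNIV smooth_on_homogeneous_poly[OF times_coordinate(2)]]
    by (simp add: partial_deriv_inner)
  then have eq: "partial_deriv b (\<lambda>x. (x \<bullet> c) * p x) = (\<lambda>x. (b \<bullet> c) * p x + (x \<bullet> c) * partial_deriv b p x)" by (rule ext)
  have "homogeneous_poly d (\<lambda>x. (x \<bullet> c) * partial_deriv b p x)"
  proof (cases d)
    case 0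
    then show ?thesis using times_coordinate(3) homogeneous_poly_zero[of 0] by simp
  next
    case (Suc e)
    then show ?thesis using times_coordinate(3) homogeneous_poly.times_coordinate[OF times_coordinate(1)] by simp
  qed
  then have "homogeneous_poly d (partial_deriv b (\<lambda>x. (x \<bullet> c) * p x))"
    unfolding eq by (intro homogeneous_poly.add homogeneous_poly_scale times_coordinate(2))
  then show ?case by simp
next
  case (add d p q)
  have "partial_deriv b (\<lambda>x. p x + q x) x = partial_deriv b p x + partial_deriv b q x" for x
    using partial_deriv_add[of p x q b] smooth_on_differentiable[OF open_UNIV smooth_on_homogeneous_poly[OF add(1)]]
      smooth_on_differentiable[OF open_UNIV smooth_on_homogeneous_poly[OF add(2)]] by simp
  then have eq: "partial_deriv b (\<lambda>x. p x + q x) = (\<lambda>x. partial_deriv b p x + partial_deriv b q x)" by (rule ext)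
  show ?case unfolding eq using add.IH by (auto intro: homogeneous_poly.add)
qed

lemma homogeneous_poly_laplacian_low:
  assumes p: "homogeneous_poly d p" and d: "d < 2" shows "laplacian p x = 0"
proof -
  have "partial_deriv b (partial_deriv b p) x = 0" if b: "b \<in> Basis" for b
  proof (cases d)
    case 0
    then show ?thesis using homogeneous_poly_partial_deriv_aux[OF p b] by (simp add: partial_deriv_const)
  next
    case (Suc e)
    then have "e = 0" using d by simp
    have "homogeneous_poly e (partial_deriv b p)" using homogeneous_poly_partial_deriv_aux[OF p b] Suc by blast
    from homogeneous_poly_partial_deriv_aux[OF this b] show ?thesis using \<open>e = 0\<close> by simp
  qed
  then show ?thesis by (simp add: laplacian_def)
qed

lemma homogeneous_poly_laplacian:
  assumes p: "homogeneous_poly (Suc (Suc d)) p" shows "homogeneous_poly d (laplacian p)"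
proof -
  have "homogeneous_poly d (partial_deriv b (partial_deriv b p))" if b: "b \<in> Basis" for b
    using homogeneous_poly_partial_deriv_aux[OF _ b] p by blast
  then show ?thesis unfolding laplacian_def[abs_def] by (intro homogeneous_poly_sum)
qed

lemma homogeneous_poly_euler:
  assumes p: "homogeneous_poly d p" shows "grad p x \<bullet> x = real d * p x"
proof (cases "x = 0")
  case False
  then show ?thesis
    using homogeneous_euler[OF homogeneous_poly_homogeneous[OF p] smooth_on_UNIV_imp[OF smooth_on_homogeneous_poly[OF p]]] by simp
next
  case True
  then show ?thesis using homogeneous_poly_scaleR[OF p, of 0 x] by (cases d) auto
qed

lemma laplacian_norm_sq_mult:
  fixes p :: "'a::euclidean_space \<Rightarrow> real"
  assumes p: "homogeneous_poly d p"
  shows "laplacian (\<lambda>x. (x \<bullet> x) * p x) x = 2 * (real DIM('a) + 2 * real d) * p x + (x \<bullet> x) * laplacian p x"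
proof -
  have "laplacian (\<lambda>x. (\<lambda>s. s) (x \<bullet> x) * p x) x
    = radial_laplacian (real DIM('a) + 2 * real d) (\<lambda>s. s) (x \<bullet> x) * p x + (x \<bullet> x) * laplacian p x"
    by (rule laplacian_radial_mult[of UNIV "\<lambda>s. s" UNIV])
      (auto intro!: smooth smooth_on_homogeneous_poly[OF p] homogeneous_poly_euler[OF p])
  moreover have "deriv (\<lambda>s::real. s) = (\<lambda>s. 1)" by (auto simp: fun_eq_iff intro!: DERIV_imp_deriv)
  ultimately show ?thesis by (simp add: radial_laplacian_def)
qed

text \<open>The operator \<open>c + \<bar>x\<bar>\<^sup>2 \<Delta>\<close> is onto the homogeneous polynomials of degree \<open>e\<close>, by induction on \<open>e\<close>: the
  ansatz \<open>q' = q / c - \<bar>x\<bar>\<^sup>2 r\<close> leads to the same equation for \<open>r\<close> in degree \<open>e - 2\<close>, with a larger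
  constant.\<close>

lemma solve_shifted_laplacian:
  fixes q :: "'a::euclidean_space \<Rightarrow> real"
  assumes "homogeneous_poly e q" "c > 0"
  shows "\<exists>q'. homogeneous_poly e q' \<and> (\<forall>x. c * q' x + (x \<bullet> x) * laplacian q' x = q x)"
  using assms
proof (induction e arbitrary: c q rule: less_induct)
  case (less e)
  have sq: "smooth_on UNIV q" by (rule smooth_on_homogeneous_poly[OF less.prems(1)])
  have qc: "homogeneous_poly e (\<lambda>x. (1/c) * q x)" by (rule homogeneous_poly_scale[OF less.prems(1)])
  have lqc: "laplacian (\<lambda>x. (1/c) * q x) x = (1/c) * laplacian q x" for x
    by (rule laplacian_scale[OF open_UNIV UNIV_I sq])
  show ?case
  proof (cases "e < 2")
    case True
    then show ?thesis
      using qc homogeneous_poly_laplacian_low[OF qc] \<open>c > 0\<close> by (intro exI[of _ "\<lambda>x. (1/c) * q x"]) auto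
  next
    case False
    then obtain d where d: "e = Suc (Suc d)" by (metis less_2_cases_iff not0_implies_Suc One_nat_def)
    define c' where "c' = c + 2 * (real DIM('a) + 2 * real d)"
    have "c' > 0" using less.prems(2) by (simp add: c'_def add_pos_nonneg)
    moreover have "homogeneous_poly d (\<lambda>x. (1/c) * laplacian q x)"
      by (rule homogeneous_poly_scale[OF homogeneous_poly_laplacian]) (use less.prems d in simp)
    ultimately obtain r where r: "homogeneous_poly d r"
      and eq: "\<And>x. c' * r x + (x \<bullet> x) * laplacian r x = (1/c) * laplacian q x"
      using less.IH[of d "\<lambda>x. (1/c) * laplacian q x" c'] d by auto
    have xr: "homogeneous_poly e (\<lambda>x. - 1 * ((x \<bullet> x) * r x))"
      using homogeneous_poly_scale[OF homogeneous_poly_mult[OF homogeneous_poly_norm_sq r], of "- 1"] d by simp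
    define q' where "q' = (\<lambda>x. (1/c) * q x + - 1 * ((x \<bullet> x) * r x))"
    have "homogeneous_poly e q'" unfolding q'_def by (rule homogeneous_poly.add[OF qc xr])
    moreover have "c * q' x + (x \<bullet> x) * laplacian q' x = q x" for x
    proof -
      have "laplacian q' x = laplacian (\<lambda>x. (1/c) * q x) x + laplacian (\<lambda>x. - 1 * ((x \<bullet> x) * r x)) x"
        unfolding q'_def by (rule laplacian_add[OF open_UNIV UNIV_I]) (intro smooth_on_homogeneous_poly[OF qc] smooth_on_homogeneous_poly[OF xr])+
      also have "laplacian (\<lambda>x. - 1 * ((x \<bullet> x) * r x)) x = - 1 * laplacian (\<lambda>x. (x \<bullet> x) * r x) x"
        by (rule laplacian_scale[OF open_UNIV UNIV_I])
          (rule smooth_on_homogeneous_poly[OF homogeneous_poly_mult[OF homogeneous_poly_norm_sq r]])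
      also have "laplacian (\<lambda>x. (x \<bullet> x) * r x) x = 2 * (real DIM('a) + 2 * real d) * r x + (x \<bullet> x) * laplacian r x"
        by (rule laplacian_norm_sq_mult[OF r])
      also have "laplacian (\<lambda>x. (1/c) * q x) x = c' * r x + (x \<bullet> x) * laplacian r x"
        unfolding lqc eq[symmetric] ..
      finally have "laplacian q' x = c * r x" by (simp add: c'_def algebra_simps)
      then show ?thesis using \<open>c > 0\<close> by (simp add: q'_def algebra_simps)
    qed
    ultimately show ?thesis by blast
  qed
qed

text \<open>One has to find \<open>q\<close> with \<open>\<Delta>(\<bar>x\<bar>\<^sup>2 q) = \<Delta>p\<close>. In degree \<open>d\<close> the operator \<open>q \<mapsto> \<Delta>(\<bar>x\<bar>\<^sup>2 q)\<close> is
  \<open>c + \<bar>x\<bar>\<^sup>2 \<Delta>\<close> with \<open>c = 2 (N + 2 d)\<close>.\<close>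

lemma homogeneous_poly_harmonic_split:
  fixes p :: "'a::euclidean_space \<Rightarrow> real"
  assumes p: "homogeneous_poly (Suc (Suc d)) p"
  shows "\<exists>h q. homogeneous_poly (Suc (Suc d)) h \<and> (\<forall>x. laplacian h x = 0) \<and> homogeneous_poly d q \<and> (\<forall>x. p x = h x + (x \<bullet> x) * q x)"
proof -
  have "2 * (real DIM('a) + 2 * real d) > 0" using DIM_positive[where 'a='a] by (simp add: add_pos_nonneg)
  then obtain q where q: "homogeneous_poly d q"
    and eq: "\<And>x. 2 * (real DIM('a) + 2 * real d) * q x + (x \<bullet> x) * laplacian q x = laplacian p x"
    using solve_shifted_laplacian[OF homogeneous_poly_laplacian[OF p]] by blast
  have xq: "homogeneous_poly (Suc (Suc d)) (\<lambda>x. - 1 * ((x \<bullet> x) * q x))"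
    using homogeneous_poly_scale[OF homogeneous_poly_mult[OF homogeneous_poly_norm_sq q], of "- 1"] by simp
  define h where "h = (\<lambda>x. p x + - 1 * ((x \<bullet> x) * q x))"
  have "laplacian h x = 0" for x
  proof -
    have "laplacian h x = laplacian p x + laplacian (\<lambda>x. - 1 * ((x \<bullet> x) * q x)) x"
      unfolding h_def by (rule laplacian_add[OF open_UNIV UNIV_I]) (intro smooth_on_homogeneous_poly[OF p] smooth_on_homogeneous_poly[OF xq])+
    also have "laplacian (\<lambda>x. - 1 * ((x \<bullet> x) * q x)) x = - 1 * laplacian (\<lambda>x. (x \<bullet> x) * q x) x"
      by (rule laplacian_scale[OF open_UNIV UNIV_I])
        (rule smooth_on_homogeneous_poly[OF homogeneous_poly_mult[OF homogeneous_poly_norm_sq q]])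
    also have "laplacian (\<lambda>x. (x \<bullet> x) * q x) x = laplacian p x"
      unfolding laplacian_norm_sq_mult[OF q] eq ..
    finally show ?thesis by simp
  qed
  moreover have "homogeneous_poly (Suc (Suc d)) h" unfolding h_def by (rule homogeneous_poly.add[OF p xq])
  ultimately show ?thesis using q by (intro exI[of _ h] exI[of _ q]) (auto simp: h_def)
qed

inductive polynomial_span :: "('a::euclidean_space \<Rightarrow> real) \<Rightarrow> bool" where
  homogeneous: "homogeneous_poly d p \<Longrightarrow> polynomial_span p"
| sum: "polynomial_span p \<Longrightarrow> polynomial_span q \<Longrightarrow> polynomial_span (\<lambda>x. p x + q x)"

lemma polynomial_span_mult:
  assumes "polynomial_span p" "polynomial_span q" shows "polynomial_span (\<lambda>x. p x * q x)"
  using assms(1)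
proof induction
  case (homogeneous d p)
  show ?case using assms(2)
  proof induction
    case (homogeneous e q)
    show ?case
      by (rule polynomial_span.homogeneous[OF homogeneous_poly_mult[OF \<open>homogeneous_poly d p\<close> homogeneous]])
  next
    case (sum q r)
    then show ?case using polynomial_span.sum[OF sum.IH] by (simp add: distrib_left)
  qed
next
  case (sum p r)
  then show ?case using polynomial_span.sum[OF sum.IH] by (simp add: distrib_right)
qed

lemma homogeneous_poly_coordinate: "b \<in> Basis \<Longrightarrow> homogeneous_poly 1 (\<lambda>x. x \<bullet> b)"
  using homogeneous_poly.times_coordinate[OF _ homogeneous_poly.const, of b 1] by simp

lemma real_polynomial_function_span:
  fixes p :: "'a::euclidean_space \<Rightarrow> real"
  assumes "real_polynomial_function p" shows "polynomial_span p"
  using assms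
proof induction
  case (linear f)
  interpret bounded_linear f by fact
  have "f x = (\<Sum>b\<in>Basis. f b * (x \<bullet> b))" for x
  proof -
    have "f x = f (\<Sum>b\<in>Basis. (x \<bullet> b) *\<^sub>R b)" by (simp add: euclidean_representation)
    then show ?thesis by (simp add: sum scaleR mult.commute)
  qed
  then have "f = (\<lambda>x. \<Sum>b\<in>Basis. f b * (x \<bullet> b))" by (rule ext)
  moreover have "homogeneous_poly 1 (\<lambda>x. \<Sum>b\<in>Basis. f b * (x \<bullet> b))"
    by (intro homogeneous_poly_sum homogeneous_poly_scale homogeneous_poly_coordinate)
  ultimately show ?case by (metis polynomial_span.homogeneous)
next
  case (const c)
  show ?case by (rule polynomial_span.homogeneous[OF homogeneous_poly.const])
next
  case (add f g)
  then show ?case by (intro polynomial_span.sum)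
next
  case (mult f g)
  then show ?case by (intro polynomial_span_mult)
qed

text \<open>Iterating the splitting \<open>p = h + \<bar>x\<bar>\<^sup>2 q\<close> shows that the polynomials are the sums of products
  \<open>\<bar>x\<bar>\<^sup>2\<^sup>k H\<close> with homogeneous harmonic polynomials \<open>H\<close>.\<close>

lemma polynomial_harmonic_induct [consumes 1, case_names harmonic add]:
  fixes p :: "'a::euclidean_space \<Rightarrow> real"
  assumes p: "real_polynomial_function p"
    and harm: "\<And>n k H. homogeneous_poly n H \<Longrightarrow> (\<And>x. laplacian H x = 0) \<Longrightarrow> P (\<lambda>x. (x \<bullet> x) ^ k * H x)"
    and add: "\<And>q r. P q \<Longrightarrow> P r \<Longrightarrow> P (\<lambda>x. q x + r x)"
  shows "P p"
proof -
  have hom: "P (\<lambda>x. (x \<bullet> x) ^ k * q x)" if "homogeneous_poly d q" for d k q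
    using that
  proof (induction d arbitrary: k q rule: less_induct)
    case (less d)
    show ?case
    proof (cases "d < 2")
      case True
      then show ?thesis using harm[OF less.prems] homogeneous_poly_laplacian_low[OF less.prems] by blast
    next
      case False
      then obtain e where e: "d = Suc (Suc e)" by (metis less_2_cases_iff not0_implies_Suc One_nat_def)
      obtain h r where h: "homogeneous_poly d h" "\<And>x. laplacian h x = 0" and r: "homogeneous_poly e r"
        and eq: "\<And>x. q x = h x + (x \<bullet> x) * r x"
        using homogeneous_poly_harmonic_split less.prems unfolding e by blast
      have "P (\<lambda>x. (x \<bullet> x) ^ k * h x + (x \<bullet> x) ^ Suc k * r x)"
        by (intro add harm[OF h] less.IH[OF _ r]) (simp add: e)
      then show ?thesis by (simp add: eq algebra_simps)
    qed
  qed
  from real_polynomial_function_span[OF p] show ?thesis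
  proof induction
    case (homogeneous d p)
    then show ?case using hom[of d p 0] by simp
  next
    case (sum p q)
    then show ?case by (intro add)
  qed
qed

lemma harmonic_poly_solid_harmonic:
  assumes "homogeneous_poly n H" "\<And>x. laplacian H x = 0" shows "solid_harmonic n H"
  unfolding solid_harmonic_def
  using assms(2) homogeneous_poly_homogeneous[OF assms(1)] smooth_on_UNIV_imp[OF smooth_on_homogeneous_poly[OF assms(1)], of "- {0}"]
  by simp

text \<open>Real and imaginary part of \<open>(x\<^sub>b + i x\<^sub>c)\<^sup>n\<close>.\<close>

primrec planar_power :: "'a::euclidean_space \<Rightarrow> 'a \<Rightarrow> nat \<Rightarrow> ('a \<Rightarrow> real) \<times> ('a \<Rightarrow> real)" where
  "planar_power b c 0 = (\<lambda>x. 1, \<lambda>x. 0)"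
| "planar_power b c (Suc n) = (\<lambda>x. (x \<bullet> b) * fst (planar_power b c n) x - (x \<bullet> c) * snd (planar_power b c n) x,
     \<lambda>x. (x \<bullet> b) * snd (planar_power b c n) x + (x \<bullet> c) * fst (planar_power b c n) x)"

lemma homogeneous_poly_planar_power:
  assumes "b \<in> Basis" "c \<in> Basis"
  shows "homogeneous_poly n (fst (planar_power b c n)) \<and> homogeneous_poly n (snd (planar_power b c n))"
proof (induction n)
  case (Suc n)
  then show ?case using assms
    by (auto intro!: homogeneous_poly_diff homogeneous_poly.add homogeneous_poly.times_coordinate)
qed (auto intro: homogeneous_poly.const)

lemma planar_power_at_basis:
  assumes "b \<in> Basis" "c \<in> Basis" "b \<noteq> c"
  shows "fst (planar_power b c n) b = 1 \<and> snd (planar_power b c n) b = 0"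
  using assms by (induction n) (auto simp: inner_Basis)

lemma partial_deriv_planar_power:
  assumes bc: "b \<in> Basis" "c \<in> Basis"
  shows "partial_deriv e (fst (planar_power b c (Suc n))) x
      = real (Suc n) * ((e \<bullet> b) * fst (planar_power b c n) x - (e \<bullet> c) * snd (planar_power b c n) x)
    \<and> partial_deriv e (snd (planar_power b c (Suc n))) x
      = real (Suc n) * ((e \<bullet> b) * snd (planar_power b c n) x + (e \<bullet> c) * fst (planar_power b c n) x)"
proof (induction n)
  case 0
  then show ?case by (simp add: partial_deriv_inner)
next
  case (Suc n)
  let ?p = "fst (planar_power b c (Suc n))" and ?q = "snd (planar_power b c (Suc n))"
  have d: "?p differentiable (at x)" "?q differentiable (at x)" "\<And>v. (\<lambda>x. x \<bullet> v) differentiable (at x)"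
    using smooth_on_differentiable[OF open_UNIV smooth_on_homogeneous_poly] homogeneous_poly_planar_power[OF bc, of "Suc n"] by auto
  have m: "partial_deriv e (\<lambda>x. (x \<bullet> v) * f x) x = (e \<bullet> v) * f x + (x \<bullet> v) * partial_deriv e f x"
    if "f differentiable (at x)" for v and f :: "'a \<Rightarrow> real"
    using partial_deriv_mult[OF d(3) that, of e v] by (simp add: partial_deriv_inner)
  have "partial_deriv e (fst (planar_power b c (Suc (Suc n)))) x
      = partial_deriv e (\<lambda>x. (x \<bullet> b) * ?p x + (x \<bullet> (- c)) * ?q x) x"
    by (simp add: planar_power.simps(2)[of b c "Suc n"] del: planar_power.simps)
  also have "\<dots> = ((e \<bullet> b) * ?p x + (x \<bullet> b) * partial_deriv e ?p x) + ((e \<bullet> (- c)) * ?q x + (x \<bullet> (- c)) * partial_deriv e ?q x)"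
    unfolding m[OF d(1), symmetric] m[OF d(2), symmetric] by (intro partial_deriv_add differentiable_mult d)
  finally have 1: "partial_deriv e (fst (planar_power b c (Suc (Suc n)))) x
     = (e \<bullet> b) * ?p x - (e \<bullet> c) * ?q x + (x \<bullet> b) * partial_deriv e ?p x - (x \<bullet> c) * partial_deriv e ?q x" by simp
  have "partial_deriv e (snd (planar_power b c (Suc (Suc n)))) x
      = partial_deriv e (\<lambda>x. (x \<bullet> b) * ?q x + (x \<bullet> c) * ?p x) x"
    by (simp add: planar_power.simps(2)[of b c "Suc n"] del: planar_power.simps)
  also have "\<dots> = ((e \<bullet> b) * ?q x + (x \<bullet> b) * partial_deriv e ?q x) + ((e \<bullet> c) * ?p x + (x \<bullet> c) * partial_deriv e ?p x)"
    unfolding m[OF d(1), symmetric] m[OF d(2), symmetric] by (intro partial_deriv_add differentiable_mult d)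
  finally have 2: "partial_deriv e (snd (planar_power b c (Suc (Suc n)))) x
     = (e \<bullet> b) * ?q x + (e \<bullet> c) * ?p x + (x \<bullet> b) * partial_deriv e ?q x + (x \<bullet> c) * partial_deriv e ?p x" by simp
  have S: "?p x = (x \<bullet> b) * fst (planar_power b c n) x - (x \<bullet> c) * snd (planar_power b c n) x"
    "?q x = (x \<bullet> b) * snd (planar_power b c n) x + (x \<bullet> c) * fst (planar_power b c n) x" by simp_all
  show ?case
    unfolding 1 2 conjunct1[OF Suc.IH] conjunct2[OF Suc.IH] of_nat_Suc S by (simp add: algebra_simps)
qed

text \<open>The real part of the \<open>n\<close>-th power of a complex coordinate in a coordinate plane.\<close>

lemma exists_nonzero_harmonic:
  assumes dim: "DIM('a::euclidean_space) \<ge> 2"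
  shows "\<exists>H :: 'a \<Rightarrow> real. homogeneous_poly n H \<and> (\<forall>x. laplacian H x = 0) \<and> (\<exists>x. norm x = 1 \<and> H x \<noteq> 0)"
proof -
  obtain b c :: 'a where bc: "b \<in> Basis" "c \<in> Basis" "b \<noteq> c"
  proof -
    obtain b :: 'a where b: "b \<in> Basis" using nonempty_Basis by blast
    have "Basis \<noteq> {b}"
    proof
      assume "Basis = {b}"
      then have "card (Basis :: 'a set) = card {b}" by (rule arg_cong)
      with dim show False by simp
    qed
    then show ?thesis using that b by blast
  qed
  let ?H = "fst (planar_power b c n)"
  have hp: "homogeneous_poly n ?H" using homogeneous_poly_planar_power[OF bc(1,2)] by blast
  have "laplacian ?H x = 0" for x
  proof (cases "n < 2")
    case True
    then show ?thesis by (rule homogeneous_poly_laplacian_low[OF hp])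
  next
    case False
    then obtain k where k: "n = Suc (Suc k)" by (metis less_2_cases_iff not0_implies_Suc One_nat_def)
    let ?p = "fst (planar_power b c (Suc k))" and ?q = "snd (planar_power b c (Suc k))"
    let ?r = "fst (planar_power b c k)" and ?s = "snd (planar_power b c k)"
    have d: "?p differentiable (at x)" "?q differentiable (at x)"
      using smooth_on_differentiable[OF open_UNIV smooth_on_homogeneous_poly _] homogeneous_poly_planar_power[OF bc(1,2), of "Suc k"]
      by blast+
    have sc: "partial_deriv e (\<lambda>x. r * f x) x = r * partial_deriv e f x" if "f differentiable (at x)" for r e and f :: "'a \<Rightarrow> real"
      using partial_deriv_mult[OF differentiable_const[of r] that, of e] by (simp add: partial_deriv_const)
    have "partial_deriv e (partial_deriv e ?H) x
       = real n * real (Suc k) * (((e \<bullet> b)\<^sup>2 - (e \<bullet> c)\<^sup>2) * ?r x - 2 * ((e \<bullet> b) * (e \<bullet> c)) * ?s x)" for e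
    proof -
      have "partial_deriv e ?H = (\<lambda>x. (real n * (e \<bullet> b)) * ?p x + (- real n * (e \<bullet> c)) * ?q x)"
        unfolding k using partial_deriv_planar_power[OF bc(1,2), of e "Suc k"]
        by (intro ext) (simp add: algebra_simps del: planar_power.simps)
      then have "partial_deriv e (partial_deriv e ?H) x = partial_deriv e (\<lambda>x. (real n * (e \<bullet> b)) * ?p x + (- real n * (e \<bullet> c)) * ?q x) x" by simp
      also have "\<dots> = (real n * (e \<bullet> b)) * partial_deriv e ?p x + (- real n * (e \<bullet> c)) * partial_deriv e ?q x"
        unfolding sc[OF d(1), symmetric] sc[OF d(2), symmetric]
        by (intro partial_deriv_add differentiable_mult differentiable_const d)
      also have "\<dots> = real n * real (Suc k) * (((e \<bullet> b)\<^sup>2 - (e \<bullet> c)\<^sup>2) * ?r x - 2 * ((e \<bullet> b) * (e \<bullet> c)) * ?s x)"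
        unfolding conjunct1[OF partial_deriv_planar_power[OF bc(1,2), of e k]] conjunct2[OF partial_deriv_planar_power[OF bc(1,2), of e k]]
        by (simp add: power2_eq_square algebra_simps)
      finally show ?thesis .
    qed
    then have "laplacian ?H x = (\<Sum>e\<in>Basis. real n * real (Suc k) * (((e \<bullet> b)\<^sup>2 - (e \<bullet> c)\<^sup>2) * ?r x - 2 * ((e \<bullet> b) * (e \<bullet> c)) * ?s x))"
      by (simp add: laplacian_def)
    also have "\<dots> = real n * real (Suc k) * (((\<Sum>e\<in>Basis. (e \<bullet> b)\<^sup>2) - (\<Sum>e\<in>Basis. (e \<bullet> c)\<^sup>2)) * ?r x - 2 * (\<Sum>e\<in>Basis. (e \<bullet> b) * (e \<bullet> c)) * ?s x)"
      by (simp add: sum_distrib_left sum_distrib_right sum_subtractf left_diff_distrib right_diff_distrib mult.assoc)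
    finally have L: "laplacian ?H x = \<dots>" .
    have S: "(\<Sum>e\<in>Basis. (e \<bullet> b)\<^sup>2) = b \<bullet> b" "(\<Sum>e\<in>Basis. (e \<bullet> c)\<^sup>2) = c \<bullet> c" "(\<Sum>e\<in>Basis. (e \<bullet> b) * (e \<bullet> c)) = b \<bullet> c"
      by (simp_all add: euclidean_inner[of b b] euclidean_inner[of c c] euclidean_inner[of b c] power2_eq_square inner_commute)
    show ?thesis unfolding L S using bc by (simp add: inner_Basis)
  qed
  moreover have "norm b = 1" "?H b \<noteq> 0" using bc planar_power_at_basis[OF bc, of n] by auto
  ultimately show ?thesis using hp by blast
qed

section \<open>Radial profiles times solid harmonics as test functions\<close>

lemma homogeneous_bound:
  fixes f :: "'a::euclidean_space \<Rightarrow> 'b::real_normed_vector"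
  assumes c: "continuous_on (- {0}) f"
    and hom: "\<And>x t. x \<noteq> 0 \<Longrightarrow> t > 0 \<Longrightarrow> norm (f (t *\<^sub>R x)) = t powr \<kappa> * norm (f x)"
  shows "\<exists>K>0. \<forall>x. x \<noteq> 0 \<longrightarrow> norm (f x) \<le> K * norm x powr \<kappa>"
proof -
  have "continuous_on (sphere 0 1) f" by (rule continuous_on_subset[OF c]) auto
  then obtain K where K: "K > 0" "\<And>x. x \<in> sphere 0 1 \<Longrightarrow> norm (f x) \<le> K"
    by (rule continuous_on_compact_bounded[OF compact_sphere]) blast
  have "norm (f x) \<le> K * norm x powr \<kappa>" if "x \<noteq> 0" for x
  proof -
    have "norm (f (norm x *\<^sub>R (x /\<^sub>R norm x))) = norm x powr \<kappa> * norm (f (x /\<^sub>R norm x))"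
      using that by (intro hom) auto
    then have "norm (f x) = norm x powr \<kappa> * norm (f (x /\<^sub>R norm x))" using that by simp
    also have "\<dots> \<le> norm x powr \<kappa> * K" using that by (intro mult_left_mono K) auto
    finally show ?thesis by (simp add: mult.commute)
  qed
  with K(1) show ?thesis by blast
qed

lemma solid_harmonic_bounds:
  fixes H :: "'a::euclidean_space \<Rightarrow> real"
  assumes dim: "DIM('a) \<ge> 2" and H: "solid_harmonic n H"
  obtains K where "K > 0" "\<And>x. x \<noteq> 0 \<Longrightarrow> norm x \<le> 1 \<Longrightarrow> \<bar>H x\<bar> \<le> K * norm x ^ n"
    "\<And>x. x \<noteq> 0 \<Longrightarrow> norm x \<le> 1 \<Longrightarrow> norm (grad H x) \<le> K"
proof -
  have sm: "smooth_on (- {0}) H" and hom: "homogeneous (real n) H" using H by (auto simp: solid_harmonic_def)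
  obtain K1 where K1: "K1 > 0" "\<And>x. x \<noteq> 0 \<Longrightarrow> norm (H x) \<le> K1 * norm x powr real n"
    using homogeneous_bound[OF smooth_on_continuous[OF sm], of "real n"] homogeneousD[OF hom] by (auto simp: abs_mult)
  obtain K2 where K2: "K2 > 0" "\<And>x. x \<noteq> 0 \<Longrightarrow> norm (grad H x) \<le> K2 * norm x powr (real n - 1)"
    using homogeneous_bound[OF smooth_on_continuous_grad[OF sm], of "real n - 1"] homogeneous_grad[OF hom sm] by auto
  have "\<bar>H x\<bar> \<le> max K1 K2 * norm x ^ n" if "x \<noteq> 0" for x
    using K1(2)[OF that] that by (auto simp: powr_realpow intro: order_trans mult_right_mono)
  moreover have "norm (grad H x) \<le> max K1 K2" if x: "x \<noteq> 0" "norm x \<le> 1" for x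
  proof (cases n)
    case 0
    then obtain c where c: "\<And>y. y \<noteq> 0 \<Longrightarrow> H y = c" using solid_harmonic_0_const[OF dim] H by blast
    have "grad H x = grad (\<lambda>_. c) x" by (rule grad_cong[of "- {0}"]) (use x c in auto)
    also have "\<dots> = 0" by (rule grad_unique) simp
    finally show ?thesis using K1 by simp
  next
    case (Suc k)
    have "norm x powr (real n - 1) \<le> 1" using x Suc by (intro powr_le1) auto
    then have "K2 * norm x powr (real n - 1) \<le> K2 * 1" using K2(1) by (intro mult_left_mono) auto
    with K2(2)[OF x(1)] show ?thesis by simp
  qed
  ultimately show ?thesis using that[of "max K1 K2"] K1(1) by (simp add: less_max_iff_disj)
qed

lemma test_functions_mono: "\<phi> \<in> test_functions S \<Longrightarrow> S \<subseteq> T \<Longrightarrow> \<phi> \<in> test_functions T"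
  by (auto simp: test_functions_def)

lemma eventually_step_large:
  fixes c :: real assumes "c > 0" shows "\<forall>\<^sub>F k in sequentially. real (Suc k) * c > 2"
proof -
  obtain m where m: "real m * c > 2" using reals_Archimedean3[OF assms] by blast
  have "real (Suc k) * c > 2" if "k \<ge> m" for k
  proof -
    have "real m * c \<le> real (Suc k) * c" using that assms by (intro mult_right_mono) auto
    with m show ?thesis by linarith
  qed
  then show ?thesis unfolding eventually_sequentially by blast
qed

lemma bounded_by_distance_to_zero:
  assumes G: "smooth_on {0<..} G" and C: "\<And>s. s \<in> {0<..4} \<Longrightarrow> \<bar>deriv G s\<bar> \<le> C" and G1: "G 1 = 0" and s: "s \<in> {0<..4}"
  shows "\<bar>G s\<bar> \<le> C * \<bar>1 - s\<bar>"
proof -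
  have "norm (G s - G 1) \<le> C * norm (s - 1)"
    by (rule field_differentiable_bound[of "{0<..4}" G "deriv G" C])
      (use s C smooth_on_deriv(1)[OF G] in \<open>auto intro: has_field_derivative_at_within\<close>)
  then show ?thesis using G1 by (simp add: abs_minus_commute)
qed

text \<open>If the degree is positive, the product vanishes on the sphere and at the origin, and it can be cut
  off near both, by a function of \<open>\<bar>x\<bar>\<^sup>2 (1 - \<bar>x\<bar>\<^sup>2)\<close>.\<close>

lemma radial_harmonic_in_H10_pos:
  fixes H :: "'a::euclidean_space \<Rightarrow> real"
  assumes dim: "DIM('a) \<ge> 2" and H: "solid_harmonic n H" and n: "n \<ge> 1"
    and G: "smooth_on {0<..} G" and G1: "G 1 = 0"
    and C: "\<And>s. s \<in> {0<..4} \<Longrightarrow> \<bar>G s\<bar> \<le> C \<and> \<bar>deriv G s\<bar> \<le> C"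
    and gb: "\<And>x. x \<in> ball 0 1 - {0} \<Longrightarrow> norm (grad (\<lambda>x. G (x \<bullet> x) * H x) x) \<le> D"
  shows "\<exists>\<phi> E. (\<forall>k::nat. \<phi> k \<in> test_functions (ball 0 1)) \<and>
    (\<forall>k. \<forall>x\<in>ball 0 1 - {0}. \<bar>\<phi> k x\<bar> \<le> E \<and> norm (grad (\<phi> k) x) \<le> E) \<and>
    (\<forall>x\<in>ball 0 1 - {0}. (\<lambda>k. \<phi> k x) \<longlonglongrightarrow> G (x \<bullet> x) * H x \<and>
       (\<lambda>k. grad (\<phi> k) x) \<longlonglongrightarrow> grad (\<lambda>x. G (x \<bullet> x) * H x) x)"
proof -
  let ?B = "ball 0 1 - {0} :: 'a set"
  have oB: "open ?B" by auto
  let ?v = "\<lambda>x. G (x \<bullet> x) * H x"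
  have smH: "smooth_on ?B H" using H smooth_on_subset[OF open_minus_0 oB] by (auto simp: solid_harmonic_def)
  have sv: "smooth_on ?B ?v" by (rule smooth_on_radial_mult(1)[OF open_greaterThan G oB smH]) auto
  obtain K where K: "K > 0" "\<And>x. x \<noteq> 0 \<Longrightarrow> norm x \<le> 1 \<Longrightarrow> \<bar>H x\<bar> \<le> K * norm x ^ n"
    using solid_harmonic_bounds[OF dim H] by metis
  obtain T where T: "T > 0" "\<And>s. \<bar>deriv smooth_step s\<bar> \<le> T" using deriv_smooth_step_bounded by blast
  define c where "c k = real (Suc k)" for k
  have c: "c k > 0" for k by (simp add: c_def)
  define d where "d k x = c k * ((x \<bullet> x) * (1 - x \<bullet> x))" for k and x :: 'a
  have sd: "smooth_on UNIV (d k)" for k unfolding d_def by (auto intro!: smooth)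
  have gd: "grad (d k) x = (c k * (2 * (1 - 2 * (x \<bullet> x)))) *\<^sub>R x" for k x
    unfolding d_def by (rule grad_unique) (auto intro!: derivative_eq_intros simp: inner_commute algebra_simps)
  define \<phi> where "\<phi> k x = ?v x * smooth_step (d k x)" for k x
  have \<phi>: "\<phi> k \<in> test_functions (ball 0 1)" for k
  proof (rule test_functions_mono)
    show "\<phi> k \<in> test_functions ?B" unfolding \<phi>_def
      by (rule test_functions_step[OF oB sv sd]) (unfold d_def, (rule compact_annulus_step, rule c)+)
  qed auto
  have g\<phi>: "grad (\<phi> k) x = smooth_step (d k x) *\<^sub>R grad ?v x + (?v x * deriv smooth_step (d k x)) *\<^sub>R grad (d k) x"
    if x: "x \<in> ?B" for k x
  proof -
    have d: "d k differentiable (at x)" by (rule smooth_on_differentiable[OF open_UNIV sd UNIV_I])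
    have "grad (\<lambda>x. smooth_step (d k x)) x = deriv smooth_step (d k x) *\<^sub>R grad (d k) x"
      by (rule grad_chain[OF smooth_step_has_derivative d])
    moreover have "(\<lambda>x. smooth_step (d k x)) differentiable (at x)"
      by (rule smooth_on_differentiable[OF open_UNIV smooth_on_compose[OF open_UNIV open_UNIV _ smooth_on_smooth_step sd]]) auto
    ultimately show ?thesis
      unfolding \<phi>_def using grad_mult[OF smooth_on_differentiable[OF oB sv x], of "\<lambda>x. smooth_step (d k x)"] by simp
  qed
  have s: "x \<bullet> x \<in> {0<..4}" "x \<bullet> x < 1" "norm x < 1" "x \<noteq> 0" if "x \<in> ?B" for x
  proof -
    show "norm x < 1" "x \<noteq> 0" using that by auto
    then show "x \<bullet> x < 1" by (simp add: norm_lt_square)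
    then show "x \<bullet> x \<in> {0<..4}" using \<open>x \<noteq> 0\<close> by simp
  qed
  have C0: "C \<ge> 0" using C[of 1] abs_ge_zero[of "G 1"] by auto
  \<comment> \<open>The gradient of \<open>d\<close> is of size \<open>c \<bar>x\<bar>\<close>, so this bound makes its product with \<open>v\<close> a multiple of \<open>d\<close>, which is at
    most \<open>2\<close> where the step is not constant.\<close>
  have v1: "\<bar>?v x\<bar> \<le> C * K * ((1 - x \<bullet> x) * norm x)" if x: "x \<in> ?B" for x
  proof -
    have "norm x ^ n \<le> norm x ^ 1" using n s(3)[OF x] by (intro power_decreasing) auto
    then have "K * norm x ^ n \<le> K * norm x" using K(1) by simp
    moreover have "\<bar>H x\<bar> \<le> K * norm x ^ n" using K(2) s[OF x] by auto
    ultimately have "\<bar>H x\<bar> \<le> K * norm x" by linarith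
    moreover have "\<bar>G (x \<bullet> x)\<bar> \<le> C * (1 - x \<bullet> x)"
      using bounded_by_distance_to_zero[OF G _ G1 s(1)[OF x], of C] C s(2)[OF x] by auto
    ultimately have "\<bar>G (x \<bullet> x)\<bar> * \<bar>H x\<bar> \<le> (C * (1 - x \<bullet> x)) * (K * norm x)"
      using C0 s(2)[OF x] by (intro mult_mono) auto
    then show ?thesis by (simp add: abs_mult mult_ac)
  qed
  have v2: "\<bar>?v x\<bar> \<le> C * K" if x: "x \<in> ?B" for x
  proof -
    have "(1 - x \<bullet> x) * norm x \<le> 1 * 1" using s[OF x] by (intro mult_mono) auto
    then have "C * K * ((1 - x \<bullet> x) * norm x) \<le> C * K * 1" using C0 K(1) by (intro mult_left_mono) auto
    with v1[OF x] show ?thesis by simp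
  qed
  have b1: "\<bar>\<phi> k x\<bar> \<le> C * K" if x: "x \<in> ?B" for k x
  proof -
    have "\<bar>\<phi> k x\<bar> \<le> \<bar>?v x\<bar>" unfolding \<phi>_def abs_mult[of "?v x"]
      using smooth_step_nonneg[of "d k x"] smooth_step_le_1[of "d k x"] by (intro mult_left_le) auto
    with v2[OF x] show ?thesis by simp
  qed
  have b2: "norm (grad (\<phi> k) x) \<le> D + T * (4 * (C * K))" if x: "x \<in> ?B" for k x
  proof -
    have "norm (smooth_step (d k x) *\<^sub>R grad ?v x) \<le> 1 * D"
      unfolding norm_scaleR using smooth_step_nonneg[of "d k x"] smooth_step_le_1[of "d k x"] gb[OF x] by (intro mult_mono) auto
    moreover have "norm ((?v x * deriv smooth_step (d k x)) *\<^sub>R grad (d k) x) \<le> T * (4 * (C * K))"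
    proof (cases "d k x \<le> 2")
      case False
      then show ?thesis using T(1) C0 K(1) by (simp add: deriv_smooth_step_eq_0)
    next
      case True
      have "norm (grad (d k) x) = c k * (2 * \<bar>1 - 2 * (x \<bullet> x)\<bar>) * norm x"
        unfolding gd norm_scaleR abs_mult using c[of k] by simp
      also have "\<dots> \<le> c k * (2 * 1) * norm x"
        using s[OF x] c[of k] inner_ge_zero[of x] by (intro mult_right_mono mult_left_mono) (auto simp: abs_le_iff)
      finally have g: "norm (grad (d k) x) \<le> 2 * c k * norm x" by simp
      have "\<bar>?v x\<bar> * norm (grad (d k) x) \<le> (C * K * ((1 - x \<bullet> x) * norm x)) * (2 * c k * norm x)"
        using v1[OF x] g C0 K(1) s[OF x] by (intro mult_mono) auto
      also have "\<dots> = 2 * (C * K) * d k x"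
        by (simp add: d_def power2_norm_eq_inner[symmetric] power2_eq_square)
      also have "\<dots> \<le> 2 * (C * K) * 2" using True C0 K(1) by (intro mult_left_mono) auto
      finally have le: "\<bar>?v x\<bar> * norm (grad (d k) x) \<le> 4 * (C * K)" by simp
      have "\<bar>deriv smooth_step (d k x)\<bar> * (\<bar>?v x\<bar> * norm (grad (d k) x)) \<le> T * (4 * (C * K))"
        by (rule mult_mono[OF T(2) le]) (use T(1) in auto)
      then show ?thesis by (simp add: abs_mult mult_ac)
    qed
    ultimately show ?thesis unfolding g\<phi>[OF x] using norm_triangle_mono by fastforce
  qed
  have large: "\<forall>\<^sub>F k in sequentially. d k x > 2" if x: "x \<in> ?B" for x
    unfolding d_def c_def by (rule eventually_step_large) (use s[OF x] in auto)
  have l1: "(\<lambda>k. \<phi> k x) \<longlonglongrightarrow> ?v x" if x: "x \<in> ?B" for x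
    by (rule tendsto_eventually) (use large[OF x] in \<open>eventually_elim; simp add: \<phi>_def smooth_step_1\<close>)
  have l2: "(\<lambda>k. grad (\<phi> k) x) \<longlonglongrightarrow> grad ?v x" if x: "x \<in> ?B" for x
    by (rule tendsto_eventually) (use large[OF x] in \<open>eventually_elim; simp add: g\<phi>[OF x] smooth_step_1 deriv_smooth_step_eq_0\<close>)
  show ?thesis
    by (intro exI[of _ \<phi>] exI[of _ "max (C * K) (D + T * (4 * (C * K)))"] conjI allI ballI \<phi> l1 l2)
      (use b1 b2 in \<open>auto simp: le_max_iff_disj\<close>)
qed

text \<open>In degree \<open>0\<close> the product need not vanish at the origin, so that a cutoff there would have unbounded
  gradients. Instead, the argument \<open>\<bar>x\<bar>\<^sup>2\<close> of the profile is shifted by \<open>1 / c\<close>, which makes it smooth at the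
  origin. The shift also moves the zero of the profile off the sphere, but only by \<open>1 / c\<close>, the width of
  the layer in which the cutoff varies.\<close>

lemma radial_in_H10:
  assumes G: "smooth_on {0<..} G" and G1: "G 1 = 0"
    and C: "\<And>s. s \<in> {0<..4} \<Longrightarrow> \<bar>G s\<bar> \<le> C \<and> \<bar>deriv G s\<bar> \<le> C"
  shows "\<exists>\<phi> E. (\<forall>k::nat. \<phi> k \<in> test_functions (ball (0::'a::euclidean_space) 1)) \<and>
    (\<forall>k. \<forall>x\<in>ball 0 1 - {0}. \<bar>\<phi> k x\<bar> \<le> E \<and> norm (grad (\<phi> k) x) \<le> E) \<and>
    (\<forall>x\<in>ball 0 1 - {0}. (\<lambda>k. \<phi> k x) \<longlonglongrightarrow> G (x \<bullet> x) \<and>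
       (\<lambda>k. grad (\<phi> k) x) \<longlonglongrightarrow> (2 * deriv G (x \<bullet> x)) *\<^sub>R x)"
proof -
  let ?B = "ball 0 1 - {0} :: 'a set"
  obtain T where T: "T > 0" "\<And>s. \<bar>deriv smooth_step s\<bar> \<le> T" using deriv_smooth_step_bounded by blast
  define c where "c k = real (Suc k)" for k
  have c: "c k > 0" "c k \<ge> 1" for k by (auto simp: c_def)
  define w where "w k x = G (x \<bullet> x + 1 / c k)" for k and x :: 'a
  define d where "d k x = c k * (1 - x \<bullet> x)" for k and x :: 'a
  have pos: "x \<bullet> x + 1 / c k > 0" for x :: 'a and k using c(1)[of k] by (simp add: add_nonneg_pos)
  have sa: "smooth_on UNIV (\<lambda>x::'a. x \<bullet> x + 1 / c k)" for k by (auto intro!: smooth)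
  have sw: "smooth_on UNIV (w k)" for k
    unfolding w_def by (rule smooth_on_compose[OF open_UNIV open_greaterThan _ G sa]) (use pos in auto)
  have sd: "smooth_on UNIV (d k)" for k unfolding d_def by (auto intro!: smooth)
  have gd: "grad (d k) x = (c k * (- 2)) *\<^sub>R x" for k x
    unfolding d_def by (rule grad_unique) (auto intro!: derivative_eq_intros simp: inner_commute algebra_simps)
  have gw: "grad (w k) x = (2 * deriv G (x \<bullet> x + 1 / c k)) *\<^sub>R x" for k x
  proof -
    have "grad (\<lambda>x::'a. x \<bullet> x + 1 / c k) x = 2 *\<^sub>R x"
      by (rule grad_unique) (auto intro!: derivative_eq_intros simp: inner_commute)
    then show ?thesis unfolding w_def
      using grad_chain[of G _ "\<lambda>x. x \<bullet> x + 1 / c k" x, OF smooth_on_deriv(1)[OF G pos] smooth_on_differentiable[OF open_UNIV sa UNIV_I]]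
      by (simp add: mult.commute)
  qed
  define \<phi> where "\<phi> k x = w k x * smooth_step (d k x)" for k x
  have \<phi>: "\<phi> k \<in> test_functions (ball 0 1)" for k
    unfolding \<phi>_def
    by (rule test_functions_step[OF open_ball smooth_on_subset[OF open_UNIV open_ball _ sw] sd])
      (unfold d_def, (rule subset_UNIV compact_ball_step c)+)
  have g\<phi>: "grad (\<phi> k) x = smooth_step (d k x) *\<^sub>R grad (w k) x + (w k x * deriv smooth_step (d k x)) *\<^sub>R grad (d k) x" for k x
  proof -
    have d: "d k differentiable (at x)" by (rule smooth_on_differentiable[OF open_UNIV sd UNIV_I])
    have "grad (\<lambda>x. smooth_step (d k x)) x = deriv smooth_step (d k x) *\<^sub>R grad (d k) x"
      by (rule grad_chain[OF smooth_step_has_derivative d])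
    moreover have "(\<lambda>x. smooth_step (d k x)) differentiable (at x)"
      by (rule smooth_on_differentiable[OF open_UNIV smooth_on_compose[OF open_UNIV open_UNIV _ smooth_on_smooth_step sd]]) auto
    ultimately show ?thesis
      unfolding \<phi>_def using grad_mult[OF smooth_on_differentiable[OF open_UNIV sw UNIV_I], of "\<lambda>x. smooth_step (d k x)" x k] by simp
  qed
  have s: "x \<bullet> x > 0" "x \<bullet> x < 1" "norm x < 1" "x \<bullet> x + 1 / c k \<in> {0<..4}" if "x \<in> ?B" for x k
  proof -
    show "norm x < 1" "x \<bullet> x > 0" using that by auto
    then show "x \<bullet> x < 1" by (simp add: norm_lt_square)
    moreover have "1 / c k \<le> 1" using c[of k] by simp
    ultimately show "x \<bullet> x + 1 / c k \<in> {0<..4}" using pos[of x k] by simp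
  qed
  have C0: "C \<ge> 0" using C[of 1] abs_ge_zero[of "G 1"] by auto
  have b1: "\<bar>\<phi> k x\<bar> \<le> C" if x: "x \<in> ?B" for k x
  proof -
    have "\<bar>\<phi> k x\<bar> \<le> \<bar>w k x\<bar>" unfolding \<phi>_def abs_mult[of "w k x"]
      using smooth_step_nonneg[of "d k x"] smooth_step_le_1[of "d k x"] by (intro mult_left_le) auto
    with C[OF s(4)[OF x, of k]] show ?thesis by (simp add: w_def)
  qed
  have b2: "norm (grad (\<phi> k) x) \<le> 2 * C + T * (6 * C)" if x: "x \<in> ?B" for k x
  proof -
    have "norm (grad (w k) x) \<le> 2 * C * 1"
      unfolding gw norm_scaleR using C[OF s(4)[OF x, of k]] s(3)[OF x] C0 by (intro mult_mono) auto
    then have "norm (smooth_step (d k x) *\<^sub>R grad (w k) x) \<le> 1 * (2 * C)"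
      unfolding norm_scaleR using smooth_step_nonneg[of "d k x"] smooth_step_le_1[of "d k x"] by (intro mult_mono) auto
    moreover have "norm ((w k x * deriv smooth_step (d k x)) *\<^sub>R grad (d k) x) \<le> T * (6 * C)"
    proof (cases "d k x \<le> 2")
      case False
      then show ?thesis using T(1) C0 by (simp add: deriv_smooth_step_eq_0)
    next
      case True
      have "norm (grad (d k) x) \<le> 2 * c k * 1"
        unfolding gd norm_scaleR using s(3)[OF x] c[of k] by (intro mult_mono) auto
      moreover have "\<bar>w k x\<bar> \<le> C * (3 / c k)"
      proof -
        have "\<bar>w k x\<bar> \<le> C * \<bar>1 - (x \<bullet> x + 1 / c k)\<bar>"
          unfolding w_def by (rule bounded_by_distance_to_zero[OF G _ G1 s(4)[OF x]]) (use C in blast)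
        also have "\<bar>1 - (x \<bullet> x + 1 / c k)\<bar> \<le> 3 / c k"
        proof -
          have "1 - x \<bullet> x \<le> 2 / c k" using True c[of k] by (simp add: d_def field_simps)
          moreover have "1 / c k > 0" using c[of k] by simp
          moreover have "3 / c k = 2 / c k + 1 / c k" by (simp add: add_divide_distrib[symmetric])
          ultimately show ?thesis using s(2)[OF x] by linarith
        qed
        finally show ?thesis using C0 by (simp add: mult_left_mono)
      qed
      ultimately have "\<bar>w k x\<bar> * norm (grad (d k) x) \<le> (C * (3 / c k)) * (2 * c k * 1)"
        using C0 c[of k] by (intro mult_mono) auto
      also have "\<dots> = 6 * C" using c[of k] by simp
      finally have le: "\<bar>w k x\<bar> * norm (grad (d k) x) \<le> 6 * C" .
      have "\<bar>deriv smooth_step (d k x)\<bar> * (\<bar>w k x\<bar> * norm (grad (d k) x)) \<le> T * (6 * C)"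
        by (rule mult_mono[OF T(2) le]) (use T(1) in auto)
      then show ?thesis by (simp add: abs_mult mult_ac)
    qed
    ultimately show ?thesis unfolding g\<phi> using norm_triangle_mono by fastforce
  qed
  have large: "\<forall>\<^sub>F k in sequentially. d k x > 2" if x: "x \<in> ?B" for x
    unfolding d_def c_def by (rule eventually_step_large) (use s[OF x] in auto)
  have arg: "(\<lambda>k. x \<bullet> x + 1 / c k) \<longlonglongrightarrow> x \<bullet> x" for x :: 'a
    using tendsto_add[OF tendsto_const LIMSEQ_inverse_real_of_nat, of "x \<bullet> x"] by (simp add: c_def inverse_eq_divide)
  have wl: "(\<lambda>k. w k x) \<longlonglongrightarrow> G (x \<bullet> x)" "(\<lambda>k. grad (w k) x) \<longlonglongrightarrow> (2 * deriv G (x \<bullet> x)) *\<^sub>R x" if x: "x \<in> ?B" for x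
    unfolding w_def gw
    by (intro tendsto_intros isCont_tendsto_compose[OF DERIV_isCont[OF smooth_on_deriv(1)[OF G s(1)[OF x]]] arg]
        isCont_tendsto_compose[OF DERIV_isCont[OF smooth_on_deriv(1)[OF smooth_on_deriv(2)[OF G] s(1)[OF x]]] arg])+
  have l1: "(\<lambda>k. \<phi> k x) \<longlonglongrightarrow> G (x \<bullet> x)" if x: "x \<in> ?B" for x
    by (rule Lim_transform_eventually[OF wl(1)[OF x]])
      (use large[OF x] in \<open>eventually_elim; simp add: \<phi>_def smooth_step_1\<close>)
  have l2: "(\<lambda>k. grad (\<phi> k) x) \<longlonglongrightarrow> (2 * deriv G (x \<bullet> x)) *\<^sub>R x" if x: "x \<in> ?B" for x
    by (rule Lim_transform_eventually[OF wl(2)[OF x]])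
      (use large[OF x] in \<open>eventually_elim; simp add: g\<phi> smooth_step_1 deriv_smooth_step_eq_0\<close>)
  show ?thesis
    by (intro exI[of _ \<phi>] exI[of _ "max C (2 * C + T * (6 * C))"] conjI allI ballI \<phi> l1 l2)
      (use b1 b2 in \<open>auto simp: le_max_iff_disj\<close>)
qed

text \<open>The profile may be singular at \<open>s = 0\<close>, and \<open>H\<close> at the origin. The bounds on the gradient and on the
  Laplacian of the product are what Green's formula and the approximation in \<open>H\<^sup>1\<^sub>0\<close> rest on. Eigenfunctions and test
  functions alike are of this form.\<close>

lemma radial_harmonic_dirichlet_function:
  fixes H :: "'a::euclidean_space \<Rightarrow> real"
  assumes dim: "DIM('a) \<ge> 2" and H: "solid_harmonic n H"
    and prof: "radial_profile (real DIM('a) + 2 * real n) G" and G1: "G 1 = 0"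
  defines "v \<equiv> \<lambda>x. G (x \<bullet> x) * H x"
  shows "dirichlet_function v (grad v) (\<lambda>x. - radial_laplacian (real DIM('a) + 2 * real n) G (x \<bullet> x) * H x)"
proof -
  let ?B = "ball 0 1 - {0} :: 'a set"
  let ?M = "unit_ball_measure :: 'a measure"
  let ?L = "radial_laplacian (real DIM('a) + 2 * real n) G"
  have oB: "open ?B" by auto
  have G: "smooth_on {0<..} G" using prof by (simp add: radial_profile_def)
  obtain C where C: "\<And>s. s \<in> {0<..4} \<Longrightarrow> \<bar>G s\<bar> \<le> C \<and> \<bar>deriv G s\<bar> \<le> C \<and> \<bar>?L s\<bar> \<le> C"
    using prof unfolding radial_profile_def by blast
  have C0: "C \<ge> 0" using C[of 1] abs_ge_zero[of "G 1"] by auto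
  have sm: "smooth_on (- {0}) H" and hom: "homogeneous (real n) H" and lap: "\<And>x. x \<noteq> 0 \<Longrightarrow> laplacian H x = 0"
    using H by (auto simp: solid_harmonic_def)
  have smH: "smooth_on ?B H" by (rule smooth_on_subset[OF open_minus_0 oB _ sm]) auto
  have sq: "y \<in> ?B \<Longrightarrow> y \<bullet> y \<in> {0<..}" for y by auto
  have sv: "smooth_on ?B v" unfolding v_def by (rule smooth_on_radial_mult(1)[OF open_greaterThan G oB smH sq])
  obtain K where K: "K > 0" "\<And>x. x \<noteq> 0 \<Longrightarrow> norm x \<le> 1 \<Longrightarrow> \<bar>H x\<bar> \<le> K * norm x ^ n"
    "\<And>x. x \<noteq> 0 \<Longrightarrow> norm x \<le> 1 \<Longrightarrow> norm (grad H x) \<le> K"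
    using solid_harmonic_bounds[OF dim H] by metis
  have s: "x \<bullet> x \<in> {0<..4}" "norm x \<le> 1" "x \<noteq> 0" "\<bar>H x\<bar> \<le> K" if "x \<in> ?B" for x
  proof -
    show x: "norm x \<le> 1" "x \<noteq> 0" using that by auto
    have "x \<bullet> x < 1" using that by (simp add: norm_lt_square)
    then show "x \<bullet> x \<in> {0<..4}" using x by simp
    have "K * norm x ^ n \<le> K * 1" using x K(1) by (intro mult_left_mono power_le_one) auto
    then show "\<bar>H x\<bar> \<le> K" using K(2)[OF x(2,1)] by simp
  qed
  have gv: "grad v x = (2 * deriv G (x \<bullet> x) * H x) *\<^sub>R x + G (x \<bullet> x) *\<^sub>R grad H x" if "x \<in> ?B" for x
    unfolding v_def by (rule grad_radial_mult[OF open_greaterThan G oB smH sq that])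
  have gb: "norm (grad v x) \<le> 2 * C * K * 1 + C * K" if x: "x \<in> ?B" for x
  proof -
    have "norm ((2 * deriv G (x \<bullet> x) * H x) *\<^sub>R x) \<le> 2 * C * K * 1"
      unfolding norm_scaleR abs_mult using C[OF s(1)[OF x]] s[OF x] C0 K(1) by (intro mult_mono) auto
    moreover have "norm (G (x \<bullet> x) *\<^sub>R grad H x) \<le> C * K"
      unfolding norm_scaleR using C[OF s(1)[OF x]] s[OF x] C0 K(1) K(3)[OF s(3)[OF x] s(2)[OF x]] by (intro mult_mono) auto
    ultimately show ?thesis unfolding gv[OF x] by (rule norm_triangle_mono)
  qed
  have lv: "laplacian v x = ?L (x \<bullet> x) * H x" if x: "x \<in> ?B" for x
  proof -
    have "laplacian v x = ?L (x \<bullet> x) * H x + G (x \<bullet> x) * laplacian H x" unfolding v_def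
      by (rule laplacian_radial_mult[OF open_greaterThan G oB smH sq x homogeneous_euler[OF hom sm s(3)[OF x]]])
    then show ?thesis using lap[OF s(3)[OF x]] by simp
  qed
  have lb: "\<bar>?L (x \<bullet> x) * H x\<bar> \<le> C * K" if x: "x \<in> ?B" for x
    unfolding abs_mult using C[OF s(1)[OF x]] s(4)[OF x] C0 by (intro mult_mono) auto
  obtain \<phi> E where \<phi>: "\<And>k::nat. \<phi> k \<in> test_functions (ball 0 1)"
    and bd: "\<And>k x. x \<in> ?B \<Longrightarrow> \<bar>\<phi> k x\<bar> \<le> E" "\<And>k x. x \<in> ?B \<Longrightarrow> norm (grad (\<phi> k) x) \<le> E"
    and lim: "\<And>x. x \<in> ?B \<Longrightarrow> (\<lambda>k. \<phi> k x) \<longlonglongrightarrow> v x" "\<And>x. x \<in> ?B \<Longrightarrow> (\<lambda>k. grad (\<phi> k) x) \<longlonglongrightarrow> grad v x"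
  proof (cases "n \<ge> 1")
    case True
    have CC: "\<And>s. s \<in> {0<..4} \<Longrightarrow> \<bar>G s\<bar> \<le> C \<and> \<bar>deriv G s\<bar> \<le> C" using C by blast
    obtain \<phi> E where *: "\<forall>k::nat. \<phi> k \<in> test_functions (ball 0 1)"
      "\<forall>k. \<forall>x\<in>?B. \<bar>\<phi> k x\<bar> \<le> E \<and> norm (grad (\<phi> k) x) \<le> E"
      "\<forall>x\<in>?B. (\<lambda>k. \<phi> k x) \<longlonglongrightarrow> v x \<and> (\<lambda>k. grad (\<phi> k) x) \<longlonglongrightarrow> grad v x"
      using radial_harmonic_in_H10_pos[OF dim H True G G1 CC gb[unfolded v_def]] unfolding v_def by blast
    show thesis by (rule that[of \<phi> E]) (use * in blast)+
  next
    case False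
    then have "n = 0" by simp
    then obtain c where c: "\<And>y. y \<noteq> 0 \<Longrightarrow> H y = c" using solid_harmonic_0_const[OF dim, of H] H by auto
    have CC: "\<And>s. s \<in> {0<..4} \<Longrightarrow> \<bar>G s\<bar> \<le> C \<and> \<bar>deriv G s\<bar> \<le> C" using C by blast
    obtain \<phi> E where \<phi>: "\<And>k::nat. \<phi> k \<in> test_functions (ball (0::'a) 1)"
      and bd: "\<And>k x. x \<in> ?B \<Longrightarrow> \<bar>\<phi> k x\<bar> \<le> E" "\<And>k x. x \<in> ?B \<Longrightarrow> norm (grad (\<phi> k) x) \<le> E"
      and lim: "\<And>x. x \<in> ?B \<Longrightarrow> (\<lambda>k. \<phi> k x) \<longlonglongrightarrow> G (x \<bullet> x)"
        "\<And>x. x \<in> ?B \<Longrightarrow> (\<lambda>k. grad (\<phi> k) x) \<longlonglongrightarrow> (2 * deriv G (x \<bullet> x)) *\<^sub>R x"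
    proof -
      obtain \<phi> E where *: "\<forall>k::nat. \<phi> k \<in> test_functions (ball (0::'a) 1)"
        "\<forall>k. \<forall>x\<in>?B. \<bar>\<phi> k x\<bar> \<le> E \<and> norm (grad (\<phi> k) x) \<le> E"
        "\<forall>x\<in>?B. (\<lambda>k. \<phi> k x) \<longlonglongrightarrow> G (x \<bullet> x) \<and> (\<lambda>k. grad (\<phi> k) x) \<longlonglongrightarrow> (2 * deriv G (x \<bullet> x)) *\<^sub>R x"
        using radial_in_H10[OF G G1 CC, where 'a = 'a] by blast
      show thesis by (rule that[of \<phi> E]) (use * in blast)+
    qed
    have gs: "grad (\<lambda>x. c * \<phi> k x) x = c *\<^sub>R grad (\<phi> k) x" for k x
      by (intro grad_scale smooth_on_differentiable[OF open_UNIV] test_functionsD(1)[OF \<phi>]) auto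
    have gH: "grad H x = 0" if x: "x \<noteq> 0" for x
    proof -
      have "grad H x = grad (\<lambda>_. c) x" by (rule grad_cong[of "- {0}"]) (use x c in auto)
      also have "\<dots> = 0" by (rule grad_unique) simp
      finally show ?thesis .
    qed
    show thesis
    proof (rule that[of "\<lambda>k x. c * \<phi> k x" "\<bar>c\<bar> * E"])
      show "(\<lambda>x. c * \<phi> k x) \<in> test_functions (ball 0 1)" for k by (rule test_functions_scale[OF \<phi>])
      fix x assume x: "x \<in> ?B"
      show "\<bar>c * \<phi> k x\<bar> \<le> \<bar>c\<bar> * E" for k using bd(1)[OF x, of k] by (simp add: abs_mult mult_left_mono)
      show "norm (grad (\<lambda>x. c * \<phi> k x) x) \<le> \<bar>c\<bar> * E" for k using bd(2)[OF x, of k] by (simp add: gs mult_left_mono)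
      show "(\<lambda>k. c * \<phi> k x) \<longlonglongrightarrow> v x"
        using tendsto_mult[OF tendsto_const lim(1)[OF x], of c] c[of x] s(3)[OF x] by (simp add: v_def mult.commute)
      show "(\<lambda>k. grad (\<lambda>x. c * \<phi> k x) x) \<longlonglongrightarrow> grad v x"
        using tendsto_scaleR[OF tendsto_const lim(2)[OF x], of c] c[of x] s(3)[OF x] gH[of x] by (simp add: gs gv[OF x] mult.commute)
    qed
  qed
  have H10: "has_weak_gradient (ball 0 1) v (grad v)" "v \<in> H10 (ball 0 1)"
    "AE x in ?M. \<bar>v x\<bar> \<le> E" "AE x in ?M. norm (grad v x) \<le> E"
    using bounded_limit_in_H10[of \<phi> E v "grad v", OF \<phi> bd lim] by blast+
  have cl: "continuous_on ?B (laplacian v)" unfolding laplacian_def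
    by (intro continuous_intros smooth_on_continuous smooth_on_partial_deriv sv)
  have lm: "(\<lambda>x. - ?L (x \<bullet> x) * H x) \<in> borel_measurable ?M"
  proof (rule borel_measurable_off_origin)
    from cl have "continuous_on ?B (\<lambda>x. - laplacian v x)" by (rule continuous_on_minus)
    then show "continuous_on ?B (\<lambda>x. - ?L (x \<bullet> x) * H x)"
      by (rule continuous_on_eq) (simp add: lv)
  qed auto
  have AEl: "AE x in ?M. \<bar>- ?L (x \<bullet> x) * H x\<bar> \<le> C * K"
    by (rule AE_lebesgue_on_off_origin) (use lb in auto)
  have test: "(\<integral>x. grad v x \<bullet> grad \<psi> x \<partial>?M) = (\<integral>x. (- ?L (x \<bullet> x) * H x) * \<psi> x \<partial>?M)"
    if \<psi>: "\<psi> \<in> test_functions (ball 0 1)" for \<psi>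
  proof -
    have "(\<integral>x. grad v x \<bullet> grad \<psi> x \<partial>?M) = - (\<integral>x. \<psi> x * laplacian v x \<partial>?M)"
    proof (rule green_off_origin[OF dim \<psi> sv])
      show "norm (grad v x) \<le> 2 * C * K * 1 + C * K" if "x \<in> ?B" for x by (rule gb[OF that])
      show "\<bar>laplacian v x\<bar> \<le> 2 * C * K * 1 + C * K" if "x \<in> ?B" for x
      proof -
        have "C * K \<le> 2 * C * K * 1 + C * K" using C0 K(1) by simp
        with lb[OF that] show ?thesis unfolding lv[OF that] by (rule order_trans)
      qed
    qed
    also have "\<dots> = (\<integral>x. - (\<psi> x * laplacian v x) \<partial>?M)" by simp
    also have "\<dots> = (\<integral>x. (- ?L (x \<bullet> x) * H x) * \<psi> x \<partial>?M)"
    proof (rule integral_cong_AE)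
      have [measurable]: "laplacian v \<in> borel_measurable ?M"
        by (rule borel_measurable_off_origin[OF ball_lebesgue(1) cl])
      have [measurable]: "\<psi> \<in> borel_measurable ?M"
        using square_integrable_test_function(1)[OF \<psi> ball_lebesgue(2)[of 0 1]] by (simp add: square_integrable_on_def)
      show "(\<lambda>x. - (\<psi> x * laplacian v x)) \<in> borel_measurable ?M" by measurable
      show "(\<lambda>x. (- ?L (x \<bullet> x) * H x) * \<psi> x) \<in> borel_measurable ?M" using lm by measurable
      show "AE x in ?M. - (\<psi> x * laplacian v x) = (- ?L (x \<bullet> x) * H x) * \<psi> x"
        by (rule AE_lebesgue_on_off_origin) (use lv in auto)
    qed
    finally show ?thesis .
  qed
  have m: "AE x in ?M. \<bar>v x\<bar> \<le> max E (C * K)" "AE x in ?M. norm (grad v x) \<le> max E (C * K)"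
    "AE x in ?M. \<bar>- ?L (x \<bullet> x) * H x\<bar> \<le> max E (C * K)"
    by (rule eventually_mono[OF H10(3)] eventually_mono[OF H10(4)] eventually_mono[OF AEl], simp)+
  show ?thesis unfolding dirichlet_function_def using H10(1,2) lm m test by blast
qed

section \<open>Completeness\<close>

text \<open>The common part of the two cases of the Fredholm alternative: from a profile \<open>F\<close> with \<open>F(1) \<noteq> 0\<close> and
  the profile \<open>frob (k + 1)\<close> one forms the combination that vanishes at \<open>1\<close> and tests the equation
  with it.\<close>

lemma eigenspace_orthogonal_powers:
  fixes u :: "'a::euclidean_space \<Rightarrow> real" and \<alpha> :: real and n :: nat
  defines "a \<equiv> 1 + \<alpha> / 2" and "M \<equiv> real DIM('a) + 2 * real n"
  assumes dim: "DIM('a) \<ge> 2" and \<alpha>: "\<alpha> \<ge> 0"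
    and u: "u \<in> eigenspace (ball 0 1) \<alpha> \<mu>"
    and H: "homogeneous_poly n H" "\<And>x. laplacian H x = 0"
    and F: "radial_profile M F" "F 1 \<noteq> 0"
    and R: "\<And>s. s > 0 \<Longrightarrow> radial_laplacian M F s + \<mu> * s powr (a - 1) * F s = R s"
    and orth: "(\<integral>x. u x * (R (x \<bullet> x) * H x) \<partial>unit_ball_measure) = 0"
  shows "integrable unit_ball_measure (\<lambda>x. u x * ((x \<bullet> x) ^ k * H x))"
    and "(\<integral>x. u x * ((x \<bullet> x) ^ k * H x) \<partial>unit_ball_measure) = 0"
proof -
  let ?M = "unit_ball_measure :: 'a measure"
  have a: "a \<ge> 1" and M: "M \<ge> 2" using \<alpha> dim by (auto simp: a_def M_def)
  note sH = harmonic_poly_solid_harmonic[OF H]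
  define f where "f = frob M a \<mu> (Suc k)"
  have pf: "radial_profile M f" unfolding f_def by (rule radial_profile_frob[OF a M])
  define q where "q = indicial M (real (Suc k))"
  have q: "q > 0" using M by (simp add: q_def indicial_def)
  have feq: "radial_laplacian M f s + \<mu> * s powr (a - 1) * f s = q * s ^ k" if "s > 0" for s
    using frob_equation[OF a M that, of \<mu> "Suc k"] that by (simp add: f_def q_def powr_realpow)
  define c where "c = f 1 / F 1"
  define G where "G = (\<lambda>s. f s - c * F s)"
  have pG: "radial_profile M G" unfolding G_def by (rule radial_profile_diff[OF pf F(1)])
  have G1: "G 1 = 0" using F(2) by (simp add: G_def c_def)
  have sf: "smooth_on {0<..} f" and sF: "smooth_on {0<..} F" using pf F(1) by (auto simp: radial_profile_def)
  have Geq: "radial_laplacian M G s + \<mu> * s powr (a - 1) * G s = q * s ^ k - c * R s" if "s > 0" for s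
    unfolding feq[OF that, symmetric] R[OF that, symmetric] G_def radial_laplacian_diff(2)[OF sf sF that, of M c]
    by (simp add: algebra_simps)
  note dir = radial_harmonic_dirichlet_function[OF dim sH pG[unfolded M_def] G1, folded M_def]
  let ?I = "\<lambda>x. u x * (\<mu> * (norm x powr \<alpha> * (G (x \<bullet> x) * H x)) - - radial_laplacian M G (x \<bullet> x) * H x)"
  note eo = eigenspace_orthogonal[OF \<alpha> u dir]
  have su: "square_integrable_on (ball 0 1) u" by (rule H10_square_integrable[OF eigenspaceD[OF u]])
  have iu: "integrable ?M u" by (rule square_integrable_imp_integrable[OF ball_lebesgue(2) su])
  show int: "integrable ?M (\<lambda>x. u x * ((x \<bullet> x) ^ k * H x))"
  proof -
    have c: "continuous_on UNIV (\<lambda>x. (x \<bullet> x) ^ k * H x)"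
      by (intro continuous_intros smooth_on_continuous[OF smooth_on_homogeneous_poly[OF H(1)]])
    obtain B where B: "\<And>x. x \<in> cball 0 1 \<Longrightarrow> norm ((x \<bullet> x) ^ k * H x) \<le> B"
      by (rule continuous_on_compact_bounded[OF compact_cball[of "0::'a" 1] continuous_on_subset[OF c subset_UNIV]]) blast
    show ?thesis
      by (rule integrable_mult_bounded[OF iu, where C = B])
        (use B in \<open>auto intro!: AE_I2 measurable_continuous_ball continuous_on_subset[OF c]\<close>)
  qed
  have AE: "AE x in ?M. ?I x = q * (u x * ((x \<bullet> x) ^ k * H x)) - c * (u x * (R (x \<bullet> x) * H x))"
  proof (rule AE_lebesgue_on_off_origin)
    fix x :: 'a assume "x \<in> ball 0 1 - {0}"
    then have x: "x \<noteq> 0" by simp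
    have w: "norm x powr \<alpha> = (x \<bullet> x) powr (a - 1)" using norm_eq_inner_powr[OF x, of "a - 1"] by (simp add: a_def)
    have "?I x = u x * ((radial_laplacian M G (x \<bullet> x) + \<mu> * (x \<bullet> x) powr (a - 1) * G (x \<bullet> x)) * H x)"
      unfolding w by (simp add: algebra_simps)
    also have "\<dots> = u x * ((q * (x \<bullet> x) ^ k - c * R (x \<bullet> x)) * H x)"
      using Geq[OF inner_self_pos[OF x]] by simp
    finally show "?I x = q * (u x * ((x \<bullet> x) ^ k * H x)) - c * (u x * (R (x \<bullet> x) * H x))"
      by (simp add: algebra_simps)
  qed auto
  define J where "J x = q * (u x * ((x \<bullet> x) ^ k * H x)) - ?I x" for x
  have "AE x in ?M. J x = c * (u x * (R (x \<bullet> x) * H x))" using AE by eventually_elim (simp add: J_def)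
  moreover have intJ: "integrable ?M J" unfolding J_def
    by (rule Bochner_Integration.integrable_diff[OF integrable_mult_right[OF int] eo(2)])
  ultimately have "integral\<^sup>L ?M J = (\<integral>x. c * (u x * (R (x \<bullet> x) * H x)) \<partial>?M)"
    by (intro integral_cong_AE measurable_AE_cong[OF ball_lebesgue(1) borel_measurable_integrable[OF intJ]]) auto
  also have "\<dots> = 0" using orth by simp
  finally have "q * (\<integral>x. u x * ((x \<bullet> x) ^ k * H x) \<partial>?M) - integral\<^sup>L ?M ?I = 0"
    unfolding J_def using Bochner_Integration.integral_diff[OF integrable_mult_right[OF int, of q] eo(2)] by simp
  then show "(\<integral>x. u x * ((x \<bullet> x) ^ k * H x) \<partial>?M) = 0" using eo(1) q by simp
qed

text \<open>In the degrees \<open>n\<close> where \<open>frob\<close> vanishes at \<open>1\<close>, its products with harmonic polynomials are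
  eigenfunctions, so orthogonality to them has to be assumed. There \<open>euler_frob\<close> serves as the second
  profile; it does not vanish at \<open>1\<close> since the zero of \<open>frob\<close> is simple.\<close>

lemma eigenspace_orthogonal_imp_AE_0:
  fixes u :: "'a::euclidean_space \<Rightarrow> real" and \<alpha> :: real
  defines "a \<equiv> 1 + \<alpha> / 2"
  assumes dim: "DIM('a) \<ge> 2" and \<alpha>: "\<alpha> \<ge> 0"
    and u: "u \<in> eigenspace (ball 0 1) \<alpha> \<mu>"
    and orth: "\<And>n H. frob (real DIM('a) + 2 * real n) a \<mu> 0 1 = 0 \<Longrightarrow> homogeneous_poly n H \<Longrightarrow> (\<And>x. laplacian H x = 0) \<Longrightarrow>
      (\<integral>x. norm x powr \<alpha> * u x * (frob (real DIM('a) + 2 * real n) a \<mu> 0 (x \<bullet> x) * H x) \<partial>unit_ball_measure) = 0"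
  shows "AE x in unit_ball_measure. u x = 0"
proof -
  let ?M = "unit_ball_measure :: 'a measure"
  have a: "a \<ge> 1" using \<alpha> by (simp add: a_def)
  have harm: "integrable ?M (\<lambda>x. u x * ((x \<bullet> x) ^ k * H x)) \<and> (\<integral>x. u x * ((x \<bullet> x) ^ k * H x) \<partial>?M) = 0"
    if H: "homogeneous_poly n H" "\<And>x. laplacian H x = 0" for n k H
  proof -
    define M where "M = real DIM('a) + 2 * real n"
    have M: "M \<ge> 2" using dim by (simp add: M_def)
    show ?thesis
    proof (cases "frob M a \<mu> 0 1 = 0")
      case False
      have "radial_laplacian M (frob M a \<mu> 0) s + \<mu> * s powr (a - 1) * frob M a \<mu> 0 s = 0" if "s > 0" for s
        using frob_equation[OF a M that, of \<mu> 0] by (simp add: indicial_def)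
      from eigenspace_orthogonal_powers[OF dim \<alpha> u H radial_profile_frob[OF a M, unfolded M_def, of \<mu> 0, unfolded a_def]
          False[unfolded M_def a_def] this[unfolded M_def a_def]]
      show ?thesis by simp
    next
      case True
      have e1: "euler_frob M a \<mu> 1 \<noteq> 0" by (rule frob_zero_simple[OF a M _ True]) simp
      have "(\<integral>x. u x * (- (\<mu> * a) * (x \<bullet> x) powr (a - 1) * frob M a \<mu> 0 (x \<bullet> x) * H x) \<partial>?M)
          = (\<integral>x. - (\<mu> * a) * (norm x powr \<alpha> * u x * (frob M a \<mu> 0 (x \<bullet> x) * H x)) \<partial>?M)"
      proof (rule Bochner_Integration.integral_cong)
        fix x :: 'a
        have "(x \<bullet> x) powr (a - 1) = norm x powr \<alpha>"
          using norm_eq_inner_powr[of x "a - 1"] by (cases "x = 0") (auto simp: a_def)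
        then show "u x * (- (\<mu> * a) * (x \<bullet> x) powr (a - 1) * frob M a \<mu> 0 (x \<bullet> x) * H x)
          = - (\<mu> * a) * (norm x powr \<alpha> * u x * (frob M a \<mu> 0 (x \<bullet> x) * H x))" by simp
      qed simp
      also have "\<dots> = 0" using orth[OF True[unfolded M_def] H] by (simp add: M_def)
      finally have o: "(\<integral>x. u x * (- (\<mu> * a) * (x \<bullet> x) powr (a - 1) * frob M a \<mu> 0 (x \<bullet> x) * H x) \<partial>?M) = 0" .
      show ?thesis
        using eigenspace_orthogonal_powers[OF dim \<alpha> u H radial_profile_euler_frob[OF a M, unfolded M_def, of \<mu>, unfolded a_def]
          e1[unfolded M_def a_def] euler_frob_equation[OF a M, unfolded M_def a_def] o[unfolded M_def a_def]] by blast
    qed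
  qed
  show ?thesis
  proof (rule orthogonal_polynomials_imp_AE_0)
    show "integrable ?M u"
      by (rule square_integrable_imp_integrable[OF ball_lebesgue(2) H10_square_integrable[OF eigenspaceD[OF u]]])
    show "(\<integral>x. u x * p x \<partial>?M) = 0" if "real_polynomial_function p" for p
    proof -
      from that have "integrable ?M (\<lambda>x. u x * p x) \<and> (\<integral>x. u x * p x \<partial>?M) = 0"
      proof (induction rule: polynomial_harmonic_induct)
        case (harmonic n k H)
        then show ?case by (rule harm)
      next
        case (add q r)
        then show ?case by (simp add: distrib_left)
      qed
      then show ?thesis ..
    qed
  qed
qed

section \<open>The explicit eigenfunctions\<close>

lemma frob_harmonic_in_eigenspace:
  fixes H :: "'a::euclidean_space \<Rightarrow> real" and \<alpha> :: real
  defines "a \<equiv> 1 + \<alpha> / 2"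
  assumes dim: "DIM('a) \<ge> 2" and \<alpha>: "\<alpha> \<ge> 0" and H: "solid_harmonic n H"
    and z: "frob (real DIM('a) + 2 * real n) a \<mu> 0 1 = 0"
  shows "(\<lambda>x. frob (real DIM('a) + 2 * real n) a \<mu> 0 (x \<bullet> x) * H x) \<in> eigenspace (ball 0 1) \<alpha> \<mu>"
proof -
  define M where "M = real DIM('a) + 2 * real n"
  have a: "a \<ge> 1" and M: "M \<ge> 2" using \<alpha> dim by (auto simp: a_def M_def)
  note dir = radial_harmonic_dirichlet_function[OF dim H radial_profile_frob[OF a M, unfolded M_def] z]
  show ?thesis
  proof (rule dirichlet_function_in_eigenspace[OF dir], rule AE_lebesgue_on_off_origin, fold M_def)
    fix x :: 'a assume "x \<in> ball 0 1 - {0}"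
    then have x: "x \<noteq> 0" by simp
    have w: "norm x powr \<alpha> = (x \<bullet> x) powr (a - 1)" using norm_eq_inner_powr[OF x, of "a - 1"] by (simp add: a_def)
    have "radial_laplacian M (frob M a \<mu> 0) (x \<bullet> x) = - (\<mu> * (x \<bullet> x) powr (a - 1) * frob M a \<mu> 0 (x \<bullet> x))"
      using frob_equation[OF a M inner_self_pos[OF x], of \<mu> 0] by (simp add: indicial_def eq_neg_iff_add_eq_0)
    then show "- radial_laplacian M (frob M a \<mu> 0) (x \<bullet> x) * H x = \<mu> * (norm x powr \<alpha> * (frob M a \<mu> 0 (x \<bullet> x) * H x))"
      unfolding w by simp
  qed auto
qed

lemma bessel_order_eq: "\<alpha> \<ge> 0 \<Longrightarrow> bessel_order N \<alpha> n = (real N + 2 * real n - 2) / (2 * (1 + \<alpha> / 2))"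
  by (simp add: bessel_order_def algebra_simps)

lemma bessel_order_nonneg: "N \<ge> 2 \<Longrightarrow> \<alpha> \<ge> 0 \<Longrightarrow> bessel_order N \<alpha> n \<ge> 0"
  by (simp add: bessel_order_def)

lemma mu_eq: "mu N \<alpha> n i = ((1 + \<alpha> / 2) * bessel_zero (bessel_order N \<alpha> n) i)\<^sup>2"
  by (simp add: mu_def field_simps)

lemma mu_pos: "N \<ge> 2 \<Longrightarrow> \<alpha> \<ge> 0 \<Longrightarrow> i \<ge> 1 \<Longrightarrow> mu N \<alpha> n i > 0"
  using bessel_zero_props(1)[OF bessel_order_nonneg, of N \<alpha> i n] by (simp add: mu_eq)

lemma frob_zero_iff_mu:
  assumes N: "N \<ge> 2" and \<alpha>: "\<alpha> \<ge> 0"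
  shows "frob (real N + 2 * real n) (1 + \<alpha> / 2) \<mu> 0 1 = 0 \<longleftrightarrow> (\<exists>i\<ge>1. mu N \<alpha> n i = \<mu>)"
proof -
  define a where "a = 1 + \<alpha> / 2"
  define M where "M = real N + 2 * real n"
  define \<beta> where "\<beta> = bessel_order N \<alpha> n"
  have a: "a \<ge> 1" and M: "M \<ge> 2" using \<alpha> N by (auto simp: a_def M_def)
  have \<beta>: "\<beta> \<ge> 0" unfolding \<beta>_def by (rule bessel_order_nonneg[OF N \<alpha>])
  have \<beta>': "(M - 2) / (2 * a) = \<beta>" unfolding \<beta>_def bessel_order_eq[OF \<alpha>] M_def a_def ..
  have eq: "frob M a \<mu> 0 1 = bessel_series \<beta> (\<mu> / a\<^sup>2)" if "\<mu> > 0" for \<mu>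
    using frob_eq_bessel_series[OF a M that, of 1] by (simp add: \<beta>')
  have "frob M a \<mu> 0 1 = 0 \<longleftrightarrow> (\<exists>i\<ge>1. mu N \<alpha> n i = \<mu>)"
  proof
    assume z: "frob M a \<mu> 0 1 = 0"
    then have \<mu>: "\<mu> > 0" using frob_pos_of_nonpos[OF a M, of \<mu>] by force
    define r where "r = sqrt \<mu> / a"
    have r: "r > 0" "r\<^sup>2 = \<mu> / a\<^sup>2" using \<mu> a by (auto simp: r_def power_divide)
    then have "bessel_J \<beta> r = 0" using bessel_J_zero_iff[OF \<beta> r(1)] eq[OF \<mu>] z by simp
    then obtain i where i: "i \<ge> 1" "bessel_zero \<beta> i = r" using bessel_zero_surj[OF \<beta> r(1)] by blast
    have "mu N \<alpha> n i = (a * r)\<^sup>2" unfolding mu_eq using i by (simp add: \<beta>_def a_def)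
    also have "\<dots> = \<mu>" using r(2) a by (simp add: power_mult_distrib)
    finally show "\<exists>i\<ge>1. mu N \<alpha> n i = \<mu>" using i by blast
  next
    assume "\<exists>i\<ge>1. mu N \<alpha> n i = \<mu>"
    then obtain i where i: "i \<ge> 1" "\<mu> = mu N \<alpha> n i" by blast
    define z where "z = bessel_zero \<beta> i"
    have z: "z > 0" "bessel_J \<beta> z = 0" unfolding z_def using bessel_zero_props[OF \<beta> i(1)] by auto
    have \<mu>: "\<mu> = (a * z)\<^sup>2" unfolding i(2) mu_eq by (simp add: z_def \<beta>_def a_def)
    then have "\<mu> / a\<^sup>2 = z\<^sup>2" "\<mu> > 0" using a z by (auto simp: power_mult_distrib)
    then show "frob M a \<mu> 0 1 = 0" using eq[of \<mu>] bessel_J_zero_iff[OF \<beta> z(1)] z(2) by simp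
  qed
  then show ?thesis by (simp add: a_def M_def)
qed

lemma mu_inj:
  assumes "N \<ge> 2" "\<alpha> \<ge> 0" "i \<ge> 1" "i' \<ge> 1" "mu N \<alpha> n i = mu N \<alpha> n i'" shows "i = i'"
proof -
  let ?\<beta> = "bessel_order N \<alpha> n"
  have \<beta>: "?\<beta> \<ge> 0" by (rule bessel_order_nonneg) fact+
  have "((1 + \<alpha> / 2) * bessel_zero ?\<beta> i)\<^sup>2 = ((1 + \<alpha> / 2) * bessel_zero ?\<beta> i')\<^sup>2" using assms(5) by (simp only: mu_eq)
  then have h: "(1 + \<alpha> / 2) * bessel_zero ?\<beta> i = (1 + \<alpha> / 2) * bessel_zero ?\<beta> i'"
    by (rule power2_eq_imp_eq)
      (use bessel_zero_props(1)[OF \<beta> assms(3)] bessel_zero_props(1)[OF \<beta> assms(4)] assms(2) in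
        \<open>simp_all add: mult_nonneg_nonneg less_imp_le\<close>)
  have "1 + \<alpha> / 2 \<noteq> 0" using assms(2) by simp
  from mult_left_cancel[OF this, THEN iffD1, OF h] have eq: "bessel_zero ?\<beta> i = bessel_zero ?\<beta> i'" .
  from bessel_zero_props(3)[OF \<beta> assms(3)] show ?thesis
    unfolding eq bessel_zero_props(3)[OF \<beta> assms(4)] by (rule sym)
qed

text \<open>The degree \<open>n\<close> is bounded by a multiple of \<open>\<mu>\<close>, and in each degree there is at most one \<open>i\<close>.\<close>

lemma finite_mu_indices:
  fixes m :: "nat \<Rightarrow> nat"
  assumes N: "N \<ge> 2" and \<alpha>: "\<alpha> \<ge> 0"
  shows "finite {(n, i, j). i \<ge> 1 \<and> j \<in> {1..m n} \<and> mu N \<alpha> n i = \<mu>}" (is "finite ?T")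
proof -
  let ?I = "\<lambda>n. {i. i \<ge> 1 \<and> mu N \<alpha> n i = \<mu>}"
  have fI: "finite (?I n)" for n
  proof (cases "?I n = {}")
    case False
    then obtain i where "i \<in> ?I n" by blast
    then have "?I n \<subseteq> {i}" using mu_inj[OF N \<alpha>] by blast
    then show ?thesis by (rule finite_subset) simp
  next
    case True
    then show ?thesis by (simp only: finite.emptyI)
  qed
  have n: "n \<le> nat \<lceil>4 * \<mu>\<rceil>" if "i \<ge> 1" "mu N \<alpha> n i = \<mu>" for n i
  proof (rule ccontr)
    assume "\<not> n \<le> nat \<lceil>4 * \<mu>\<rceil>"
    then have "4 * \<mu> \<le> real N + 2 * real n" by linarith
    moreover have "\<mu> > 0" using mu_pos[OF N \<alpha> that(1), of n] that(2) by simp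
    ultimately have "frob (real N + 2 * real n) (1 + \<alpha> / 2) \<mu> 0 1 > 0"
      using N \<alpha> by (intro frob_pos_of_small) auto
    moreover have "frob (real N + 2 * real n) (1 + \<alpha> / 2) \<mu> 0 1 = 0" using frob_zero_iff_mu[OF N \<alpha>] that by blast
    ultimately show False by simp
  qed
  have "?T \<subseteq> (SIGMA n:{..nat \<lceil>4 * \<mu>\<rceil>}. ?I n \<times> {1..m n})" using n by auto
  then show ?thesis by (rule finite_subset) (intro finite_SigmaI finite_cartesian_product fI; simp)
qed

text \<open>With \<open>\<beta>\<close> the order of the Bessel function, the leading power \<open>(z \<bar>x\<bar>\<^sup>a)\<^sup>\<beta>\<close> of the Bessel function
  and the factor \<open>\<bar>x\<bar>\<^bsup>-(N-2)/2\<^esup>\<close> combine to a multiple of \<open>\<bar>x\<bar>\<^sup>n\<close>, as \<open>a \<beta> = (N - 2) / 2 + n\<close>.\<close>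

lemma omega_eq:
  assumes dim: "DIM('a::euclidean_space) \<ge> 2" and \<alpha>: "\<alpha> \<ge> 0" and i: "i \<ge> 1"
  obtains K where "K \<noteq> 0" "\<And>(Y :: 'a \<Rightarrow> real) x. x \<noteq> 0 \<Longrightarrow> omega \<alpha> n i Y x
    = K * (frob (real DIM('a) + 2 * real n) (1 + \<alpha> / 2) (mu DIM('a) \<alpha> n i) 0 (x \<bullet> x) * (norm x powr real n * Y (x /\<^sub>R norm x)))"
proof -
  define a where "a = 1 + \<alpha> / 2"
  define M where "M = real DIM('a) + 2 * real n"
  define \<beta> where "\<beta> = bessel_order DIM('a) \<alpha> n"
  define z where "z = bessel_zero \<beta> i"
  define \<mu> where "\<mu> = mu DIM('a) \<alpha> n i"
  have a: "a \<ge> 1" and M: "M \<ge> 2" using \<alpha> dim by (auto simp: a_def M_def)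
  have \<beta>: "\<beta> \<ge> 0" unfolding \<beta>_def by (rule bessel_order_nonneg[OF dim \<alpha>])
  have \<beta>': "(M - 2) / (2 * a) = \<beta>" unfolding \<beta>_def bessel_order_eq[OF \<alpha>] M_def a_def ..
  then have a\<beta>: "a * \<beta> = (real DIM('a) - 2) / 2 + real n" using a by (simp add: M_def field_simps)
  have z: "z > 0" unfolding z_def using bessel_zero_props[OF \<beta> i] by auto
  have \<mu>: "\<mu> = (a * z)\<^sup>2" unfolding \<mu>_def mu_eq by (simp add: z_def \<beta>_def a_def)
  then have \<mu>0: "\<mu> > 0" "\<mu> / a\<^sup>2 = z\<^sup>2" using a z by (auto simp: power_mult_distrib)
  have G: "Gamma (\<beta> + 1) > 0" using \<beta> by (intro Gamma_real_pos) auto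
  define K where "K = z powr \<beta> / Gamma (\<beta> + 1)"
  have K: "K \<noteq> 0" using z G by (simp add: K_def)
  have "omega \<alpha> n i Y x = K * (frob M a \<mu> 0 (x \<bullet> x) * (norm x powr real n * Y (x /\<^sub>R norm x)))"
    if x: "x \<noteq> 0" for Y and x :: 'a
  proof -
    define \<rho> where "\<rho> = z * norm x powr a"
    have \<rho>: "\<rho> > 0" using z x by (simp add: \<rho>_def)
    have \<rho>2: "\<rho>\<^sup>2 = \<mu> / a\<^sup>2 * (x \<bullet> x) powr a"
      unfolding \<mu>0(2) norm_eq_inner_powr[OF x] \<rho>_def using x
      by (simp add: power_mult_distrib powr_power mult.commute)
    have "bessel_J \<beta> \<rho> = \<rho> powr \<beta> / Gamma (\<beta> + 1) * frob M a \<mu> 0 (x \<bullet> x)"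
      unfolding bessel_J_eq[OF \<beta> \<rho>] \<rho>2 frob_eq_bessel_series[OF a M \<mu>0(1) inner_self_pos[OF x]] \<beta>' ..
    also have "\<rho> powr \<beta> = z powr \<beta> * norm x powr (a * \<beta>)"
      unfolding \<rho>_def using z by (simp add: powr_mult powr_powr)
    finally have J: "bessel_J \<beta> \<rho> = K * norm x powr (a * \<beta>) * frob M a \<mu> 0 (x \<bullet> x)" by (simp add: K_def)
    have p: "norm x powr (- ((real DIM('a) - 2) / 2)) * norm x powr (a * \<beta>) = norm x powr real n"
      unfolding powr_add[symmetric] a\<beta> by simp
    have "omega \<alpha> n i Y x = norm x powr (- ((real DIM('a) - 2) / 2)) * bessel_J \<beta> \<rho> * Y (x /\<^sub>R norm x)"
      by (simp add: omega_def \<beta>_def z_def \<rho>_def a_def add_divide_distrib)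
    also have "\<dots> = K * (frob M a \<mu> 0 (x \<bullet> x) *
        ((norm x powr (- ((real DIM('a) - 2) / 2)) * norm x powr (a * \<beta>)) * Y (x /\<^sub>R norm x)))"
      unfolding J by (simp only: mult_ac)
    finally show ?thesis unfolding p .
  qed
  from this[unfolded M_def a_def \<mu>_def] show ?thesis by (rule that[OF K])
qed

lemma omega_in_eigenspace:
  fixes Y :: "'a::euclidean_space \<Rightarrow> real"
  assumes dim: "DIM('a) \<ge> 2" and \<alpha>: "\<alpha> \<ge> 0" and i: "i \<ge> 1"
    and Y: "Y \<in> sphere_eigenspace (real n * (real DIM('a) - 2 + real n))"
  shows "omega \<alpha> n i Y \<in> eigenspace (ball 0 1) \<alpha> (mu DIM('a) \<alpha> n i)"
proof -
  let ?f = "\<lambda>x::'a. frob (real DIM('a) + 2 * real n) (1 + \<alpha> / 2) (mu DIM('a) \<alpha> n i) 0 (x \<bullet> x) * (norm x powr real n * Y (x /\<^sub>R norm x))"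
  obtain K where K: "K \<noteq> 0" "\<And>x::'a. x \<noteq> 0 \<Longrightarrow> omega \<alpha> n i Y x = K * ?f x"
    by (rule omega_eq[OF dim \<alpha> i, of n]) blast
  have "frob (real DIM('a) + 2 * real n) (1 + \<alpha> / 2) (mu DIM('a) \<alpha> n i) 0 1 = 0"
    using frob_zero_iff_mu[OF dim \<alpha>] i by blast
  then have "?f \<in> eigenspace (ball 0 1) \<alpha> (mu DIM('a) \<alpha> n i)"
    by (rule frob_harmonic_in_eigenspace[OF dim \<alpha> sphere_eigenspace_imp_solid_harmonic[OF Y]])
  then have "(\<lambda>x. K * ?f x) \<in> eigenspace (ball 0 1) \<alpha> (mu DIM('a) \<alpha> n i)" by (rule eigenspace_scale)
  then show ?thesis
    by (rule eigenspace_AE_cong[OF \<alpha>]) (rule AE_lebesgue_on_off_origin, use K in auto)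
qed

text \<open>Near the origin the radial factor is positive, and \<open>Y\<close> is nonzero on an open cone.\<close>

lemma omega_not_AE_0:
  fixes Y :: "'a::euclidean_space \<Rightarrow> real"
  assumes dim: "DIM('a) \<ge> 2" and \<alpha>: "\<alpha> \<ge> 0" and i: "i \<ge> 1"
    and Y: "Y \<in> sphere_eigenspace (real n * (real DIM('a) - 2 + real n))" and y: "norm y = 1" "Y y \<noteq> 0"
  shows "\<not> (AE x in unit_ball_measure. omega \<alpha> n i Y x = 0)"
proof
  assume AE: "AE x in unit_ball_measure. omega \<alpha> n i Y x = 0"
  define F where "F = frob (real DIM('a) + 2 * real n) (1 + \<alpha> / 2) (mu DIM('a) \<alpha> n i) 0"
  define H where "H x = norm x powr real n * Y (x /\<^sub>R norm x)" for x
  obtain K where K: "K \<noteq> 0" "\<And>x::'a. x \<noteq> 0 \<Longrightarrow> omega \<alpha> n i Y x = K * (F (x \<bullet> x) * H x)"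
    unfolding F_def H_def by (rule omega_eq[OF dim \<alpha> i, of n]) blast
  have sH: "solid_harmonic n H" unfolding H_def[abs_def] by (rule sphere_eigenspace_imp_solid_harmonic[OF Y])
  then have sm: "smooth_on (- {0}) H" and hom: "homogeneous (real n) H" by (auto simp: solid_harmonic_def)
  have "(F \<longlongrightarrow> 1) (at_right 0)" unfolding F_def by (rule frob_tendsto_1) (use \<alpha> dim in auto)
  then have "\<forall>\<^sub>F s in at_right 0. F s > 0" by (rule order_tendstoD) simp
  then obtain e where e: "e > 0" "\<And>s. 0 < s \<Longrightarrow> s < e \<Longrightarrow> F s > 0"
    unfolding eventually_at_right_field by auto
  define t where "t = min (1/2) (sqrt e / 2)"
  have t: "t > 0" "t < 1" "t < sqrt e" using e(1) by (auto simp: t_def min_less_iff_disj)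
  define Z where "Z = (ball 0 1 \<inter> ball 0 (sqrt e) - {0}) \<inter> H -` (- {0})"
  have "open Z" unfolding Z_def
    by (rule continuous_open_preimage[OF continuous_on_subset[OF smooth_on_continuous[OF sm]]]) auto
  have "AE x in lebesgue. x \<in> ball 0 1 \<longrightarrow> omega \<alpha> n i Y x = 0" using AE by (subst (asm) AE_restrict_space_iff) auto
  then have AEZ: "AE x\<in>UNIV in lebesgue. x \<in> - Z"
  proof eventually_elim
    case (elim x)
    show ?case
    proof (rule impI, rule ComplI)
      assume x: "x \<in> Z"
      then have x0: "x \<noteq> 0" "norm x < sqrt e" "H x \<noteq> 0" "omega \<alpha> n i Y x = 0" using elim by (auto simp: Z_def)
      then have "x \<bullet> x < e" using norm_lt_square[of x "sqrt e"] e(1) by simp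
      then have "F (x \<bullet> x) > 0" using e(2) x0(1) by simp
      then show False using K(2)[OF x0(1)] K(1) x0 by simp
    qed
  qed
  have "t *\<^sub>R y \<in> - Z"
    by (rule mem_closed_if_AE_lebesgue_open[OF open_UNIV _ AEZ]) (use \<open>open Z\<close> in auto)
  moreover have "t *\<^sub>R y \<in> ball 0 1 \<inter> ball 0 (sqrt e) - {0}" using t y by auto
  ultimately have "H (t *\<^sub>R y) = 0" by (simp add: Z_def)
  moreover have "H (t *\<^sub>R y) = t powr real n * Y y" using t y by (simp add: H_def)
  ultimately show False using t y by simp
qed

section \<open>Projection onto finitely many functions\<close>

definition weighted_inner :: "real \<Rightarrow> ('a::euclidean_space \<Rightarrow> real) \<Rightarrow> ('a \<Rightarrow> real) \<Rightarrow> real" where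
  "weighted_inner \<alpha> f g = (\<integral>x. norm x powr \<alpha> * f x * g x \<partial>unit_ball_measure)"

lemma weighted_inner_commute: "weighted_inner \<alpha> f g = weighted_inner \<alpha> g f"
  by (simp add: weighted_inner_def mult_ac)

lemma weighted_inner_diff_left:
  fixes f :: "'a::euclidean_space \<Rightarrow> real"
  assumes "\<alpha> \<ge> 0" "square_integrable_on (ball 0 1) f" "square_integrable_on (ball 0 1) g" "square_integrable_on (ball 0 1) h"
  shows "weighted_inner \<alpha> (\<lambda>x. f x - c * g x) h = weighted_inner \<alpha> f h - c * weighted_inner \<alpha> g h"
proof -
  have "weighted_inner \<alpha> (\<lambda>x. f x - c * g x) h = (\<integral>x. norm x powr \<alpha> * f x * h x - c * (norm x powr \<alpha> * g x * h x) \<partial>unit_ball_measure)"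
    unfolding weighted_inner_def by (rule Bochner_Integration.integral_cong) (auto simp: algebra_simps)
  then show ?thesis unfolding weighted_inner_def
    using integrable_weighted_product[OF assms(1,2,4)] integrable_weighted_product[OF assms(1,3,4)] by simp
qed

lemma square_integrable_sum:
  fixes b :: "'t \<Rightarrow> 'a::euclidean_space \<Rightarrow> real"
  assumes "\<And>t. t \<in> T \<Longrightarrow> square_integrable_on S (b t)"
  shows "square_integrable_on S (\<lambda>x. \<Sum>t\<in>T. c t * b t x)"
  using assms
proof (induction T rule: infinite_finite_induct)
  case (insert t T)
  then show ?case
    using square_integrable_add[OF square_integrable_scaleR[of S "b t" "c t"], of "\<lambda>x. \<Sum>t\<in>T. c t * b t x"] by simp
qed (auto simp: square_integrable_on_def)

lemma weighted_inner_sum_right: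
  fixes b :: "'t \<Rightarrow> 'a::euclidean_space \<Rightarrow> real"
  assumes \<alpha>: "\<alpha> \<ge> 0" and f: "square_integrable_on (ball 0 1) f" and b: "\<And>t. t \<in> T \<Longrightarrow> square_integrable_on (ball 0 1) (b t)"
  shows "weighted_inner \<alpha> f (\<lambda>x. \<Sum>t\<in>T. c t * b t x) = (\<Sum>t\<in>T. c t * weighted_inner \<alpha> f (b t))"
proof -
  have "weighted_inner \<alpha> f (\<lambda>x. \<Sum>t\<in>T. c t * b t x) = (\<integral>x. (\<Sum>t\<in>T. c t * (norm x powr \<alpha> * f x * b t x)) \<partial>unit_ball_measure)"
    unfolding weighted_inner_def by (rule Bochner_Integration.integral_cong) (auto simp: sum_distrib_left mult_ac)
  also have "\<dots> = (\<Sum>t\<in>T. \<integral>x. c t * (norm x powr \<alpha> * f x * b t x) \<partial>unit_ball_measure)"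
    by (intro Bochner_Integration.integral_sum integrable_mult_right integrable_weighted_product \<alpha> f b)
  finally show ?thesis by (simp add: weighted_inner_def)
qed

lemma weighted_inner_self_0:
  fixes w :: "'a::euclidean_space \<Rightarrow> real"
  assumes \<alpha>: "\<alpha> \<ge> 0" and w: "square_integrable_on (ball 0 1) w" and z: "weighted_inner \<alpha> w w = 0"
    and u: "square_integrable_on (ball 0 1) u"
  shows "weighted_inner \<alpha> u w = 0"
proof -
  have "AE x in unit_ball_measure. norm x powr \<alpha> * w x * w x = 0"
    using z integrable_weighted_product[OF \<alpha> w w] unfolding weighted_inner_def
    by (subst (asm) integral_nonneg_eq_0_iff_AE) (auto simp: mult.assoc)
  then have "AE x in unit_ball_measure. norm x powr \<alpha> * u x * w x = 0" by eventually_elim auto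
  then show ?thesis unfolding weighted_inner_def by (rule integral_eq_zero_AE)
qed

text \<open>One Gram--Schmidt step for each function. A vector of length zero can occur, and is then
  orthogonal to everything.\<close>

lemma weighted_projection_exists:
  fixes b :: "'t \<Rightarrow> 'a::euclidean_space \<Rightarrow> real"
  assumes "finite T" and \<alpha>: "\<alpha> \<ge> 0" and "\<And>t. t \<in> T \<Longrightarrow> square_integrable_on (ball 0 1) (b t)"
    and "square_integrable_on (ball 0 1) u"
  shows "\<exists>c. \<forall>t\<in>T. weighted_inner \<alpha> (\<lambda>x. u x - (\<Sum>t\<in>T. c t * b t x)) (b t) = 0"
  using assms(1,3,4)
proof (induction T arbitrary: u rule: finite_induct)
  case empty
  then show ?case by simp
next
  case (insert t T)
  have sb: "square_integrable_on (ball 0 1) (b t')" if "t' \<in> insert t T" for t' using insert.prems(1)[OF that] .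
  obtain cu where cu: "\<And>t'. t' \<in> T \<Longrightarrow> weighted_inner \<alpha> (\<lambda>x. u x - (\<Sum>t\<in>T. cu t * b t x)) (b t') = 0"
    using insert.IH[of u] insert.prems by auto
  obtain cb where cb: "\<And>t'. t' \<in> T \<Longrightarrow> weighted_inner \<alpha> (\<lambda>x. b t x - (\<Sum>t\<in>T. cb t * b t x)) (b t') = 0"
    using insert.IH[of "b t"] insert.prems by auto
  define u' where "u' x = u x - (\<Sum>t\<in>T. cu t * b t x)" for x
  define w where "w x = b t x - (\<Sum>t\<in>T. cb t * b t x)" for x
  have su': "square_integrable_on (ball 0 1) u'" unfolding u'_def
    by (intro square_integrable_diff square_integrable_sum sb insert.prems(2)) auto
  have sw: "square_integrable_on (ball 0 1) w" unfolding w_def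
    by (intro square_integrable_diff square_integrable_sum sb) auto
  define l where "l = weighted_inner \<alpha> u' w / weighted_inner \<alpha> w w"
  define v where "v x = u' x - l * w x" for x
  have sv: "square_integrable_on (ball 0 1) v"
    unfolding v_def using square_integrable_diff[OF su' square_integrable_scaleR[OF sw, of l]] by simp
  have vT: "weighted_inner \<alpha> v (b t') = 0" if "t' \<in> T" for t'
    unfolding v_def using weighted_inner_diff_left[OF \<alpha> su' sw sb[of t']] cu[OF that] cb[OF that] that
    by (simp add: u'_def[abs_def] w_def[abs_def])
  have vw: "weighted_inner \<alpha> v w = 0"
  proof -
    have "weighted_inner \<alpha> v w = weighted_inner \<alpha> u' w - l * weighted_inner \<alpha> w w"
      unfolding v_def by (rule weighted_inner_diff_left[OF \<alpha> su' sw sw])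
    also have "\<dots> = 0"
      using weighted_inner_self_0[OF \<alpha> sw _ su'] by (cases "weighted_inner \<alpha> w w = 0") (auto simp: l_def)
    finally show ?thesis .
  qed
  have vt: "weighted_inner \<alpha> v (b t) = 0"
  proof -
    have "weighted_inner \<alpha> v w = weighted_inner \<alpha> (\<lambda>x. b t x - 1 * (\<Sum>t\<in>T. cb t * b t x)) v"
      by (subst weighted_inner_commute) (simp add: w_def[abs_def])
    also have "\<dots> = weighted_inner \<alpha> (b t) v - 1 * weighted_inner \<alpha> (\<lambda>x. \<Sum>t\<in>T. cb t * b t x) v"
      by (intro weighted_inner_diff_left \<alpha> sb square_integrable_sum sv) auto
    also have "weighted_inner \<alpha> (\<lambda>x. \<Sum>t\<in>T. cb t * b t x) v = (\<Sum>t\<in>T. cb t * weighted_inner \<alpha> v (b t))"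
      by (subst weighted_inner_commute) (intro weighted_inner_sum_right \<alpha> sv sb; simp)
    also have "\<dots> = 0" using vT by simp
    finally show ?thesis using vw by (simp add: weighted_inner_commute[of \<alpha> "b t"])
  qed
  define c where "c t' = (if t' = t then l else cu t' - l * cb t')" for t'
  have "v x = u x - (\<Sum>t'\<in>insert t T. c t' * b t' x)" for x
  proof -
    have "(\<Sum>t'\<in>insert t T. c t' * b t' x) = l * b t x + (\<Sum>t'\<in>T. c t' * b t' x)"
      using insert.hyps by (simp add: c_def)
    also have "(\<Sum>t'\<in>T. c t' * b t' x) = (\<Sum>t'\<in>T. (cu t' - l * cb t') * b t' x)"
      by (rule sum.cong) (use insert.hyps in \<open>auto simp: c_def\<close>)
    also have "\<dots> = (\<Sum>t'\<in>T. cu t' * b t' x) - l * (\<Sum>t'\<in>T. cb t' * b t' x)"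
      by (simp add: left_diff_distrib sum_subtractf sum_distrib_left mult.assoc)
    finally show ?thesis by (simp add: v_def u'_def w_def algebra_simps)
  qed
  then have "v = (\<lambda>x. u x - (\<Sum>t'\<in>insert t T. c t' * b t' x))" by (rule ext)
  then show ?case using vT vt by (intro exI[of _ c]) auto
qed

section \<open>Eigenvalues and eigenfunctions\<close>

lemma is_sphere_basis_nonzero:
  fixes Y :: "nat \<Rightarrow> 'a::euclidean_space \<Rightarrow> real"
  assumes "is_sphere_basis V m Y" "j \<in> {1..m}" shows "Y j \<in> V \<and> (\<exists>y. norm y = 1 \<and> Y j y \<noteq> 0)"
proof -
  have V: "Y j \<in> V" using assms by (simp add: is_sphere_basis_def)
  have "\<exists>y. norm y = 1 \<and> Y j y \<noteq> 0"
  proof (rule ccontr)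
    assume "\<not> ?thesis"
    then have z: "\<And>y. norm y = 1 \<Longrightarrow> Y j y = 0" by blast
    define c where "c i = (if i = j then 1 else 0 :: real)" for i
    have "(\<Sum>i=1..m. c i * Y i y) = 0" if "norm y = 1" for y
      by (rule sum.neutral) (use z[OF that] in \<open>auto simp: c_def\<close>)
    then have "\<forall>j\<in>{1..m}. c j = 0" using assms(1) unfolding is_sphere_basis_def by simp
    then have "c j = 0" using assms(2) by blast
    then show False by (simp add: c_def)
  qed
  with V show ?thesis by blast
qed

text \<open>The restriction of \<open>H\<close> to the sphere lies in the eigenspace, and by homogeneity its expansion there extends to
  the whole space.\<close>

lemma harmonic_poly_in_span_of_basis:
  fixes Y :: "nat \<Rightarrow> 'a::euclidean_space \<Rightarrow> real"
  assumes Y: "is_sphere_basis (sphere_eigenspace (real n * (real DIM('a) - 2 + real n))) m Y"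
    and H: "homogeneous_poly n H" "\<And>x. laplacian H x = 0"
  obtains c where "\<And>x. x \<noteq> 0 \<Longrightarrow> H x = (\<Sum>j=1..m. c j * (norm x powr real n * Y j (x /\<^sub>R norm x)))"
proof -
  have "H \<in> sphere_eigenspace (real n * (real DIM('a) - 2 + real n))"
    by (rule solid_harmonic_in_sphere_eigenspace[OF harmonic_poly_solid_harmonic[OF H]])
  then obtain c where c: "\<And>x. norm x = 1 \<Longrightarrow> H x = (\<Sum>j=1..m. c j * Y j x)"
    using Y unfolding is_sphere_basis_def by (auto simp: dist_norm)
  have "H x = (\<Sum>j=1..m. c j * (norm x powr real n * Y j (x /\<^sub>R norm x)))" if x: "x \<noteq> 0" for x
  proof -
    have "H x = H (norm x *\<^sub>R (x /\<^sub>R norm x))" using x by simp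
    also have "\<dots> = norm x powr real n * H (x /\<^sub>R norm x)"
      using homogeneousD[OF homogeneous_poly_homogeneous[OF H(1)], of "x /\<^sub>R norm x" "norm x"] x by simp
    also have "\<dots> = norm x powr real n * (\<Sum>j=1..m. c j * Y j (x /\<^sub>R norm x))" using c[of "x /\<^sub>R norm x"] x by simp
    finally show ?thesis by (simp add: sum_distrib_left mult_ac)
  qed
  then show ?thesis using that by blast
qed

theorem lemma2p3:
  fixes \<alpha> :: real
    and Y :: "nat \<Rightarrow> nat \<Rightarrow> 'a::euclidean_space \<Rightarrow> real"
    and m :: "nat \<Rightarrow> nat"
  assumes "DIM('a) \<ge> 2"
    and "\<alpha> \<ge> 0"
    and "\<And>n. is_sphere_basis (sphere_eigenspace (real n * (real DIM('a) - 2 + real n))) (m n) (Y n)"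
  shows "{\<mu>. eigenvalue (ball (0::'a) 1) \<alpha> \<mu>} = {mu DIM('a) \<alpha> n i | n i. i \<ge> 1} \<and>
    (\<forall>n. \<forall>i\<ge>1. \<forall>j\<in>{1..m n}.
       eigenfunction (ball 0 1) \<alpha> (mu DIM('a) \<alpha> n i) (omega \<alpha> n i (Y n j))) \<and>
    (\<forall>\<mu>. eigenvalue (ball (0::'a) 1) \<alpha> \<mu> \<longrightarrow>
       eigenspace (ball 0 1) \<alpha> \<mu> =
         {u. \<exists>F c. finite F \<and>
            F \<subseteq> {(n, i, j). i \<ge> 1 \<and> j \<in> {1..m n} \<and> mu DIM('a) \<alpha> n i = \<mu>} \<and>
            (AE x in lebesgue_on (ball 0 1).
               u x = (\<Sum>(n, i, j)\<in>F. c (n, i, j) * omega \<alpha> n i (Y n j) x))})"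
proof -
  note dim = assms(1) and \<alpha> = assms(2) and Y = assms(3)
  let ?M = "unit_ball_measure :: 'a measure"
  have ef: "eigenfunction (ball 0 1) \<alpha> (mu DIM('a) \<alpha> n i) (omega \<alpha> n i (Y n j))" if i: "i \<ge> 1" and j: "j \<in> {1..m n}" for n i j
    using is_sphere_basis_nonzero[OF Y j] omega_in_eigenspace[OF dim \<alpha> i] omega_not_AE_0[OF dim \<alpha> i]
    unfolding eigenfunction_def by blast
  have m_pos: "1 \<in> {1..m n}" for n
  proof -
    obtain H :: "'a \<Rightarrow> real" and y where H: "homogeneous_poly n H" "\<And>x. laplacian H x = 0" and y: "norm y = 1" "H y \<noteq> 0"
      using exists_nonzero_harmonic[OF dim, of n] by blast
    obtain c where c: "\<And>x. x \<noteq> 0 \<Longrightarrow> H x = (\<Sum>j=1..m n. c j * (norm x powr real n * Y n j (x /\<^sub>R norm x)))"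
      using harmonic_poly_in_span_of_basis[OF Y H] by blast
    have "y \<noteq> 0" using y by auto
    from c[OF this] have "(\<Sum>j=1..m n. c j * (norm y powr real n * Y n j (y /\<^sub>R norm y))) \<noteq> 0" using y(2) by simp
    then have "m n \<noteq> 0" by (intro notI) simp
    then show ?thesis by simp
  qed
  have ev: "\<exists>n. \<exists>i\<ge>1. mu DIM('a) \<alpha> n i = \<mu>" if e: "eigenvalue (ball (0::'a) 1) \<alpha> \<mu>" for \<mu>
  proof (rule ccontr)
    assume "\<not> ?thesis"
    then have no: "frob (real DIM('a) + 2 * real n) (1 + \<alpha> / 2) \<mu> 0 1 \<noteq> 0" for n
      using frob_zero_iff_mu[OF dim \<alpha>] by blast
    obtain u :: "'a \<Rightarrow> real" where u: "u \<in> eigenspace (ball 0 1) \<alpha> \<mu>" "\<not> (AE x in ?M. u x = 0)"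
      using e unfolding eigenvalue_def eigenfunction_def by blast
    have "AE x in ?M. u x = 0" by (rule eigenspace_orthogonal_imp_AE_0[OF dim \<alpha> u(1)]) (use no in blast)
    with u(2) show False by blast
  qed
  have 1: "{\<mu>. eigenvalue (ball (0::'a) 1) \<alpha> \<mu>} = {mu DIM('a) \<alpha> n i | n i. i \<ge> 1}"
  proof (intro equalityI subsetI)
    fix \<mu> assume "\<mu> \<in> {mu DIM('a) \<alpha> n i | n i. i \<ge> 1}"
    then obtain n i where "i \<ge> 1" "\<mu> = mu DIM('a) \<alpha> n i" by blast
    then show "\<mu> \<in> {\<mu>. eigenvalue (ball (0::'a) 1) \<alpha> \<mu>}" using ef[OF _ m_pos] unfolding eigenvalue_def by blast
  qed (use ev in blast)
  have 3: "eigenspace (ball 0 1) \<alpha> \<mu> =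
         {u. \<exists>F c. finite F \<and>
            F \<subseteq> {(n, i, j). i \<ge> 1 \<and> j \<in> {1..m n} \<and> mu DIM('a) \<alpha> n i = \<mu>} \<and>
            (AE x in ?M. u x = (\<Sum>(n, i, j)\<in>F. c (n, i, j) * omega \<alpha> n i (Y n j) x))}" (is "_ = ?S") for \<mu>
  proof (intro equalityI subsetI)
    let ?T = "{(n, i, j). i \<ge> 1 \<and> j \<in> {1..m n} \<and> mu DIM('a) \<alpha> n i = \<mu>}"
    define b where "b = (\<lambda>(n, i, j). omega \<alpha> n i (Y n j))"
    have bE: "b t \<in> eigenspace (ball 0 1) \<alpha> \<mu>" if "t \<in> ?T" for t
      using that ef unfolding b_def eigenfunction_def by fastforce
    {
      fix u assume "u \<in> ?S"
      then obtain F c where F: "F \<subseteq> ?T" and eq: "AE x in ?M. u x = (\<Sum>(n, i, j)\<in>F. c (n, i, j) * omega \<alpha> n i (Y n j) x)" by blast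
      have "(\<lambda>x. \<Sum>t\<in>F. c t * b t x) \<in> eigenspace (ball 0 1) \<alpha> \<mu>"
        by (rule eigenspace_sum[OF \<alpha> bE]) (use F in blast)
      then show "u \<in> eigenspace (ball 0 1) \<alpha> \<mu>"
        by (rule eigenspace_AE_cong[OF \<alpha>]) (use eq in \<open>auto simp: b_def case_prod_beta elim!: eventually_mono\<close>)
    next
      fix u :: "'a \<Rightarrow> real" assume u: "u \<in> eigenspace (ball 0 1) \<alpha> \<mu>"
      have fin: "finite ?T" by (rule finite_mu_indices[OF dim \<alpha>])
      have sb: "square_integrable_on (ball 0 1) (b t)" if "t \<in> ?T" for t
        by (rule H10_square_integrable[OF eigenspaceD[OF bE[OF that]]])
      have su: "square_integrable_on (ball 0 1) u" by (rule H10_square_integrable[OF eigenspaceD[OF u]])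
      obtain c where c': "\<forall>t\<in>?T. weighted_inner \<alpha> (\<lambda>x. u x - (\<Sum>t\<in>?T. c t * b t x)) (b t) = 0"
        by (rule exE[OF weighted_projection_exists[OF fin \<alpha> sb su]])
      note c = bspec[OF c']
      define v where "v x = u x - (\<Sum>t\<in>?T. c t * b t x)" for x
      have sumE: "(\<lambda>x. \<Sum>t\<in>?T. c t * b t x) \<in> eigenspace (ball 0 1) \<alpha> \<mu>"
        by (rule eigenspace_sum[OF \<alpha> bE])
      have v: "v \<in> eigenspace (ball 0 1) \<alpha> \<mu>"
        using eigenspace_add[OF \<alpha> u eigenspace_scale[OF sumE, of "-1"]] by (simp add: v_def[abs_def])
      have sv: "square_integrable_on (ball 0 1) v" by (rule H10_square_integrable[OF eigenspaceD[OF v]])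
      have "AE x in ?M. v x = 0"
      proof (rule eigenspace_orthogonal_imp_AE_0[OF dim \<alpha> v])
        fix n and H :: "'a \<Rightarrow> real"
        let ?F = "frob (real DIM('a) + 2 * real n) (1 + \<alpha> / 2) \<mu> 0"
        assume z: "?F 1 = 0" and H: "homogeneous_poly n H" "\<And>x. laplacian H x = 0"
        obtain i where i: "i \<ge> 1" "mu DIM('a) \<alpha> n i = \<mu>" using frob_zero_iff_mu[OF dim \<alpha>] z by blast
        obtain K where K: "K \<noteq> 0" "\<And>Y x. x \<noteq> (0::'a) \<Longrightarrow> omega \<alpha> n i Y x = K * (?F (x \<bullet> x) * (norm x powr real n * Y (x /\<^sub>R norm x)))"
          using omega_eq[OF dim \<alpha> i(1), of n] unfolding i(2) by blast
        obtain d where d: "\<And>x. x \<noteq> 0 \<Longrightarrow> H x = (\<Sum>j=1..m n. d j * (norm x powr real n * Y n j (x /\<^sub>R norm x)))"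
          using harmonic_poly_in_span_of_basis[OF Y H] by blast
        have so: "square_integrable_on (ball 0 1) (omega \<alpha> n i (Y n j))" if "j \<in> {1..m n}" for j
          using sb[of "(n, i, j)"] that i by (simp add: b_def)
        have sFH: "(\<lambda>x. ?F (x \<bullet> x) * H x) \<in> eigenspace (ball 0 1) \<alpha> \<mu>"
          by (rule frob_harmonic_in_eigenspace[OF dim \<alpha> harmonic_poly_solid_harmonic[OF H] z])
        have ssum: "square_integrable_on (ball 0 1) (\<lambda>x. \<Sum>j=1..m n. (d j / K) * omega \<alpha> n i (Y n j) x)"
          by (rule square_integrable_sum[OF so])
        have "(\<integral>x. norm x powr \<alpha> * v x * (?F (x \<bullet> x) * H x) \<partial>?M)
            = (\<integral>x. norm x powr \<alpha> * v x * (\<Sum>j=1..m n. (d j / K) * omega \<alpha> n i (Y n j) x) \<partial>?M)"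
        proof (rule integral_cong_AE)
          show "(\<lambda>x. norm x powr \<alpha> * v x * (?F (x \<bullet> x) * H x)) \<in> borel_measurable ?M"
            by (rule borel_measurable_integrable[OF integrable_weighted_product[OF \<alpha> sv H10_square_integrable[OF eigenspaceD[OF sFH]]]])
          show "(\<lambda>x. norm x powr \<alpha> * v x * (\<Sum>j=1..m n. (d j / K) * omega \<alpha> n i (Y n j) x)) \<in> borel_measurable ?M"
            by (rule borel_measurable_integrable[OF integrable_weighted_product[OF \<alpha> sv ssum]])
          show "AE x in ?M. norm x powr \<alpha> * v x * (?F (x \<bullet> x) * H x)
              = norm x powr \<alpha> * v x * (\<Sum>j=1..m n. (d j / K) * omega \<alpha> n i (Y n j) x)"
          proof (rule AE_lebesgue_on_off_origin)
            fix x :: 'a assume "x \<in> ball 0 1 - {0}"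
            then have x: "x \<noteq> 0" by simp
            have "?F (x \<bullet> x) * H x = (\<Sum>j=1..m n. (d j / K) * omega \<alpha> n i (Y n j) x)"
              unfolding d[OF x] K(2)[OF x] sum_distrib_left using K(1) by (intro sum.cong) auto
            then show "norm x powr \<alpha> * v x * (?F (x \<bullet> x) * H x)
              = norm x powr \<alpha> * v x * (\<Sum>j=1..m n. (d j / K) * omega \<alpha> n i (Y n j) x)" by simp
          qed auto
        qed
        also have "\<dots> = (\<Sum>j=1..m n. (d j / K) * weighted_inner \<alpha> v (omega \<alpha> n i (Y n j)))"
          unfolding weighted_inner_def[symmetric] by (rule weighted_inner_sum_right[OF \<alpha> sv so])
        also have "\<dots> = 0"
        proof (rule sum.neutral, rule ballI)
          fix j assume "j \<in> {1..m n}"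
          then have "weighted_inner \<alpha> v (b (n, i, j)) = 0" unfolding v_def[abs_def] using i by (intro c) auto
          then show "(d j / K) * weighted_inner \<alpha> v (omega \<alpha> n i (Y n j)) = 0" by (simp add: b_def)
        qed
        finally show "(\<integral>x. norm x powr \<alpha> * v x * (?F (x \<bullet> x) * H x) \<partial>?M) = 0" .
      qed
      then have AE: "AE x in ?M. u x = (\<Sum>(n, i, j)\<in>?T. c (n, i, j) * omega \<alpha> n i (Y n j) x)"
      proof eventually_elim
        case (elim x)
        have "c t * b t x = (case t of (n, i, j) \<Rightarrow> c (n, i, j) * omega \<alpha> n i (Y n j) x)" for t
          by (cases t) (simp add: b_def)
        then have "(\<Sum>t\<in>?T. c t * b t x) = (\<Sum>(n, i, j)\<in>?T. c (n, i, j) * omega \<alpha> n i (Y n j) x)"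
          by (rule sum.cong[OF refl])
        with elim show ?case by (simp only: v_def eq_iff_diff_eq_0[symmetric])
      qed
      show "u \<in> ?S"
        by (rule CollectI, rule exI[of _ ?T], rule exI[of _ c]) (rule conjI[OF fin conjI[OF subset_refl AE]])
    }
  qed
  show ?thesis
  proof (intro conjI allI impI ballI)
    show "{\<mu>. eigenvalue (ball (0::'a) 1) \<alpha> \<mu>} = {mu DIM('a) \<alpha> n i | n i. i \<ge> 1}" by (rule 1)
  qed (assumption | rule ef 3)+
qed

end
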